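(* Let $g\in\mathbb N_{\ge1}$ and $n\in g\mathbb N$. 1) The representation $L^{h,h'}(n,g)$ of $U_{h,h'}(\mathfrak{sl}_2,g)$ is a deformation along $h'$ of the indecomposable representation $L^h(n)$ of $U_h(\mathfrak{sl}_2)$: $\lim_{h'\to0}L^{h,h'}(n,g)=L^h(n)$. 2) The specialization $L^{\varepsilon,h'}(n,g)$ at $Q=\varepsilon$ of $L^{h,h'}(n,g)$ is a weight $U_{\varepsilon,h'}(\mathfrak{sl}_2,g)$-module. 3) $L^{\varepsilon,h'}(n,g)$ contains the representation ${}^L\!L^{h'}(n,g)$ of $U_{gh'}(\mathfrak{sl}_2)$, Langlands $g$-dual of $L^h(n)$, as the sum of the weight spaces whose weight is divisible by $g$. 4) The characters of $L^h(n)$ and ${}^L\!L^{h'}(n,g)$ are related by $$(\Pi_g\circ\chi^h)\big(L^h(n)\big)=\chi^{gh'}\big({}^L\!L^{h'}(n,g)\big).$$ 5) If $g$ is even, ${}^L\!L^{h'}(n,g)\simeq L^{gh'}\!\left(\frac ng\right)\oplus L^{gh'}\!\left(\frac ng-1\right)$ for $n>0$, and ${}^L\!L^{h'}(0,g)\simeq L^{gh'}(0)$. 6) If $g$ is odd, ${}^L\!L^{h'}(n,g)\simeq L^{gh'}\!\left(\frac ng\right)$.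
   Context: $\mathbb N=\{0,1,2,\dots\}$. For a vector space $V$, $V[[\bar h]]$ is the space of formal power series in the parameters $\bar h$ with coefficients in $V$. The $\mathbb C[[\bar h]]$-algebra topologically generated by a set $X$ with relations $\mathcal R$ is $\mathbb C\langle X\rangle[[\bar h]]$ modulo the $\bar h$-adic closure of the two-sided ideal generated by $\mathcal R$. Definition of $U_{h,h'}(\mathfrak{sl}_2,g)$. Let $\varepsilon=\exp(i\pi/g)$, $Q=\exp(h)$, $T=\exp(h')$, $$P(u)=\tfrac12\left(u^{g-1}+u^{1-g}\right)\prod_{k=1}^{g-1}\frac{\varepsilon^k u-\varepsilon^{-k}u^{-1}}{\varepsilon^k-\varepsilon^{-k}}.$$ $U_{h,h'}(\mathfrak{sl}_2,g)$ is the $\mathbb C[[h,h']]$-algebra topologically generated by $X^+,X^-,H,C$ with relations $[C,X^\pm]=[C,H]=0$, $[H,X^\pm]=\pm2X^\pm$, $$X^\pm X^\mp=\prod_{e=1,-1}\frac{\left(Q\,T^{\{H_e^\pm\}_Q}\right)^{H_e^\pm}-\left(Q\,T^{\{H_e^\pm\}_Q}\right)^{-H_e^\pm}}{Q\,T^{\{H_e^\pm\}_Q}-Q^{-1}T^{-\{H_e^\pm\}_Q}},$$ where $H_e^\pm=\frac12(\sqrt C+eH\mp e)$, $\{H_e^\pm\}_Q=P(Q^{H_e^\pm})$. Numerator and denominator are series in $\mathbb C[H,\sqrt C][[h,h']]$, each divided by $h+h'\{H_e^\pm\}_Q$ before the quotient is taken; the product over $e$ is invariant under $\sqrt C\mapsto-\sqrt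 C$, and $(\sqrt C)^2$ is replaced by $C$. Similarly any expression even in $\sqrt C$, such as $Q^{\sqrt C}+Q^{-\sqrt C}$, is an element of the algebra. $U_h(\mathfrak{sl}_2)$ is the $\mathbb C[[h]]$-algebra topologically generated by $\tilde X^\pm,\tilde H$ with $[\tilde H,\tilde X^\pm]=\pm2\tilde X^\pm$, $[\tilde X^+,\tilde X^-]=\sinh(h\tilde H)/\sinh(h)$. $U_{gh'}(\mathfrak{sl}_2)$ is the $\mathbb C[[h']]$-algebra topologically generated by $\tilde X^\pm,\tilde H$ with $[\tilde H,\tilde X^\pm]=\pm2\tilde X^\pm$, $[\tilde X^+,\tilde X^-]=\sinh(gh'\tilde H)/\sinh(gh')$. One has $U_{h,h'}(\mathfrak{sl}_2,g)/(h'=0)\simeq U_h(\mathfrak{sl}_2)$ via $X^\pm\leftrightarrow\tilde X^\pm$, $H\leftrightarrow\tilde H$. Representations. A representation of one of these algebras over $\mathbb C[[\bar h]]$ is an action by $\mathbb C[[\bar h]]$-linear operators on $V[[\bar h]]$ for a vector space $V$; it has finite rank if $\dim V<\infty$. A representation of $U_{h,h'}(\mathfrak{sl}_2,g)$ on $V[[h,h']]$ is a deformation along $h'$ of the representation of $U_h(\mathfrak{sl}_2)$ on $V[[h]]$ that it induces modulo $h'$; the latter is its limit $\lim_{h'\to0}$. Put $[a]_q=\frac{q^a-q^{-a}}{q-q^{-1}}$ and $\{a\}=P(Q^a)$ for $a\in\mathbb Z$. $L^{h,h'}(n,g)$ ($n\in\mathbb N$): $\big(\bigoplus_{0\le j\le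 n}\mathbb C m_j\big)[[h,h']]$ with $Hm_j=(n-2j)m_j$, $Cm_j=(n+1)^2m_j$, $X^-m_j=m_{j+1}$, $X^+m_j=[j]_{QT^{\{j\}}}[n-j+1]_{QT^{\{n-j+1\}}}m_{j-1}$ ($m_{-1}=m_{n+1}=0$). $L^h(n)$: $\big(\bigoplus_{0\le j\le n}\mathbb C m_j\big)[[h]]$ with $\tilde H m_j=(n-2j)m_j$, $\tilde X^-m_j=m_{j+1}$, $\tilde X^+m_j=[j]_Q[n-j+1]_Qm_{j-1}$. $L^{gh'}(n)$ is the representation of $U_{gh'}(\mathfrak{sl}_2)$ given by the same formulas as $L^h(n)$ with $h$ replaced by $gh'$ (i.e. $Q$ replaced by $T^g$). Specialization. $\mathcal A=\mathbb C[Q^{\pm1}]\subset\mathbb C[[h]]$. $U_{\mathcal A,h'}(\mathfrak{sl}_2,g)$ is the sub-$\mathcal A[[h']]$-algebra of $U_{h,h'}(\mathfrak{sl}_2,g)$ topologically generated ($h'$-adically) by $C,H,X^\pm,Q^{\pm H},Q^{\sqrt C}+Q^{-\sqrt C}$, and $U_{\varepsilon,h'}(\mathfrak{sl}_2,g)=U_{\mathcal A,h'}(\mathfrak{sl}_2,g)/\overline{(Q=\varepsilon)}^{\,h'}$ (closure in the $h'$-adic topology). $L^{\mathcal A,h'}(n,g)=\big(\bigoplus_{0\le j\le n}\mathcal A m_j\big)[[h']]\subset L^{h,h'}(n,g)$ is stable under $U_{\mathcal A,h'}(\mathfrak{sl}_2,g)$, and $L^{\varepsilon,h'}(n,g)=L^{\mathcal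 A,h'}(n,g)/\overline{(Q-\varepsilon)L^{\mathcal A,h'}(n,g)}^{\,h'}\simeq\big(\bigoplus_{0\le j\le n}\mathbb C m_j\big)[[h']]$, a $U_{\varepsilon,h'}(\mathfrak{sl}_2,g)$-module. A $U_{\varepsilon,h'}(\mathfrak{sl}_2,g)$-module $V$ is a weight module if $V=\bigoplus_{m\in\mathbb Z}V_m$ with $V_m=\{f:Hf=mf\}$ (the weight space of weight $m$). Langlands $g$-dual. For $n\in g\mathbb N$, ${}^L\!L^{h'}(n,g)$ is the sum of the weight spaces of $L^{\varepsilon,h'}(n,g)$ whose weight is divisible by $g$, regarded as a representation of $U_{gh'}(\mathfrak{sl}_2)$ by letting $\tilde X^\pm,\tilde H$ act as ${}^L\!X^\pm,{}^L\!H$ (operators on its localization at $h'$ which preserve it), where $${}^L\!X^+=([g-1]^!_\varepsilon)^{-2}(\varepsilon T-\varepsilon^{-1}T^{-1})^2(T^g-T^{-g})^{-2}(X^+)^g,\quad {}^L\!X^-=(X^-)^g,\quad {}^L\!H=H/g,$$ and $[g-1]^!_\varepsilon=\prod_{k=1}^{g-1}\frac{\varepsilon^k-\varepsilon^{-k}}{\varepsilon-\varepsilon^{-1}}$. Characters. $P=\mathbb Z\omega$ is the weight lattice of $\mathfrak{sl}_2$, $\mathbb Z[P]$ its group ring. $\chi^h$ and $\chi^{gh'}$ send a finite-rank representation of $U_h(\mathfrak{sl}_2)$, resp. $U_{gh'}(\mathfrak{sl}_2)$, to $\sum_m(\text{rank of the weight-}m\text{ space of }\tilde H)\,e^{m\omega}\in\mathbb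 Z[P]$. $\Pi_g:\mathbb Z[P]\to\mathbb Z[P]$ is the additive map with $\Pi_g(e^{m\omega})=e^{(m/g)\omega}$ if $g\mid m$, and $\Pi_g(e^{m\omega})=0$ otherwise.
   Formalization: For g odd and n even positive the printed ᴸX⁺ gives [ᴸX⁺,ᴸX⁻] the wrong sign (g=1, n=2: −(T+T⁻¹) on m₀, not T+T⁻¹), so there X̃⁺ acts on the dual by −ᴸX⁺; in all other cases it acts by ᴸX⁺ as printed. *)

theory Defs
  imports
    "HOL-Algebra.Algebraic_Closure_Type"
    "HOL-Algebra.QuotRing"
    "HOL-Algebra.Module"
    "HOL-Library.FuncSet"
    "HOL-Library.Poly_Mapping"
    "HOL-Computational_Algebra.Formal_Laurent_Series"
begin

(* Conventions.  C[[h]] and C[[h']] are both the type "complex fps"; C[[h,h']] is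
   "complex fps fps", where the outer variable is h' and the inner one is h.
   So h' is fps_X, h is fps_const fps_X, and f $ b $ a is the coefficient of h^a h'^b. *)

section \<open>Free algebras and their power series\<close>

datatype 'x word = Word "'x list"

instantiation word :: (type) monoid_add
begin

definition zero_word :: "'a word" where "0 = Word []"

fun plus_word :: "'a word \<Rightarrow> 'a word \<Rightarrow> 'a word" where
  "Word u + Word v = Word (u @ v)"

instance
proof
  fix a b c :: "'a word"
  show "a + b + c = a + (b + c)" by (cases a; cases b; cases c) simp
  show "0 + a = a" by (cases a) (simp add: zero_word_def)
  show "a + 0 = a" by (cases a) (simp add: zero_word_def)
qed

end

text \<open>The free algebra \<open>\<complex>\<langle>X\<rangle>\<close> is the monoid algebra of the monoid of words.\<close>

type_synonym 'x free_alg = "'x word \<Rightarrow>\<^sub>0 complex"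

definition fa_var :: "'x \<Rightarrow> 'x free_alg" where
  "fa_var x = Poly_Mapping.single (Word [x]) 1"

definition fa_const :: "complex \<Rightarrow> 'x free_alg" where
  "fa_const z = Poly_Mapping.single 0 z"

definition map_fps :: "('a \<Rightarrow> 'b) \<Rightarrow> 'a fps \<Rightarrow> 'b fps" where
  "map_fps \<phi> f = Abs_fps (\<lambda>k. \<phi> (f $ k))"

text \<open>An algebra over a commutative ring is given by a \<^typ>\<open>('k, 'u) module\<close> record in which
  the multiplicative fields are used as well.\<close>

definition free_series :: "(complex fps, 'x free_alg fps) module" where
  "free_series = \<lparr>carrier = UNIV, monoid.mult = (*), one = 1, zero = 0, add = (+),
     module.smult = (\<lambda>c x. map_fps fa_const c * x)\<rparr>"

definition free_series2 :: "(complex fps fps, 'x free_alg fps fps) module" where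
  "free_series2 = \<lparr>carrier = UNIV, monoid.mult = (*), one = 1, zero = 0, add = (+),
     module.smult = (\<lambda>c x. map_fps (map_fps fa_const) c * x)\<rparr>"

section \<open>Closures, generated subalgebras and quotients\<close>

text \<open>Closure of \<open>S\<close> in the \<open>t\<close>-adic topology of \<open>V\<close>, i.e. for the neighbourhoods \<open>t\<^sup>N V\<close> of 0.\<close>

definition adic_closure :: "'k::comm_ring_1 \<Rightarrow> ('k, 'm, 'c) module_scheme \<Rightarrow> 'm set \<Rightarrow> 'm set" where
  "adic_closure t V S =
     {x \<in> carrier V. \<forall>N::nat. \<exists>y\<in>S. \<exists>z\<in>carrier V. x = y \<oplus>\<^bsub>V\<^esub> (t ^ N) \<odot>\<^bsub>V\<^esub> z}"

text \<open>Closure in the \<open>(h,h')\<close>-adic topology of \<open>\<complex>\<langle>X\<rangle>[[h,h']]\<close>.\<close>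

definition adic_closure2 :: "'x free_alg fps fps set \<Rightarrow> 'x free_alg fps fps set" where
  "adic_closure2 S = {x. \<forall>N::nat. \<exists>y\<in>S. \<forall>a b. a + b < N \<longrightarrow> x $ b $ a = y $ b $ a}"

definition is_subalgebra :: "'k set \<Rightarrow> ('k, 'u, 'c) module_scheme \<Rightarrow> 'u set \<Rightarrow> bool" where
  "is_subalgebra R U S \<longleftrightarrow> S \<subseteq> carrier U \<and> \<one>\<^bsub>U\<^esub> \<in> S \<and>
     (\<forall>x\<in>S. \<forall>y\<in>S. x \<oplus>\<^bsub>U\<^esub> y \<in> S \<and> x \<otimes>\<^bsub>U\<^esub> y \<in> S) \<and> (\<forall>c\<in>R. \<forall>x\<in>S. c \<odot>\<^bsub>U\<^esub> x \<in> S)"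

definition generated_subalgebra :: "'k set \<Rightarrow> ('k, 'u, 'c) module_scheme \<Rightarrow> 'u set \<Rightarrow> 'u set" where
  "generated_subalgebra R U G = \<Inter>{S. is_subalgebra R U S \<and> G \<subseteq> S}"

text \<open>Quotient of the algebra \<open>U\<close> by the two-sided ideal \<open>J\<close>, regarded as an algebra over a
  ring of scalars that is mapped to the scalars of \<open>U\<close> by \<open>\<phi>\<close>.\<close>

definition quot_alg :: "('l \<Rightarrow> 'k) \<Rightarrow> ('k, 'u) module \<Rightarrow> 'u set \<Rightarrow> ('l, 'u set) module" where
  "quot_alg \<phi> U J = \<lparr>carrier = carrier (U Quot J), monoid.mult = monoid.mult (U Quot J),
     one = one (U Quot J), zero = zero (U Quot J), add = add (U Quot J),
     module.smult = (\<lambda>c Z. \<Union>x\<in>Z. J +>\<^bsub>U\<^esub> (\<phi> c \<odot>\<^bsub>U\<^esub> x))\<rparr>"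

section \<open>Modules over algebras\<close>

record ('k, 'm, 'u) rep = "('k, 'm) module" +
  act :: "'u \<Rightarrow> 'm \<Rightarrow> 'm"

definition alg_module :: "('k::comm_ring_1, 'u) module \<Rightarrow> ('k, 'm, 'u) rep \<Rightarrow> bool" where
  "alg_module U V \<longleftrightarrow> module (ring_of_type_algebra :: 'k ring) V \<and>
     (\<forall>u\<in>carrier U. \<forall>x\<in>carrier V. act V u x \<in> carrier V) \<and>
     (\<forall>u\<in>carrier U. \<forall>x\<in>carrier V. \<forall>y\<in>carrier V. act V u (x \<oplus>\<^bsub>V\<^esub> y) = act V u x \<oplus>\<^bsub>V\<^esub> act V u y) \<and>
     (\<forall>u\<in>carrier U. \<forall>c. \<forall>x\<in>carrier V. act V u (c \<odot>\<^bsub>V\<^esub> x) = c \<odot>\<^bsub>V\<^esub> act V u x) \<and>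
     (\<forall>u\<in>carrier U. \<forall>v\<in>carrier U. \<forall>x\<in>carrier V. act V (u \<oplus>\<^bsub>U\<^esub> v) x = act V u x \<oplus>\<^bsub>V\<^esub> act V v x) \<and>
     (\<forall>u\<in>carrier U. \<forall>c. \<forall>x\<in>carrier V. act V (c \<odot>\<^bsub>U\<^esub> u) x = c \<odot>\<^bsub>V\<^esub> act V u x) \<and>
     (\<forall>u\<in>carrier U. \<forall>v\<in>carrier U. \<forall>x\<in>carrier V. act V (u \<otimes>\<^bsub>U\<^esub> v) x = act V u (act V v x)) \<and>
     (\<forall>x\<in>carrier V. act V \<one>\<^bsub>U\<^esub> x = x)"

definition is_basis :: "('k::comm_ring_1, 'm, 'c) module_scheme \<Rightarrow> 'm set \<Rightarrow> bool" where
  "is_basis V B \<longleftrightarrow> finite B \<and> B \<subseteq> carrier V \<and>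
     (\<forall>v\<in>carrier V. \<exists>!c. c \<in> extensional B \<and> v = (\<Oplus>\<^bsub>V\<^esub>b\<in>B. c b \<odot>\<^bsub>V\<^esub> b))"

definition module_rank :: "('k::comm_ring_1, 'm, 'c) module_scheme \<Rightarrow> nat" where
  "module_rank V = (THE r. \<exists>B. is_basis V B \<and> card B = r)"

text \<open>Representations of finite rank: for \<open>dim V = r < \<infinity>\<close>, \<open>V[[h]]\<close> is the same as a free module
  with a basis of \<open>r\<close> elements.\<close>

definition finite_rank_rep :: "('k::comm_ring_1, 'u) module \<Rightarrow> ('k, 'm, 'u) rep \<Rightarrow> bool" where
  "finite_rank_rep U V \<longleftrightarrow> alg_module U V \<and> (\<exists>B. is_basis V B)"

definition rep_iso :: "('k::comm_ring_1, 'u) module \<Rightarrow> ('k, 'm, 'u) rep \<Rightarrow> ('k, 'n, 'u) rep \<Rightarrow> bool" where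
  "rep_iso U V W \<longleftrightarrow> (\<exists>\<phi>. bij_betw \<phi> (carrier V) (carrier W) \<and>
     (\<forall>x\<in>carrier V. \<forall>y\<in>carrier V. \<phi> (x \<oplus>\<^bsub>V\<^esub> y) = \<phi> x \<oplus>\<^bsub>W\<^esub> \<phi> y) \<and>
     (\<forall>c. \<forall>x\<in>carrier V. \<phi> (c \<odot>\<^bsub>V\<^esub> x) = c \<odot>\<^bsub>W\<^esub> \<phi> x) \<and>
     (\<forall>u\<in>carrier U. \<forall>x\<in>carrier V. \<phi> (act V u x) = act W u (\<phi> x)))"

definition rep_sum :: "('k, 'm, 'u) rep \<Rightarrow> ('k, 'n, 'u) rep \<Rightarrow> ('k, 'm \<times> 'n, 'u) rep" where
  "rep_sum V W = \<lparr>carrier = carrier V \<times> carrier W, monoid.mult = undefined, one = undefined,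
     zero = (\<zero>\<^bsub>V\<^esub>, \<zero>\<^bsub>W\<^esub>),
     add = (\<lambda>x y. (fst x \<oplus>\<^bsub>V\<^esub> fst y, snd x \<oplus>\<^bsub>W\<^esub> snd y)),
     module.smult = (\<lambda>c x. (c \<odot>\<^bsub>V\<^esub> fst x, c \<odot>\<^bsub>W\<^esub> snd x)),
     act = (\<lambda>u x. (act V u (fst x), act W u (snd x)))\<rparr>"

definition indecomposable :: "('k::comm_ring_1, 'u) module \<Rightarrow> ('k, 'm, 'u) rep \<Rightarrow> bool" where
  "indecomposable U V \<longleftrightarrow> carrier V \<noteq> {\<zero>\<^bsub>V\<^esub>} \<and>
     (\<forall>A B. A \<subseteq> carrier V \<and> B \<subseteq> carrier V \<and>
        alg_module U (V\<lparr>carrier := A\<rparr>) \<and> alg_module U (V\<lparr>carrier := B\<rparr>) \<and>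
        A \<inter> B = {\<zero>\<^bsub>V\<^esub>} \<and> carrier V = A <+>\<^bsub>V\<^esub> B \<longrightarrow>
        A = {\<zero>\<^bsub>V\<^esub>} \<or> B = {\<zero>\<^bsub>V\<^esub>})"

text \<open>For an algebra \<open>U\<close> topologically generated by the elements \<open>\<gamma> x\<close> and a module \<open>V\<close>, the action
  of \<open>U\<close> on \<open>V\<close> for which every \<open>\<gamma> x\<close> acts by the given operator \<open>T x\<close>. The action is taken
  to be extensional, so that it is unique if it exists.\<close>

definition rep_by_generators ::
  "('k::comm_ring_1, 'u) module \<Rightarrow> ('x \<Rightarrow> 'u) \<Rightarrow> ('k, 'm, 'u) rep \<Rightarrow> ('x \<Rightarrow> 'm \<Rightarrow> 'm) \<Rightarrow> ('k, 'm, 'u) rep"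
where
  "rep_by_generators U \<gamma> V T = V\<lparr>act := (THE \<rho>. \<rho> \<in> carrier U \<rightarrow>\<^sub>E (carrier V \<rightarrow>\<^sub>E carrier V) \<and>
     alg_module U (V\<lparr>act := \<rho>\<rparr>) \<and> (\<forall>x. \<forall>v\<in>carrier V. \<rho> (\<gamma> x) v = T x v))\<rparr>"

text \<open>\<open>\<phi>\<close> restricts the scalars, as in \<^const>\<open>quot_alg\<close>; the acting algebra is a quotient algebra.\<close>

definition quot_rep :: "('l \<Rightarrow> 'k) \<Rightarrow> ('k, 'm, 'u) rep \<Rightarrow> 'm set \<Rightarrow> ('l, 'm set, 'u set) rep" where
  "quot_rep \<phi> V N = \<lparr>carrier = a_rcosets\<^bsub>V\<^esub> N, monoid.mult = undefined, one = undefined,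
     zero = N, add = set_add V,
     module.smult = (\<lambda>c Z. \<Union>x\<in>Z. N +>\<^bsub>V\<^esub> (\<phi> c \<odot>\<^bsub>V\<^esub> x)),
     act = (\<lambda>F Z. \<Union>y\<in>F. \<Union>x\<in>Z. N +>\<^bsub>V\<^esub> act V y x)\<rparr>"

definition weight_space :: "('k::comm_ring_1, 'm, 'u) rep \<Rightarrow> 'u \<Rightarrow> int \<Rightarrow> 'm set" where
  "weight_space V H m = {f \<in> carrier V. act V H f = of_int m \<odot>\<^bsub>V\<^esub> f}"

definition weight_module :: "('k::comm_ring_1, 'u) module \<Rightarrow> 'u \<Rightarrow> ('k, 'm, 'u) rep \<Rightarrow> bool" where
  "weight_module U H V \<longleftrightarrow> alg_module U V \<and>
     (\<forall>v\<in>carrier V. \<exists>!f. (\<forall>m. f m \<in> weight_space V H m) \<and> finite {m. f m \<noteq> \<zero>\<^bsub>V\<^esub>} \<and>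
        v = (\<Oplus>\<^bsub>V\<^esub>m\<in>{m. f m \<noteq> \<zero>\<^bsub>V\<^esub>}. f m))"

definition sum_of_weight_spaces :: "('k::comm_ring_1, 'm, 'u) rep \<Rightarrow> 'u \<Rightarrow> int set \<Rightarrow> 'm set" where
  "sum_of_weight_spaces V H M = {v. \<exists>S f. finite S \<and> S \<subseteq> M \<and> (\<forall>m\<in>S. f m \<in> weight_space V H m) \<and>
     v = (\<Oplus>\<^bsub>V\<^esub>m\<in>S. f m)}"

section \<open>Series\<close>

text \<open>In the following three definitions \<open>c\<close> is the structure map of a commutative
  \<open>\<complex>\<close>-algebra \<open>R\<close>.\<close>

definition exp_series :: "(complex \<Rightarrow> 'r::comm_ring_1) \<Rightarrow> 'r \<Rightarrow> 'r fps" where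
  "exp_series c a = Abs_fps (\<lambda>k. c (1 / fact k) * a ^ k)"

text \<open>The quotient \<open>a / b\<close> in an integral domain, for \<open>b \<noteq> 0\<close> dividing \<open>a\<close>.\<close>

definition exact_quot :: "'r::idom \<Rightarrow> 'r \<Rightarrow> 'r" where
  "exact_quot a b = (THE y. b * y = a)"

definition eps :: "nat \<Rightarrow> complex" where
  "eps g = exp (\<i> * of_real pi / of_nat g)"

text \<open>\<open>{a}\<^sub>Q = P(Q\<^sup>a) \<in> R[[h]]\<close>, where \<open>Q\<^sup>a = exp(ha)\<close>.\<close>

definition P_of :: "nat \<Rightarrow> (complex \<Rightarrow> 'r::comm_ring_1) \<Rightarrow> 'r \<Rightarrow> 'r fps" where
  "P_of g c a = (let u = exp_series c a; v = exp_series c (- a); s = (\<lambda>z. fps_const (c z)) in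
     s (1 / 2) * (u ^ (g - 1) + v ^ (g - 1)) *
     (\<Prod>k=1..g - 1. s (1 / (eps g ^ k - inverse (eps g) ^ k)) *
        (s (eps g ^ k) * u - s (inverse (eps g) ^ k) * v)))"

text \<open>\<open>(Q T\<^bsup>{a}\<^esup>)\<^sup>b = exp(hb) exp(h'{a}b) \<in> R[[h,h']]\<close>.\<close>

definition QT_power :: "nat \<Rightarrow> (complex \<Rightarrow> 'r::comm_ring_1) \<Rightarrow> 'r \<Rightarrow> 'r \<Rightarrow> 'r fps fps" where
  "QT_power g c a b = fps_const (exp_series c b) *
     exp_series (\<lambda>z. fps_const (c z)) (P_of g c a * fps_const b)"

text \<open>\<open>((Q T\<^bsup>{a}\<^esup>)\<^sup>a - (Q T\<^bsup>{a}\<^esup>)\<^sup>-\<^sup>a) / (Q T\<^bsup>{a}\<^esup> - Q\<^sup>-\<^sup>1 T\<^bsup>-{a}\<^esup>)\<close>, where numerator and denominator are first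
  divided by \<open>h + h'{a}\<close>.\<close>

definition QT_number :: "nat \<Rightarrow> (complex \<Rightarrow> 'r::idom) \<Rightarrow> 'r \<Rightarrow> 'r fps fps" where
  "QT_number g c a = (let z = fps_const fps_X + fps_X * fps_const (P_of g c a) in
     exact_quot (exact_quot (QT_power g c a a - QT_power g c a (- a)) z)
                (exact_quot (QT_power g c a 1 - QT_power g c a (- 1)) z))"

section \<open>The algebra \<open>U\<^bsub>h,h'\<^esub>(sl\<^sub>2, g)\<close>\<close>

datatype gen = X_plus | X_minus | H_gen | C_gen

text \<open>\<open>\<complex>[H, \<surd>C]\<close> is \<^typ>\<open>complex poly poly\<close>, with outer variable \<open>\<surd>C\<close> and inner variable \<open>H\<close>.\<close>

definition pp_const :: "complex \<Rightarrow> complex poly poly" where "pp_const z = [:[:z:]:]"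
definition pp_H :: "complex poly poly" where "pp_H = [:[:0, 1:]:]"
definition pp_sqrtC :: "complex poly poly" where "pp_sqrtC = [:0, 1:]"

text \<open>For \<open>p\<close> even in \<open>\<surd>C\<close>: the element of the free algebra obtained by replacing \<open>(\<surd>C)\<^sup>2\<close> by \<open>C\<close>.\<close>

definition even_subst :: "complex poly poly \<Rightarrow> gen free_alg" where
  "even_subst p = (\<Sum>j\<le>Polynomial.degree p. \<Sum>i\<le>Polynomial.degree (Polynomial.coeff p (2 * j)).
     fa_const (Polynomial.coeff (Polynomial.coeff p (2 * j)) i) * fa_var H_gen ^ i * fa_var C_gen ^ j)"

text \<open>\<open>H\<^sub>e\<^sup>\<plusminus> = (\<surd>C + e H \<mp> e) / 2\<close>, where \<open>s = 1\<close> for \<open>+\<close> and \<open>s = -1\<close> for \<open>-\<close>.\<close>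

definition H_e :: "complex \<Rightarrow> complex \<Rightarrow> complex poly poly" where
  "H_e s e = pp_const (1 / 2) * (pp_sqrtC + pp_const e * pp_H - pp_const (s * e))"

definition XX_series :: "nat \<Rightarrow> complex \<Rightarrow> gen free_alg fps fps" where
  "XX_series g s = map_fps (map_fps even_subst) (\<Prod>e\<in>{1, -1}. QT_number g pp_const (H_e s e))"

definition hh_var :: "gen \<Rightarrow> gen free_alg fps fps" where
  "hh_var x = fps_const (fps_const (fa_var x))"

definition hh_relations :: "nat \<Rightarrow> gen free_alg fps fps set" where
  "hh_relations g = (let E = hh_var X_plus; F = hh_var X_minus; H = hh_var H_gen; C = hh_var C_gen in
     {C * E - E * C, C * F - F * C, C * H - H * C,
      H * E - E * H - 2 * E, H * F - F * H + 2 * F,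
      E * F - XX_series g 1, F * E - XX_series g (- 1)})"

definition hh_ideal :: "nat \<Rightarrow> gen free_alg fps fps set" where
  "hh_ideal g = adic_closure2 (Idl\<^bsub>free_series2\<^esub> (hh_relations g))"

definition U_hh :: "nat \<Rightarrow> (complex fps fps, gen free_alg fps fps set) module" where
  "U_hh g = quot_alg id free_series2 (hh_ideal g)"

definition hh_class :: "nat \<Rightarrow> gen free_alg fps fps \<Rightarrow> gen free_alg fps fps set" where
  "hh_class g x = hh_ideal g +>\<^bsub>free_series2\<^esub> x"

definition hh_gen :: "nat \<Rightarrow> gen \<Rightarrow> gen free_alg fps fps set" where
  "hh_gen g x = hh_class g (hh_var x)"

section \<open>The algebras \<open>U\<^sub>h(sl\<^sub>2)\<close> and \<open>U\<^bsub>gh'\<^esub>(sl\<^sub>2)\<close>\<close>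

datatype qgen = Xt_plus | Xt_minus | Ht_gen

text \<open>\<open>U_q r\<close> is \<open>U\<^sub>h(sl\<^sub>2)\<close> with \<open>h\<close> replaced by \<open>r\<close> times the formal variable, so that \<open>U_q 1\<close> is
  \<open>U\<^sub>h(sl\<^sub>2)\<close> and \<open>U_q g\<close> is \<open>U\<^bsub>gh'\<^esub>(sl\<^sub>2)\<close>. The polynomial variable below is \<open>H\<close>.\<close>

definition sinh_series :: "complex poly \<Rightarrow> complex poly fps" where
  "sinh_series a = fps_const [:1 / 2:] * (exp_series (\<lambda>z. [:z:]) a - exp_series (\<lambda>z. [:z:]) (- a))"

definition poly_subst :: "complex poly \<Rightarrow> qgen free_alg" where
  "poly_subst p = (\<Sum>i\<le>Polynomial.degree p. fa_const (Polynomial.coeff p i) * fa_var Ht_gen ^ i)"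

definition q_var :: "qgen \<Rightarrow> qgen free_alg fps" where
  "q_var x = fps_const (fa_var x)"

definition q_relations :: "complex \<Rightarrow> qgen free_alg fps set" where
  "q_relations r = (let E = q_var Xt_plus; F = q_var Xt_minus; H = q_var Ht_gen in
     {H * E - E * H - 2 * E, H * F - F * H + 2 * F,
      E * F - F * E - map_fps poly_subst (exact_quot (sinh_series [:0, r:]) (sinh_series [:r:]))})"

definition q_ideal :: "complex \<Rightarrow> qgen free_alg fps set" where
  "q_ideal r = adic_closure fps_X free_series (Idl\<^bsub>free_series\<^esub> (q_relations r))"

definition U_q :: "complex \<Rightarrow> (complex fps, qgen free_alg fps set) module" where
  "U_q r = quot_alg id free_series (q_ideal r)"

definition q_gen :: "complex \<Rightarrow> qgen \<Rightarrow> qgen free_alg fps set" where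
  "q_gen r x = q_ideal r +>\<^bsub>free_series\<^esub> q_var x"

section \<open>The representations \<open>L\<^bsup>h,h'\<^esup>(n,g)\<close>, \<open>L\<^sup>h(n)\<close> and \<open>L\<^bsup>gh'\<^esup>(n)\<close>\<close>

text \<open>The free module with basis \<open>m\<^sub>0, \<dots>, m\<^sub>n\<close>; its vectors are coordinate functions.\<close>

definition coord_module :: "nat \<Rightarrow> ('k::comm_ring_1, nat \<Rightarrow> 'k, 'u) rep" where
  "coord_module n = \<lparr>carrier = {f. \<forall>j>n. f j = 0}, monoid.mult = undefined, one = undefined,
     zero = (\<lambda>j. 0), add = (\<lambda>f f' j. f j + f' j), module.smult = (\<lambda>c f j. c * f j), act = undefined\<rparr>"

definition m_vec :: "nat \<Rightarrow> nat \<Rightarrow> 'k::comm_ring_1" where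
  "m_vec j = (\<lambda>i. if i = j then 1 else 0)"

definition lin_ext :: "nat \<Rightarrow> (nat \<Rightarrow> nat \<Rightarrow> 'k::comm_ring_1) \<Rightarrow> (nat \<Rightarrow> 'k) \<Rightarrow> (nat \<Rightarrow> 'k)" where
  "lin_ext n T f = (\<lambda>i. \<Sum>j\<le>n. f j * T j i)"

definition L_hh_gen :: "nat \<Rightarrow> nat \<Rightarrow> gen \<Rightarrow> (nat \<Rightarrow> complex fps fps) \<Rightarrow> (nat \<Rightarrow> complex fps fps)" where
  "L_hh_gen g n x = lin_ext n (\<lambda>j. case x of
       H_gen \<Rightarrow> (\<lambda>i. of_int (int n - 2 * int j) * m_vec j i)
     | C_gen \<Rightarrow> (\<lambda>i. of_nat ((n + 1)\<^sup>2) * m_vec j i)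
     | X_minus \<Rightarrow> (if j = n then (\<lambda>i. 0) else m_vec (j + 1))
     | X_plus \<Rightarrow> (if j = 0 then (\<lambda>i. 0) else
         (\<lambda>i. QT_number g id (of_nat j) * QT_number g id (of_nat (n - j + 1)) * m_vec (j - 1) i)))"

definition L_hh :: "nat \<Rightarrow> nat \<Rightarrow>
    (complex fps fps, nat \<Rightarrow> complex fps fps, gen free_alg fps fps set) rep" where
  "L_hh n g = rep_by_generators (U_hh g) (hh_gen g) (coord_module n) (L_hh_gen g n)"

text \<open>\<open>[a]\<^sub>q\<close> for \<open>q = exp(rh)\<close>.\<close>

definition q_number :: "complex \<Rightarrow> nat \<Rightarrow> complex fps" where
  "q_number r a = exact_quot (fps_exp (r * of_nat a) - fps_exp (- (r * of_nat a)))
     (fps_exp r - fps_exp (- r))"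

definition L_q_gen :: "complex \<Rightarrow> nat \<Rightarrow> qgen \<Rightarrow> (nat \<Rightarrow> complex fps) \<Rightarrow> (nat \<Rightarrow> complex fps)" where
  "L_q_gen r n x = lin_ext n (\<lambda>j. case x of
       Ht_gen \<Rightarrow> (\<lambda>i. of_int (int n - 2 * int j) * m_vec j i)
     | Xt_minus \<Rightarrow> (if j = n then (\<lambda>i. 0) else m_vec (j + 1))
     | Xt_plus \<Rightarrow> (if j = 0 then (\<lambda>i. 0) else
         (\<lambda>i. q_number r j * q_number r (n - j + 1) * m_vec (j - 1) i)))"

text \<open>\<open>L_q 1 n\<close> is \<open>L\<^sup>h(n)\<close> and \<open>L_q g n\<close> is \<open>L\<^bsup>gh'\<^esup>(n)\<close>.\<close>

definition L_q :: "complex \<Rightarrow> nat \<Rightarrow> (complex fps, nat \<Rightarrow> complex fps, qgen free_alg fps set) rep" where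
  "L_q r n = rep_by_generators (U_q r) (q_gen r) (coord_module n) (L_q_gen r n)"

section \<open>Limits and deformations along \<open>h'\<close>\<close>

definition mod_h' :: "(nat \<Rightarrow> complex fps fps) \<Rightarrow> (nat \<Rightarrow> complex fps)" where
  "mod_h' f = (\<lambda>j. f j $ 0)"

fun hh_of_q :: "qgen \<Rightarrow> gen" where
  "hh_of_q Xt_plus = X_plus"
| "hh_of_q Xt_minus = X_minus"
| "hh_of_q Ht_gen = H_gen"

text \<open>The limit of a representation of \<open>U\<^bsub>h,h'\<^esub>(sl\<^sub>2, g)\<close> on a space of coordinate functions: the action on the
  reduction modulo \<open>h'\<close>, seen as an action of \<open>U\<^sub>h(sl\<^sub>2)\<close> through
  \<open>U\<^bsub>h,h'\<^esub>(sl\<^sub>2, g)/(h' = 0) \<simeq> U\<^sub>h(sl\<^sub>2)\<close>, which sends \<open>X\<^sup>\<plusminus>\<close>, \<open>H\<close> to the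
  generators of \<open>U\<^sub>h(sl\<^sub>2)\<close> of the same name.\<close>

definition lim_h' :: "nat \<Rightarrow> (complex fps fps, nat \<Rightarrow> complex fps fps, gen free_alg fps fps set) rep \<Rightarrow>
    (complex fps, nat \<Rightarrow> complex fps, qgen free_alg fps set) rep" where
  "lim_h' g V = rep_by_generators (U_q 1) (q_gen 1)
     \<lparr>carrier = mod_h' ` carrier V, monoid.mult = undefined, one = undefined,
      zero = (\<lambda>j. 0), add = (\<lambda>f f' j. f j + f' j), module.smult = (\<lambda>c f j. c * f j), act = undefined\<rparr>
     (\<lambda>x v. THE w. \<exists>f\<in>carrier V. mod_h' f = v \<and> w = mod_h' (act V (hh_gen g (hh_of_q x)) f))"

definition is_deformation :: "nat \<Rightarrow>
    (complex fps fps, nat \<Rightarrow> complex fps fps, gen free_alg fps fps set) rep \<Rightarrow>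
    (complex fps, nat \<Rightarrow> complex fps, qgen free_alg fps set) rep \<Rightarrow> bool" where
  "is_deformation g V W \<longleftrightarrow> finite_rank_rep (U_hh g) V \<and> finite_rank_rep (U_q 1) W \<and> lim_h' g V = W"

section \<open>Specialization at \<open>Q = \<epsilon>\<close>\<close>

text \<open>\<open>\<A> = \<complex>[Q\<^sup>\<plusminus>\<^sup>1]\<close> inside \<open>\<complex>[[h]]\<close>, and \<open>\<A>[[h']]\<close> inside \<open>\<complex>[[h,h']]\<close>.\<close>

definition A_ring :: "complex fps set" where
  "A_ring = {\<Sum>k\<in>S. fps_const (c k) * fps_exp (of_int k) | (S :: int set) c. finite S}"

definition A_h' :: "complex fps fps set" where
  "A_h' = {f. \<forall>k. f $ k \<in> A_ring}"

definition Q_minus_eps :: "nat \<Rightarrow> complex fps fps" where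
  "Q_minus_eps g = fps_const (fps_exp 1 - fps_const (eps g))"

text \<open>The inclusion of \<open>\<complex>[[h']]\<close> in \<open>\<A>[[h']]\<close>.\<close>

definition incl_h' :: "complex fps \<Rightarrow> complex fps fps" where
  "incl_h' = map_fps fps_const"

definition Q_power :: "complex poly poly \<Rightarrow> complex poly poly fps fps" where
  "Q_power a = fps_const (exp_series pp_const a)"

definition A_generators :: "nat \<Rightarrow> gen free_alg fps fps set set" where
  "A_generators g = range (hh_gen g) \<union>
     (\<lambda>f. hh_class g (map_fps (map_fps even_subst) f)) `
       {Q_power pp_H, Q_power (- pp_H), Q_power pp_sqrtC + Q_power (- pp_sqrtC)}"

definition U_A :: "nat \<Rightarrow> (complex fps fps, gen free_alg fps fps set) module" where
  "U_A g = (U_hh g)\<lparr>carrier :=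
     adic_closure fps_X (U_hh g) (generated_subalgebra A_h' (U_hh g) (A_generators g))\<rparr>"

definition eps_ideal :: "nat \<Rightarrow> gen free_alg fps fps set set" where
  "eps_ideal g = adic_closure fps_X (U_A g)
     (Idl\<^bsub>U_A g\<^esub> {Q_minus_eps g \<odot>\<^bsub>U_A g\<^esub> \<one>\<^bsub>U_A g\<^esub>})"

definition U_eps :: "nat \<Rightarrow> (complex fps, gen free_alg fps fps set set) module" where
  "U_eps g = quot_alg incl_h' (U_A g) (eps_ideal g)"

definition eps_gen :: "nat \<Rightarrow> gen \<Rightarrow> gen free_alg fps fps set set" where
  "eps_gen g x = eps_ideal g +>\<^bsub>U_A g\<^esub> hh_gen g x"

definition L_A :: "nat \<Rightarrow> nat \<Rightarrow>
    (complex fps fps, nat \<Rightarrow> complex fps fps, gen free_alg fps fps set) rep" where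
  "L_A n g = (L_hh n g)\<lparr>carrier := {f \<in> carrier (L_hh n g). \<forall>j. f j \<in> A_h'}\<rparr>"

definition L_eps :: "nat \<Rightarrow> nat \<Rightarrow>
    (complex fps, (nat \<Rightarrow> complex fps fps) set, gen free_alg fps fps set set) rep" where
  "L_eps n g = quot_rep incl_h' (L_A n g)
     (adic_closure fps_X (L_A n g) ((\<lambda>x. Q_minus_eps g \<odot>\<^bsub>L_A n g\<^esub> x) ` carrier (L_A n g)))"

section \<open>Localization at \<open>h'\<close>\<close>

definition loc_rel :: "(complex fps, 'm, 'c) module_scheme \<Rightarrow> (('m \<times> nat) \<times> ('m \<times> nat)) set" where
  "loc_rel V = {((v, k), (w, l)). v \<in> carrier V \<and> w \<in> carrier V \<and>
     (\<exists>r. fps_X ^ (r + l) \<odot>\<^bsub>V\<^esub> v = fps_X ^ (r + k) \<odot>\<^bsub>V\<^esub> w)}"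

text \<open>The fraction \<open>v / h'\<^sup>k\<close>.\<close>

definition loc_frac :: "(complex fps, 'm, 'c) module_scheme \<Rightarrow> 'm \<Rightarrow> nat \<Rightarrow> ('m \<times> nat) set" where
  "loc_frac V v k = loc_rel V `` {(v, k)}"

text \<open>In the scalar multiplication, \<open>c \<in> \<complex>((h'))\<close> is written as \<open>h'\<^sup>d b\<close> with \<open>b \<in> \<complex>[[h']]\<close>.\<close>

definition localize :: "(complex fps, 'm, 'u) rep \<Rightarrow> (complex fls, ('m \<times> nat) set, 'u) rep" where
  "localize V = \<lparr>carrier = {loc_frac V v k | v k. v \<in> carrier V}, monoid.mult = undefined, one = undefined,
     zero = loc_frac V \<zero>\<^bsub>V\<^esub> 0,
     add = (\<lambda>\<xi> \<eta>. \<Union>(v, k)\<in>\<xi>. \<Union>(w, l)\<in>\<eta>.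
        loc_frac V ((fps_X ^ l) \<odot>\<^bsub>V\<^esub> v \<oplus>\<^bsub>V\<^esub> (fps_X ^ k) \<odot>\<^bsub>V\<^esub> w) (k + l)),
     module.smult = (\<lambda>c \<xi>. \<Union>(v, k)\<in>\<xi>. loc_frac V
        ((fps_X ^ nat (fls_subdegree c) * fls_base_factor_to_fps c) \<odot>\<^bsub>V\<^esub> v) (k + nat (- fls_subdegree c))),
     act = (\<lambda>u \<xi>. \<Union>(v, k)\<in>\<xi>. loc_frac V (act V u v) k)\<rparr>"

section \<open>The Langlands dual representation\<close>

definition eps_factorial :: "nat \<Rightarrow> complex" where
  "eps_factorial g = (\<Prod>k=1..g - 1. (eps g ^ k - inverse (eps g) ^ k) / (eps g - inverse (eps g)))"

definition dual_coeff :: "nat \<Rightarrow> complex fls" where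
  "dual_coeff g = inverse (fls_const (eps_factorial g) ^ 2) *
     (fps_to_fls (fps_const (eps g) * fps_exp 1 - fps_const (inverse (eps g)) * fps_exp (- 1))) ^ 2 *
     inverse ((fps_to_fls (fps_exp (of_nat g) - fps_exp (- of_nat g))) ^ 2)"

text \<open>\<open>\<^sup>LX\<^sup>+\<close>, \<open>\<^sup>LX\<^sup>-\<close>, \<open>\<^sup>LH\<close> as operators on the localization of \<open>L\<^bsup>\<epsilon>,h'\<^esup>(n,g)\<close>.\<close>

definition dual_op :: "nat \<Rightarrow> nat \<Rightarrow> qgen \<Rightarrow>
    ((nat \<Rightarrow> complex fps fps) set \<times> nat) set \<Rightarrow> ((nat \<Rightarrow> complex fps fps) set \<times> nat) set" where
  "dual_op n g x \<xi> = (let V = localize (L_eps n g) in case x of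
       Xt_plus \<Rightarrow> dual_coeff g \<odot>\<^bsub>V\<^esub> act V (eps_gen g X_plus [^]\<^bsub>U_eps g\<^esub> g) \<xi>
     | Xt_minus \<Rightarrow> act V (eps_gen g X_minus [^]\<^bsub>U_eps g\<^esub> g) \<xi>
     | Ht_gen \<Rightarrow> fls_const (1 / of_nat g) \<odot>\<^bsub>V\<^esub> act V (eps_gen g H_gen) \<xi>)"

text \<open>With these operators \<open>[\<^sup>LX\<^sup>+, \<^sup>LX\<^sup>-]\<close> is \<open>(-1)\<^bsup>n+g\<^esup>\<close> times \<open>sinh(gh' \<^sup>LH) / sinh(gh')\<close>, because \<open>\<epsilon>\<^sup>g = -1\<close>. So
  \<open>\<^sup>LX\<^sup>+\<close> has to be multiplied by a sign if \<open>g\<close> is odd and \<open>n\<close> is even; for example,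
  \<open>[\<^sup>LX\<^sup>+, \<^sup>LX\<^sup>-] m\<^sub>0 = -(T + T\<^sup>-\<^sup>1) m\<^sub>0\<close> for \<open>g = 1\<close> and \<open>n = 2\<close>. The sign is the parameter \<open>s\<close> below.\<close>

definition twisted_dual_op :: "int \<Rightarrow> nat \<Rightarrow> nat \<Rightarrow> qgen \<Rightarrow>
    ((nat \<Rightarrow> complex fps fps) set \<times> nat) set \<Rightarrow> ((nat \<Rightarrow> complex fps fps) set \<times> nat) set" where
  "twisted_dual_op s n g x \<xi> =
     (if x = Xt_plus then of_int s \<odot>\<^bsub>localize (L_eps n g)\<^esub> dual_op n g x \<xi> else dual_op n g x \<xi>)"

definition dual_space :: "nat \<Rightarrow> nat \<Rightarrow> (nat \<Rightarrow> complex fps fps) set set" where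
  "dual_space n g = sum_of_weight_spaces (L_eps n g) (eps_gen g H_gen) {m. int g dvd m}"

definition dual_L :: "int \<Rightarrow> nat \<Rightarrow> nat \<Rightarrow>
    (complex fps, (nat \<Rightarrow> complex fps fps) set, qgen free_alg fps set) rep" where
  "dual_L s n g = rep_by_generators (U_q (of_nat g)) (q_gen (of_nat g))
     \<lparr>carrier = dual_space n g, monoid.mult = undefined, one = undefined, zero = \<zero>\<^bsub>L_eps n g\<^esub>,
      add = add (L_eps n g), module.smult = module.smult (L_eps n g), act = undefined\<rparr>
     (\<lambda>x v. THE w. w \<in> dual_space n g \<and>
        loc_frac (L_eps n g) w 0 = twisted_dual_op s n g x (loc_frac (L_eps n g) v 0))"

section \<open>Characters\<close>

text \<open>The group ring \<open>\<int>[P]\<close> of \<open>P = \<int>\<omega>\<close> is \<^typ>\<open>int \<Rightarrow>\<^sub>0 int\<close>, where \<open>e\<^bsup>m\<omega>\<^esup>\<close> is \<open>Poly_Mapping.single m 1\<close>.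
  \<open>chi r\<close> is the character for \<open>U_q r\<close>.\<close>

definition chi :: "complex \<Rightarrow> (complex fps, 'm, qgen free_alg fps set) rep \<Rightarrow> (int \<Rightarrow>\<^sub>0 int)" where
  "chi r V = (\<Sum>m\<in>{m. weight_space V (q_gen r Ht_gen) m \<noteq> {\<zero>\<^bsub>V\<^esub>}}.
     Poly_Mapping.single m (int (module_rank (V\<lparr>carrier := weight_space V (q_gen r Ht_gen) m\<rparr>))))"

definition Pi_g :: "nat \<Rightarrow> (int \<Rightarrow>\<^sub>0 int) \<Rightarrow> (int \<Rightarrow>\<^sub>0 int)" where
  "Pi_g g f = (\<Sum>m\<in>Poly_Mapping.keys f.
     if int g dvd m then Poly_Mapping.single (m div int g) (Poly_Mapping.lookup f m) else 0)"

end

theory Submission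
  imports Defs "HOL-Analysis.FPS_Convergence"
begin

text \<open>
  Every representation in the theorem has an explicit basis \<open>m\<^sub>0, \<dots>, m\<^sub>n\<close>, so the whole argument is
  carried out with matrices. An action of a topologically generated algebra on a module that is separated for
  the adic topology is determined by the generators, because the elements on which two actions agree form a
  closed subalgebra (\<open>unique_action_U_q\<close>, \<open>unique_action_U_hh\<close>). Conversely, matrices for the generators
  extend continuously to the power series over the free algebra, and they give a representation as soon as they
  satisfy the defining relations (\<open>rep_by_generators_matrep\<close>).

  The relations on \<open>L\<^bsup>h,h'\<^esup>(n,g)\<close> (\<open>L_hh_relations\<close>) hold because \<open>C\<close> acts as \<open>(n+1)\<^sup>2\<close>: in a series that is even
  in \<open>\<surd>C\<close> one may put \<open>\<surd>C = n + 1\<close>, and then \<open>H\<^sub>e\<^sup>\<plusminus>\<close> takes on \<open>m\<^sub>j\<close> the integral values that occur in the formulas for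
  \<open>X\<^sup>+X\<^sup>-\<close> and \<open>X\<^sup>-X\<^sup>+\<close>. The numbers themselves become manageable through one observation:
  \<open>(Q T\<^bsup>{a}\<^esup>)\<^sup>b = exp(b(h + h'{a}))\<close> arises from \<open>exp(bh)\<close> by the translation \<open>h \<mapsto> h + h'{a}\<close>, hence \<open>[a]\<close> with base
  \<open>Q T\<^bsup>{a}\<^esup>\<close> is the translate of \<open>[a]\<^sub>Q\<close> (\<open>QT_number_eq\<close>). Modulo \<open>h'\<close> the translation is the identity, which gives the
  limit \<open>L\<^sup>h(n)\<close>. That module is indecomposable since every nonzero submodule contains a nonzero multiple of \<open>m\<^sub>n\<close>.

  An element of \<open>\<complex>[Q\<^sup>\<plusminus>\<^sup>1]\<close> that vanishes at \<open>Q = \<epsilon>\<close> is divisible by \<open>Q - \<epsilon>\<close>, so \<open>L\<^bsup>\<epsilon>,h'\<^esup>(n,g)\<close> consists of the fibres of the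
  coefficientwise evaluation at \<open>\<epsilon>\<close> and is free over \<open>\<complex>[[h']]\<close> on the images of the \<open>m\<^sub>j\<close>. The decisive point is that
  \<open>P(\<epsilon>\<^sup>a)\<close> is \<open>1\<close> if \<open>g\<close> divides \<open>a\<close> and \<open>0\<close> otherwise (\<open>ev_P_of\<close>). Among \<open>g\<close> consecutive numbers \<open>[a]\<close> exactly one
  therefore depends on \<open>T\<close>; it is \<open>\<plusminus>(T\<^bsup>gb\<^esup> - T\<^bsup>-gb\<^esup>)/(\<epsilon>T - \<epsilon>\<^sup>-\<^sup>1T\<^sup>-\<^sup>1)\<close>, while the others multiply to \<open>\<plusminus>[g-1]\<^sup>!\<^sub>\<epsilon>\<close>
  (\<open>eps_number_prod\<close>). With the normalization of \<open>\<^sup>LX\<^sup>+\<close>, the entry of \<open>(X\<^sup>+)\<^sup>g\<close> from \<open>m\<^bsub>i+g\<^esub>\<close> to \<open>m\<^sub>i\<close> becomes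
  \<open>(-1)\<^bsup>n+g\<^esup>\<close> times a product of two quantum numbers with \<open>q = T\<^sup>g\<close> (\<open>dual_coeff_prod\<close>), and the sign is
  cancelled by \<open>s\<close>.

  Since \<open>g\<close> divides \<open>n\<close>, the weight \<open>n - 2j\<close> is divisible by \<open>g\<close> if and only if \<open>g\<close> divides \<open>2j\<close>. The dual operators move
  indices by \<open>g\<close> and preserve each residue class modulo \<open>g\<close>. If \<open>g\<close> is odd, the only class is that of \<open>0\<close>, and the vectors
  \<open>m\<^bsub>gk\<^esub>\<close> with \<open>k \<le> n/g\<close> span \<open>L\<^bsup>gh'\<^esup>(n/g)\<close>. If \<open>g\<close> is even, the class of \<open>g/2\<close> occurs as well, and for \<open>n > 0\<close> its vectors
  \<open>m\<^bsub>gk + g/2\<^esub>\<close> with \<open>k \<le> n/g - 1\<close> span \<open>L\<^bsup>gh'\<^esup>(n/g - 1)\<close>. The character identity holds because dividing the weights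
  by \<open>g\<close> is what \<open>\<^sup>LH = H/g\<close> does.
\<close>

unbundle no vec_syntax

section \<open>Quotients of algebras\<close>

lemma ring_transfer:
  assumes "ring R" "carrier S = carrier R" "monoid.mult S = monoid.mult R" "one S = one R"
    "zero S = zero R" "add S = add R"
  shows "ring S"
proof -
  interpret R: ring R by fact
  have "\<exists>y\<in>carrier S. y \<oplus>\<^bsub>S\<^esub> x = \<zero>\<^bsub>S\<^esub>" if "x \<in> carrier S" for x
    by (rule bexI[of _ "\<ominus>\<^bsub>R\<^esub> x"]) (use that in \<open>simp_all add: assms(2-) R.l_neg\<close>)
  then have "abelian_group S"
    by (intro abelian_groupI) (simp_all add: assms(2-) R.a_assoc R.a_comm R.a_lcomm)
  moreover have "monoid S"
    by (rule monoidI) (simp_all add: assms(2-) R.m_assoc)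
  ultimately show ?thesis
    by (rule ringI) (simp_all add: assms(2-) R.l_distr R.r_distr)
qed

text \<open>The scalar multiplication of a quotient is a union over representatives; under these conditions it
  is a single coset.\<close>

locale alg_quotient =
  fixes \<phi> :: "'l \<Rightarrow> 'k" and U :: "('k, 'u) module" and J
  assumes J: "ideal J U"
    and smult_closed: "x \<in> carrier U \<Longrightarrow> \<phi> c \<odot>\<^bsub>U\<^esub> x \<in> carrier U"
    and smult_J: "x \<in> J \<Longrightarrow> \<phi> c \<odot>\<^bsub>U\<^esub> x \<in> J"
    and smult_add: "x \<in> carrier U \<Longrightarrow> y \<in> carrier U \<Longrightarrow>
      \<phi> c \<odot>\<^bsub>U\<^esub> (x \<oplus>\<^bsub>U\<^esub> y) = \<phi> c \<odot>\<^bsub>U\<^esub> x \<oplus>\<^bsub>U\<^esub> \<phi> c \<odot>\<^bsub>U\<^esub> y"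
begin

interpretation J: ideal J U by (rule J)

lemma carrier_quot: "carrier (quot_alg \<phi> U J) = (\<lambda>x. J +>\<^bsub>U\<^esub> x) ` carrier U"
  by (auto simp: quot_alg_def FactRing_def A_RCOSETS_def')

lemma one_quot: "\<one>\<^bsub>quot_alg \<phi> U J\<^esub> = J +>\<^bsub>U\<^esub> \<one>\<^bsub>U\<^esub>"
  by (simp add: quot_alg_def FactRing_def)

lemma zero_quot: "\<zero>\<^bsub>quot_alg \<phi> U J\<^esub> = J"
  by (simp add: quot_alg_def FactRing_def)

lemma mult_quot:
  "x \<in> carrier U \<Longrightarrow> y \<in> carrier U \<Longrightarrow>
    (J +>\<^bsub>U\<^esub> x) \<otimes>\<^bsub>quot_alg \<phi> U J\<^esub> (J +>\<^bsub>U\<^esub> y) = J +>\<^bsub>U\<^esub> (x \<otimes>\<^bsub>U\<^esub> y)"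
  by (simp add: quot_alg_def FactRing_def J.rcoset_mult_add)

lemma add_quot:
  "x \<in> carrier U \<Longrightarrow> y \<in> carrier U \<Longrightarrow>
    (J +>\<^bsub>U\<^esub> x) \<oplus>\<^bsub>quot_alg \<phi> U J\<^esub> (J +>\<^bsub>U\<^esub> y) = J +>\<^bsub>U\<^esub> (x \<oplus>\<^bsub>U\<^esub> y)"
  by (simp add: quot_alg_def FactRing_def J.a_rcos_sum)

lemma coset_eq: "x \<in> carrier U \<Longrightarrow> j \<in> J \<Longrightarrow> J +>\<^bsub>U\<^esub> (j \<oplus>\<^bsub>U\<^esub> x) = J +>\<^bsub>U\<^esub> x"
  by (metis J.a_Hcarr J.a_coset_add_assoc J.a_coset_join2 J.a_subset J.is_additive_subgroup
      additive_subgroup.a_subgroup)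

lemma mem_coset: "y \<in> J +>\<^bsub>U\<^esub> x \<longleftrightarrow> (\<exists>j\<in>J. y = j \<oplus>\<^bsub>U\<^esub> x)"
  by (auto simp: a_r_coset_def')

lemma self_mem_coset: "x \<in> carrier U \<Longrightarrow> x \<in> J +>\<^bsub>U\<^esub> x"
  by (rule J.a_rcos_self)

lemma smult_quot:
  assumes "x \<in> carrier U"
  shows "c \<odot>\<^bsub>quot_alg \<phi> U J\<^esub> (J +>\<^bsub>U\<^esub> x) = J +>\<^bsub>U\<^esub> (\<phi> c \<odot>\<^bsub>U\<^esub> x)"
proof -
  have "J +>\<^bsub>U\<^esub> (\<phi> c \<odot>\<^bsub>U\<^esub> y) = J +>\<^bsub>U\<^esub> (\<phi> c \<odot>\<^bsub>U\<^esub> x)" if y: "y \<in> J +>\<^bsub>U\<^esub> x" for y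
  proof -
    obtain j where "j \<in> J" "y = j \<oplus>\<^bsub>U\<^esub> x" using y mem_coset by auto
    then show ?thesis
      using assms by (simp add: smult_add J.a_Hcarr coset_eq smult_J smult_closed)
  qed
  then have "(\<Union>y\<in>J +>\<^bsub>U\<^esub> x. J +>\<^bsub>U\<^esub> (\<phi> c \<odot>\<^bsub>U\<^esub> y)) = J +>\<^bsub>U\<^esub> (\<phi> c \<odot>\<^bsub>U\<^esub> x)"
    using self_mem_coset[OF assms] by (intro SUP_eq_const) blast+
  then show ?thesis by (simp add: quot_alg_def)
qed

lemma ring_quot: "ring (quot_alg \<phi> U J)"
  by (rule ring_transfer[OF J.quotient_is_ring]) (simp_all add: quot_alg_def)

end

text \<open>Both algebras of power series over a free algebra are rings given by a type, with the scalars embedded by a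
  ring homomorphism \<open>\<sigma>\<close>.\<close>

definition type_alg :: "('k \<Rightarrow> 'a::ring_1) \<Rightarrow> ('k, 'a) module" where
  "type_alg \<sigma> = \<lparr>carrier = UNIV, monoid.mult = (*), one = 1, zero = 0, add = (+),
     module.smult = (\<lambda>c x. \<sigma> c * x)\<rparr>"

lemma type_alg_simps [simp]:
  "carrier (type_alg \<sigma>) = UNIV" "monoid.mult (type_alg \<sigma>) = (*)" "one (type_alg \<sigma>) = 1"
  "zero (type_alg \<sigma>) = 0" "add (type_alg \<sigma>) = (+)" "module.smult (type_alg \<sigma>) = (\<lambda>c x. \<sigma> c * x)"
  by (simp_all add: type_alg_def)

lemma ring_type_alg: "ring (type_alg (\<sigma> :: 'k \<Rightarrow> 'a::ring_1))"
proof -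
  have "\<exists>y. y + x = 0" for x :: 'a by (rule exI[of _ "- x"]) simp
  then show ?thesis
    by (intro ringI abelian_groupI monoidI) (auto simp: algebra_simps)
qed

definition two_sided :: "'a::ring_1 set \<Rightarrow> bool" where
  "two_sided J \<longleftrightarrow> 0 \<in> J \<and> (\<forall>x\<in>J. \<forall>y\<in>J. x + y \<in> J) \<and> (\<forall>x\<in>J. \<forall>a. a * x \<in> J \<and> x * a \<in> J)"

lemma a_inv_type_alg: "\<ominus>\<^bsub>type_alg \<sigma>\<^esub> x = - x"
proof -
  interpret ring "type_alg \<sigma>" by (rule ring_type_alg)
  show ?thesis by (rule minus_equality) auto
qed

lemma ideal_type_alg: "ideal J (type_alg \<sigma>) \<longleftrightarrow> two_sided J"
proof
  assume "ideal J (type_alg \<sigma>)"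
  then interpret ideal J "type_alg \<sigma>" .
  show "two_sided J"
    using additive_subgroup.zero_closed[OF is_additive_subgroup]
      additive_subgroup.a_closed[OF is_additive_subgroup] I_l_closed I_r_closed
    by (auto simp: two_sided_def)
next
  assume J: "two_sided J"
  have um: "- x \<in> J" if "x \<in> J" for x
    using J that unfolding two_sided_def by (metis mult_minus1)
  show "ideal J (type_alg \<sigma>)"
  proof (rule idealI[OF ring_type_alg])
    show "subgroup J (add_monoid (type_alg \<sigma>))"
    proof (rule subgroup.intro)
      fix x assume "x \<in> J"
      then show "inv\<^bsub>add_monoid (type_alg \<sigma>)\<^esub> x \<in> J"
        using um a_inv_type_alg[of \<sigma> x] unfolding a_inv_def by simp
    qed (use J in \<open>auto simp: two_sided_def\<close>)
  qed (use J in \<open>auto simp: two_sided_def\<close>)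
qed

lemma two_sided_Idl: "two_sided (Idl\<^bsub>type_alg \<sigma>\<^esub> S)"
  using ring.genideal_ideal[OF ring_type_alg, of S \<sigma>] by (simp add: ideal_type_alg)

lemma Idl_subset: "two_sided J \<Longrightarrow> S \<subseteq> J \<Longrightarrow> Idl\<^bsub>type_alg \<sigma>\<^esub> S \<subseteq> J"
  using ring.genideal_minimal[OF ring_type_alg] by (metis ideal_type_alg)

lemma alg_quotient_type_alg:
  assumes "two_sided J"
  shows "alg_quotient id (type_alg \<sigma>) J"
  using assms ideal_type_alg[of J \<sigma>]
  by (intro alg_quotient.intro) (auto simp: two_sided_def distrib_left)

section \<open>Modules of coordinate functions\<close>

text \<open>The index set is arbitrary because the dual space has a basis indexed by some of the numbers up to \<open>n\<close>.\<close>

definition coord_on :: "nat set \<Rightarrow> ('k::comm_ring_1, nat \<Rightarrow> 'k, 'u) rep" where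
  "coord_on J = \<lparr>carrier = {f. \<forall>j. j \<notin> J \<longrightarrow> f j = 0}, monoid.mult = undefined, one = undefined,
     zero = (\<lambda>j. 0), add = (\<lambda>f f' j. f j + f' j), module.smult = (\<lambda>c f j. c * f j), act = undefined\<rparr>"

lemma coord_on_simps [simp]:
  "carrier (coord_on J) = {f. \<forall>j. j \<notin> J \<longrightarrow> f j = 0}" "zero (coord_on J) = (\<lambda>j. 0)"
  "add (coord_on J) = (\<lambda>f f' j. f j + f' j)" "module.smult (coord_on J) = (\<lambda>c f j. c * f j)"
  by (simp_all add: coord_on_def)

lemma coord_module_eq: "coord_module n = coord_on {..n}"
  by (auto simp: coord_module_def coord_on_def not_le)

lemma module_coord_on: "module (ring_of_type_algebra :: 'k::comm_ring_1 ring) (coord_on J)"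
proof (rule moduleI)
  have "\<exists>y\<in>carrier (coord_on J). y \<oplus>\<^bsub>coord_on J\<^esub> x = \<zero>\<^bsub>coord_on J\<^esub>"
    if "x \<in> carrier (coord_on J)" for x :: "nat \<Rightarrow> 'k"
    by (rule bexI[of _ "\<lambda>j. - x j"]) (use that in auto)
  then show "abelian_group (coord_on J :: ('k, _, _) rep)"
    by (intro abelian_groupI) (auto simp: add_ac)
qed (use cring_from_type_algebra in \<open>auto simp: ring_of_type_algebra_def algebra_simps\<close>)

lemma module_act_update [simp]:
  "module R (V\<lparr>act := \<rho>\<rparr>) \<longleftrightarrow> module R (V :: ('k, 'm, 'u) rep)"
proof -
  have *: "module R (V\<lparr>act := \<rho>\<rparr>)" if "module R V" for V :: "('k, 'm, 'u) rep" and \<rho>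
  proof -
    interpret V: module R V by fact
    have "\<exists>y\<in>carrier (V\<lparr>act := \<rho>\<rparr>). y \<oplus>\<^bsub>V\<lparr>act := \<rho>\<rparr>\<^esub> x = \<zero>\<^bsub>V\<lparr>act := \<rho>\<rparr>\<^esub>"
      if "x \<in> carrier (V\<lparr>act := \<rho>\<rparr>)" for x
      by (rule bexI[of _ "\<ominus>\<^bsub>V\<^esub> x"]) (use that in \<open>simp_all add: V.M.l_neg\<close>)
    then have "abelian_group (V\<lparr>act := \<rho>\<rparr>)"
      by (intro abelian_groupI) (simp_all add: V.M.a_assoc V.M.a_comm V.M.a_lcomm)
    with V.R.is_cring show ?thesis
      by (rule moduleI) (simp_all add: V.smult_l_distr V.smult_r_distr V.smult_assoc1)
  qed
  have "V = (V\<lparr>act := \<rho>\<rparr>)\<lparr>act := act V\<rparr>" by simp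
  then show ?thesis using * by metis
qed

text \<open>An isomorphism of module records. The modules of the theorem are built by quotients and unions, so
  module axioms and bases are established for coordinate functions and carried over along such a map.\<close>

definition lin_transfer :: "('k::comm_ring_1, 'm, 'c) module_scheme \<Rightarrow> ('k, 'n, 'd) module_scheme \<Rightarrow>
    ('m \<Rightarrow> 'n) \<Rightarrow> bool" where
  "lin_transfer W V \<beta> \<longleftrightarrow> bij_betw \<beta> (carrier W) (carrier V) \<and> zero V = \<beta> (zero W) \<and>
     (\<forall>x\<in>carrier W. \<forall>y\<in>carrier W. \<beta> x \<oplus>\<^bsub>V\<^esub> \<beta> y = \<beta> (x \<oplus>\<^bsub>W\<^esub> y)) \<and>
     (\<forall>c. \<forall>x\<in>carrier W. c \<odot>\<^bsub>V\<^esub> \<beta> x = \<beta> (c \<odot>\<^bsub>W\<^esub> x))"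

lemma lin_transferD:
  assumes "lin_transfer W V \<beta>"
  shows "carrier V = \<beta> ` carrier W" "inj_on \<beta> (carrier W)" "zero V = \<beta> (zero W)"
    "x \<in> carrier W \<Longrightarrow> y \<in> carrier W \<Longrightarrow> \<beta> x \<oplus>\<^bsub>V\<^esub> \<beta> y = \<beta> (x \<oplus>\<^bsub>W\<^esub> y)"
    "x \<in> carrier W \<Longrightarrow> c \<odot>\<^bsub>V\<^esub> \<beta> x = \<beta> (c \<odot>\<^bsub>W\<^esub> x)"
    "x \<in> carrier W \<Longrightarrow> y \<in> carrier W \<Longrightarrow> \<beta> x = \<beta> y \<longleftrightarrow> x = y"
  using assms by (auto simp: lin_transfer_def bij_betw_def inj_on_eq_iff)

lemma module_lin_transfer:
  assumes "module (ring_of_type_algebra :: 'k::comm_ring_1 ring) W" "lin_transfer W V \<beta>"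
  shows "module (ring_of_type_algebra :: 'k ring) V"
proof -
  interpret W: module "ring_of_type_algebra :: 'k ring" W by fact
  note D = lin_transferD[OF assms(2)]
  have c[simp]: "c \<odot>\<^bsub>W\<^esub> x \<in> carrier W" if "x \<in> carrier W" for c x
    using W.smult_closed[of c x] that by (simp add: ring_of_type_algebra_def)
  have "\<exists>y\<in>carrier V. y \<oplus>\<^bsub>V\<^esub> x = \<zero>\<^bsub>V\<^esub>" if x: "x \<in> carrier V" for x
  proof -
    obtain w where w: "w \<in> carrier W" "x = \<beta> w" using x D(1) by auto
    then show ?thesis
      by (intro bexI[of _ "\<beta> (\<ominus>\<^bsub>W\<^esub> w)"]) (simp_all add: D(1,3,4) W.M.l_neg)
  qed
  then have "abelian_group V"
    by (intro abelian_groupI) (auto simp: D W.M.a_assoc W.M.a_comm W.M.a_lcomm)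
  with W.R.is_cring show ?thesis
    by (rule moduleI)
      (use W.smult_l_distr W.smult_r_distr W.smult_assoc1 W.smult_one in
        \<open>auto simp: D ring_of_type_algebra_def\<close>)
qed

lemma alg_moduleD:
  assumes "alg_module (U :: ('k::comm_ring_1, 'u) module) V"
  shows "module (ring_of_type_algebra :: 'k ring) V"
    "u \<in> carrier U \<Longrightarrow> x \<in> carrier V \<Longrightarrow> act V u x \<in> carrier V"
    "u \<in> carrier U \<Longrightarrow> x \<in> carrier V \<Longrightarrow> y \<in> carrier V \<Longrightarrow> act V u (x \<oplus>\<^bsub>V\<^esub> y) = act V u x \<oplus>\<^bsub>V\<^esub> act V u y"
    "u \<in> carrier U \<Longrightarrow> x \<in> carrier V \<Longrightarrow> act V u (c \<odot>\<^bsub>V\<^esub> x) = c \<odot>\<^bsub>V\<^esub> act V u x"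
    "u \<in> carrier U \<Longrightarrow> v \<in> carrier U \<Longrightarrow> x \<in> carrier V \<Longrightarrow> act V (u \<oplus>\<^bsub>U\<^esub> v) x = act V u x \<oplus>\<^bsub>V\<^esub> act V v x"
    "u \<in> carrier U \<Longrightarrow> x \<in> carrier V \<Longrightarrow> act V (c \<odot>\<^bsub>U\<^esub> u) x = c \<odot>\<^bsub>V\<^esub> act V u x"
    "u \<in> carrier U \<Longrightarrow> v \<in> carrier U \<Longrightarrow> x \<in> carrier V \<Longrightarrow> act V (u \<otimes>\<^bsub>U\<^esub> v) x = act V u (act V v x)"
    "x \<in> carrier V \<Longrightarrow> act V \<one>\<^bsub>U\<^esub> x = x"
  using assms by (simp_all add: alg_module_def)

lemma module_type_smult_closed:
  assumes "module (ring_of_type_algebra :: 'k::comm_ring_1 ring) V" "x \<in> carrier V"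
  shows "c \<odot>\<^bsub>V\<^esub> x \<in> carrier V"
  using module.smult_closed[OF assms(1), of c x] assms(2) by (simp add: ring_of_type_algebra_def)

lemma module_add_closed:
  assumes "module R V" "x \<in> carrier V" "y \<in> carrier V"
  shows "x \<oplus>\<^bsub>V\<^esub> y \<in> carrier V"
  using assms by (simp add: abelian_monoid.a_closed module.axioms abelian_group.axioms)

lemma alg_module_lin_transfer:
  assumes W: "alg_module U W" and tr: "lin_transfer W V \<beta>"
    and act: "\<And>u x. u \<in> carrier U \<Longrightarrow> x \<in> carrier W \<Longrightarrow> act V u (\<beta> x) = \<beta> (act W u x)"
    and cl: "\<And>u v. u \<in> carrier U \<Longrightarrow> v \<in> carrier U \<Longrightarrow> u \<oplus>\<^bsub>U\<^esub> v \<in> carrier U \<and> u \<otimes>\<^bsub>U\<^esub> v \<in> carrier U"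
      "\<And>c u. u \<in> carrier U \<Longrightarrow> c \<odot>\<^bsub>U\<^esub> u \<in> carrier U" "\<one>\<^bsub>U\<^esub> \<in> carrier U"
  shows "alg_module U V"
proof -
  note D = lin_transferD[OF tr]
  note A = alg_moduleD[OF W]
  note c = module_type_smult_closed[OF A(1)] module_add_closed[OF A(1)]
  show ?thesis
    unfolding alg_module_def
    using module_lin_transfer[OF A(1) tr]
    by (auto simp: D act cl A c)
qed

lemma finsum_lin_transfer:
  assumes W: "abelian_monoid W" and V: "abelian_monoid V" and tr: "lin_transfer W V \<beta>"
    and f: "\<And>a. a \<in> A \<Longrightarrow> f a \<in> carrier W"
  shows "(\<Oplus>\<^bsub>V\<^esub>a\<in>A. \<beta> (f a)) = \<beta> (\<Oplus>\<^bsub>W\<^esub>a\<in>A. f a)"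
proof -
  interpret W: abelian_monoid W by fact
  interpret V: abelian_monoid V by fact
  note D = lin_transferD[OF tr]
  show ?thesis using f
  proof (induction A rule: infinite_finite_induct)
    case (insert a A)
    then show ?case by (simp add: D Pi_def)
  qed (simp_all add: D)
qed

lemma module_abelian_monoid: "module R V \<Longrightarrow> abelian_monoid V"
  by (simp add: module.axioms abelian_group.axioms)

lemma is_basis_lin_transfer:
  fixes W :: "('k::comm_ring_1, 'm, 'c) module_scheme"
  assumes mW: "module (ring_of_type_algebra :: 'k ring) W" and tr: "lin_transfer W V \<beta>"
    and B: "is_basis W B"
  shows "is_basis V (\<beta> ` B)"
proof -
  note D = lin_transferD[OF tr]
  have mV: "module (ring_of_type_algebra :: 'k ring) V" by (rule module_lin_transfer[OF mW tr])
  have BW: "B \<subseteq> carrier W" "finite B" using B by (auto simp: is_basis_def)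
  have inj: "inj_on \<beta> B" using D(2) BW inj_on_subset by blast
  interpret V: abelian_monoid V by (rule module_abelian_monoid[OF mV])
  interpret W: abelian_monoid W by (rule module_abelian_monoid[OF mW])
  have sum: "(\<Oplus>\<^bsub>V\<^esub>b\<in>\<beta> ` B. c b \<odot>\<^bsub>V\<^esub> b) = \<beta> (\<Oplus>\<^bsub>W\<^esub>b\<in>B. c (\<beta> b) \<odot>\<^bsub>W\<^esub> b)" for c
  proof -
    have "(\<Oplus>\<^bsub>V\<^esub>b\<in>\<beta> ` B. c b \<odot>\<^bsub>V\<^esub> b) = (\<Oplus>\<^bsub>V\<^esub>b\<in>B. c (\<beta> b) \<odot>\<^bsub>V\<^esub> \<beta> b)"
      by (rule V.add.finprod_reindex[OF _ inj])
        (use BW D(1) module_type_smult_closed[OF mV] in auto)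
    also have "\<dots> = (\<Oplus>\<^bsub>V\<^esub>b\<in>B. \<beta> (c (\<beta> b) \<odot>\<^bsub>W\<^esub> b))"
      by (rule V.finsum_cong') (use BW D module_type_smult_closed[OF mW] in auto)
    also have "\<dots> = \<beta> (\<Oplus>\<^bsub>W\<^esub>b\<in>B. c (\<beta> b) \<odot>\<^bsub>W\<^esub> b)"
      by (rule finsum_lin_transfer[OF W.abelian_monoid_axioms V.abelian_monoid_axioms tr])
        (use BW module_type_smult_closed[OF mW] in auto)
    finally show ?thesis .
  qed
  have Wsum: "(\<Oplus>\<^bsub>W\<^esub>b\<in>B. c b \<odot>\<^bsub>W\<^esub> b) \<in> carrier W" for c
    by (rule W.finsum_closed) (use BW module_type_smult_closed[OF mW] in auto)
  have "\<exists>!c. c \<in> extensional (\<beta> ` B) \<and> v = (\<Oplus>\<^bsub>V\<^esub>b\<in>\<beta> ` B. c b \<odot>\<^bsub>V\<^esub> b)" if v: "v \<in> carrier V" for v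
  proof -
    obtain w where w: "w \<in> carrier W" "v = \<beta> w" using v D(1) by auto
    obtain c where c: "c \<in> extensional B" "w = (\<Oplus>\<^bsub>W\<^esub>b\<in>B. c b \<odot>\<^bsub>W\<^esub> b)"
      and uniq: "\<And>c'. c' \<in> extensional B \<Longrightarrow> w = (\<Oplus>\<^bsub>W\<^esub>b\<in>B. c' b \<odot>\<^bsub>W\<^esub> b) \<Longrightarrow> c' = c"
    proof -
      have "\<exists>!c. c \<in> extensional B \<and> w = (\<Oplus>\<^bsub>W\<^esub>b\<in>B. c b \<odot>\<^bsub>W\<^esub> b)"
        using B w(1) unfolding is_basis_def by blast
      then show ?thesis using that by (elim ex1E) blast
    qed
    have cong: "(\<Oplus>\<^bsub>W\<^esub>b\<in>B. d b \<odot>\<^bsub>W\<^esub> b) = (\<Oplus>\<^bsub>W\<^esub>b\<in>B. d' b \<odot>\<^bsub>W\<^esub> b)" if "\<And>b. b \<in> B \<Longrightarrow> d b = d' b" for d d'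
      by (rule W.finsum_cong') (use that BW module_type_smult_closed[OF mW] in auto)
    show ?thesis
    proof (rule ex1I[of _ "restrict (c \<circ> the_inv_into B \<beta>) (\<beta> ` B)"])
      show "restrict (c \<circ> the_inv_into B \<beta>) (\<beta> ` B) \<in> extensional (\<beta> ` B) \<and>
        v = (\<Oplus>\<^bsub>V\<^esub>b\<in>\<beta> ` B. restrict (c \<circ> the_inv_into B \<beta>) (\<beta> ` B) b \<odot>\<^bsub>V\<^esub> b)"
        unfolding sum w(2) c(2)
        by (intro conjI arg_cong[of _ _ \<beta>] cong) (simp_all add: the_inv_into_f_f[OF inj])
    next
      fix d assume d: "d \<in> extensional (\<beta> ` B) \<and> v = (\<Oplus>\<^bsub>V\<^esub>b\<in>\<beta> ` B. d b \<odot>\<^bsub>V\<^esub> b)"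
      then have "\<beta> w = \<beta> (\<Oplus>\<^bsub>W\<^esub>b\<in>B. d (\<beta> b) \<odot>\<^bsub>W\<^esub> b)" using sum w by metis
      then have "w = (\<Oplus>\<^bsub>W\<^esub>b\<in>B. d (\<beta> b) \<odot>\<^bsub>W\<^esub> b)" using D(6)[OF w(1) Wsum] by simp
      also have "\<dots> = (\<Oplus>\<^bsub>W\<^esub>b\<in>B. restrict (d \<circ> \<beta>) B b \<odot>\<^bsub>W\<^esub> b)" by (rule cong) simp
      finally have *: "restrict (d \<circ> \<beta>) B = c" by (intro uniq) auto
      show "d = restrict (c \<circ> the_inv_into B \<beta>) (\<beta> ` B)"
      proof (rule extensionalityI)
        fix y assume "y \<in> \<beta> ` B"
        then show "d y = restrict (c \<circ> the_inv_into B \<beta>) (\<beta> ` B) y"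
          by (auto simp: the_inv_into_f_f[OF inj] simp flip: *)
      qed (use d in auto)
    qed
  qed
  then show ?thesis unfolding is_basis_def using BW D(1) by auto
qed

lemma finsum_coord_on:
  assumes "\<And>a. a \<in> A \<Longrightarrow> f a \<in> carrier (coord_on J)" "finite A"
  shows "(\<Oplus>\<^bsub>coord_on J :: ('k::comm_ring_1, _, _) rep\<^esub>a\<in>A. f a) = (\<lambda>j. \<Sum>a\<in>A. f a j)"
proof -
  interpret module "ring_of_type_algebra :: 'k ring" "coord_on J" by (rule module_coord_on)
  show ?thesis using assms(2,1)
    by (induction A rule: finite_induct) (auto simp: Pi_def fun_eq_iff)
qed

lemma is_basis_coord_on:
  assumes "finite J"
  shows "is_basis (coord_on J :: ('k::comm_ring_1, nat \<Rightarrow> 'k, 'u) rep) (m_vec ` J)"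
proof -
  let ?V = "coord_on J :: ('k, nat \<Rightarrow> 'k, 'u) rep"
  have inj: "inj_on (m_vec :: nat \<Rightarrow> nat \<Rightarrow> 'k) J"
    by (auto simp: inj_on_def m_vec_def fun_eq_iff split: if_splits)
  have car: "m_vec j \<in> carrier ?V" if "j \<in> J" for j
    using that by (auto simp: m_vec_def)
  have sum: "(\<Oplus>\<^bsub>?V\<^esub>b\<in>m_vec ` J. c b \<odot>\<^bsub>?V\<^esub> b) = (\<lambda>j. if j \<in> J then c (m_vec j) else 0)"
    for c :: "(nat \<Rightarrow> 'k) \<Rightarrow> 'k"
  proof -
    have "(\<Oplus>\<^bsub>?V\<^esub>b\<in>m_vec ` J. c b \<odot>\<^bsub>?V\<^esub> b) = (\<lambda>i. \<Sum>b\<in>m_vec ` J. c b * b i)"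
      by (subst finsum_coord_on) (use car assms in auto)
    also have "\<dots> = (\<lambda>i. \<Sum>j\<in>J. c (m_vec j) * m_vec j i)"
      by (simp add: sum.reindex[OF inj])
    also have "\<dots> = (\<lambda>j. if j \<in> J then c (m_vec j) else 0)"
      using assms by (auto simp: m_vec_def fun_eq_iff if_distrib[of "\<lambda>x. _ * x"] cong: if_cong)
    finally show ?thesis .
  qed
  have "\<exists>!c. c \<in> extensional (m_vec ` J) \<and> v = (\<Oplus>\<^bsub>?V\<^esub>b\<in>m_vec ` J. c b \<odot>\<^bsub>?V\<^esub> b)"
    if v: "v \<in> carrier ?V" for v :: "nat \<Rightarrow> 'k"
  proof (rule ex1I[of _ "restrict (v \<circ> the_inv_into J m_vec) (m_vec ` J)"])
    show "restrict (v \<circ> the_inv_into J m_vec) (m_vec ` J) \<in> extensional (m_vec ` J) \<and>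
      v = (\<Oplus>\<^bsub>?V\<^esub>b\<in>m_vec ` J. restrict (v \<circ> the_inv_into J m_vec) (m_vec ` J) b \<odot>\<^bsub>?V\<^esub> b)"
      unfolding sum using v by (auto simp: the_inv_into_f_f[OF inj])
    fix d assume d: "d \<in> extensional (m_vec ` J) \<and> v = (\<Oplus>\<^bsub>?V\<^esub>b\<in>m_vec ` J. d b \<odot>\<^bsub>?V\<^esub> b)"
    show "d = restrict (v \<circ> the_inv_into J m_vec) (m_vec ` J)"
    proof (rule extensionalityI)
      fix y :: "nat \<Rightarrow> 'k" assume "y \<in> m_vec ` J"
      then show "d y = restrict (v \<circ> the_inv_into J m_vec) (m_vec ` J) y"
        using d unfolding sum by (auto simp: the_inv_into_f_f[OF inj])
    qed (use d in auto)
  qed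
  then show ?thesis unfolding is_basis_def using car assms by auto
qed

section \<open>Matrix representations\<close>

text \<open>Representations by matrices are preferred to operators because the specialization at \<open>Q = \<epsilon>\<close> can be applied
  to the entries.\<close>

definition matrep :: "('k::comm_ring_1, 'u) module \<Rightarrow> nat \<Rightarrow> ('u \<Rightarrow> nat \<Rightarrow> nat \<Rightarrow> 'k) \<Rightarrow> bool" where
  "matrep U n M \<longleftrightarrow> (\<forall>i\<le>n. \<forall>j\<le>n.
     (\<forall>u\<in>carrier U. \<forall>v\<in>carrier U. M (u \<oplus>\<^bsub>U\<^esub> v) i j = M u i j + M v i j \<and>
        M (u \<otimes>\<^bsub>U\<^esub> v) i j = (\<Sum>l\<le>n. M u i l * M v l j)) \<and>
     (\<forall>u\<in>carrier U. \<forall>c. M (c \<odot>\<^bsub>U\<^esub> u) i j = c * M u i j) \<and> M \<one>\<^bsub>U\<^esub> i j = of_bool (i = j))"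

definition mat_act :: "nat \<Rightarrow> (nat \<Rightarrow> nat \<Rightarrow> 'k::comm_ring_1) \<Rightarrow> (nat \<Rightarrow> 'k) \<Rightarrow> nat \<Rightarrow> 'k" where
  "mat_act n A f = (\<lambda>i. if i \<le> n then \<Sum>j\<le>n. A i j * f j else 0)"

lemma alg_module_matrep:
  fixes M :: "'u \<Rightarrow> nat \<Rightarrow> nat \<Rightarrow> 'k::comm_ring_1"
  assumes M: "matrep U n M"
    and A: "\<And>u f. u \<in> carrier U \<Longrightarrow> f \<in> carrier (coord_module n :: ('k, _, 'u) rep) \<Longrightarrow> A u f = mat_act n (M u) f"
    and cl: "\<And>u v. u \<in> carrier U \<Longrightarrow> v \<in> carrier U \<Longrightarrow> u \<oplus>\<^bsub>U\<^esub> v \<in> carrier U \<and> u \<otimes>\<^bsub>U\<^esub> v \<in> carrier U"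
      "\<And>c u. u \<in> carrier U \<Longrightarrow> c \<odot>\<^bsub>U\<^esub> u \<in> carrier U" "\<one>\<^bsub>U\<^esub> \<in> carrier U"
  shows "alg_module U ((coord_module n)\<lparr>act := A\<rparr>)"
proof -
  have mod: "module (ring_of_type_algebra :: 'k ring) ((coord_module n)\<lparr>act := A\<rparr>)"
    by (simp add: coord_module_eq module_coord_on)
  have *: "mat_act n (M (u \<otimes>\<^bsub>U\<^esub> v)) f = mat_act n (M u) (mat_act n (M v) f)"
    if "u \<in> carrier U" "v \<in> carrier U" for u v f
  proof (rule ext)
    fix i
    have "(\<Sum>j\<le>n. (\<Sum>l\<le>n. M u i l * M v l j) * f j) = (\<Sum>l\<le>n. M u i l * (\<Sum>j\<le>n. M v l j * f j))"
      by (simp add: sum_distrib_left sum_distrib_right mult.assoc) (rule sum.swap)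
    then show "mat_act n (M (u \<otimes>\<^bsub>U\<^esub> v)) f i = mat_act n (M u) (mat_act n (M v) f) i"
      using M that by (auto simp: mat_act_def matrep_def)
  qed
  have one: "mat_act n (M \<one>\<^bsub>U\<^esub>) f = f" if "\<forall>j. j \<notin> {..n} \<longrightarrow> f j = 0" for f
  proof (rule ext)
    fix i show "mat_act n (M \<one>\<^bsub>U\<^esub>) f i = f i"
    proof (cases "i \<le> n")
      case True
      have "(\<Sum>j\<le>n. M \<one>\<^bsub>U\<^esub> i j * f j) = (\<Sum>j\<le>n. if j = i then f j else 0)"
        using M True by (intro sum.cong refl) (auto simp: matrep_def)
      then show ?thesis using True by (simp add: mat_act_def)
    qed (use that in \<open>simp add: mat_act_def\<close>)
  qed
  have closed: "mat_act n B f j = 0" if "\<not> j \<le> n" for B :: "nat \<Rightarrow> nat \<Rightarrow> 'k" and f j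
    using that by (simp add: mat_act_def)
  have add: "mat_act n B (\<lambda>j. f j + f' j) = (\<lambda>j. mat_act n B f j + mat_act n B f' j)"
    for B :: "nat \<Rightarrow> nat \<Rightarrow> 'k" and f f'
    by (simp add: mat_act_def fun_eq_iff algebra_simps sum.distrib)
  have smult: "mat_act n B (\<lambda>j. c * f j) = (\<lambda>j. c * mat_act n B f j)"
    for B :: "nat \<Rightarrow> nat \<Rightarrow> 'k" and f c
    by (simp add: mat_act_def fun_eq_iff sum_distrib_left mult.left_commute)
  have add2: "mat_act n (M (u \<oplus>\<^bsub>U\<^esub> v)) f = (\<lambda>j. mat_act n (M u) f j + mat_act n (M v) f j)"
    if "u \<in> carrier U" "v \<in> carrier U" for u v f
    using M that by (simp add: mat_act_def fun_eq_iff matrep_def distrib_right sum.distrib)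
  have smult2: "mat_act n (M (c \<odot>\<^bsub>U\<^esub> u)) f = (\<lambda>j. c * mat_act n (M u) f j)"
    if "u \<in> carrier U" for u c f
    using M that by (simp add: mat_act_def fun_eq_iff matrep_def sum_distrib_left mult.assoc)
  show ?thesis
    unfolding alg_module_def using mod A
    by (auto simp: cl coord_module_eq * one closed add smult add2 smult2)
qed

section \<open>Ring homomorphisms on coefficients\<close>

definition rhom :: "('a::ring_1 \<Rightarrow> 'b::ring_1) \<Rightarrow> bool" where
  "rhom \<phi> \<longleftrightarrow> (\<forall>x y. \<phi> (x + y) = \<phi> x + \<phi> y) \<and> (\<forall>x y. \<phi> (x * y) = \<phi> x * \<phi> y) \<and> \<phi> 1 = 1"

lemma rhomI:
  assumes "\<And>x y. \<phi> (x + y) = \<phi> x + \<phi> y" "\<And>x y. \<phi> (x * y) = \<phi> x * \<phi> y" "\<phi> 1 = 1"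
  shows "rhom \<phi>"
  using assms by (simp add: rhom_def)

lemma additive_sum:
  fixes e :: "'a::ab_group_add \<Rightarrow> 'b::ab_group_add"
  assumes "\<And>x y. e (x + y) = e x + e y"
  shows "e 0 = 0" "e (sum f S) = (\<Sum>s\<in>S. e (f s))" "e (- x) = - e x" "e (x - y) = e x - e y"
proof -
  have z: "e 0 = 0" using assms[of 0 0] by simp
  show "e 0 = 0" by (rule z)
  show "e (sum f S) = (\<Sum>s\<in>S. e (f s))"
    by (induction S rule: infinite_finite_induct) (simp_all add: z assms)
  have m: "e (- x) = - e x" for x using assms[of x "- x"] z by (simp add: eq_neg_iff_add_eq_0 add.commute)
  show "e (- x) = - e x" by (rule m)
  show "e (x - y) = e x - e y" using assms[of x "- y"] m by simp
qed

lemma rhomD: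
  assumes "rhom \<phi>"
  shows "\<phi> (x + y) = \<phi> x + \<phi> y" "\<phi> (x * y) = \<phi> x * \<phi> y" "\<phi> 1 = 1" "\<phi> 0 = 0"
    "\<phi> (- x) = - \<phi> x" "\<phi> (x - y) = \<phi> x - \<phi> y" "\<phi> (sum f S) = (\<Sum>s\<in>S. \<phi> (f s))"
    "\<phi> (x ^ k) = \<phi> x ^ k" "\<phi> (of_nat k) = of_nat k"
proof -
  have a: "\<And>x y. \<phi> (x + y) = \<phi> x + \<phi> y" using assms by (simp add: rhom_def)
  show "\<phi> (x + y) = \<phi> x + \<phi> y" "\<phi> (x * y) = \<phi> x * \<phi> y" "\<phi> 1 = 1"
    using assms by (simp_all add: rhom_def)
  show "\<phi> 0 = 0" "\<phi> (- x) = - \<phi> x" "\<phi> (x - y) = \<phi> x - \<phi> y" "\<phi> (sum f S) = (\<Sum>s\<in>S. \<phi> (f s))"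
    using additive_sum[of \<phi>, OF a] by auto
  show "\<phi> (x ^ k) = \<phi> x ^ k" using assms by (induction k) (simp_all add: rhom_def)
  show "\<phi> (of_nat k) = of_nat k"
    using assms additive_sum(1)[of \<phi>, OF a] by (induction k) (simp_all add: rhom_def)
qed

lemma rhom_prod:
  fixes \<phi> :: "'a::comm_ring_1 \<Rightarrow> 'b::comm_ring_1"
  shows "rhom \<phi> \<Longrightarrow> \<phi> (prod f S) = (\<Prod>s\<in>S. \<phi> (f s))"
  by (induction S rule: infinite_finite_induct) (simp_all add: rhomD)

lemma map_fps_nth [simp]: "map_fps \<phi> f $ k = \<phi> (f $ k)"
  by (simp add: map_fps_def)

lemma rhom_map_fps: "rhom \<phi> \<Longrightarrow> rhom (map_fps \<phi>)"
  by (rule rhomI) (simp_all add: fps_eq_iff fps_mult_nth rhomD)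

lemma rhom_comp: "rhom \<phi> \<Longrightarrow> rhom \<psi> \<Longrightarrow> rhom (\<lambda>x. \<phi> (\<psi> x))"
  by (simp add: rhom_def)

lemma rhom_fps_const: "rhom fps_const"
  by (rule rhomI) simp_all

lemma map_fps_const [simp]: "\<phi> 0 = 0 \<Longrightarrow> map_fps \<phi> (fps_const a) = fps_const (\<phi> a)"
  by (simp add: fps_eq_iff)

lemma map_fps_X: "rhom \<phi> \<Longrightarrow> map_fps \<phi> fps_X = fps_X"
  by (simp add: fps_eq_iff rhomD)

lemma map_fps_id [simp]: "map_fps id = id" "map_fps (\<lambda>x. x) = (\<lambda>x. x)"
  by (auto simp: fps_eq_iff fun_eq_iff)

lemma rhom_fa_const: "rhom fa_const"
  by (rule rhomI) (simp_all add: fa_const_def single_add mult_single)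

section \<open>The free algebra\<close>

lemma single_word: "Poly_Mapping.single (Word ws) z = fa_const z * prod_list (map fa_var ws)"
proof -
  have 0: "Word [] = 0" by (simp add: zero_word_def)
  have "prod_list (map fa_var ws) = Poly_Mapping.single (Word ws) (1::complex)"
    by (induction ws) (simp_all add: fa_var_def mult_single 0)
  then show ?thesis by (simp add: fa_const_def mult_single)
qed

lemma sum_monomials: "a = (\<Sum>w\<in>Poly_Mapping.keys a. Poly_Mapping.single w (Poly_Mapping.lookup a w))"
proof (rule poly_mapping_eqI)
  fix w
  show "Poly_Mapping.lookup a w =
      Poly_Mapping.lookup (\<Sum>w\<in>Poly_Mapping.keys a. Poly_Mapping.single w (Poly_Mapping.lookup a w)) w"
    by (simp add: lookup_sum lookup_single when_def in_keys_iff)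
qed

lemma free_alg_generated:
  assumes c: "\<And>z. P (fa_const z)" and v: "\<And>x. P (fa_var x)"
    and a: "\<And>a b. P a \<Longrightarrow> P b \<Longrightarrow> P (a + b)" and m: "\<And>a b. P a \<Longrightarrow> P b \<Longrightarrow> P (a * b)"
  shows "P a"
proof -
  have "P (Poly_Mapping.single w z)" for w z
  proof (cases w)
    case (Word ws)
    have "P (prod_list (map fa_var ws))"
    proof (induction ws)
      case Nil
      then show ?case using c[of 1] by (simp add: rhomD[OF rhom_fa_const])
    qed (simp add: v m)
    then show ?thesis using Word c m by (simp add: single_word)
  qed
  moreover have "P (0::'a free_alg)" using c[of 0] by (simp add: rhomD[OF rhom_fa_const])
  ultimately have "P (\<Sum>w\<in>S. Poly_Mapping.single w (Poly_Mapping.lookup a w))" for S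
    by (induction S rule: infinite_finite_induct) (simp_all add: a)
  then show ?thesis using sum_monomials[of a] by metis
qed

lemma fps_decompose: "(x :: 'a::ring_1 fps) = fps_const (x $ 0) + fps_X * fps_shift 1 x"
  by (simp add: fps_eq_iff fps_X_mult_nth)

text \<open>Each further power of \<open>X\<close> is reached by moving the constant term of the remainder into the polynomial part.\<close>

lemma fps_approx:
  assumes c: "\<And>a. fps_const a \<in> S" and X: "fps_X \<in> S"
    and a: "\<And>x y. x \<in> S \<Longrightarrow> y \<in> S \<Longrightarrow> x + y \<in> S" and m: "\<And>x y. x \<in> S \<Longrightarrow> y \<in> S \<Longrightarrow> x * y \<in> S"
  shows "\<exists>y\<in>S. \<exists>z. (x :: 'a::ring_1 fps) = y + fps_X ^ N * z"
proof (induction N)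
  case 0
  show ?case using c[of 0] by (intro bexI[of _ 0] exI[of _ x]) simp_all
next
  case (Suc N)
  then obtain y z where *: "y \<in> S" "x = y + fps_X ^ N * z" by blast
  have "fps_X ^ N \<in> S" using c[of 1] X by (induction N) (simp_all add: m)
  then have "y + fps_X ^ N * fps_const (z $ 0) \<in> S" using * a m c by simp
  moreover have "x = y + fps_X ^ N * fps_const (z $ 0) + fps_X ^ Suc N * fps_shift 1 z"
    unfolding *(2) by (subst fps_decompose[of z])
      (simp add: distrib_left add.assoc power_Suc2 mult.assoc del: power_Suc)
  ultimately show ?case by blast
qed

section \<open>Uniqueness of actions\<close>

text \<open>The elements on which two actions of a quotient algebra agree form a subalgebra, which is closed if \<open>V\<close> is
  separated. So two actions that agree on topological generators are equal.\<close>

locale quotient_actions =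
  fixes \<sigma> :: "'k::comm_ring_1 \<Rightarrow> 'a::ring_1" and J and V :: "('k, 'm, 'a set) rep" and \<rho> \<rho>'
  assumes J: "two_sided J"
    and \<rho>: "alg_module (quot_alg id (type_alg \<sigma>) J) (V\<lparr>act := \<rho>\<rparr>)"
    and \<rho>': "alg_module (quot_alg id (type_alg \<sigma>) J) (V\<lparr>act := \<rho>'\<rparr>)"
begin

abbreviation "cls x \<equiv> J +>\<^bsub>type_alg \<sigma>\<^esub> x"

definition agree :: "'a set" where
  "agree = {x. \<forall>v\<in>carrier V. \<rho> (cls x) v = \<rho>' (cls x) v}"

lemmas quot_simps = alg_quotient.carrier_quot[OF alg_quotient_type_alg[OF J, of \<sigma>]]
  alg_quotient.mult_quot[OF alg_quotient_type_alg[OF J, of \<sigma>], simplified]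
  alg_quotient.add_quot[OF alg_quotient_type_alg[OF J, of \<sigma>], simplified]
  alg_quotient.smult_quot[OF alg_quotient_type_alg[OF J, of \<sigma>], simplified]
  alg_quotient.one_quot[OF alg_quotient_type_alg[OF J, of \<sigma>], simplified]

lemma mod: "module (ring_of_type_algebra :: 'k ring) V"
  using alg_moduleD(1)[OF \<rho>] by simp

lemma action_closed: "v \<in> carrier V \<Longrightarrow> \<rho> (cls x) v \<in> carrier V"
    "v \<in> carrier V \<Longrightarrow> \<rho>' (cls x) v \<in> carrier V"
  using alg_moduleD(2)[OF \<rho>, of "cls x" v] alg_moduleD(2)[OF \<rho>', of "cls x" v]
  by (simp_all add: quot_simps)

lemma action_add: "v \<in> carrier V \<Longrightarrow> \<rho> (cls (x + y)) v = \<rho> (cls x) v \<oplus>\<^bsub>V\<^esub> \<rho> (cls y) v"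
    "v \<in> carrier V \<Longrightarrow> \<rho>' (cls (x + y)) v = \<rho>' (cls x) v \<oplus>\<^bsub>V\<^esub> \<rho>' (cls y) v"
  using alg_moduleD(5)[OF \<rho>, of "cls x" "cls y" v] alg_moduleD(5)[OF \<rho>', of "cls x" "cls y" v]
  by (simp_all add: quot_simps)

lemma action_mult: "v \<in> carrier V \<Longrightarrow> \<rho> (cls (x * y)) v = \<rho> (cls x) (\<rho> (cls y) v)"
    "v \<in> carrier V \<Longrightarrow> \<rho>' (cls (x * y)) v = \<rho>' (cls x) (\<rho>' (cls y) v)"
  using alg_moduleD(7)[OF \<rho>, of "cls x" "cls y" v] alg_moduleD(7)[OF \<rho>', of "cls x" "cls y" v]
  by (simp_all add: quot_simps)

lemma action_smult: "v \<in> carrier V \<Longrightarrow> \<rho> (cls (\<sigma> c * x)) v = c \<odot>\<^bsub>V\<^esub> \<rho> (cls x) v"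
    "v \<in> carrier V \<Longrightarrow> \<rho>' (cls (\<sigma> c * x)) v = c \<odot>\<^bsub>V\<^esub> \<rho>' (cls x) v"
  using alg_moduleD(6)[OF \<rho>, of "cls x" v c] alg_moduleD(6)[OF \<rho>', of "cls x" v c]
  by (simp_all add: quot_simps)

lemma agree_one: "1 \<in> agree"
  using alg_moduleD(8)[OF \<rho>] alg_moduleD(8)[OF \<rho>'] by (simp add: agree_def quot_simps)

lemma agree_add: "x \<in> agree \<Longrightarrow> y \<in> agree \<Longrightarrow> x + y \<in> agree"
  by (simp add: agree_def action_add)

lemma agree_mult: "x \<in> agree \<Longrightarrow> y \<in> agree \<Longrightarrow> x * y \<in> agree"
  by (simp add: agree_def action_mult action_closed)

lemma agree_scalar: "\<sigma> c * 1 \<in> agree"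
  using agree_one unfolding agree_def by (auto simp: action_smult simp del: mult_1_right)

text \<open>If \<open>x = y + t\<^sup>N z\<close> and the actions agree on \<open>y\<close>, then their difference at \<open>x\<close> maps \<open>V\<close> to \<open>t\<^sup>N V\<close>.\<close>

lemma agree_closed:
  assumes sep: "\<And>v. v \<in> carrier V \<Longrightarrow> (\<And>N::nat. \<exists>z\<in>carrier V. v = (t ^ N) \<odot>\<^bsub>V\<^esub> z) \<Longrightarrow> v = \<zero>\<^bsub>V\<^esub>"
    and x: "\<And>N::nat. \<exists>y\<in>agree. \<exists>z. x = y + \<sigma> (t ^ N) * z"
  shows "x \<in> agree"
proof -
  interpret V: module "ring_of_type_algebra :: 'k ring" V by (rule mod)
  have "\<rho> (cls x) v = \<rho>' (cls x) v" if v: "v \<in> carrier V" for v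
  proof -
    define d where "d = \<rho> (cls x) v \<oplus>\<^bsub>V\<^esub> \<ominus>\<^bsub>V\<^esub> \<rho>' (cls x) v"
    have dc: "d \<in> carrier V" using v action_closed by (simp add: d_def)
    have "\<exists>z\<in>carrier V. d = (t ^ N) \<odot>\<^bsub>V\<^esub> z" for N
    proof -
      obtain y z where y: "y \<in> agree" "x = y + \<sigma> (t ^ N) * z" using x by blast
      define a b c where "a = \<rho>' (cls y) v" "b = \<rho> (cls z) v" "c = \<rho>' (cls z) v"
      have abc: "a \<in> carrier V" "b \<in> carrier V" "c \<in> carrier V"
        using v action_closed by (auto simp: a_b_c_def)
      have tc: "t ^ N \<odot>\<^bsub>V\<^esub> u \<in> carrier V" if "u \<in> carrier V" for u
        using module_type_smult_closed[OF mod that] .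
      have "\<rho> (cls x) v = a \<oplus>\<^bsub>V\<^esub> (t ^ N) \<odot>\<^bsub>V\<^esub> b" "\<rho>' (cls x) v = a \<oplus>\<^bsub>V\<^esub> (t ^ N) \<odot>\<^bsub>V\<^esub> c"
        using y v by (simp_all add: action_add action_smult a_b_c_def agree_def)
      then have "d = (t ^ N) \<odot>\<^bsub>V\<^esub> b \<oplus>\<^bsub>V\<^esub> \<ominus>\<^bsub>V\<^esub> ((t ^ N) \<odot>\<^bsub>V\<^esub> c)"
        unfolding d_def using abc tc
        by (simp add: V.M.minus_add V.M.a_ac V.M.r_neg2)
      also have "\<dots> = (t ^ N) \<odot>\<^bsub>V\<^esub> (b \<oplus>\<^bsub>V\<^esub> \<ominus>\<^bsub>V\<^esub> c)"
        using V.smult_r_minus[of "t ^ N" c] V.smult_r_distr[of "t ^ N" b "\<ominus>\<^bsub>V\<^esub> c"] abc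
        by (simp add: ring_of_type_algebra_def)
      finally show ?thesis using abc by (intro bexI[of _ "b \<oplus>\<^bsub>V\<^esub> \<ominus>\<^bsub>V\<^esub> c"]) auto
    qed
    then have "d = \<zero>\<^bsub>V\<^esub>" using sep dc by blast
    then show ?thesis unfolding d_def
      using v action_closed by (metis V.M.a_inv_closed V.M.minus_equality V.M.minus_minus)
  qed
  then show ?thesis by (simp add: agree_def)
qed

end

text \<open>The uniqueness that the definite description of an action by its values on generators requires.\<close>

definition unique_action ::
  "('k::comm_ring_1, 'u) module \<Rightarrow> ('x \<Rightarrow> 'u) \<Rightarrow> ('k, 'm, 'u) rep \<Rightarrow> bool" where
  "unique_action U \<gamma> V \<longleftrightarrow> (\<forall>\<rho> \<rho>'. alg_module U (V\<lparr>act := \<rho>\<rparr>) \<longrightarrow> alg_module U (V\<lparr>act := \<rho>'\<rparr>) \<longrightarrow>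
     (\<forall>x. \<forall>v\<in>carrier V. \<rho> (\<gamma> x) v = \<rho>' (\<gamma> x) v) \<longrightarrow> (\<forall>u\<in>carrier U. \<forall>v\<in>carrier V. \<rho> u v = \<rho>' u v))"

lemma rep_by_generators_eqI:
  assumes "\<rho> \<in> carrier U \<rightarrow>\<^sub>E (carrier V \<rightarrow>\<^sub>E carrier V)" "alg_module U (V\<lparr>act := \<rho>\<rparr>)"
    and "\<And>x v. v \<in> carrier V \<Longrightarrow> \<rho> (\<gamma> x) v = T x v"
    and uniq: "unique_action U \<gamma> V"
  shows "rep_by_generators U \<gamma> V T = V\<lparr>act := \<rho>\<rparr>"
proof -
  have "(THE \<rho>. \<rho> \<in> carrier U \<rightarrow>\<^sub>E (carrier V \<rightarrow>\<^sub>E carrier V) \<and>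
     alg_module U (V\<lparr>act := \<rho>\<rparr>) \<and> (\<forall>x. \<forall>v\<in>carrier V. \<rho> (\<gamma> x) v = T x v)) = \<rho>"
  proof (rule the_equality)
    fix \<rho>' assume *: "\<rho>' \<in> carrier U \<rightarrow>\<^sub>E (carrier V \<rightarrow>\<^sub>E carrier V) \<and>
      alg_module U (V\<lparr>act := \<rho>'\<rparr>) \<and> (\<forall>x. \<forall>v\<in>carrier V. \<rho>' (\<gamma> x) v = T x v)"
    have **: "\<rho>' u v = \<rho> u v" if "u \<in> carrier U" "v \<in> carrier V" for u v
      using uniq[unfolded unique_action_def, rule_format, of \<rho>' \<rho> u v] * assms(2,3) that by simp
    show "\<rho>' = \<rho>"
    proof (rule PiE_ext)
      fix u assume u: "u \<in> carrier U"
      show "\<rho>' u = \<rho> u"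
        by (rule PiE_ext[of _ "carrier V" "\<lambda>_. carrier V"]) (use * assms(1) u ** in auto)
    qed (use * assms(1) in auto)
  qed (use assms(1-3) in auto)
  then show ?thesis by (simp add: rep_by_generators_def)
qed

section \<open>Extending matrix coefficients to power series\<close>

text \<open>\<open>f(X, Y) \<mapsto> f(X, X)\<close>.\<close>

definition fps_diag :: "'k::comm_ring_1 fps fps \<Rightarrow> 'k fps" where
  "fps_diag f = Abs_fps (\<lambda>N. \<Sum>k\<le>N. f $ k $ (N - k))"

lemma fps_diag_add: "fps_diag (f + g) = fps_diag f + fps_diag g"
  by (simp add: fps_diag_def fps_eq_iff sum.distrib)

lemma fps_diag_const_mult: "fps_diag (fps_const c * f) = c * fps_diag f"
proof (rule fps_ext)
  fix N
  have "(\<Sum>k\<le>N. \<Sum>i\<le>N - k. c $ i * f $ k $ (N - k - i)) = (\<Sum>i\<le>N. \<Sum>k\<le>N - i. c $ i * f $ k $ (N - i - k))"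
    unfolding sum.Sigma[OF finite_atMost ballI[OF finite_atMost]]
    by (rule sum.reindex_bij_witness[of _ "\<lambda>(i, k). (k, i)" "\<lambda>(k, i). (i, k)"])
      (auto simp: add.commute diff_diff_add)
  then show "fps_diag (fps_const c * f) $ N = (c * fps_diag f) $ N"
    unfolding fps_diag_def fps_nth_Abs_fps fps_mult_left_const_nth
    by (simp add: fps_mult_nth sum_distrib_left atLeast0AtMost)
qed

lemma fps_diag_X_mult: "fps_diag (fps_X * f) = fps_X * fps_diag f"
proof (rule fps_ext)
  fix N show "fps_diag (fps_X * f) $ N = (fps_X * fps_diag f) $ N"
    by (cases N) (simp_all add: fps_diag_def sum.atMost_Suc_shift fps_X_mult_nth del: sum.atMost_Suc)
qed

text \<open>The defect of multiplicativity is divisible by every power of \<open>X\<close>, because a series is a constant plus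
  \<open>X\<close> times a series.\<close>

lemma fps_diag_mult: "fps_diag (f * g) = fps_diag f * fps_diag g"
proof -
  define d where "d f = fps_diag (f * g) - fps_diag f * fps_diag g" for f
  have step: "d f = fps_X * d (fps_shift 1 f)" for f
  proof -
    have "d f = d (fps_const (f $ 0) + fps_X * fps_shift 1 f)" by (rule arg_cong[OF fps_decompose])
    also have "\<dots> = fps_X * d (fps_shift 1 f)"
    proof -
      have "fps_diag (fps_const (f $ 0)) = f $ 0"
        using fps_diag_const_mult[of "f $ 0" 1]
        by (simp add: fps_diag_def fps_eq_iff if_distrib[of "\<lambda>x. x $ _"] cong: if_cong)
      moreover have "(fps_const (f $ 0) + fps_X * fps_shift 1 f) * g =
          fps_const (f $ 0) * g + fps_X * (fps_shift 1 f * g)"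
        by (simp add: distrib_right mult.assoc)
      ultimately show ?thesis
        unfolding d_def
        by (simp only: fps_diag_add fps_diag_const_mult fps_diag_X_mult) (simp add: algebra_simps)
    qed
    finally show ?thesis .
  qed
  have "d f $ N = 0" for N f
  proof (induction N arbitrary: f)
    case 0
    then show ?case by (subst step) simp
  next
    case (Suc N)
    then show ?case by (subst step) (simp add: fps_X_mult_nth)
  qed
  then have "d f = 0" by (simp add: fps_eq_iff)
  then show ?thesis by (simp add: d_def)
qed

lemma fps_diag_sum: "fps_diag (sum f S) = (\<Sum>s\<in>S. fps_diag (f s))"
  by (rule additive_sum) (rule fps_diag_add)

text \<open>The continuous extension of an additive map from coefficients to series: the variable is sent
  to the variable.\<close>

definition cont_ext :: "('a \<Rightarrow> 'k::comm_ring_1 fps) \<Rightarrow> 'a fps \<Rightarrow> 'k fps" where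
  "cont_ext e x = fps_diag (map_fps e x)"

text \<open>The extension in the inner variable of a double series, one outer coefficient at a time.\<close>

definition inner_ext :: "('a \<Rightarrow> 'k::comm_ring_1 fps fps) \<Rightarrow> 'a fps \<Rightarrow> 'k fps fps" where
  "inner_ext e x = Abs_fps (\<lambda>B. cont_ext (\<lambda>a. e a $ B) x)"

lemma ext_nth: "cont_ext e x $ N = (\<Sum>k\<le>N. e (x $ k) $ (N - k))"
  by (simp add: cont_ext_def fps_diag_def)

lemma inner_ext_nth: "inner_ext e x $ B $ A = (\<Sum>k\<le>A. e (x $ k) $ B $ (A - k))"
  by (simp add: inner_ext_def ext_nth)

lemma ext_add: "(\<And>a b. e (a + b) = e a + e b) \<Longrightarrow> cont_ext e (x + y) = cont_ext e x + cont_ext e y"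
  by (simp add: fps_eq_iff ext_nth sum.distrib)

lemma inner_ext_add: "(\<And>a b. e (a + b) = e a + e b) \<Longrightarrow> inner_ext e (x + y) = inner_ext e x + inner_ext e y"
  by (simp add: fps_eq_iff inner_ext_nth sum.distrib)

lemma ext_mult:
  fixes e :: "'a::ring_1 \<Rightarrow> 'k::comm_ring_1 fps"
  assumes e: "\<And>a b. e (a + b) = e a + e b"
    and m: "\<And>a b. e (a * b) = (\<Sum>s\<in>S. p s a * q s b)"
  shows "cont_ext e (x * y) = (\<Sum>s\<in>S. cont_ext (p s) x * cont_ext (q s) y)"
proof -
  have "map_fps e (x * y) = (\<Sum>s\<in>S. map_fps (p s) x * map_fps (q s) y)"
  proof (rule fps_ext)
    fix k
    show "map_fps e (x * y) $ k = (\<Sum>s\<in>S. map_fps (p s) x * map_fps (q s) y) $ k"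
      by (simp add: fps_mult_nth additive_sum(2)[of e, OF e] m fps_sum_nth) (rule sum.swap)
  qed
  then show ?thesis by (simp add: cont_ext_def fps_diag_sum fps_diag_mult)
qed

lemma inner_ext_mult:
  fixes e :: "'a::ring_1 \<Rightarrow> 'k::comm_ring_1 fps fps"
  assumes e: "\<And>a b. e (a + b) = e a + e b"
    and m: "\<And>a b. e (a * b) = (\<Sum>s\<in>S. p s a * q s b)" and S: "finite S"
  shows "inner_ext e (x * y) = (\<Sum>s\<in>S. inner_ext (p s) x * inner_ext (q s) y)"
proof (rule fps_ext)
  fix B
  have "cont_ext (\<lambda>a. e a $ B) (x * y) =
      (\<Sum>t\<in>S \<times> {0..B}. cont_ext (\<lambda>a. p (fst t) a $ snd t) x * cont_ext (\<lambda>a. q (fst t) a $ (B - snd t)) y)"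
  proof (rule ext_mult)
    show "e (a * b) $ B = (\<Sum>t\<in>S \<times> {0..B}. p (fst t) a $ snd t * q (fst t) b $ (B - snd t))" for a b
      by (simp add: m fps_sum_nth fps_mult_nth sum.cartesian_product' split_def)
  qed (simp add: e)
  also have "\<dots> = (\<Sum>s\<in>S. inner_ext (p s) x * inner_ext (q s) y) $ B"
    by (simp add: inner_ext_def fps_sum_nth fps_mult_nth sum.cartesian_product' split_def)
  finally show "inner_ext e (x * y) $ B = (\<Sum>s\<in>S. inner_ext (p s) x * inner_ext (q s) y) $ B"
    by (simp add: inner_ext_def)
qed

lemma ext_map:
  assumes "\<And>p. e (\<phi> p) = fps_const (\<eta> p)"
  shows "cont_ext e (map_fps \<phi> f) = map_fps \<eta> f"
proof (rule fps_ext)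
  fix N
  have "(\<Sum>k\<le>N. fps_const (\<eta> (f $ k)) $ (N - k)) = (\<Sum>k\<le>N. if k = N then \<eta> (f $ k) else 0)"
    by (intro sum.cong) auto
  then show "cont_ext e (map_fps \<phi> f) $ N = map_fps \<eta> f $ N"
    by (simp add: ext_nth assms)
qed

lemma inner_ext_map:
  assumes "\<And>p. e (\<phi> p) = fps_const (fps_const (\<eta> p))"
  shows "inner_ext e (map_fps \<phi> f) = fps_const (map_fps \<eta> f)"
proof (rule fps_ext)
  fix B
  show "inner_ext e (map_fps \<phi> f) $ B = fps_const (map_fps \<eta> f) $ B"
  proof (cases "B = 0")
    case True
    have "cont_ext (\<lambda>a. e a $ 0) (map_fps \<phi> f) = map_fps \<eta> f" by (rule ext_map) (simp add: assms)
    then show ?thesis using True by (simp add: inner_ext_def)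
  next
    case False
    then show ?thesis by (simp add: fps_eq_iff inner_ext_nth assms)
  qed
qed

lemma ext_const:
  assumes "e 0 = 0"
  shows "cont_ext e (fps_const a) = e a"
proof (rule fps_ext)
  fix N
  have "(\<Sum>k\<le>N. e (fps_const a $ k) $ (N - k)) = (\<Sum>k\<le>N. if k = 0 then e a $ N else 0)"
    by (intro sum.cong) (auto simp: assms)
  then show "cont_ext e (fps_const a) $ N = e a $ N" by (simp add: ext_nth)
qed

lemma inner_ext_const: "e 0 = 0 \<Longrightarrow> inner_ext e (fps_const a) = e a"
  by (simp add: inner_ext_def ext_const fps_eq_iff)

section \<open>Matrices of words\<close>

primrec letters :: "'x word \<Rightarrow> 'x list" where "letters (Word ws) = ws"

primrec word_mat :: "nat \<Rightarrow> ('x \<Rightarrow> nat \<Rightarrow> nat \<Rightarrow> 'k::comm_ring_1) \<Rightarrow> 'x list \<Rightarrow> nat \<Rightarrow> nat \<Rightarrow> 'k" where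
  "word_mat n G [] = (\<lambda>i j. of_bool (i = j))"
| "word_mat n G (x # ws) = (\<lambda>i j. \<Sum>l\<le>n. G x i l * word_mat n G ws l j)"

text \<open>The matrix by which an element of the free algebra acts if the generator \<open>x\<close> acts by \<open>G x\<close>.\<close>

definition fa_mat :: "nat \<Rightarrow> (complex \<Rightarrow> 'k::comm_ring_1) \<Rightarrow> ('x \<Rightarrow> nat \<Rightarrow> nat \<Rightarrow> 'k) \<Rightarrow> 'x free_alg \<Rightarrow> nat \<Rightarrow> nat \<Rightarrow> 'k"
where
  "fa_mat n \<kappa> G a i j =
     (\<Sum>w\<in>Poly_Mapping.keys a. \<kappa> (Poly_Mapping.lookup a w) * word_mat n G (letters w) i j)"

lemma sum_of_bool_mult: "(i::nat) \<le> n \<Longrightarrow> (\<Sum>l\<le>n. of_bool (i = l) * (f l :: 'k::comm_ring_1)) = f i"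
  "j \<le> n \<Longrightarrow> (\<Sum>l\<le>n. f l * of_bool (l = j)) = f j"
proof -
  have "(\<Sum>l\<le>n. of_bool (i = l) * f l) = (\<Sum>l\<le>n. if l = i then f l else 0)" by (intro sum.cong) auto
  then show "i \<le> n \<Longrightarrow> (\<Sum>l\<le>n. of_bool (i = l) * f l) = f i" by simp
  have "(\<Sum>l\<le>n. f l * of_bool (l = j)) = (\<Sum>l\<le>n. if l = j then f l else 0)" by (intro sum.cong) auto
  then show "j \<le> n \<Longrightarrow> (\<Sum>l\<le>n. f l * of_bool (l = j)) = f j" by simp
qed

lemma word_mat_append:
  "i \<le> n \<Longrightarrow> word_mat n G (u @ v) i j = (\<Sum>l\<le>n. word_mat n G u i l * word_mat n G v l j)"
proof (induction u arbitrary: i)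
  case Nil
  then show ?case by (simp add: sum_of_bool_mult)
next
  case (Cons x u)
  have "(\<Sum>l\<le>n. G x i l * (\<Sum>m\<le>n. word_mat n G u l m * word_mat n G v m j)) =
    (\<Sum>m\<le>n. (\<Sum>l\<le>n. G x i l * word_mat n G u l m) * word_mat n G v m j)"
    by (simp add: sum_distrib_left sum_distrib_right mult.assoc) (rule sum.swap)
  then show ?case using Cons.IH by simp
qed

lemma free_alg_additive_induct:
  assumes "\<And>w z. P (Poly_Mapping.single w z)" "\<And>a b. P a \<Longrightarrow> P b \<Longrightarrow> P (a + b)"
  shows "P (a :: 'x free_alg)"
proof -
  have "P 0" using assms(1)[of 0 0] by simp
  then have "P (\<Sum>w\<in>S. Poly_Mapping.single w (Poly_Mapping.lookup a w))" for S
    by (induction S rule: infinite_finite_induct) (simp_all add: assms)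
  then show ?thesis using sum_monomials[of a] by metis
qed

context
  fixes n :: nat and \<kappa> :: "complex \<Rightarrow> 'k::comm_ring_1" and G :: "'x \<Rightarrow> nat \<Rightarrow> nat \<Rightarrow> 'k"
  assumes \<kappa>: "rhom \<kappa>"
begin

lemma fa_mat_superset:
  assumes "finite S" "Poly_Mapping.keys a \<subseteq> S"
  shows "fa_mat n \<kappa> G a i j = (\<Sum>w\<in>S. \<kappa> (Poly_Mapping.lookup a w) * word_mat n G (letters w) i j)"
  unfolding fa_mat_def
  by (rule sum.mono_neutral_left) (use assms \<kappa> in \<open>auto simp: in_keys_iff rhomD\<close>)

lemma fa_mat_add: "fa_mat n \<kappa> G (a + b) i j = fa_mat n \<kappa> G a i j + fa_mat n \<kappa> G b i j"
proof -
  let ?S = "Poly_Mapping.keys a \<union> Poly_Mapping.keys b"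
  have *: "finite ?S" "Poly_Mapping.keys a \<subseteq> ?S" "Poly_Mapping.keys b \<subseteq> ?S" "Poly_Mapping.keys (a + b) \<subseteq> ?S"
    using keys_add[of a b] by auto
  show ?thesis
    by (simp add: fa_mat_superset[OF *(1,2)] fa_mat_superset[OF *(1,3)] fa_mat_superset[OF *(1,4)]
        lookup_add rhomD[OF \<kappa>] distrib_right sum.distrib)
qed

lemma fa_mat_single: "fa_mat n \<kappa> G (Poly_Mapping.single w z) i j = \<kappa> z * word_mat n G (letters w) i j"
  by (subst fa_mat_superset[of "{w}"]) simp_all

lemma fa_mat_mult:
  assumes "i \<le> n"
  shows "fa_mat n \<kappa> G (a * b) i j = (\<Sum>l\<le>n. fa_mat n \<kappa> G a i l * fa_mat n \<kappa> G b l j)"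
proof (induction a rule: free_alg_additive_induct)
  case (1 w z)
  show ?case
  proof (induction b rule: free_alg_additive_induct)
    case (1 w' z')
    obtain ws ws' where w: "w = Word ws" "w' = Word ws'" by (cases w; cases w')
    show ?case
      using assms by (simp add: mult_single fa_mat_single w word_mat_append rhomD[OF \<kappa>] sum_distrib_left mult_ac)
  next
    case (2 a b)
    then show ?case by (simp add: distrib_left fa_mat_add sum.distrib)
  qed
next
  case (2 a b)
  then show ?case by (simp add: distrib_right fa_mat_add sum.distrib)
qed

lemma fa_mat_const: "fa_mat n \<kappa> G (fa_const z) i j = of_bool (i = j) * \<kappa> z"
proof -
  have "letters (0 :: 'x word) = []" by (simp add: zero_word_def)
  then show ?thesis by (simp add: fa_const_def fa_mat_single)
qed

lemma fa_mat_var: "j \<le> n \<Longrightarrow> fa_mat n \<kappa> G (fa_var x) i j = G x i j"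
  by (simp add: fa_var_def fa_mat_single rhomD[OF \<kappa>] sum_of_bool_mult)

lemma fa_mat_0: "fa_mat n \<kappa> G 0 i j = 0"
  by (simp add: fa_mat_def)

end

text \<open>The continuous extensions to series over the free algebra. For two parameters the inner variable is treated first.\<close>

definition q_mat :: "nat \<Rightarrow> ('x \<Rightarrow> nat \<Rightarrow> nat \<Rightarrow> complex fps) \<Rightarrow> 'x free_alg fps \<Rightarrow> nat \<Rightarrow> nat \<Rightarrow> complex fps" where
  "q_mat n G x i j = cont_ext (\<lambda>a. fa_mat n fps_const G a i j) x"

definition hh_mat :: "nat \<Rightarrow> ('x \<Rightarrow> nat \<Rightarrow> nat \<Rightarrow> complex fps fps) \<Rightarrow> 'x free_alg fps fps \<Rightarrow> nat \<Rightarrow> nat \<Rightarrow> complex fps fps"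
where
  "hh_mat n G x i j = cont_ext (inner_ext (\<lambda>a. fa_mat n (\<lambda>z. fps_const (fps_const z)) G a i j)) x"

lemma rhom_const2: "rhom (\<lambda>z. fps_const (fps_const z))"
  by (rule rhomI) simp_all

lemma free_series_eq: "free_series = type_alg (map_fps fa_const)"
  by (simp add: free_series_def type_alg_def)

lemma free_series2_eq: "free_series2 = type_alg (map_fps (map_fps fa_const))"
  by (simp add: free_series2_def type_alg_def)

lemma q_mat_map:
  assumes "\<And>p. fa_mat n fps_const G (\<phi> p) i j = of_bool (i = j) * fps_const (\<eta> p)"
  shows "q_mat n G (map_fps \<phi> f) i j = of_bool (i = j) * map_fps \<eta> f"
proof -
  have "cont_ext (\<lambda>a. fa_mat n fps_const G a i j) (map_fps \<phi> f) = map_fps (\<lambda>p. of_bool (i = j) * \<eta> p) f"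
    by (rule ext_map) (simp add: assms)
  then show ?thesis by (simp add: q_mat_def fps_eq_iff)
qed

lemma hh_mat_map:
  assumes "\<And>p. fa_mat n (\<lambda>z. fps_const (fps_const z)) G (\<phi> p) i j = of_bool (i = j) * fps_const (fps_const (\<eta> p))"
  shows "hh_mat n G (map_fps (map_fps \<phi>) f) i j = of_bool (i = j) * map_fps (map_fps \<eta>) f"
proof -
  have "cont_ext (inner_ext (\<lambda>a. fa_mat n (\<lambda>z. fps_const (fps_const z)) G a i j)) (map_fps (map_fps \<phi>) f) =
      map_fps (map_fps (\<lambda>p. of_bool (i = j) * \<eta> p)) f"
    by (rule ext_map, rule inner_ext_map) (simp add: assms)
  then show ?thesis by (simp add: hh_mat_def fps_eq_iff)
qed

lemma q_mat_var: "j \<le> n \<Longrightarrow> q_mat n G (fps_const (fa_var x)) i j = G x i j"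
  by (simp add: q_mat_def ext_const fa_mat_0 fa_mat_var rhom_fps_const)

lemma inner_ext_0: "e 0 = 0 \<Longrightarrow> inner_ext e 0 = 0"
  by (simp add: fps_eq_iff inner_ext_nth)

lemma hh_mat_var: "j \<le> n \<Longrightarrow> hh_mat n G (fps_const (fps_const (fa_var x))) i j = G x i j"
  by (simp add: hh_mat_def ext_const inner_ext_const fa_mat_0 fa_mat_var rhom_const2 inner_ext_0)

lemma matrep_type_algI:
  assumes "\<And>x y i j. i \<le> n \<Longrightarrow> j \<le> n \<Longrightarrow> M (x + y) i j = M x i j + M y i j"
    and mult: "\<And>x y i j. i \<le> n \<Longrightarrow> j \<le> n \<Longrightarrow> M (x * y) i j = (\<Sum>l\<le>n. M x i l * M y l j)"
    and scal: "\<And>c i j. M (\<sigma> c) i j = of_bool (i = j) * c" and one: "\<sigma> 1 = 1"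
  shows "matrep (type_alg \<sigma>) n M"
proof -
  have "M (\<sigma> c * x) i j = c * M x i j" if ij: "i \<le> n" "j \<le> n" for c x i j
  proof -
    have "M (\<sigma> c * x) i j = (\<Sum>l\<le>n. of_bool (i = l) * (c * M x l j))"
      using ij by (simp add: mult scal mult.assoc)
    then show ?thesis using ij by (simp add: sum_of_bool_mult)
  qed
  then show ?thesis
    unfolding matrep_def type_alg_simps using assms(1,2) scal[of 1] by (simp add: one)
qed

lemma matrep_q_mat: "matrep free_series n (q_mat n G)"
proof -
  have mult: "q_mat n G (x * y) i j = (\<Sum>l\<le>n. q_mat n G x i l * q_mat n G y l j)" if "i \<le> n" for x y i j
    unfolding q_mat_def
    by (rule ext_mult) (use that in \<open>simp_all add: fa_mat_add fa_mat_mult rhom_fps_const\<close>)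
  have add: "q_mat n G (x + y) i j = q_mat n G x i j + q_mat n G y i j" for x y i j
    by (simp add: q_mat_def ext_add fa_mat_add rhom_fps_const)
  have scal: "q_mat n G (map_fps fa_const c) i j = of_bool (i = j) * c" for c i j
    using q_mat_map[of n G fa_const i j id c] by (simp add: fa_mat_const rhom_fps_const)
  have one: "map_fps fa_const 1 = 1" using rhomD(3)[OF rhom_map_fps[OF rhom_fa_const]] .
  show ?thesis
    unfolding free_series_eq
    by (rule matrep_type_algI) (simp_all add: one add mult scal)
qed

lemma matrep_hh_mat: "matrep free_series2 n (hh_mat n G)"
proof -
  have mult: "hh_mat n G (x * y) i j = (\<Sum>l\<le>n. hh_mat n G x i l * hh_mat n G y l j)" if "i \<le> n" for x y i j
    unfolding hh_mat_def
    by (rule ext_mult, rule inner_ext_add, simp add: fa_mat_add rhom_const2, rule inner_ext_mult)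
      (use that in \<open>simp_all add: fa_mat_add fa_mat_mult rhom_const2\<close>)
  have add: "hh_mat n G (x + y) i j = hh_mat n G x i j + hh_mat n G y i j" for x y i j
    by (simp add: hh_mat_def ext_add inner_ext_add fa_mat_add rhom_const2)
  have scal: "hh_mat n G (map_fps (map_fps fa_const) c) i j = of_bool (i = j) * c" for c i j
    using hh_mat_map[of n G fa_const i j id c] by (simp add: fa_mat_const rhom_const2)
  have one: "map_fps (map_fps fa_const) 1 = 1" using rhomD(3)[OF rhom_map_fps[OF rhom_map_fps[OF rhom_fa_const]]] .
  show ?thesis
    unfolding free_series2_eq
    by (rule matrep_type_algI) (simp_all add: one add mult scal)
qed

lemma hh_mat_cong:
  assumes "\<And>b a. b \<le> B \<Longrightarrow> a \<le> A \<Longrightarrow> x $ b $ a = y $ b $ a"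
  shows "hh_mat n G x i j $ B $ A = hh_mat n G y i j $ B $ A"
  unfolding hh_mat_def ext_nth fps_sum_nth inner_ext_nth
  by (intro sum.cong refl) (simp add: assms)

section \<open>Matrix representations of quotients\<close>

lemma matrep_type_algD:
  assumes "matrep (type_alg \<sigma>) n M" "i \<le> n" "j \<le> n"
  shows "M (x + y) i j = M x i j + M y i j" "M (x * y) i j = (\<Sum>l\<le>n. M x i l * M y l j)"
    "M (\<sigma> c * x) i j = c * M x i j" "M 1 i j = of_bool (i = j)" "M 0 i j = 0" "M (- x) i j = - M x i j"
    "M (x - y) i j = M x i j - M y i j"
proof -
  show a: "M (x + y) i j = M x i j + M y i j" for x y using assms by (simp add: matrep_def)
  show "M (x * y) i j = (\<Sum>l\<le>n. M x i l * M y l j)"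
    "M (\<sigma> c * x) i j = c * M x i j" "M 1 i j = of_bool (i = j)"
    using assms unfolding matrep_def type_alg_simps by blast+
  show "M 0 i j = 0" "M (- x) i j = - M x i j" "M (x - y) i j = M x i j - M y i j"
    using additive_sum[of "\<lambda>x. M x i j", OF a] by auto
qed

text \<open>To annihilate an ideal it therefore suffices to annihilate its generators.\<close>

lemma two_sided_kernel:
  assumes "matrep (type_alg \<sigma>) n M"
  shows "two_sided {x. \<forall>i\<le>n. \<forall>j\<le>n. M x i j = 0}"
  using matrep_type_algD[OF assms] by (auto simp: two_sided_def)

text \<open>The choice of representative is irrelevant on cosets of an ideal that the matrices annihilate.\<close>

definition coset_mat :: "('a \<Rightarrow> nat \<Rightarrow> nat \<Rightarrow> 'k) \<Rightarrow> 'a set \<Rightarrow> nat \<Rightarrow> nat \<Rightarrow> 'k" where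
  "coset_mat M u = M (SOME x. x \<in> u)"

lemma coset_mat:
  assumes M: "matrep (type_alg \<sigma>) n M" and J: "two_sided J"
    and ker: "\<And>x i j. x \<in> J \<Longrightarrow> i \<le> n \<Longrightarrow> j \<le> n \<Longrightarrow> M x i j = 0" and ij: "i \<le> n" "j \<le> n"
  shows "coset_mat M (J +>\<^bsub>type_alg \<sigma>\<^esub> x) i j = M x i j"
proof -
  interpret q: alg_quotient id "type_alg \<sigma>" J by (rule alg_quotient_type_alg[OF J])
  have "(SOME y. y \<in> J +>\<^bsub>type_alg \<sigma>\<^esub> x) \<in> J +>\<^bsub>type_alg \<sigma>\<^esub> x"
    by (rule someI[of _ x]) (simp add: q.self_mem_coset)
  then obtain k where "k \<in> J" "(SOME y. y \<in> J +>\<^bsub>type_alg \<sigma>\<^esub> x) = k + x"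
    by (auto simp: q.mem_coset)
  then show ?thesis using matrep_type_algD[OF M ij] ker ij by (simp add: coset_mat_def)
qed

lemma matrep_quot:
  assumes M: "matrep (type_alg \<sigma>) n M" and J: "two_sided J"
    and ker: "\<And>x i j. x \<in> J \<Longrightarrow> i \<le> n \<Longrightarrow> j \<le> n \<Longrightarrow> M x i j = 0"
  shows "matrep (quot_alg id (type_alg \<sigma>) J) n (coset_mat M)"
proof -
  interpret q: alg_quotient id "type_alg \<sigma>" J by (rule alg_quotient_type_alg[OF J])
  note [simp] = q.mult_quot[simplified] q.add_quot[simplified] q.smult_quot[simplified] q.one_quot[simplified]
    coset_mat[OF M J ker]
  show ?thesis
    unfolding matrep_def q.carrier_quot using matrep_type_algD[OF M] by auto
qed

text \<open>The Hausdorff property of the \<open>t\<close>-adic topology.\<close>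

definition separated :: "'k::comm_ring_1 \<Rightarrow> ('k, 'm, 'c) module_scheme \<Rightarrow> bool" where
  "separated t V \<longleftrightarrow> (\<forall>v\<in>carrier V. (\<forall>N::nat. \<exists>z\<in>carrier V. v = (t ^ N) \<odot>\<^bsub>V\<^esub> z) \<longrightarrow> v = \<zero>\<^bsub>V\<^esub>)"

lemma fps_X_adic_zero:
  assumes "\<And>N. \<exists>h. f = fps_X ^ N * h"
  shows "(f :: 'k::comm_ring_1 fps) = 0"
proof (rule fps_ext)
  fix k
  obtain h where "f = fps_X ^ Suc k * h" using assms by blast
  then show "f $ k = 0 $ k" by (simp add: fps_X_power_mult_nth del: power_Suc)
qed

lemma separated_coord_on_X: "separated fps_X (coord_on J :: ('k::comm_ring_1 fps, _, _) rep)"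
  unfolding separated_def
proof (intro ballI impI)
  fix v :: "nat \<Rightarrow> 'k fps"
  assume "\<forall>N. \<exists>z\<in>carrier (coord_on J). v = fps_X ^ N \<odot>\<^bsub>coord_on J\<^esub> z"
  then have "\<exists>h. v j = fps_X ^ N * h" for N j unfolding coord_on_simps by metis
  then have "v j = 0" for j by (rule fps_X_adic_zero)
  then show "v = \<zero>\<^bsub>coord_on J\<^esub>" by auto
qed

lemma separated_coord_on_h: "separated (fps_const fps_X) (coord_on J :: ('k::comm_ring_1 fps fps, _, _) rep)"
  unfolding separated_def
proof (intro ballI impI)
  fix v :: "nat \<Rightarrow> 'k fps fps"
  assume *: "\<forall>N. \<exists>z\<in>carrier (coord_on J). v = fps_const fps_X ^ N \<odot>\<^bsub>coord_on J\<^esub> z"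
  have "\<exists>h. v j $ b = fps_X ^ N * h" for N b j
  proof -
    obtain z where "v = (\<lambda>j. fps_const fps_X ^ N * z j)" using * by auto
    then have "v j $ b = fps_X ^ N * z j $ b" by (simp add: fps_const_power)
    then show ?thesis by blast
  qed
  then have "v j $ b = 0" for j b by (rule fps_X_adic_zero)
  then show "v = \<zero>\<^bsub>coord_on J\<^esub>" by (auto simp: fps_eq_iff)
qed

lemma separated_lin_transfer:
  assumes W: "module (ring_of_type_algebra :: 'k::comm_ring_1 ring) W" "lin_transfer W V \<beta>" "separated t W"
  shows "separated (t :: 'k) V"
  unfolding separated_def
proof (intro ballI impI)
  fix v assume v: "v \<in> carrier V" "\<forall>N::nat. \<exists>z\<in>carrier V. v = (t ^ N) \<odot>\<^bsub>V\<^esub> z"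
  note D = lin_transferD[OF W(2)]
  obtain w where w: "w \<in> carrier W" "v = \<beta> w" using v D(1) by auto
  have "\<exists>z\<in>carrier W. w = (t ^ N) \<odot>\<^bsub>W\<^esub> z" for N
  proof -
    obtain z where "z \<in> carrier W" "\<beta> w = (t ^ N) \<odot>\<^bsub>V\<^esub> \<beta> z" using v(2) w D(1) by auto
    then show ?thesis using D w module_type_smult_closed[OF W(1)] by (intro bexI[of _ z]) auto
  qed
  then have "w = \<zero>\<^bsub>W\<^esub>" using W(3) w by (auto simp: separated_def)
  then show "v = \<zero>\<^bsub>V\<^esub>" using w D by simp
qed

text \<open>The matrices provide the existence, and \<open>unique_action\<close> the uniqueness, of the representation that
  \<open>rep_by_generators\<close> describes.\<close>

lemma rep_by_generators_matrep:
  fixes M :: "'u \<Rightarrow> nat \<Rightarrow> nat \<Rightarrow> 'k::comm_ring_1"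
  assumes M: "matrep U n M" and R: "ring U" and cs: "\<And>c u. u \<in> carrier U \<Longrightarrow> c \<odot>\<^bsub>U\<^esub> u \<in> carrier U"
    and gen: "\<And>x. \<gamma> x \<in> carrier U"
    and T: "\<And>x v. v \<in> carrier (coord_module n :: ('k, _, 'u) rep) \<Longrightarrow> T x v = mat_act n (M (\<gamma> x)) v"
    and uniq: "unique_action U \<gamma> (coord_module n :: ('k, _, 'u) rep)"
  defines "V \<equiv> rep_by_generators U \<gamma> (coord_module n) T"
  shows "alg_module U V" "\<exists>\<rho>. V = (coord_module n)\<lparr>act := \<rho>\<rparr>"
    "\<And>u v. u \<in> carrier U \<Longrightarrow> v \<in> carrier V \<Longrightarrow> act V u v = mat_act n (M u) v"
proof -
  interpret ring U by (rule R)
  let ?C = "carrier (coord_module n :: ('k, nat \<Rightarrow> 'k, 'u) rep)"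
  define \<rho> where "\<rho> = (\<lambda>u\<in>carrier U. \<lambda>v\<in>?C. mat_act n (M u) v)"
  have \<rho>: "\<rho> u v = mat_act n (M u) v" if "u \<in> carrier U" "v \<in> ?C" for u v
    using that by (simp add: \<rho>_def)
  have alg: "alg_module U ((coord_module n)\<lparr>act := \<rho>\<rparr>)"
    by (rule alg_module_matrep[OF M]) (auto simp: \<rho> cs)
  have "V = (coord_module n)\<lparr>act := \<rho>\<rparr>"
    unfolding V_def
  proof (rule rep_by_generators_eqI)
    have "mat_act n A v \<in> ?C" for A v by (simp add: coord_module_eq mat_act_def)
    then show "\<rho> \<in> carrier U \<rightarrow>\<^sub>E (?C \<rightarrow>\<^sub>E ?C)" by (auto simp: \<rho>_def)
    show "\<rho> (\<gamma> x) v = T x v" if "v \<in> ?C" for x v using T that gen by (simp add: \<rho>)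
  qed (rule alg uniq)+
  then show "alg_module U V" "\<exists>\<rho>. V = (coord_module n)\<lparr>act := \<rho>\<rparr>"
    "\<And>u v. u \<in> carrier U \<Longrightarrow> v \<in> carrier V \<Longrightarrow> act V u v = mat_act n (M u) v"
    using alg \<rho> by auto
qed

section \<open>Exponential series\<close>

lemma exp_series_add:
  assumes c: "rhom c"
  shows "exp_series c (a + b) = exp_series c a * exp_series c (b :: 'r::comm_ring_1)"
proof (rule fps_ext)
  fix N
  have "c (1 / fact N) * (of_nat (N choose k) * a ^ k * b ^ (N - k)) =
    c (1 / fact k) * a ^ k * (c (1 / fact (N - k)) * b ^ (N - k))" if "k \<le> N" for k
  proof -
    have "c (1 / fact N) * of_nat (N choose k) = c (1 / fact N * of_nat (N choose k))"
      by (simp only: rhomD(2,9)[OF c])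
    also have "(1::complex) / fact N * of_nat (N choose k) = 1 / fact k * (1 / fact (N - k))"
      using that by (simp add: binomial_fact)
    also have "c (1 / fact k * (1 / fact (N - k))) = c (1 / fact k) * c (1 / fact (N - k))"
      by (rule rhomD(2)[OF c])
    finally have *: "c (1 / fact N) * of_nat (N choose k) = c (1 / fact k) * c (1 / fact (N - k))" .
    have "c (1 / fact N) * (of_nat (N choose k) * a ^ k * b ^ (N - k)) =
        (c (1 / fact N) * of_nat (N choose k)) * (a ^ k * b ^ (N - k))"
      by (simp only: mult_ac)
    then show ?thesis unfolding * by (simp only: mult_ac)
  qed
  then show "exp_series c (a + b) $ N = (exp_series c a * exp_series c b) $ N"
    by (simp add: exp_series_def fps_mult_nth binomial_ring sum_distrib_left atLeast0AtMost)
qed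

lemma exp_series_0: "rhom c \<Longrightarrow> exp_series c 0 = 1"
  by (auto simp: exp_series_def fps_eq_iff power_0_left rhomD)

lemma exp_series_map: "rhom \<eta> \<Longrightarrow> map_fps \<eta> (exp_series c a) = exp_series (\<lambda>z. \<eta> (c z)) (\<eta> a)"
  by (simp add: fps_eq_iff exp_series_def rhomD)

lemma exp_series_id: "exp_series id a = fps_exp a" "exp_series (\<lambda>z. z) a = fps_exp a"
  by (simp_all add: exp_series_def fps_eq_iff)

lemma exact_quot_eqI: "b \<noteq> 0 \<Longrightarrow> b * y = a \<Longrightarrow> exact_quot a b = y"
  unfolding exact_quot_def by (rule the_equality) auto

text \<open>\<open>sinh(ah)/sinh(uh)\<close>, which is \<open>[a]\<^sub>Q\<close> for \<open>u = 1\<close>.\<close>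

definition sinh_quot :: "(complex \<Rightarrow> 'r::idom) \<Rightarrow> 'r \<Rightarrow> 'r \<Rightarrow> 'r fps" where
  "sinh_quot c u a = exact_quot (exp_series c a - exp_series c (- a)) (exp_series c u - exp_series c (- u))"

lemma sinh_series_X:
  "exp_series c a - exp_series c (- a) = fps_X * fps_shift 1 (exp_series c a - exp_series c (- a))"
  by (subst fps_decompose) (simp add: exp_series_def)

context
  fixes c :: "complex \<Rightarrow> 'r::idom" and u v :: 'r
  assumes c: "rhom c" and uv: "u * v = 1"
begin

lemma two_invertible: "(2::'r) * c (1 / 2) = 1"
proof -
  have "(2::'r) = c 2" using rhomD(9)[OF c, of 2] by simp
  then have "2 * c (1 / 2) = c (2 * (1 / 2))" by (simp only: rhomD[OF c])
  then show ?thesis by (simp add: rhomD[OF c])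
qed

lemma sinh_shift_0: "fps_shift 1 (exp_series c a - exp_series c (- a)) $ 0 = 2 * a"
  by (simp add: exp_series_def rhomD[OF c])

lemma sinh_nonzero: "exp_series c u - exp_series c (- u) \<noteq> 0"
proof
  assume *: "exp_series c u - exp_series c (- u) = 0"
  then have "2 * u = 0" using sinh_shift_0[of u] by simp
  then have "2 * u * (c (1 / 2) * v) = 0" by simp
  then have "(2 * c (1 / 2)) * (u * v) = 0" by (simp only: mult_ac)
  then show False by (simp add: two_invertible uv)
qed

text \<open>After division by \<open>h\<close> the denominator has constant term \<open>2u\<close>, so it is invertible when \<open>u\<close> is a unit.\<close>

lemma sinh_quot: "(exp_series c u - exp_series c (- u)) * sinh_quot c u a = exp_series c a - exp_series c (- a)"
proof -
  let ?w = "\<lambda>a. fps_shift 1 (exp_series c a - exp_series c (- a))"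
  have "?w u $ 0 * (c (1 / 2) * v) = (2 * c (1 / 2)) * (u * v)" unfolding sinh_shift_0 by (simp only: mult_ac)
  then have "?w u $ 0 * (c (1 / 2) * v) = 1" by (simp add: two_invertible uv)
  then have inv: "?w u * fps_right_inverse (?w u) (c (1 / 2) * v) = 1" by (rule fps_right_inverse)
  define y where "y = fps_right_inverse (?w u) (c (1 / 2) * v) * ?w a"
  have "(exp_series c u - exp_series c (- u)) * y = fps_X * (?w u * y)"
    by (subst sinh_series_X) (simp only: mult.assoc)
  also have "?w u * y = ?w a" unfolding y_def by (simp only: mult.assoc[symmetric] inv mult_1_left)
  also have "fps_X * ?w a = exp_series c a - exp_series c (- a)" using sinh_series_X by metis
  finally show ?thesis unfolding sinh_quot_def using exact_quot_eqI[OF sinh_nonzero] by metis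
qed

lemma sinh_quot_eqI:
  "(exp_series c u - exp_series c (- u)) * y = exp_series c a - exp_series c (- a) \<Longrightarrow> sinh_quot c u a = y"
  unfolding sinh_quot_def by (rule exact_quot_eqI[OF sinh_nonzero])

lemma sinh_quot_minus: "sinh_quot c u (- a) = - sinh_quot c u a"
  by (rule sinh_quot_eqI) (simp only: mult_minus_right sinh_quot, simp)

end

lemma sinh_quot_map:
  fixes \<eta> :: "'r::idom \<Rightarrow> 's::idom"
  assumes c: "rhom c" and uv: "u * v = 1" and \<eta>: "rhom \<eta>"
  shows "map_fps \<eta> (sinh_quot c u a) = sinh_quot (\<lambda>z. \<eta> (c z)) (\<eta> u) (\<eta> a)"
proof (rule sym, rule sinh_quot_eqI)
  show "rhom (\<lambda>z. \<eta> (c z))" by (rule rhom_comp[OF \<eta> c])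
  show "\<eta> u * \<eta> v = 1" using uv by (simp add: rhomD[OF \<eta>] flip: rhomD(2)[OF \<eta>])
  have "map_fps \<eta> ((exp_series c u - exp_series c (- u)) * sinh_quot c u a) =
      map_fps \<eta> (exp_series c a - exp_series c (- a))"
    by (simp only: sinh_quot[OF c uv])
  then show "(exp_series (\<lambda>z. \<eta> (c z)) (\<eta> u) - exp_series (\<lambda>z. \<eta> (c z)) (- \<eta> u)) *
      map_fps \<eta> (sinh_quot c u a) = exp_series (\<lambda>z. \<eta> (c z)) (\<eta> a) - exp_series (\<lambda>z. \<eta> (c z)) (- \<eta> a)"
    by (simp add: rhomD[OF rhom_map_fps[OF \<eta>]] exp_series_map[OF \<eta>] rhomD[OF \<eta>])
qed

section \<open>Translation of power series\<close>

text \<open>The Hasse derivative \<open>F\<^bsup>(k)\<^esup>/k!\<close>.\<close>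

definition hasse :: "nat \<Rightarrow> 'r::comm_ring_1 fps \<Rightarrow> 'r fps" where
  "hasse k F = Abs_fps (\<lambda>m. of_nat ((m + k) choose k) * F $ (m + k))"

text \<open>\<open>F(h) \<mapsto> F(h + h' P)\<close>, by Taylor's formula.\<close>

definition translate :: "'r::comm_ring_1 fps \<Rightarrow> 'r fps \<Rightarrow> 'r fps fps" where
  "translate P F = Abs_fps (\<lambda>k. P ^ k * hasse k F)"

lemma hasse_0: "hasse 0 F = F"
  by (simp add: hasse_def fps_eq_iff)

lemma hasse_add: "hasse k (F + G) = hasse k F + hasse k G"
  by (simp add: hasse_def fps_eq_iff distrib_left)

lemma hasse_const_mult: "hasse k (fps_const a * F) = fps_const a * hasse k F"
  by (simp add: hasse_def fps_eq_iff mult_ac)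

lemma hasse_X_mult: "hasse (Suc k) (fps_X * F) = fps_X * hasse (Suc k) F + hasse k F"
proof (rule fps_ext)
  fix m
  show "hasse (Suc k) (fps_X * F) $ m = (fps_X * hasse (Suc k) F + hasse k F) $ m"
  proof (cases m)
    case (Suc m')
    have "((Suc m' + Suc k) choose Suc k) = ((m' + Suc k) choose Suc k) + ((Suc m' + k) choose k)"
      by (simp add: add.commute)
    then show ?thesis using Suc by (simp add: hasse_def fps_X_mult_nth distrib_right del: binomial_Suc_Suc)
  qed (simp add: hasse_def fps_X_mult_nth binomial_eq_0)
qed

lemma translate_0_nth [simp]: "translate P F $ 0 = F"
  by (simp add: translate_def hasse_0)

lemma translate_add: "translate P (F + G) = translate P F + translate P G"
  by (simp add: translate_def fps_eq_iff hasse_add distrib_left)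

lemma translate_const_mult: "translate P (fps_const a * F) = fps_const (fps_const a) * translate P F"
  by (rule fps_ext) (simp add: translate_def hasse_const_mult mult.left_commute)

lemma translate_X_mult: "translate P (fps_X * F) = (fps_const fps_X + fps_X * fps_const P) * translate P F"
proof (rule fps_ext)
  fix k
  show "translate P (fps_X * F) $ k = ((fps_const fps_X + fps_X * fps_const P) * translate P F) $ k"
    by (cases k) (simp_all add: translate_def distrib_right mult.assoc fps_X_mult_nth hasse_0 hasse_X_mult
        distrib_left mult.left_commute)
qed

lemma translate_const: "translate P (fps_const a) = fps_const (fps_const a)"
proof (rule fps_ext)
  fix k show "translate P (fps_const a) $ k = fps_const (fps_const a) $ k"
    by (cases k) (auto simp: translate_def hasse_def fps_eq_iff fps_mult_nth)
qed

text \<open>Again the defect of multiplicativity is divisible by every power of \<open>h + h'P\<close>, the image of \<open>h\<close>.\<close>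

lemma translate_mult: "translate P (F * G) = translate P F * translate P G"
proof -
  define d where "d F = translate P (F * G) - translate P F * translate P G" for F
  have step: "d F = (fps_const fps_X + fps_X * fps_const P) * d (fps_shift 1 F)" for F
  proof -
    let ?c = "fps_const (F $ 0)" and ?s = "fps_shift 1 F"
    have "d F = d (?c + fps_X * ?s)" by (rule arg_cong[OF fps_decompose])
    moreover have "(?c + fps_X * ?s) * G = ?c * G + fps_X * (?s * G)"
      by (simp add: distrib_right mult.assoc)
    ultimately show ?thesis
      unfolding d_def
      by (simp only: translate_add translate_const_mult translate_X_mult translate_const) (simp add: algebra_simps)
  qed
  have "d F $ k $ m = 0" if "k + m < N" for N F k m
    using that
  proof (induction N arbitrary: F k m)
    case (Suc N)
    let ?d = "d (fps_shift 1 F)"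
    have "d F $ k = fps_X * ?d $ k + (if k = 0 then 0 else P * ?d $ (k - 1))"
      by (subst step) (simp add: distrib_right mult.assoc fps_X_mult_nth)
    moreover have "(fps_X * ?d $ k) $ m = 0"
      using Suc by (simp add: fps_X_mult_nth)
    moreover have "(P * ?d $ (k - 1)) $ m = 0" if "k \<noteq> 0"
      using Suc that by (auto simp: fps_mult_nth intro!: sum.neutral)
    ultimately show ?case by simp
  qed simp
  then have "d F = 0" by (simp add: fps_eq_iff) (meson lessI)
  then show ?thesis by (simp add: d_def)
qed

lemma rhom_translate: "rhom (translate P)"
  using translate_const[of P 1] by (intro rhomI translate_add translate_mult) simp

lemma translate_exp:
  assumes c: "rhom c"
  shows "translate P (exp_series c b) =
    fps_const (exp_series c b) * exp_series (\<lambda>z. fps_const (c z)) (P * fps_const b)"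
proof (rule fps_ext)
  fix k
  have "hasse k (exp_series c b) = fps_const (c (1 / fact k) * b ^ k) * exp_series c b"
  proof (rule fps_ext)
    fix m
    have "c (1 / fact (m + k)) * of_nat ((m + k) choose k) = c (1 / fact (m + k) * of_nat ((m + k) choose k))"
      by (simp only: rhomD(2,9)[OF c])
    also have "(1::complex) / fact (m + k) * of_nat ((m + k) choose k) = 1 / fact k * (1 / fact m)"
      by (simp add: binomial_fact)
    also have "c (1 / fact k * (1 / fact m)) = c (1 / fact k) * c (1 / fact m)"
      by (rule rhomD(2)[OF c])
    finally have "of_nat ((m + k) choose k) * c (1 / fact (m + k)) = c (1 / fact k) * c (1 / fact m)"
      by (simp only: mult.commute)
    then show "hasse k (exp_series c b) $ m = (fps_const (c (1 / fact k) * b ^ k) * exp_series c b) $ m"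
      by (simp add: hasse_def exp_series_def power_add mult_ac)
  qed
  then show "translate P (exp_series c b) $ k =
      (fps_const (exp_series c b) * exp_series (\<lambda>z. fps_const (c z)) (P * fps_const b)) $ k"
    by (simp add: translate_def exp_series_def[of "\<lambda>z. fps_const (c z)"] power_mult_distrib fps_const_power mult_ac
        flip: fps_const_mult)
qed

lemma translate_map:
  assumes "rhom \<eta>"
  shows "map_fps (map_fps \<eta>) (translate P F) = translate (map_fps \<eta> P) (map_fps \<eta> F)"
proof (rule fps_ext)
  fix k
  have "map_fps \<eta> (hasse k F) = hasse k (map_fps \<eta> F)"
    by (simp add: hasse_def fps_eq_iff rhomD[OF assms])
  then show "map_fps (map_fps \<eta>) (translate P F) $ k = translate (map_fps \<eta> P) (map_fps \<eta> F) $ k"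
    by (simp add: translate_def rhomD[OF rhom_map_fps[OF assms]])
qed

section \<open>The numbers \<open>[a]\<close> with base \<open>Q T\<^bsup>{a}\<^esup>\<close>\<close>

lemma QT_power_eq: "rhom c \<Longrightarrow> QT_power g c a b = translate (P_of g c a) (exp_series c b)"
  by (simp add: QT_power_def translate_exp)

text \<open>Translation by \<open>h'{a}\<close> sends \<open>h\<close> to the divisor \<open>h + h'{a}\<close> and \<open>exp(bh)\<close> to \<open>(Q T\<^bsup>{a}\<^esup>)\<^sup>b\<close>, so it carries the quotient
  that defines \<open>[a]\<^sub>Q\<close> to the one that defines \<open>[a]\<close> with base \<open>Q T\<^bsup>{a}\<^esup>\<close>.\<close>

lemma QT_number_eq:
  assumes c: "rhom c"
  shows "QT_number g c a = translate (P_of g c a) (sinh_quot c 1 a)"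
proof -
  let ?t = "translate (P_of g c a)" and ?z = "fps_const fps_X + fps_X * fps_const (P_of g c a)"
  let ?w = "\<lambda>a. fps_shift 1 (exp_series c a - exp_series c (- a))"
  have z: "?z \<noteq> 0"
  proof
    assume "?z = 0"
    then have "?z $ 0 $ 1 = 0" by simp
    then show False by simp
  qed
  have quot: "exact_quot (QT_power g c a b - QT_power g c a (- b)) ?z = ?t (?w b)" for b
  proof (rule exact_quot_eqI[OF z])
    have "?z * ?t (?w b) = ?t (exp_series c b - exp_series c (- b))"
      by (subst (2) sinh_series_X) (simp only: translate_X_mult)
    then show "?z * ?t (?w b) = QT_power g c a b - QT_power g c a (- b)"
      by (simp add: QT_power_eq[OF c] rhomD[OF rhom_translate])
  qed
  have one: "(1::'a) * 1 = 1" by simp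
  have nz: "?w 1 \<noteq> 0"
    using sinh_nonzero[OF c one] sinh_series_X[of c 1] by auto
  have "fps_X * (?w 1 * sinh_quot c 1 a) = fps_X * ?w a"
    using sinh_quot[OF c one, of a] sinh_series_X[of c 1] sinh_series_X[of c a]
    by (metis mult.assoc)
  then have "?w 1 * sinh_quot c 1 a = ?w a" by simp
  then have "?t (?w 1) * ?t (sinh_quot c 1 a) = ?t (?w a)" by (metis translate_mult)
  moreover have "?t (?w 1) \<noteq> 0" using nz translate_0_nth[of "P_of g c a" "?w 1"] by (metis fps_zero_nth)
  ultimately have "exact_quot (?t (?w a)) (?t (?w 1)) = ?t (sinh_quot c 1 a)"
    by (intro exact_quot_eqI)
  then show ?thesis using quot[of a] quot[of 1] by (simp add: QT_number_def Let_def)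
qed

lemma P_of_map:
  fixes \<eta> :: "'r::comm_ring_1 \<Rightarrow> 's::comm_ring_1"
  assumes \<eta>: "rhom \<eta>"
  shows "map_fps \<eta> (P_of g c a) = P_of g (\<lambda>z. \<eta> (c z)) (\<eta> a)"
  unfolding P_of_def Let_def
  by (simp add: rhomD[OF rhom_map_fps[OF \<eta>]] rhom_prod[OF rhom_map_fps[OF \<eta>]] exp_series_map[OF \<eta>] rhomD[OF \<eta>])

lemma QT_number_map:
  fixes \<eta> :: "'r::idom \<Rightarrow> 's::idom"
  assumes c: "rhom c" and \<eta>: "rhom \<eta>"
  shows "map_fps (map_fps \<eta>) (QT_number g c a) = QT_number g (\<lambda>z. \<eta> (c z)) (\<eta> a)"
proof -
  have one: "(1::'r) * 1 = 1" by simp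
  show ?thesis
    by (simp add: QT_number_eq[OF c] QT_number_eq[OF rhom_comp[OF \<eta> c]] translate_map[OF \<eta>] P_of_map[OF \<eta>]
        sinh_quot_map[OF c one \<eta>] rhomD[OF \<eta>])
qed

lemma eps_nonzero [simp]: "eps g \<noteq> 0"
  by (simp add: eps_def)

lemma eps_power_g: "g \<ge> 1 \<Longrightarrow> eps g ^ g = -1"
  by (simp add: eps_def flip: exp_of_nat_mult)

lemma eps_power_diff: "g \<ge> 1 \<Longrightarrow> k \<le> g \<Longrightarrow> eps g ^ (g - k) = - (inverse (eps g) ^ k)"
  by (simp add: power_diff eps_power_g field_simps power_inverse)

lemma inverse_eps_power_diff: "g \<ge> 1 \<Longrightarrow> k \<le> g \<Longrightarrow> inverse (eps g) ^ (g - k) = - (eps g ^ k)"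
  by (simp add: power_inverse eps_power_diff)

text \<open>\<open>P\<close> is invariant under \<open>u \<mapsto> u\<^sup>-\<^sup>1\<close>: as \<open>\<epsilon>\<^sup>g = -1\<close>, the factor for \<open>k\<close> becomes the factor for \<open>g - k\<close>.\<close>

lemma P_of_minus:
  assumes c: "rhom c" and g: "g \<ge> 1"
  shows "P_of g c (- a) = P_of g c a"
proof -
  let ?u = "exp_series c a" and ?v = "exp_series c (- a)" and ?s = "\<lambda>z. fps_const (c z)"
  let ?f = "\<lambda>u v k. ?s (1 / (eps g ^ k - inverse (eps g) ^ k)) * (?s (eps g ^ k) * u - ?s (inverse (eps g) ^ k) * v)"
  have "(\<Prod>k=1..g - 1. ?f ?v ?u k) = (\<Prod>k=1..g - 1. ?f ?u ?v k)"
  proof (rule prod.reindex_bij_witness[of _ "\<lambda>k. g - k" "\<lambda>k. g - k"])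
    fix k assume "k \<in> {1..g - 1}"
    then have k: "k \<le> g" by auto
    have "1 / (- (inverse (eps g) ^ k) - - (eps g ^ k)) = 1 / (eps g ^ k - inverse (eps g) ^ k)"
      by simp
    then show "?f ?u ?v (g - k) = ?f ?v ?u k"
      unfolding eps_power_diff[OF g k] inverse_eps_power_diff[OF g k] rhomD(5)[OF c]
      by (simp add: rhomD(5)[OF c] flip: fps_const_neg)
  qed auto
  then show ?thesis by (simp add: P_of_def Let_def add.commute)
qed

lemma QT_number_minus:
  assumes c: "rhom c" and g: "g \<ge> 1"
  shows "QT_number g c (- a) = - QT_number g c a"
proof -
  have one: "(1::'a) * 1 = 1" by simp
  show ?thesis
    by (simp add: QT_number_eq[OF c] P_of_minus[OF c g] sinh_quot_minus[OF c one] rhomD[OF rhom_translate])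
qed

lemma rhom_id: "rhom id" "rhom (\<lambda>x. x)"
  by (simp_all add: rhom_def)

lemma exp_diff_nonzero: "r \<noteq> 0 \<Longrightarrow> fps_exp r - fps_exp (- r) \<noteq> (0 :: complex fps)"
proof
  assume r: "r \<noteq> 0" and "fps_exp r - fps_exp (- r) = (0 :: complex fps)"
  then have "(fps_exp r - fps_exp (- r)) $ 1 = 0" by simp
  then show False using r by simp
qed

lemma sinh_quot_complex:
  assumes "r \<noteq> 0"
  shows "(fps_exp r - fps_exp (- r)) * sinh_quot id r a = fps_exp a - fps_exp (- a)"
  using sinh_quot[OF rhom_id(1), of r "1 / r" a] assms by (simp add: exp_series_id)

lemma q_number_eq: "q_number r a = sinh_quot id r (r * of_nat a)"
  by (simp add: q_number_def sinh_quot_def exp_series_id)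

lemma sinh_quot_of_nat:
  assumes r: "r \<noteq> 0"
  shows "sinh_quot id r (r * of_nat a) = (\<Sum>i<a. fps_exp (r * (of_nat a - 1 - 2 * of_nat i)))"
proof -
  have "(fps_exp r - fps_exp (- r)) * (\<Sum>i<a. fps_exp (r * (of_nat a - 1 - 2 * of_nat i))) =
      (\<Sum>i<a. fps_exp (r * (of_nat a - 2 * of_nat i)) - fps_exp (r * (of_nat a - 2 * of_nat (Suc i))))"
    unfolding sum_distrib_left left_diff_distrib fps_exp_add_mult[symmetric]
    by (intro sum.cong refl arg_cong2[of _ _ _ _ "(-)"] arg_cong[of _ _ fps_exp]) (simp_all add: algebra_simps)
  also have "\<dots> = fps_exp (r * of_nat a) - fps_exp (- (r * of_nat a))"
    by (subst sum_lessThan_telescope') (simp add: algebra_simps)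
  finally show ?thesis
    using r by (intro sinh_quot_eqI[OF rhom_id(1), of r "1 / r"]) (simp_all add: exp_series_id)
qed

lemma q_number_0: "r \<noteq> 0 \<Longrightarrow> q_number r 0 = 0"
  by (simp add: q_number_eq sinh_quot_of_nat del: mult_zero_right of_nat_0)

text \<open>\<open>[j+1][k] - [j][k+1] = [k-j]\<close>: this is the relation for \<open>[X\<^sup>+, X\<^sup>-]\<close> on a weight vector.\<close>

lemma q_number_comm:
  assumes r: "r \<noteq> 0"
  shows "q_number r (j + 1) * q_number r k - q_number r j * q_number r (k + 1) =
    sinh_quot id r (r * of_int (int k - int j))"
proof -
  let ?D = "fps_exp r - fps_exp (- r)"
  let ?e = "\<lambda>x. fps_exp (r * of_nat x)" and ?e' = "\<lambda>x. fps_exp (- (r * of_nat x))"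
  have D: "?D * q_number r x = ?e x - ?e' x" for x
    using sinh_quot_complex[OF r] by (simp add: q_number_eq)
  have s: "?e (x + 1) = ?e x * fps_exp r" "?e' (x + 1) = ?e' x * fps_exp (- r)" for x
    by (simp_all add: distrib_left flip: fps_exp_add_mult)
  have "?D * (?D * (q_number r (j + 1) * q_number r k - q_number r j * q_number r (k + 1))) =
    (?D * q_number r (j + 1)) * (?D * q_number r k) - (?D * q_number r j) * (?D * q_number r (k + 1))"
    by (simp add: algebra_simps)
  also have "\<dots> = ?D * (?e' j * ?e k - ?e j * ?e' k)"
    unfolding D s by (simp add: algebra_simps)
  also have "?e' j * ?e k - ?e j * ?e' k = fps_exp (r * of_int (int k - int j)) - fps_exp (- (r * of_int (int k - int j)))"
    by (simp add: algebra_simps flip: fps_exp_add_mult)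
  also have "\<dots> = ?D * sinh_quot id r (r * of_int (int k - int j))"
    using sinh_quot_complex[OF r] by simp
  finally show ?thesis using exp_diff_nonzero[OF r] by simp
qed

text \<open>For integral \<open>a\<close> the quotient is a finite geometric sum, so it has coefficients in \<open>\<complex>[Q\<^sup>\<plusminus>\<^sup>1]\<close>.\<close>

lemma QT_number_of_nat:
  "QT_number g id (of_nat a) = (\<Sum>i<a. QT_power g id (of_nat a) (of_int (int a - 1 - 2 * int i)))"
  using sinh_quot_of_nat[of 1 a]
  by (simp add: QT_number_eq[OF rhom_id(1)] QT_power_eq[OF rhom_id(1)] rhomD[OF rhom_translate] exp_series_id)

lemma QT_number_quot:
  "(QT_power g id a 1 - QT_power g id a (- 1)) * QT_number g id a = QT_power g id a a - QT_power g id a (- a)"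
proof -
  have one: "(1::complex) * 1 = 1" by simp
  show ?thesis
    using sinh_quot[OF rhom_id(1) one, of a]
    by (simp add: QT_number_eq[OF rhom_id(1)] QT_power_eq[OF rhom_id(1)]
        flip: rhomD(6)[OF rhom_translate] translate_mult)
qed

lemma QT_number_nth_0: "QT_number g id (of_nat a) $ 0 = q_number 1 a"
  by (simp add: QT_number_eq[OF rhom_id(1)] q_number_eq)

lemma QT_number_0: "QT_number g id 0 = 0"
  using QT_number_of_nat[of g 0] by simp

section \<open>The quantum algebras as quotients\<close>

lemma two_sided_adic_closure:
  assumes "two_sided I"
  shows "two_sided (adic_closure fps_X free_series (I :: 'x free_alg fps set))"
proof -
  have X: "map_fps fa_const (fps_X ^ N) = (fps_X ^ N :: 'x free_alg fps)" for N
    by (simp add: rhomD[OF rhom_map_fps[OF rhom_fa_const]] map_fps_X rhom_fa_const)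
  have *: "x \<in> adic_closure fps_X free_series I \<longleftrightarrow> (\<forall>N. \<exists>y\<in>I. \<exists>z. x = y + fps_X ^ N * z)" for x
    by (simp add: adic_closure_def free_series_eq X)
  show ?thesis
    unfolding two_sided_def
  proof (intro conjI ballI allI)
    show "0 \<in> adic_closure fps_X free_series I"
      unfolding * using assms by (auto simp: two_sided_def intro!: bexI[of _ 0] exI[of _ 0])
  next
    fix x y assume xy: "x \<in> adic_closure fps_X free_series I" "y \<in> adic_closure fps_X free_series I"
    show "x + y \<in> adic_closure fps_X free_series I"
      unfolding *
    proof
      fix N
      obtain x' y' z z' where I: "x' \<in> I" "y' \<in> I" and "x = x' + fps_X ^ N * z" "y = y' + fps_X ^ N * z'"
        using xy unfolding * by blast
      then have "x + y = (x' + y') + fps_X ^ N * (z + z')" by (simp add: algebra_simps)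
      then show "\<exists>w\<in>I. \<exists>z. x + y = w + fps_X ^ N * z"
        using I assms unfolding two_sided_def by blast
    qed
  next
    fix x a assume x: "x \<in> adic_closure fps_X free_series I"
    show "a * x \<in> adic_closure fps_X free_series I"
      unfolding *
    proof
      fix N
      obtain y z where "y \<in> I" "x = y + fps_X ^ N * z" using x unfolding * by blast
      moreover have "a * (fps_X ^ N * z) = fps_X ^ N * (a * z)"
        by (metis fps_mult_fps_X_power_commute mult.assoc)
      ultimately have "a * x = a * y + fps_X ^ N * (a * z)" "a * y \<in> I"
        using assms by (simp_all add: two_sided_def distrib_left)
      then show "\<exists>y\<in>I. \<exists>z. a * x = y + fps_X ^ N * z" by blast
    qed
    show "x * a \<in> adic_closure fps_X free_series I"
      unfolding *
    proof
      fix N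
      obtain y z where "y \<in> I" "x = y + fps_X ^ N * z" using x unfolding * by blast
      then have "x * a = y * a + fps_X ^ N * (z * a)" "y * a \<in> I"
        using assms by (simp_all add: two_sided_def distrib_right mult.assoc)
      then show "\<exists>y\<in>I. \<exists>z. x * a = y + fps_X ^ N * z" by blast
    qed
  qed
qed

lemma two_sided_q_ideal: "two_sided (q_ideal r)"
  unfolding q_ideal_def by (rule two_sided_adic_closure) (simp add: free_series_eq two_sided_Idl)

lemma two_sided_adic_closure2:
  assumes I: "two_sided I"
  shows "two_sided (adic_closure2 I)"
  unfolding two_sided_def
proof (intro conjI ballI allI)
  show "0 \<in> adic_closure2 I"
    using I unfolding adic_closure2_def mem_Collect_eq
    by (intro allI bexI[of _ 0]) (simp_all add: two_sided_def)
next
  fix x y assume xy: "x \<in> adic_closure2 I" "y \<in> adic_closure2 I"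
  show "x + y \<in> adic_closure2 I"
    unfolding adic_closure2_def mem_Collect_eq
  proof
    fix N
    obtain x' y' where *: "x' \<in> I" "y' \<in> I"
      "\<forall>a b. a + b < N \<longrightarrow> x $ b $ a = x' $ b $ a" "\<forall>a b. a + b < N \<longrightarrow> y $ b $ a = y' $ b $ a"
      using xy unfolding adic_closure2_def mem_Collect_eq by meson
    then have "x' + y' \<in> I" using I by (simp add: two_sided_def)
    then show "\<exists>z\<in>I. \<forall>a b. a + b < N \<longrightarrow> (x + y) $ b $ a = z $ b $ a"
      by (rule bexI[rotated]) (simp add: *)
  qed
next
  fix x c assume x: "x \<in> adic_closure2 I"
  have low: "(c * x) $ b $ a = (c * y) $ b $ a \<and> (x * c) $ b $ a = (y * c) $ b $ a"
    if "\<forall>a b. a + b < N \<longrightarrow> x $ b $ a = y $ b $ a" "a + b < N" for y N a b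
    unfolding fps_mult_nth fps_sum_nth
    by (intro conjI sum.cong refl arg_cong2[of _ _ _ _ "(*)"] that(1)[rule_format]) (use that(2) in auto)
  show "c * x \<in> adic_closure2 I" "x * c \<in> adic_closure2 I"
    unfolding adic_closure2_def mem_Collect_eq
  proof (safe)
    fix N
    obtain y where y: "y \<in> I" "\<forall>a b. a + b < N \<longrightarrow> x $ b $ a = y $ b $ a"
      using x unfolding adic_closure2_def mem_Collect_eq by meson
    then have "c * y \<in> I" "y * c \<in> I" using I by (auto simp: two_sided_def)
    then show "\<exists>y\<in>I. \<forall>a b. a + b < N \<longrightarrow> (c * x) $ b $ a = y $ b $ a"
      "\<exists>y\<in>I. \<forall>a b. a + b < N \<longrightarrow> (x * c) $ b $ a = y $ b $ a"
      using low[OF y(2)] by blast+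
  qed
qed

lemma two_sided_hh_ideal: "two_sided (hh_ideal g)"
  unfolding hh_ideal_def by (rule two_sided_adic_closure2) (simp add: free_series2_eq two_sided_Idl)

lemma U_q_eq: "U_q r = quot_alg id (type_alg (map_fps fa_const)) (q_ideal r)"
  by (simp add: U_q_def free_series_eq)

lemma U_hh_eq: "U_hh g = quot_alg id (type_alg (map_fps (map_fps fa_const))) (hh_ideal g)"
  by (simp add: U_hh_def free_series2_eq)

lemma q_gen_eq: "q_gen r x = q_ideal r +>\<^bsub>type_alg (map_fps fa_const)\<^esub> fps_const (fa_var x)"
  by (simp add: q_gen_def q_var_def free_series_eq)

lemma hh_class_eq: "hh_class g x = hh_ideal g +>\<^bsub>type_alg (map_fps (map_fps fa_const))\<^esub> x"
  by (simp add: hh_class_def free_series2_eq)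

lemma hh_gen_eq: "hh_gen g x = hh_class g (fps_const (fps_const (fa_var x)))"
  by (simp add: hh_gen_def hh_var_def)

interpretation q: alg_quotient id "type_alg (map_fps fa_const)" "q_ideal r"
  by (rule alg_quotient_type_alg[OF two_sided_q_ideal])

interpretation hh: alg_quotient id "type_alg (map_fps (map_fps fa_const))" "hh_ideal g"
  by (rule alg_quotient_type_alg[OF two_sided_hh_ideal])

lemma ring_U_q: "ring (U_q r)"
  unfolding U_q_eq by (rule q.ring_quot)

lemma ring_U_hh: "ring (U_hh g)"
  unfolding U_hh_eq by (rule hh.ring_quot)

lemma carrier_U_q: "carrier (U_q r) = range (\<lambda>x. q_ideal r +>\<^bsub>type_alg (map_fps fa_const)\<^esub> x)"
  by (simp add: U_q_eq q.carrier_quot)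

lemma carrier_U_hh: "carrier (U_hh g) = range (hh_class g)"
  by (auto simp: U_hh_eq hh.carrier_quot hh_class_eq)

lemma hh_class_ops:
  "hh_class g x \<otimes>\<^bsub>U_hh g\<^esub> hh_class g y = hh_class g (x * y)"
  "hh_class g x \<oplus>\<^bsub>U_hh g\<^esub> hh_class g y = hh_class g (x + y)"
  "c \<odot>\<^bsub>U_hh g\<^esub> hh_class g x = hh_class g (map_fps (map_fps fa_const) c * x)"
  "\<one>\<^bsub>U_hh g\<^esub> = hh_class g 1" "\<zero>\<^bsub>U_hh g\<^esub> = hh_class g 0"
proof -
  interpret R: ring "type_alg (map_fps (map_fps fa_const)) :: (complex fps fps, gen free_alg fps fps) module"
    by (rule ring_type_alg)
  interpret I: ideal "hh_ideal g" "type_alg (map_fps (map_fps fa_const))" by (rule hh.J)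
  have "hh_ideal g +>\<^bsub>type_alg (map_fps (map_fps fa_const))\<^esub> 0 = hh_ideal g"
    using R.a_coset_add_zero[of "hh_ideal g"] by simp
  then show "\<zero>\<^bsub>U_hh g\<^esub> = hh_class g 0" by (simp add: U_hh_eq hh_class_eq hh.zero_quot)
qed (simp_all add: U_hh_eq hh_class_eq hh.mult_quot[simplified] hh.add_quot[simplified]
    hh.smult_quot[simplified] hh.one_quot[simplified])

lemma smult_closed_U_q: "u \<in> carrier (U_q r) \<Longrightarrow> c \<odot>\<^bsub>U_q r\<^esub> u \<in> carrier (U_q r)"
  by (auto simp: U_q_eq q.carrier_quot q.smult_quot[simplified])

lemma smult_closed_U_hh: "u \<in> carrier (U_hh g) \<Longrightarrow> c \<odot>\<^bsub>U_hh g\<^esub> u \<in> carrier (U_hh g)"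
  by (auto simp: carrier_U_hh hh_class_ops)

lemma q_gen_carrier [simp]: "q_gen r x \<in> carrier (U_q r)"
  by (auto simp: q_gen_eq carrier_U_q)

lemma hh_gen_carrier [simp]: "hh_gen g x \<in> carrier (U_hh g)"
  by (auto simp: hh_gen_eq carrier_U_hh)

text \<open>The generators generate the free algebra, and polynomials over it are dense in the power series.\<close>

lemma unique_action_U_q:
  assumes sep: "separated fps_X V"
  shows "unique_action (U_q r) (q_gen r) V"
  unfolding unique_action_def
proof (intro allI impI ballI)
  fix \<rho> \<rho>' u v
  assume alg: "alg_module (U_q r) (V\<lparr>act := \<rho>\<rparr>)" "alg_module (U_q r) (V\<lparr>act := \<rho>'\<rparr>)"
    and gen: "\<forall>x. \<forall>v\<in>carrier V. \<rho> (q_gen r x) v = \<rho>' (q_gen r x) v"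
    and u: "u \<in> carrier (U_q r)" and v: "v \<in> carrier V"
  interpret quotient_actions "map_fps fa_const" "q_ideal r" V \<rho> \<rho>'
    using alg by unfold_locales (simp_all add: two_sided_q_ideal U_q_eq)
  note h = rhom_map_fps[OF rhom_fa_const]
  have const: "fps_const a \<in> agree" for a
  proof (rule free_alg_generated)
    show "fps_const (fa_const z) \<in> agree" for z
      using agree_scalar[of "fps_const z"] by (simp add: rhomD[OF rhom_fa_const])
    show "fps_const (fa_var x) \<in> agree" for x
      using gen by (simp add: agree_def q_gen_eq)
  qed (simp_all add: agree_add agree_mult flip: fps_const_add fps_const_mult)
  have X: "fps_X \<in> agree" using agree_scalar[of fps_X] by (simp add: map_fps_X rhom_fa_const)
  have "x \<in> agree" for x
  proof (rule agree_closed[where t = fps_X])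
    show "\<exists>y\<in>agree. \<exists>z. x = y + map_fps fa_const (fps_X ^ N) * z" for N
      using fps_approx[of agree x N, OF const X agree_add agree_mult]
      by (simp add: rhomD[OF h] map_fps_X rhom_fa_const)
  qed (use sep in \<open>auto simp: separated_def\<close>)
  then show "\<rho> u v = \<rho>' u v" using u v by (auto simp: carrier_U_q agree_def)
qed

text \<open>With two parameters the density argument is applied twice, first to the coefficients of the powers of \<open>h'\<close>
  and then to the series in \<open>h'\<close>, so the module has to be separated for both topologies.\<close>

lemma unique_action_U_hh:
  assumes sep: "separated fps_X V" "separated (fps_const fps_X) V"
  shows "unique_action (U_hh g) (hh_gen g) V"
  unfolding unique_action_def
proof (intro allI impI ballI)
  fix \<rho> \<rho>' u v
  assume alg: "alg_module (U_hh g) (V\<lparr>act := \<rho>\<rparr>)" "alg_module (U_hh g) (V\<lparr>act := \<rho>'\<rparr>)"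
    and gen: "\<forall>x. \<forall>v\<in>carrier V. \<rho> (hh_gen g x) v = \<rho>' (hh_gen g x) v"
    and u: "u \<in> carrier (U_hh g)" and v: "v \<in> carrier V"
  interpret quotient_actions "map_fps (map_fps fa_const)" "hh_ideal g" V \<rho> \<rho>'
    using alg by unfold_locales (simp_all add: two_sided_hh_ideal U_hh_eq)
  note h1 = rhom_map_fps[OF rhom_fa_const]
  note h = rhom_map_fps[OF h1]
  have h_img: "map_fps (map_fps fa_const) (fps_const fps_X ^ N) = (fps_const (fps_X ^ N) :: gen free_alg fps fps)" for N
    by (simp add: rhomD[OF h] rhomD[OF h1] map_fps_X rhom_fa_const fps_const_power)
  have const2: "fps_const (fps_const a) \<in> agree" for a
  proof (rule free_alg_generated)
    show "fps_const (fps_const (fa_const z)) \<in> agree" for z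
      using agree_scalar[of "fps_const (fps_const z)"] by (simp add: rhomD[OF rhom_fa_const] rhomD[OF h1])
    show "fps_const (fps_const (fa_var x)) \<in> agree" for x
      using gen by (simp add: agree_def hh_gen_eq hh_class_eq)
  qed (simp_all add: agree_add agree_mult flip: fps_const_add fps_const_mult)
  have hX: "fps_const fps_X \<in> agree"
    using agree_scalar[of "fps_const fps_X"] h_img[of 1] by (simp only: power_one_right mult_1_right)
  have const: "fps_const y \<in> agree" for y
  proof (rule agree_closed[where t = "fps_const fps_X"])
    show "\<exists>y'\<in>agree. \<exists>z. fps_const y = y' + map_fps (map_fps fa_const) (fps_const fps_X ^ N) * z" for N
    proof -
      have "\<exists>y'\<in>{y. fps_const y \<in> agree}. \<exists>z. y = y' + fps_X ^ N * z"
        by (rule fps_approx) (simp_all add: const2 hX agree_add agree_mult flip: fps_const_add fps_const_mult)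
      then obtain y' z where "fps_const y' \<in> agree" "y = y' + fps_X ^ N * z" by blast
      then show ?thesis unfolding h_img by (intro bexI[of _ "fps_const y'"] exI[of _ "fps_const z"]) simp_all
    qed
  qed (use sep in \<open>auto simp: separated_def\<close>)
  have X: "fps_X \<in> agree" using agree_scalar[of fps_X] by (simp add: map_fps_X h1)
  have "x \<in> agree" for x
  proof (rule agree_closed[where t = fps_X])
    show "\<exists>y\<in>agree. \<exists>z. x = y + map_fps (map_fps fa_const) (fps_X ^ N) * z" for N
      using fps_approx[of agree x N, OF const X agree_add agree_mult]
      by (simp add: rhomD[OF h] map_fps_X h1)
  qed (use sep in \<open>auto simp: separated_def\<close>)
  then show "\<rho> u v = \<rho>' u v" using u v by (auto simp: carrier_U_hh hh_class_eq agree_def)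
qed

section \<open>Matrices annihilating the defining ideals\<close>

text \<open>The kernel of the matrices is an ideal that contains the relations, and it is closed since the
  matrix entries depend continuously on the series.\<close>

lemma q_mat_q_ideal:
  assumes rel: "\<And>x i j. x \<in> q_relations r \<Longrightarrow> i \<le> n \<Longrightarrow> j \<le> n \<Longrightarrow> q_mat n G x i j = 0"
    and x: "x \<in> q_ideal r" and ij: "i \<le> n" "j \<le> n"
  shows "q_mat n G x i j = 0"
proof (rule fps_X_adic_zero)
  fix N
  note M = matrep_q_mat[of n G, unfolded free_series_eq]
  have I: "Idl\<^bsub>free_series\<^esub> (q_relations r) \<subseteq> {x. \<forall>i\<le>n. \<forall>j\<le>n. q_mat n G x i j = 0}"
    unfolding free_series_eq by (rule Idl_subset[OF two_sided_kernel[OF M]]) (use rel in auto)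
  obtain y z where "y \<in> Idl\<^bsub>free_series\<^esub> (q_relations r)" "x = y + map_fps fa_const (fps_X ^ N) * z"
    using x unfolding q_ideal_def adic_closure_def by (simp add: free_series_eq) blast
  then show "\<exists>h. q_mat n G x i j = fps_X ^ N * h"
    using I ij matrep_type_algD[OF M ij] by auto
qed

text \<open>Here continuity is used in the form that a coefficient of a matrix entry depends only on finitely many
  coefficients of the series.\<close>

lemma hh_mat_hh_ideal:
  assumes rel: "\<And>x i j. x \<in> hh_relations g \<Longrightarrow> i \<le> n \<Longrightarrow> j \<le> n \<Longrightarrow> hh_mat n G x i j = 0"
    and x: "x \<in> hh_ideal g" and ij: "i \<le> n" "j \<le> n"
  shows "hh_mat n G x i j = 0"
proof -
  note M = matrep_hh_mat[of n G, unfolded free_series2_eq]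
  have I: "Idl\<^bsub>free_series2\<^esub> (hh_relations g) \<subseteq> {x. \<forall>i\<le>n. \<forall>j\<le>n. hh_mat n G x i j = 0}"
    unfolding free_series2_eq by (rule Idl_subset[OF two_sided_kernel[OF M]]) (use rel in auto)
  have "hh_mat n G x i j $ B $ A = 0" for B A
  proof -
    obtain y where y: "y \<in> Idl\<^bsub>free_series2\<^esub> (hh_relations g)"
      "\<And>a b. a + b < Suc (A + B) \<Longrightarrow> x $ b $ a = y $ b $ a"
      using x unfolding hh_ideal_def adic_closure2_def by blast
    have "hh_mat n G x i j $ B $ A = hh_mat n G y i j $ B $ A"
      by (rule hh_mat_cong) (simp add: y(2))
    then show ?thesis using y(1) I ij by auto
  qed
  then show ?thesis by (simp add: fps_eq_iff)
qed

lemma fa_mat_diag_mult: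
  assumes "rhom \<kappa>" "\<And>i j. i \<le> n \<Longrightarrow> j \<le> n \<Longrightarrow> fa_mat n \<kappa> G a i j = of_bool (i = j) * d j"
    "\<And>i j. i \<le> n \<Longrightarrow> j \<le> n \<Longrightarrow> fa_mat n \<kappa> G b i j = of_bool (i = j) * d' j" "i \<le> n" "j \<le> n"
  shows "fa_mat n \<kappa> G (a * b) i j = of_bool (i = j) * (d j * d' j)"
proof -
  have "fa_mat n \<kappa> G (a * b) i j = (\<Sum>l\<le>n. of_bool (i = l) * (d l * fa_mat n \<kappa> G b l j))"
    using assms by (simp add: fa_mat_mult mult.assoc)
  also have "\<dots> = d i * fa_mat n \<kappa> G b i j" using assms(4) by (rule sum_of_bool_mult)
  finally show ?thesis using assms by auto
qed

lemma fa_mat_diag_power: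
  assumes "rhom \<kappa>" "\<And>i j. i \<le> n \<Longrightarrow> j \<le> n \<Longrightarrow> fa_mat n \<kappa> G a i j = of_bool (i = j) * d j" "i \<le> n" "j \<le> n"
  shows "fa_mat n \<kappa> G (a ^ k) i j = of_bool (i = j) * d j ^ k"
  using assms(3,4)
proof (induction k arbitrary: i j)
  case 0
  then show ?case using fa_mat_const[OF assms(1), of n G 1 i j]
    by (simp add: rhomD[OF rhom_fa_const] rhomD[OF assms(1)])
next
  case (Suc k)
  then show ?case using fa_mat_diag_mult[OF assms(1,2) Suc.IH] by simp
qed

lemma fa_mat_sum: "rhom \<kappa> \<Longrightarrow> fa_mat n \<kappa> G (sum f S) i j = (\<Sum>s\<in>S. fa_mat n \<kappa> G (f s) i j)"
  using additive_sum(2)[of "\<lambda>a. fa_mat n \<kappa> G a i j"] by (simp add: fa_mat_add)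

lemma sum_only:
  assumes "(k::nat) \<le> n" "\<And>l. l \<le> n \<Longrightarrow> l \<noteq> k \<Longrightarrow> f l = (0::'k::comm_ring_1)"
  shows "(\<Sum>l\<le>n. f l) = f k"
proof -
  have "(\<Sum>l\<le>n. f l) = (\<Sum>l\<le>n. if l = k then f l else 0)" by (intro sum.cong) (use assms in auto)
  then show ?thesis using assms(1) by simp
qed

text \<open>Raising \<open>m\<^sub>j \<mapsto> c\<^sub>j m\<^sub>j\<^sub>-\<^sub>1\<close> and lowering \<open>m\<^sub>j \<mapsto> m\<^sub>j\<^sub>+\<^sub>1\<close> compose to diagonal matrices; the case distinctions
  are the boundary conventions \<open>m\<^sub>-\<^sub>1 = m\<^sub>n\<^sub>+\<^sub>1 = 0\<close>.\<close>

lemma raise_lower: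
  assumes "i \<le> n" "j \<le> n"
  shows "(\<Sum>l\<le>n. of_bool (l = Suc i) * c l * of_bool (l = Suc j)) =
      of_bool (i = j) * (if j < n then c (Suc j) else (0::'k::comm_ring_1))"
    "(\<Sum>l\<le>n. of_bool (i = Suc l) * (of_bool (j = Suc l) * c j)) =
      of_bool (i = j) * (if j > 0 then c j else (0::'k::comm_ring_1))"
proof -
  show "(\<Sum>l\<le>n. of_bool (l = Suc i) * c l * of_bool (l = Suc j)) =
      of_bool (i = j) * (if j < n then c (Suc j) else (0::'k::comm_ring_1))"
  proof (cases "j < n")
    case True
    then show ?thesis by (subst sum_only[of "Suc j"]) auto
  next
    case False
    then show ?thesis using assms by (auto intro!: sum.neutral)
  qed
  show "(\<Sum>l\<le>n. of_bool (i = Suc l) * (of_bool (j = Suc l) * c j)) =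
      of_bool (i = j) * (if j > 0 then c j else (0::'k::comm_ring_1))"
  proof (cases j)
    case (Suc k)
    then show ?thesis using assms by (subst sum_only[of k]) auto
  qed simp
qed

section \<open>The representations \<open>L\<^sup>h(n)\<close> and \<open>L\<^bsup>gh'\<^esup>(n)\<close>\<close>

definition L_q_mat :: "complex \<Rightarrow> nat \<Rightarrow> qgen \<Rightarrow> nat \<Rightarrow> nat \<Rightarrow> complex fps" where
  "L_q_mat r n x i j = (case x of
     Ht_gen \<Rightarrow> of_bool (i = j) * of_int (int n - 2 * int j)
   | Xt_minus \<Rightarrow> of_bool (i = Suc j)
   | Xt_plus \<Rightarrow> of_bool (j = Suc i) * (q_number r j * q_number r (n - j + 1)))"

lemma mat_act_lin_ext:
  assumes "\<And>i j. i \<le> n \<Longrightarrow> j \<le> n \<Longrightarrow> G i j = T j i" "\<And>i j. j \<le> n \<Longrightarrow> i > n \<Longrightarrow> T j i = 0"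
  shows "mat_act n G v = lin_ext n T v"
  using assms by (auto simp: mat_act_def lin_ext_def fun_eq_iff mult.commute intro!: sum.cong)

lemma mat_act_cong: "(\<And>i j. i \<le> n \<Longrightarrow> j \<le> n \<Longrightarrow> G i j = G' i j) \<Longrightarrow> mat_act n G v = mat_act n G' v"
  by (simp add: mat_act_def fun_eq_iff)

lemma L_q_gen_mat: "L_q_gen r n x v = mat_act n (L_q_mat r n x) v"
  unfolding L_q_gen_def
  by (rule mat_act_lin_ext[symmetric]; cases x) (auto simp: L_q_mat_def m_vec_def)

lemma fps_const_of_int: "fps_const (of_int k) = (of_int k :: 'a::comm_ring_1 fps)"
  by (simp add: fps_of_int)

lemma fa_mat_poly_subst:
  assumes "i \<le> n" "j \<le> n"
  shows "fa_mat n fps_const (L_q_mat r n) (poly_subst p) i j =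
    of_bool (i = j) * fps_const (poly p (of_int (int n - 2 * int j)))"
proof -
  have H: "fa_mat n fps_const (L_q_mat r n) (fa_var Ht_gen) i j = of_bool (i = j) * fps_const (of_int (int n - 2 * int j))"
    if "j \<le> n" for i j
    using that by (simp only: fa_mat_var[OF rhom_fps_const] fps_const_of_int) (simp add: L_q_mat_def)
  have c: "fa_mat n fps_const (L_q_mat r n) (fa_const z) i j = of_bool (i = j) * fps_const z" for z i j
    by (simp add: fa_mat_const rhom_fps_const)
  have "fa_mat n fps_const (L_q_mat r n) (fa_const z * fa_var Ht_gen ^ k) i j =
      of_bool (i = j) * (fps_const z * fps_const (of_int (int n - 2 * int j)) ^ k)" for z k
    by (rule fa_mat_diag_mult[OF rhom_fps_const]) (use assms c fa_mat_diag_power[OF rhom_fps_const H] in auto)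
  also have "fps_const z * fps_const (of_int (int n - 2 * int j)) ^ k =
      fps_const (z * of_int (int n - 2 * int j) ^ k)" for z :: complex and k
    by (simp add: fps_const_power)
  finally have *: "fa_mat n fps_const (L_q_mat r n) (fa_const z * fa_var Ht_gen ^ k) i j =
      of_bool (i = j) * fps_const (z * of_int (int n - 2 * int j) ^ k)" for z k .
  show ?thesis
    unfolding poly_subst_def fa_mat_sum[OF rhom_fps_const] * sum_distrib_left[symmetric]
      rhomD(7)[OF rhom_fps_const, symmetric]
    by (simp only: poly_altdef)
qed

lemma sinh_series_quot:
  assumes "r \<noteq> 0"
  shows "exact_quot (sinh_series [:0, r:]) (sinh_series [:r:]) = sinh_quot (\<lambda>z. [:z:]) [:r:] [:0, r:]"
proof (rule exact_quot_eqI)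
  have c: "rhom (\<lambda>z::complex. [:z:])" by (rule rhomI) (simp_all add: one_pCons)
  have u: "[:r:] * [:1 / r:] = 1" using assms by (simp add: one_pCons)
  have half: "fps_const [:1 / 2 :: complex:] \<noteq> 0" by simp
  show "sinh_series [:r:] \<noteq> 0" unfolding sinh_series_def using sinh_nonzero[OF c u] half by simp
  show "sinh_series [:r:] * sinh_quot (\<lambda>z. [:z:]) [:r:] [:0, r:] = sinh_series [:0, r:]"
    unfolding sinh_series_def using sinh_quot[OF c u, of "[:0, r:]"] by (simp only: mult.assoc)
qed

lemma L_q_relations:
  assumes r: "r \<noteq> 0" and x: "x \<in> q_relations r" and ij: "i \<le> n" "j \<le> n"
  shows "q_mat n (L_q_mat r n) x i j = 0"
proof -
  note M = matrep_type_algD[OF matrep_q_mat[of n "L_q_mat r n", unfolded free_series_eq]]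
  let ?G = "L_q_mat r n" and ?M = "q_mat n (L_q_mat r n)"
  let ?E = "q_var Xt_plus" and ?F = "q_var Xt_minus" and ?H = "q_var Ht_gen"
  have var: "?M (q_var y) i j = ?G y i j" if "j \<le> n" for y i j
    using that by (simp add: q_var_def q_mat_var)
  have prod: "?M (q_var y * q_var z) i j = (\<Sum>l\<le>n. ?G y i l * ?G z l j)" if "i \<le> n" "j \<le> n" for y z i j
    using that by (simp add: M(2) var)
  have HL: "(\<Sum>l\<le>n. ?G Ht_gen i l * f l) = of_int (int n - 2 * int i) * f i" for f
    using ij(1) by (subst sum_only[of i]) (auto simp: L_q_mat_def)
  have HR: "(\<Sum>l\<le>n. f l * ?G Ht_gen l j) = f j * of_int (int n - 2 * int j)" for f
    using ij(2) by (subst sum_only[of j]) (auto simp: L_q_mat_def)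
  have two: "?M (2 * y) i j = 2 * ?M y i j" for y by (simp only: mult_2 M(1)[OF ij])
  define c where "c j = q_number r j * q_number r (n - j + 1)" for j
  have EF: "?M (?E * ?F) i j = of_bool (i = j) * (if j < n then c (Suc j) else 0)"
    using raise_lower(1)[OF ij, of c] by (simp add: prod[OF ij] L_q_mat_def c_def)
  have FE: "?M (?F * ?E) i j = of_bool (i = j) * (if j > 0 then c j else 0)"
    using raise_lower(2)[OF ij, of c] by (simp add: prod[OF ij] L_q_mat_def c_def)
  let ?Y = "exact_quot (sinh_series [:0, r:]) (sinh_series [:r:])"
  have "?M (map_fps poly_subst ?Y) i j = of_bool (i = j) * map_fps (\<lambda>p. poly p (of_int (int n - 2 * int j))) ?Y"
    by (rule q_mat_map) (rule fa_mat_poly_subst[OF ij])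
  moreover have "map_fps (\<lambda>p. poly p x) ?Y = sinh_quot id r (r * x)" for x
  proof -
    have c: "rhom (\<lambda>z::complex. [:z:])" by (rule rhomI) (simp_all add: one_pCons)
    have u: "[:r:] * [:1 / r:] = 1" using r by (simp add: one_pCons)
    have "rhom (\<lambda>p. poly p x)" by (rule rhomI) simp_all
    from sinh_quot_map[OF c u this] show ?thesis
      unfolding sinh_series_quot[OF r] by (simp add: id_def mult.commute)
  qed
  ultimately have Y: "?M (map_fps poly_subst ?Y) i j = of_bool (i = j) * sinh_quot id r (r * of_int (int n - 2 * int j))"
    by simp
  have comm: "(if j < n then c (Suc j) else 0) - (if j > 0 then c j else 0) =
      sinh_quot id r (r * of_int (int n - 2 * int j))"
  proof -
    have "(if j < n then c (Suc j) else 0) = q_number r (j + 1) * q_number r (n - j)"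
      using r ij by (auto simp: c_def q_number_0 Suc_diff_Suc)
    moreover have "(if j > 0 then c j else 0) = q_number r j * q_number r (n - j + 1)"
      using r by (auto simp: c_def q_number_0)
    ultimately show ?thesis
      using q_number_comm[OF r, of j "n - j"] ij by (simp add: of_nat_diff)
  qed
  consider "x = ?H * ?E - ?E * ?H - 2 * ?E" | "x = ?H * ?F - ?F * ?H + 2 * ?F" | "x = ?E * ?F - ?F * ?E - map_fps poly_subst ?Y"
    using x by (auto simp: q_relations_def Let_def)
  then show ?thesis
  proof cases
    case 1
    then show ?thesis
      unfolding 1 M(7)[OF ij] two prod[OF ij] HL HR var[OF ij(2)] by (auto simp: L_q_mat_def algebra_simps)
  next
    case 2
    then show ?thesis
      unfolding 2 M(7)[OF ij] M(1)[OF ij] two prod[OF ij] HL HR var[OF ij(2)] by (auto simp: L_q_mat_def algebra_simps)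
  next
    case 3
    then show ?thesis
      unfolding 3 M(7)[OF ij] EF FE Y using comm by (auto simp flip: comm)
  qed
qed

context
  fixes r :: complex and n :: nat
  assumes r: "r \<noteq> 0"
begin

lemma coset_mat_q:
  "i \<le> n \<Longrightarrow> j \<le> n \<Longrightarrow> coset_mat (q_mat n (L_q_mat r n)) (q_ideal r +>\<^bsub>type_alg (map_fps fa_const)\<^esub> x) i j =
    q_mat n (L_q_mat r n) x i j"
  by (rule coset_mat[OF matrep_q_mat[unfolded free_series_eq] two_sided_q_ideal q_mat_q_ideal[OF L_q_relations[OF r]]])

lemma L_q_rep: "alg_module (U_q r) (L_q r n)" "\<exists>\<rho>. L_q r n = (coord_module n)\<lparr>act := \<rho>\<rparr>"
  "v \<in> carrier (L_q r n) \<Longrightarrow> act (L_q r n) (q_gen r x) v = mat_act n (L_q_mat r n x) v"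
proof -
  have gen: "mat_act n (coset_mat (q_mat n (L_q_mat r n)) (q_gen r x)) v = mat_act n (L_q_mat r n x) v" for x v
    unfolding q_gen_eq by (rule mat_act_cong) (simp add: coset_mat_q q_mat_var)
  note R = rep_by_generators_matrep[of "U_q r" n "coset_mat (q_mat n (L_q_mat r n))" "q_gen r" "L_q_gen r n"]
  have 1: "matrep (U_q r) n (coset_mat (q_mat n (L_q_mat r n)))"
    unfolding U_q_eq
    by (rule matrep_quot[OF matrep_q_mat[unfolded free_series_eq] two_sided_q_ideal q_mat_q_ideal[OF L_q_relations[OF r]]])
  have sep: "separated fps_X (coord_module n :: (complex fps, _, qgen free_alg fps set) rep)"
    unfolding coord_module_eq by (rule separated_coord_on_X)
  have T: "L_q_gen r n x v = mat_act n (coset_mat (q_mat n (L_q_mat r n)) (q_gen r x)) v" for x v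
    by (simp add: L_q_gen_mat gen)
  note R = R[OF 1 ring_U_q smult_closed_U_q q_gen_carrier T unique_action_U_q[OF sep], folded L_q_def]
  show "alg_module (U_q r) (L_q r n)" by (rule R(1))
  show "\<exists>\<rho>. L_q r n = (coord_module n)\<lparr>act := \<rho>\<rparr>" by (rule R(2))
  show "act (L_q r n) (q_gen r x) v = mat_act n (L_q_mat r n x) v" if "v \<in> carrier (L_q r n)"
    by (simp add: R(3)[OF _ q_gen_carrier that] gen)
qed

end

section \<open>The representation \<open>L\<^bsup>h,h'\<^esup>(n,g)\<close>\<close>

definition L_hh_mat :: "nat \<Rightarrow> nat \<Rightarrow> gen \<Rightarrow> nat \<Rightarrow> nat \<Rightarrow> complex fps fps" where
  "L_hh_mat g n x i j = (case x of
     H_gen \<Rightarrow> of_bool (i = j) * of_int (int n - 2 * int j)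
   | C_gen \<Rightarrow> of_bool (i = j) * of_nat ((n + 1)\<^sup>2)
   | X_minus \<Rightarrow> of_bool (i = Suc j)
   | X_plus \<Rightarrow> of_bool (j = Suc i) * (QT_number g id (of_nat j) * QT_number g id (of_nat (n - j + 1))))"

lemma L_hh_gen_mat: "L_hh_gen g n x v = mat_act n (L_hh_mat g n x) v"
  unfolding L_hh_gen_def
  by (rule mat_act_lin_ext[symmetric]; cases x) (auto simp: L_hh_mat_def m_vec_def)

text \<open>The value of a polynomial in \<open>H\<close> and \<open>\<surd>C\<close> at \<open>H = x\<close>, \<open>\<surd>C = y\<close>, and the part of it that is even in \<open>\<surd>C\<close>.\<close>

definition pp_eval :: "complex \<Rightarrow> complex \<Rightarrow> complex poly poly \<Rightarrow> complex" where
  "pp_eval x y p = poly (poly p [:y:]) x"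

definition pp_even :: "complex \<Rightarrow> complex \<Rightarrow> complex poly poly \<Rightarrow> complex" where
  "pp_even x y p = (\<Sum>k\<le>Polynomial.degree p. poly (Polynomial.coeff p (2 * k)) x * (y\<^sup>2) ^ k)"

lemma rhom_pp_eval: "rhom (pp_eval x y)"
  by (rule rhomI) (simp_all add: pp_eval_def)

lemma sum_even_only:
  fixes f :: "nat \<Rightarrow> 'a::comm_monoid_add"
  assumes "\<And>k. odd k \<Longrightarrow> f k = 0" "\<And>k. k > d \<Longrightarrow> f k = 0"
  shows "(\<Sum>k\<le>d. f (2 * k)) = (\<Sum>k\<le>d. f k)"
proof -
  have "(\<Sum>k\<le>2 * e. f k) = (\<Sum>k\<le>e. f (2 * k))" for e
    by (induction e) (simp_all add: assms(1))
  moreover have "(\<Sum>k\<le>d. f k) = (\<Sum>k\<le>2 * d. f k)"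
    by (rule sum.mono_neutral_left) (auto simp: assms(2))
  ultimately show ?thesis by simp
qed

lemma pp_eval_even:
  assumes "\<And>k. odd k \<Longrightarrow> Polynomial.coeff p k = 0"
  shows "pp_eval x y p = pp_even x y p"
proof -
  have "pp_eval x y p = (\<Sum>k\<le>Polynomial.degree p. poly (Polynomial.coeff p k) x * y ^ k)"
    by (simp add: pp_eval_def poly_altdef[of p] poly_sum poly_power)
  also have "\<dots> = pp_even x y p"
    unfolding pp_even_def power_mult[symmetric]
    by (rule sum_even_only[symmetric]) (simp_all add: assms coeff_eq_0)
  finally show ?thesis .
qed

lemma fa_mat_even_subst:
  assumes ij: "i \<le> n" "j \<le> n"
  shows "fa_mat n (\<lambda>z. fps_const (fps_const z)) (L_hh_mat g n) (even_subst p) i j =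
    of_bool (i = j) * fps_const (fps_const (pp_even (of_int (int n - 2 * int j)) (of_nat (n + 1)) p))"
proof -
  let ?\<kappa> = "\<lambda>z::complex. fps_const (fps_const z)"
  let ?x = "\<lambda>j. of_int (int n - 2 * int j) :: complex" and ?y = "of_nat (n + 1) :: complex"
  have c: "fa_mat n ?\<kappa> (L_hh_mat g n) (fa_const z) i j = of_bool (i = j) * ?\<kappa> z" for z i j
    by (simp add: fa_mat_const rhom_const2)
  have H: "fa_mat n ?\<kappa> (L_hh_mat g n) (fa_var H_gen) i j = of_bool (i = j) * ?\<kappa> (?x j)" if "j \<le> n" for i j
    using that by (simp only: fa_mat_var[OF rhom_const2] fps_const_of_int) (simp add: L_hh_mat_def)
  have C: "fa_mat n ?\<kappa> (L_hh_mat g n) (fa_var C_gen) i j = of_bool (i = j) * ?\<kappa> (?y\<^sup>2)" if "j \<le> n" for i j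
    using that by (simp only: fa_mat_var[OF rhom_const2]) (simp add: L_hh_mat_def fps_of_nat[symmetric])
  have "fa_mat n ?\<kappa> (L_hh_mat g n) (fa_const z * fa_var H_gen ^ k * fa_var C_gen ^ l) i j =
      of_bool (i = j) * (?\<kappa> z * ?\<kappa> (?x j) ^ k * ?\<kappa> (?y\<^sup>2) ^ l)" for z k l
    by (rule fa_mat_diag_mult[OF rhom_const2 fa_mat_diag_mult[OF rhom_const2]])
      (use ij c fa_mat_diag_power[OF rhom_const2 H] fa_mat_diag_power[OF rhom_const2 C] in auto)
  also have "?\<kappa> z * ?\<kappa> (?x j) ^ k * ?\<kappa> (?y\<^sup>2) ^ l = ?\<kappa> (z * ?x j ^ k * (?y\<^sup>2) ^ l)" for z k l
    by (simp add: fps_const_power)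
  finally have *: "fa_mat n ?\<kappa> (L_hh_mat g n) (fa_const z * fa_var H_gen ^ k * fa_var C_gen ^ l) i j =
      of_bool (i = j) * ?\<kappa> (z * ?x j ^ k * (?y\<^sup>2) ^ l)" for z k l .
  show ?thesis
    unfolding even_subst_def fa_mat_sum[OF rhom_const2] * sum_distrib_left[symmetric] rhomD(7)[OF rhom_const2, symmetric]
    by (simp only: pp_even_def poly_altdef sum_distrib_right)
qed

lemma hh_mat_even_subst:
  assumes "i \<le> n" "j \<le> n" and even: "\<And>b a k. odd k \<Longrightarrow> Polynomial.coeff (f $ b $ a) k = 0"
  shows "hh_mat n (L_hh_mat g n) (map_fps (map_fps even_subst) f) i j =
    of_bool (i = j) * map_fps (map_fps (pp_eval (of_int (int n - 2 * int j)) (of_nat (n + 1)))) f"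
proof -
  have "hh_mat n (L_hh_mat g n) (map_fps (map_fps even_subst) f) i j =
    of_bool (i = j) * map_fps (map_fps (pp_even (of_int (int n - 2 * int j)) (of_nat (n + 1)))) f"
    by (rule hh_mat_map) (rule fa_mat_even_subst[OF assms(1,2)])
  then show ?thesis by (simp add: fps_eq_iff pp_eval_even[OF even])
qed

lemma rhom_pp_const: "rhom pp_const"
  by (rule rhomI) (simp_all add: pp_const_def one_pCons)

text \<open>The substitution \<open>\<surd>C \<mapsto> -\<surd>C\<close>, whose fixed points are the polynomials even in \<open>\<surd>C\<close>.\<close>

definition reflect :: "complex poly poly \<Rightarrow> complex poly poly" where
  "reflect p = pcompose p [:0, -1:]"

lemma rhom_reflect: "rhom reflect"
  by (rule rhomI) (simp_all add: reflect_def pcompose_add pcompose_mult pcompose_1)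

lemma reflect_simps: "reflect (pp_const z) = pp_const z" "reflect pp_H = pp_H" "reflect pp_sqrtC = - pp_sqrtC"
  by (simp_all add: reflect_def pp_const_def pp_H_def pp_sqrtC_def pcompose_const pcompose_pCons)

lemma reflect_even:
  assumes "map_fps (map_fps reflect) f = f" "odd k"
  shows "Polynomial.coeff (f $ b $ a) k = 0"
proof -
  have "reflect (f $ b $ a) = f $ b $ a" using assms(1) by (metis map_fps_nth)
  then have "Polynomial.coeff (pcompose (f $ b $ a) [:0, -1:]) k = Polynomial.coeff (f $ b $ a) k"
    unfolding reflect_def by metis
  then show ?thesis using assms(2) by (simp add: coeff_pcompose_linear)
qed

text \<open>The reflection \<open>\<surd>C \<mapsto> -\<surd>C\<close> exchanges the factors for \<open>e = 1\<close> and \<open>e = -1\<close>, up to a sign in each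
  of them.\<close>

lemma XX_product_even:
  assumes g: "g \<ge> 1" and k: "odd k"
  shows "Polynomial.coeff ((\<Prod>e\<in>{1, -1}. QT_number g pp_const (H_e s e)) $ b $ a) k = 0"
proof -
  let ?f = "\<Prod>e\<in>{1, -1}. QT_number g pp_const (H_e s e)"
  have "reflect (H_e s e) = - H_e s (- e)" for e
    unfolding H_e_def rhomD[OF rhom_reflect] reflect_simps
    by (simp add: rhomD(5)[OF rhom_pp_const] algebra_simps)
  then have "map_fps (map_fps reflect) (QT_number g pp_const (H_e s e)) = - QT_number g pp_const (H_e s (- e))" for e
    by (simp add: QT_number_map[OF rhom_pp_const rhom_reflect] reflect_simps QT_number_minus[OF rhom_pp_const g])
  then have "map_fps (map_fps reflect) ?f = ?f"
    by (simp add: rhom_prod[OF rhom_map_fps[OF rhom_map_fps[OF rhom_reflect]]]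
        rhomD[OF rhom_map_fps[OF rhom_map_fps[OF rhom_reflect]]] mult.commute)
  then show ?thesis using reflect_even k by blast
qed

lemma pp_eval_H_e: "pp_eval x y (H_e s e) = (y + e * x - s * e) / 2"
  by (simp add: H_e_def pp_eval_def pp_const_def pp_H_def pp_sqrtC_def algebra_simps)

text \<open>As \<open>C\<close> acts by \<open>(n+1)\<^sup>2\<close>, a polynomial even in \<open>\<surd>C\<close> acts as its value at \<open>\<surd>C = n + 1\<close>.\<close>

lemma XX_series_mat:
  assumes g: "g \<ge> 1" and ij: "i \<le> n" "j \<le> n"
  shows "hh_mat n (L_hh_mat g n) (XX_series g s) i j =
    of_bool (i = j) * (\<Prod>e\<in>{1, -1}. QT_number g id ((of_nat (n + 1) + e * of_int (int n - 2 * int j) - s * e) / 2))"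
proof -
  let ?\<eta> = "pp_eval (of_int (int n - 2 * int j)) (of_nat (n + 1))"
  have "?\<eta> (pp_const z) = z" for z by (simp add: pp_eval_def pp_const_def)
  then have "(\<lambda>z. ?\<eta> (pp_const z)) = id" by auto
  then have "map_fps (map_fps ?\<eta>) (QT_number g pp_const (H_e s e)) = QT_number g id (?\<eta> (H_e s e))" for e
    by (simp only: QT_number_map[OF rhom_pp_const rhom_pp_eval])
  moreover have "hh_mat n (L_hh_mat g n) (XX_series g s) i j =
      of_bool (i = j) * map_fps (map_fps ?\<eta>) (\<Prod>e\<in>{1, -1}. QT_number g pp_const (H_e s e))"
    unfolding XX_series_def by (rule hh_mat_even_subst[OF ij]) (rule XX_product_even[OF g])
  ultimately show ?thesis
    by (simp only: rhom_prod[OF rhom_map_fps[OF rhom_map_fps[OF rhom_pp_eval]]] pp_eval_H_e)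
qed

text \<open>On \<open>m\<^sub>j\<close> the values of \<open>H\<^sub>e\<^sup>+\<close> are \<open>n - j\<close> and \<open>j + 1\<close>, and those of \<open>H\<^sub>e\<^sup>-\<close> are \<open>n - j + 1\<close> and \<open>j\<close>. So the two products
  prescribed by the relations are those of the coefficients of \<open>X\<^sup>+\<close> at \<open>m\<^sub>j\<^sub>+\<^sub>1\<close> and at \<open>m\<^sub>j\<close>.\<close>

lemma L_hh_relations:
  assumes g: "g \<ge> 1" and x: "x \<in> hh_relations g" and ij: "i \<le> n" "j \<le> n"
  shows "hh_mat n (L_hh_mat g n) x i j = 0"
proof -
  note M = matrep_type_algD[OF matrep_hh_mat[of n "L_hh_mat g n", unfolded free_series2_eq]]
  let ?G = "L_hh_mat g n" and ?M = "hh_mat n (L_hh_mat g n)"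
  let ?E = "hh_var X_plus" and ?F = "hh_var X_minus" and ?H = "hh_var H_gen" and ?C = "hh_var C_gen"
  have var: "?M (hh_var y) i j = ?G y i j" if "j \<le> n" for y i j
    using that by (simp add: hh_var_def hh_mat_var)
  have prod: "?M (hh_var y * hh_var z) i j = (\<Sum>l\<le>n. ?G y i l * ?G z l j)" if "i \<le> n" "j \<le> n" for y z i j
    using that by (simp add: M(2) var)
  have HL: "(\<Sum>l\<le>n. ?G H_gen i l * f l) = of_int (int n - 2 * int i) * f i"
      "(\<Sum>l\<le>n. ?G C_gen i l * f l) = of_nat ((n + 1)\<^sup>2) * f i" for f
    using ij(1) by (subst sum_only[of i]; auto simp: L_hh_mat_def)+
  have HR: "(\<Sum>l\<le>n. f l * ?G H_gen l j) = f j * of_int (int n - 2 * int j)"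
      "(\<Sum>l\<le>n. f l * ?G C_gen l j) = f j * of_nat ((n + 1)\<^sup>2)" for f
    using ij(2) by (subst sum_only[of j]; auto simp: L_hh_mat_def)+
  have two: "?M (2 * y) i j = 2 * ?M y i j" for y by (simp only: mult_2 M(1)[OF ij])
  define c where "c j = QT_number g id (of_nat j) * QT_number g id (of_nat (n - j + 1))" for j
  have EF: "?M (?E * ?F) i j = of_bool (i = j) * (if j < n then c (Suc j) else 0)"
    using raise_lower(1)[OF ij, of c] by (simp add: prod[OF ij] L_hh_mat_def c_def)
  have FE: "?M (?F * ?E) i j = of_bool (i = j) * (if j > 0 then c j else 0)"
    using raise_lower(2)[OF ij, of c] by (simp add: prod[OF ij] L_hh_mat_def c_def)
  have XX1: "?M (XX_series g 1) i j = of_bool (i = j) * (if j < n then c (Suc j) else 0)"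
  proof -
    have "(of_nat (n + 1) + 1 * of_int (int n - 2 * int j) - 1 * 1) / 2 = (of_nat (n - j) :: complex)"
      "(of_nat (n + 1) + (- 1) * of_int (int n - 2 * int j) - 1 * (- 1)) / 2 = (of_nat (Suc j) :: complex)"
      using ij by (simp_all add: of_nat_diff field_simps)
    then have "?M (XX_series g 1) i j = of_bool (i = j) * (QT_number g id (of_nat (n - j)) * QT_number g id (of_nat (Suc j)))"
      unfolding XX_series_mat[OF g ij] by (simp del: of_nat_Suc of_nat_add of_int_diff)
    moreover have "(if j < n then c (Suc j) else 0) = QT_number g id (of_nat (n - j)) * QT_number g id (of_nat (Suc j))"
      using ij QT_number_0[of g] by (auto simp: c_def Suc_diff_Suc mult.commute simp del: of_nat_Suc)
    ultimately show ?thesis by simp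
  qed
  have XX2: "?M (XX_series g (- 1)) i j = of_bool (i = j) * (if j > 0 then c j else 0)"
  proof -
    have "(of_nat (n + 1) + 1 * of_int (int n - 2 * int j) - (- 1) * 1) / 2 = (of_nat (n - j + 1) :: complex)"
      "(of_nat (n + 1) + (- 1) * of_int (int n - 2 * int j) - (- 1) * (- 1)) / 2 = (of_nat j :: complex)"
      using ij by (simp_all add: of_nat_diff field_simps)
    then have "?M (XX_series g (- 1)) i j = of_bool (i = j) * (QT_number g id (of_nat (n - j + 1)) * QT_number g id (of_nat j))"
      unfolding XX_series_mat[OF g ij] by (simp del: of_nat_Suc of_nat_add of_int_diff)
    moreover have "(if j > 0 then c j else 0) = QT_number g id (of_nat (n - j + 1)) * QT_number g id (of_nat j)"
      using ij QT_number_0[of g] by (auto simp: c_def mult.commute)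
    ultimately show ?thesis by simp
  qed
  consider "x = ?C * ?E - ?E * ?C" | "x = ?C * ?F - ?F * ?C" | "x = ?C * ?H - ?H * ?C"
    | "x = ?H * ?E - ?E * ?H - 2 * ?E" | "x = ?H * ?F - ?F * ?H + 2 * ?F"
    | "x = ?E * ?F - XX_series g 1" | "x = ?F * ?E - XX_series g (- 1)"
    using x by (auto simp: hh_relations_def Let_def)
  then show ?thesis
  proof cases
    case 4
    then show ?thesis
      unfolding 4 M(7)[OF ij] two prod[OF ij] HL HR var[OF ij(2)] by (auto simp: L_hh_mat_def algebra_simps)
  next
    case 5
    then show ?thesis
      unfolding 5 M(7)[OF ij] M(1)[OF ij] two prod[OF ij] HL HR var[OF ij(2)] by (auto simp: L_hh_mat_def algebra_simps)
  next
    case 6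
    then show ?thesis unfolding 6 M(7)[OF ij] EF XX1 by simp
  next
    case 7
    then show ?thesis unfolding 7 M(7)[OF ij] FE XX2 by simp
  qed (simp_all only: M(7)[OF ij] prod[OF ij] HL HR, auto simp: L_hh_mat_def mult.commute)
qed

context
  fixes g n :: nat
  assumes g: "g \<ge> 1"
begin

lemma coset_mat_hh:
  "i \<le> n \<Longrightarrow> j \<le> n \<Longrightarrow> coset_mat (hh_mat n (L_hh_mat g n)) (hh_class g x) i j = hh_mat n (L_hh_mat g n) x i j"
  unfolding hh_class_eq
  by (rule coset_mat[OF matrep_hh_mat[unfolded free_series2_eq] two_sided_hh_ideal hh_mat_hh_ideal[OF L_hh_relations[OF g]]])

lemma L_hh_rep: "alg_module (U_hh g) (L_hh n g)" "\<exists>\<rho>. L_hh n g = (coord_module n)\<lparr>act := \<rho>\<rparr>"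
  "v \<in> carrier (L_hh n g) \<Longrightarrow> act (L_hh n g) (hh_class g x) v = mat_act n (hh_mat n (L_hh_mat g n) x) v"
  "v \<in> carrier (L_hh n g) \<Longrightarrow> act (L_hh n g) (hh_gen g y) v = mat_act n (L_hh_mat g n y) v"
proof -
  have cls: "mat_act n (coset_mat (hh_mat n (L_hh_mat g n)) (hh_class g x)) v = mat_act n (hh_mat n (L_hh_mat g n) x) v" for x v
    by (rule mat_act_cong) (simp add: coset_mat_hh)
  have gen: "mat_act n (coset_mat (hh_mat n (L_hh_mat g n)) (hh_gen g x)) v = mat_act n (L_hh_mat g n x) v" for x v
    unfolding hh_gen_eq by (rule mat_act_cong) (simp add: coset_mat_hh hh_mat_var)
  note R = rep_by_generators_matrep[of "U_hh g" n "coset_mat (hh_mat n (L_hh_mat g n))" "hh_gen g" "L_hh_gen g n"]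
  have 1: "matrep (U_hh g) n (coset_mat (hh_mat n (L_hh_mat g n)))"
    unfolding U_hh_eq
    by (rule matrep_quot[OF matrep_hh_mat[unfolded free_series2_eq] two_sided_hh_ideal hh_mat_hh_ideal[OF L_hh_relations[OF g]]])
  let ?C = "coord_module n :: (complex fps fps, _, gen free_alg fps fps set) rep"
  have sep: "separated fps_X ?C" "separated (fps_const fps_X) ?C"
    unfolding coord_module_eq by (rule separated_coord_on_X separated_coord_on_h)+
  have T: "L_hh_gen g n x v = mat_act n (coset_mat (hh_mat n (L_hh_mat g n)) (hh_gen g x)) v" for x v
    by (simp add: L_hh_gen_mat gen)
  note R = R[OF 1 ring_U_hh smult_closed_U_hh hh_gen_carrier T unique_action_U_hh[OF sep], folded L_hh_def]
  show "alg_module (U_hh g) (L_hh n g)" by (rule R(1))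
  show "\<exists>\<rho>. L_hh n g = (coord_module n)\<lparr>act := \<rho>\<rparr>" by (rule R(2))
  have car: "hh_class g x \<in> carrier (U_hh g)" for x by (simp add: carrier_U_hh)
  show "act (L_hh n g) (hh_class g x) v = mat_act n (hh_mat n (L_hh_mat g n) x) v" if "v \<in> carrier (L_hh n g)"
    by (simp add: R(3)[OF _ car that] cls)
  show "act (L_hh n g) (hh_gen g y) v = mat_act n (L_hh_mat g n y) v" if "v \<in> carrier (L_hh n g)"
    by (simp add: R(3)[OF _ hh_gen_carrier that] gen)
qed

end

section \<open>Deformation and indecomposability\<close>

lemma lin_transfer_coord_module: "lin_transfer (coord_on {..n}) ((coord_module n)\<lparr>act := \<rho>\<rparr>) id"
  by (simp add: lin_transfer_def coord_module_eq)

lemma finite_rank_coord_module: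
  assumes "alg_module U V" "V = (coord_module n)\<lparr>act := \<rho>\<rparr>"
  shows "finite_rank_rep U V"
  using is_basis_lin_transfer[OF module_coord_on lin_transfer_coord_module is_basis_coord_on[OF finite_atMost]] assms
  unfolding finite_rank_rep_def by blast

lemma rep_by_generators_cong:
  assumes "\<And>x v. v \<in> carrier V \<Longrightarrow> T x v = T' x v"
  shows "rep_by_generators U \<gamma> V T = rep_by_generators U \<gamma> V T'"
proof -
  have "(\<forall>x. \<forall>v\<in>carrier V. \<rho> (\<gamma> x) v = T x v) \<longleftrightarrow> (\<forall>x. \<forall>v\<in>carrier V. \<rho> (\<gamma> x) v = T' x v)" for \<rho>
    using assms by auto
  then show ?thesis by (simp add: rep_by_generators_def)
qed

lemma carrier_L_hh: "g \<ge> 1 \<Longrightarrow> carrier (L_hh n g) = {f. \<forall>j>n. f j = 0}"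
  using L_hh_rep(2)[of g n] by (auto simp: coord_module_def)

lemma carrier_L_q: "r \<noteq> 0 \<Longrightarrow> carrier (L_q r n) = {f. \<forall>j>n. f j = 0}"
  using L_q_rep(2)[of r n] by (auto simp: coord_module_def)

lemma mod_h'_mat_act: "mod_h' (mat_act n A f) = mat_act n (\<lambda>i j. A i j $ 0) (mod_h' f)"
  by (auto simp: mod_h'_def mat_act_def fun_eq_iff fps_sum_nth)

lemma L_hh_mat_nth_0: "L_hh_mat g n (hh_of_q x) i j $ 0 = L_q_mat 1 n x i j"
  by (cases x) (auto simp: L_hh_mat_def L_q_mat_def QT_number_nth_0 of_bool_def simp flip: fps_of_int[of "int n - 2 * int j"]
      simp del: of_int_diff of_nat_Suc)

text \<open>Modulo \<open>h'\<close> the base \<open>Q T\<^bsup>{a}\<^esup>\<close> becomes \<open>Q\<close>, hence the matrices of the generators reduce to those of \<open>L\<^sup>h(n)\<close>.\<close>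

lemma L_hh_deformation:
  assumes g: "g \<ge> 1"
  shows "is_deformation g (L_hh n g) (L_q 1 n)"
proof -
  let ?V = "L_hh n g"
  let ?T = "\<lambda>x v. THE w. \<exists>f\<in>carrier ?V. mod_h' f = v \<and> w = mod_h' (act ?V (hh_gen g (hh_of_q x)) f)"
  have "mod_h' ` carrier ?V = {f. \<forall>j>n. f j = 0}"
  proof (intro equalityI subsetI)
    fix f :: "nat \<Rightarrow> complex fps" assume "f \<in> {f. \<forall>j>n. f j = 0}"
    then show "f \<in> mod_h' ` carrier ?V"
      by (intro image_eqI[of _ _ "\<lambda>j. fps_const (f j)"]) (auto simp: mod_h'_def carrier_L_hh[OF g])
  qed (auto simp: mod_h'_def carrier_L_hh[OF g])
  then have "lim_h' g ?V = rep_by_generators (U_q 1) (q_gen 1) (coord_module n) ?T"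
    by (simp add: lim_h'_def coord_module_def)
  also have "\<dots> = L_q 1 n"
    unfolding L_q_def
  proof (rule rep_by_generators_cong)
    fix x v assume "v \<in> carrier (coord_module n :: (complex fps, _, qgen free_alg fps set) rep)"
    then have v: "\<forall>j>n. v j = 0" by (simp add: coord_module_def)
    have *: "mod_h' (act ?V (hh_gen g (hh_of_q x)) f) = L_q_gen 1 n x (mod_h' f)" if "f \<in> carrier ?V" for f
      using that by (simp add: L_hh_rep(4)[OF g] mod_h'_mat_act L_hh_mat_nth_0 L_q_gen_mat)
    have "(\<lambda>j. fps_const (v j)) \<in> carrier ?V" "mod_h' (\<lambda>j. fps_const (v j)) = v"
      using v by (auto simp: carrier_L_hh[OF g] mod_h'_def)
    then show "?T x v = L_q_gen 1 n x v"
      by (intro the_equality) (use * in auto)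
  qed
  finally have "lim_h' g ?V = L_q 1 n" .
  moreover have "finite_rank_rep (U_hh g) ?V"
    using L_hh_rep(1,2)[OF g] finite_rank_coord_module by blast
  moreover have "finite_rank_rep (U_q 1) (L_q 1 n)"
    using L_q_rep(1,2)[of 1 n] finite_rank_coord_module by (metis one_neq_zero)
  ultimately show ?thesis by (simp add: is_deformation_def)
qed

lemma L_q_lowering:
  assumes r: "r \<noteq> 0" and v: "v \<in> carrier (L_q r n)"
  shows "act (L_q r n) (q_gen r Xt_minus) v = (\<lambda>i. if 0 < i \<and> i \<le> n then v (i - 1) else 0)"
proof (rule ext)
  fix i
  have "(\<Sum>j\<le>n. of_bool (i = Suc j) * v j) = (if 0 < i then v (i - 1) else 0)" if "i \<le> n"
  proof (cases i)
    case (Suc k)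
    then show ?thesis using that by (subst sum_only[of k]) auto
  qed simp
  then show "act (L_q r n) (q_gen r Xt_minus) v i = (if 0 < i \<and> i \<le> n then v (i - 1) else 0)"
    by (simp add: L_q_rep(3)[OF r v] mat_act_def L_q_mat_def)
qed

text \<open>Two nonzero submodules always meet: for the smallest \<open>k\<close> with \<open>v\<^sub>k \<noteq> 0\<close>, the vector
  \<open>(X\<^sup>-)\<^bsup>n-k\<^esup> v\<close> is \<open>v\<^sub>k m\<^sub>n\<close>, so each of them contains a nonzero multiple of \<open>m\<^sub>n\<close>.\<close>

lemma L_q_submodule_lowest:
  assumes r: "r \<noteq> 0" and A: "A \<subseteq> carrier (L_q r n)" "alg_module (U_q r) ((L_q r n)\<lparr>carrier := A\<rparr>)"
    and a: "a \<in> A" "a \<noteq> (\<lambda>j. 0)"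
  shows "\<exists>c. c \<noteq> 0 \<and> (\<forall>d. (\<lambda>i. if i = n then d * c else 0) \<in> A)"
proof -
  let ?S = "act (L_q r n) (q_gen r Xt_minus)"
  have car: "v \<in> A \<Longrightarrow> \<forall>j>n. v j = 0" for v using A(1) carrier_L_q[OF r] by auto
  have pow: "(?S ^^ m) a \<in> A \<and> (?S ^^ m) a = (\<lambda>i. if m \<le> i \<and> i \<le> n then a (i - m) else 0)" for m
  proof (induction m)
    case 0
    then show ?case using a car[OF a(1)] by (auto simp: fun_eq_iff)
  next
    case (Suc m)
    let ?v = "(?S ^^ m) a"
    have vA: "?v \<in> A" using Suc by blast
    have "?S ?v \<in> A" using alg_moduleD(2)[OF A(2) q_gen_carrier, of ?v Xt_minus] vA by simp
    have veq: "?v = (\<lambda>i. if m \<le> i \<and> i \<le> n then a (i - m) else 0)" using Suc by blast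
    have "?S ?v = (\<lambda>i. if 0 < i \<and> i \<le> n then ?v (i - 1) else 0)"
      using vA A(1) by (intro L_q_lowering[OF r]) auto
    also have "\<dots> = (\<lambda>i. if Suc m \<le> i \<and> i \<le> n then a (i - Suc m) else 0)"
      unfolding veq by (auto simp: fun_eq_iff)
    finally show ?case using \<open>?S ?v \<in> A\<close> by simp
  qed
  define k where "k = (LEAST k. a k \<noteq> 0)"
  have ex: "\<exists>k. a k \<noteq> 0" using a(2) by auto
  have k: "a k \<noteq> 0" unfolding k_def by (rule LeastI_ex[OF ex])
  have k0: "a i = 0" if "i < k" for i
    using not_less_Least[of i "\<lambda>k. a k \<noteq> 0"] that unfolding k_def by blast
  have kn: "k \<le> n"
  proof (rule ccontr)
    assume "\<not> k \<le> n"
    then show False using car[OF a(1)] k by simp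
  qed
  let ?w = "\<lambda>c i. if i = n then c else 0"
  have w: "(?S ^^ (n - k)) a = ?w (a k)"
  proof (rule ext)
    fix i
    have "(?S ^^ (n - k)) a i = (if n - k \<le> i \<and> i \<le> n then a (i - (n - k)) else 0)"
      using pow[of "n - k"] by simp
    then show "(?S ^^ (n - k)) a i = ?w (a k) i" using k0[of "i - (n - k)"] kn by auto
  qed
  have "?w (a k) \<in> A" using pow[of "n - k"] unfolding w by blast
  then have "d \<odot>\<^bsub>L_q r n\<^esub> ?w (a k) \<in> A" for d
    using module_type_smult_closed[OF alg_moduleD(1)[OF A(2)], of _ d] by simp
  moreover have smult: "d \<odot>\<^bsub>L_q r n\<^esub> f = (\<lambda>j. d * f j)" for d f
    using L_q_rep(2)[OF r, of n] by (auto simp: coord_module_def)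
  moreover have "(\<lambda>j. d * ?w (a k) j) = ?w (d * a k)" for d by auto
  ultimately have "?w (d * a k) \<in> A" for d by simp
  then show ?thesis using k by blast
qed

lemma L_q_indecomposable:
  assumes r: "r \<noteq> 0"
  shows "indecomposable (U_q r) (L_q r n)"
proof -
  have zero: "\<zero>\<^bsub>L_q r n\<^esub> = (\<lambda>j. 0)" using L_q_rep(2)[OF r, of n] by (auto simp: coord_module_def)
  have "m_vec 0 \<in> carrier (L_q r n)" "m_vec 0 \<noteq> (\<lambda>j. 0 :: complex fps)"
    by (auto simp: carrier_L_q[OF r] m_vec_def fun_eq_iff)
  then have ne: "carrier (L_q r n) \<noteq> {\<zero>\<^bsub>L_q r n\<^esub>}" unfolding zero by blast
  have "A = {\<zero>\<^bsub>L_q r n\<^esub>} \<or> B = {\<zero>\<^bsub>L_q r n\<^esub>}"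
    if A: "A \<subseteq> carrier (L_q r n)" "alg_module (U_q r) ((L_q r n)\<lparr>carrier := A\<rparr>)"
      and B: "B \<subseteq> carrier (L_q r n)" "alg_module (U_q r) ((L_q r n)\<lparr>carrier := B\<rparr>)"
      and AB: "A \<inter> B = {\<zero>\<^bsub>L_q r n\<^esub>}" for A B
  proof (rule ccontr)
    assume "\<not> (A = {\<zero>\<^bsub>L_q r n\<^esub>} \<or> B = {\<zero>\<^bsub>L_q r n\<^esub>})"
    then obtain a b where ab: "a \<in> A" "a \<noteq> (\<lambda>j. 0)" "b \<in> B" "b \<noteq> (\<lambda>j. 0)"
      using AB unfolding zero by blast
    obtain c d where cd: "c \<noteq> 0" "d \<noteq> 0" "\<And>x. (\<lambda>i. if i = n then x * c else 0) \<in> A"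
      "\<And>x. (\<lambda>i. if i = n then x * d else 0) \<in> B"
      using L_q_submodule_lowest[OF r A ab(1,2)] L_q_submodule_lowest[OF r B ab(3,4)] by blast
    have "(\<lambda>i. if i = n then c * d else 0) \<in> A"
      using cd(3)[of d] unfolding mult.commute[of d c] .
    then have "(\<lambda>i. if i = n then c * d else 0) \<in> A \<inter> B"
      using cd(4)[of c] by simp
    then have "(\<lambda>i. if i = n then c * d else 0) = (\<lambda>j. 0)" unfolding AB zero by simp
    then have "c * d = 0" by (metis (full_types))
    then show False using cd by simp
  qed
  then show ?thesis unfolding indecomposable_def using ne by blast
qed

section \<open>Weight decompositions\<close>

lemma of_int_fps_eq_iff: "(of_int a :: complex fps) = of_int b \<longleftrightarrow> a = b"
  by (simp flip: fps_of_int)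

text \<open>A module with a basis of weight vectors. Its weight spaces are spanned by subsets of the basis.\<close>

locale weight_coords =
  fixes J :: "nat set" and V :: "(complex fps, 'm, 'u) rep" and \<beta> :: "(nat \<Rightarrow> complex fps) \<Rightarrow> 'm"
    and h :: 'u and wt :: "nat \<Rightarrow> int"
  assumes J: "finite J" and tr: "lin_transfer (coord_on J :: (complex fps, nat \<Rightarrow> complex fps, 'u) rep) V \<beta>"
    and H: "\<And>f. f \<in> carrier (coord_on J :: (complex fps, nat \<Rightarrow> complex fps, 'u) rep) \<Longrightarrow> act V h (\<beta> f) = \<beta> (\<lambda>j. of_int (wt j) * f j)"
begin

abbreviation "coords \<equiv> {f :: nat \<Rightarrow> complex fps. \<forall>j. j \<notin> J \<longrightarrow> f j = 0}"

lemmas D = lin_transferD[OF tr, unfolded coord_on_simps]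

lemma abelian_V: "abelian_monoid V"
  by (rule module_abelian_monoid[OF module_lin_transfer[OF module_coord_on tr]])

lemma finsum_V:
  assumes "\<And>a. a \<in> A \<Longrightarrow> f a \<in> coords" "finite A"
  shows "(\<Oplus>\<^bsub>V\<^esub>a\<in>A. \<beta> (f a)) = \<beta> (\<lambda>j. \<Sum>a\<in>A. f a j)"
proof -
  have "(\<Oplus>\<^bsub>V\<^esub>a\<in>A. \<beta> (f a)) = \<beta> (\<Oplus>\<^bsub>coord_on J :: (complex fps, nat \<Rightarrow> complex fps, 'u) rep\<^esub>a\<in>A. f a)"
    by (rule finsum_lin_transfer[OF module_abelian_monoid[OF module_coord_on] abelian_V tr]) (use assms in auto)
  then show ?thesis by (subst (asm) finsum_coord_on) (use assms in auto)
qed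

lemma weight_space_eq: "weight_space V h m = \<beta> ` {f \<in> coords. \<forall>j. f j \<noteq> 0 \<longrightarrow> wt j = m}"
proof -
  have "act V h (\<beta> f) = of_int m \<odot>\<^bsub>V\<^esub> \<beta> f \<longleftrightarrow> (\<forall>j. f j \<noteq> 0 \<longrightarrow> wt j = m)" if f: "f \<in> coords" for f
  proof -
    have "act V h (\<beta> f) = of_int m \<odot>\<^bsub>V\<^esub> \<beta> f \<longleftrightarrow> (\<lambda>j. of_int (wt j) * f j) = (\<lambda>j. of_int m * f j)"
      using f H[of f] D(5)[of f] D(6)[of "\<lambda>j. of_int (wt j) * f j" "\<lambda>j. of_int m * f j"] by simp
    then show ?thesis by (auto simp: fun_eq_iff of_int_fps_eq_iff)
  qed
  then show ?thesis unfolding weight_space_def D(1) by blast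
qed

definition proj :: "int \<Rightarrow> (nat \<Rightarrow> complex fps) \<Rightarrow> nat \<Rightarrow> complex fps" where
  "proj m f = (\<lambda>j. if wt j = m then f j else 0)"

lemma sum_proj:
  assumes "f \<in> coords" "finite S" "\<And>j. f j \<noteq> 0 \<Longrightarrow> wt j \<in> S"
  shows "(\<lambda>j. \<Sum>m\<in>S. proj m f j) = f"
  using assms by (auto simp: proj_def fun_eq_iff)

lemma sum_of_weight_spaces_eq:
  "sum_of_weight_spaces V h M = \<beta> ` {f \<in> coords. \<forall>j. f j \<noteq> 0 \<longrightarrow> wt j \<in> M}"
proof (intro equalityI subsetI)
  fix v assume "v \<in> sum_of_weight_spaces V h M"
  then obtain S F where S: "finite S" "S \<subseteq> M" "\<forall>m\<in>S. F m \<in> weight_space V h m" "v = (\<Oplus>\<^bsub>V\<^esub>m\<in>S. F m)"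
    by (auto simp: sum_of_weight_spaces_def)
  have "\<forall>m\<in>S. \<exists>f. F m = \<beta> f \<and> f \<in> coords \<and> (\<forall>j. f j \<noteq> 0 \<longrightarrow> wt j = m)"
    using S(3) unfolding weight_space_eq by blast
  from bchoice[OF this] obtain G where
    G: "\<And>m. m \<in> S \<Longrightarrow> F m = \<beta> (G m) \<and> G m \<in> coords \<and> (\<forall>j. G m j \<noteq> 0 \<longrightarrow> wt j = m)"
    by blast
  interpret V: abelian_monoid V by (rule abelian_V)
  have "v = (\<Oplus>\<^bsub>V\<^esub>m\<in>S. \<beta> (G m))"
    unfolding S(4) by (rule V.finsum_cong') (use G D(1) in auto)
  also have "\<dots> = \<beta> (\<lambda>j. \<Sum>m\<in>S. G m j)" by (rule finsum_V) (use G S in auto)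
  finally have v: "v = \<beta> (\<lambda>j. \<Sum>m\<in>S. G m j)" .
  have "wt j \<in> M" if "(\<Sum>m\<in>S. G m j) \<noteq> 0" for j
  proof -
    obtain m where "m \<in> S" "G m j \<noteq> 0" using \<open>(\<Sum>m\<in>S. G m j) \<noteq> 0\<close> by (meson sum.neutral)
    then show ?thesis using G S(2) by blast
  qed
  moreover have "(\<lambda>j. \<Sum>m\<in>S. G m j) \<in> coords" using G by (auto intro!: sum.neutral)
  ultimately show "v \<in> \<beta> ` {f \<in> coords. \<forall>j. f j \<noteq> 0 \<longrightarrow> wt j \<in> M}" using v by blast
next
  fix v assume "v \<in> \<beta> ` {f \<in> coords. \<forall>j. f j \<noteq> 0 \<longrightarrow> wt j \<in> M}"
  then obtain f where f: "v = \<beta> f" "f \<in> coords" "\<And>j. f j \<noteq> 0 \<Longrightarrow> wt j \<in> M" by auto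
  let ?S = "wt ` {j \<in> J. f j \<noteq> 0}"
  have "(\<lambda>j. \<Sum>m\<in>?S. proj m f j) = f"
    by (rule sum_proj[OF f(2)]) (use f(2) J in auto)
  moreover have "(\<Oplus>\<^bsub>V\<^esub>m\<in>?S. \<beta> (proj m f)) = \<beta> (\<lambda>j. \<Sum>m\<in>?S. proj m f j)"
    by (rule finsum_V) (use f(2) J in \<open>auto simp: proj_def\<close>)
  ultimately have "v = (\<Oplus>\<^bsub>V\<^esub>m\<in>?S. \<beta> (proj m f))" using f(1) by simp
  moreover have "\<beta> (proj m f) \<in> weight_space V h m" for m
    unfolding weight_space_eq using f(2) by (intro imageI) (auto simp: proj_def)
  ultimately show "v \<in> sum_of_weight_spaces V h M"
    unfolding sum_of_weight_spaces_def using f(3) J by (intro CollectI exI[of _ ?S] exI[of _ "\<lambda>m. \<beta> (proj m f)"]) auto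
qed

lemma weight_moduleI:
  assumes "alg_module U V"
  shows "weight_module U h V"
  unfolding weight_module_def
proof (intro conjI ballI)
  fix v assume "v \<in> carrier V"
  then obtain c where c: "v = \<beta> c" "c \<in> coords" using D(1) by auto
  interpret V: abelian_monoid V by (rule abelian_V)
  have z: "\<zero>\<^bsub>V\<^esub> = \<beta> (\<lambda>j. 0)" by (rule D(3))
  have eq0: "\<beta> f = \<zero>\<^bsub>V\<^esub> \<longleftrightarrow> f = (\<lambda>j. 0)" if "f \<in> coords" for f
    unfolding z by (rule D(6)) (use that in auto)
  have pc: "proj m c \<in> coords" for m using c by (auto simp: proj_def)
  show "\<exists>!f. (\<forall>m. f m \<in> weight_space V h m) \<and> finite {m. f m \<noteq> \<zero>\<^bsub>V\<^esub>} \<and> v = (\<Oplus>\<^bsub>V\<^esub>m\<in>{m. f m \<noteq> \<zero>\<^bsub>V\<^esub>}. f m)"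
  proof (rule ex1I[of _ "\<lambda>m. \<beta> (proj m c)"])
    let ?S = "{m. \<beta> (proj m c) \<noteq> \<zero>\<^bsub>V\<^esub>}"
    have nz: "wt j \<in> ?S" if "c j \<noteq> 0" for j
      using that unfolding eq0[OF pc] mem_Collect_eq by (auto simp: proj_def fun_eq_iff)
    have "?S \<subseteq> wt ` J" unfolding eq0[OF pc] using c(2) by (auto simp: proj_def fun_eq_iff split: if_splits)
    then have fin: "finite ?S" using J finite_subset by blast
    have "(\<Oplus>\<^bsub>V\<^esub>m\<in>?S. \<beta> (proj m c)) = \<beta> (\<lambda>j. \<Sum>m\<in>?S. proj m c j)"
      by (rule finsum_V[OF pc fin])
    also have "(\<lambda>j. \<Sum>m\<in>?S. proj m c j) = c" by (rule sum_proj[OF c(2) fin nz])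
    finally have "v = (\<Oplus>\<^bsub>V\<^esub>m\<in>?S. \<beta> (proj m c))" using c by simp
    moreover have "\<beta> (proj m c) \<in> weight_space V h m" for m
      unfolding weight_space_eq using pc by (intro imageI) (auto simp: proj_def)
    ultimately show "(\<forall>m. \<beta> (proj m c) \<in> weight_space V h m) \<and> finite ?S \<and> v = (\<Oplus>\<^bsub>V\<^esub>m\<in>?S. \<beta> (proj m c))"
      using fin by blast
  next
    fix F assume F: "(\<forall>m. F m \<in> weight_space V h m) \<and> finite {m. F m \<noteq> \<zero>\<^bsub>V\<^esub>} \<and> v = (\<Oplus>\<^bsub>V\<^esub>m\<in>{m. F m \<noteq> \<zero>\<^bsub>V\<^esub>}. F m)"
    let ?S = "{m. F m \<noteq> \<zero>\<^bsub>V\<^esub>}"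
    have "\<forall>m. \<exists>f. F m = \<beta> f \<and> f \<in> coords \<and> (\<forall>j. f j \<noteq> 0 \<longrightarrow> wt j = m)"
      using F unfolding weight_space_eq by blast
    from choice[OF this] obtain G where
      "\<forall>m. F m = \<beta> (G m) \<and> G m \<in> coords \<and> (\<forall>j. G m j \<noteq> 0 \<longrightarrow> wt j = m)" ..
    then have G: "\<And>m. F m = \<beta> (G m)" "\<And>m. G m \<in> coords" "\<And>m j. G m j \<noteq> 0 \<Longrightarrow> wt j = m"
      by auto
    have S: "m \<in> ?S \<longleftrightarrow> G m \<noteq> (\<lambda>j. 0)" for m using eq0[OF G(2)] G(1) by simp
    have "v = (\<Oplus>\<^bsub>V\<^esub>m\<in>?S. F m)" using F by blast
    also have "\<dots> = (\<Oplus>\<^bsub>V\<^esub>m\<in>?S. \<beta> (G m))" by (simp only: G(1))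
    also have "\<dots> = \<beta> (\<lambda>j. \<Sum>m\<in>?S. G m j)" by (rule finsum_V) (use G F in auto)
    finally have "\<beta> c = \<beta> (\<lambda>j. \<Sum>m\<in>?S. G m j)" using c by simp
    then have ceq: "c = (\<lambda>j. \<Sum>m\<in>?S. G m j)"
      by (subst (asm) D(6)) (use c G(2) in \<open>auto intro!: sum.neutral\<close>)
    have "G m = proj m c" for m
    proof (rule ext)
      fix j
      have "(\<Sum>m'\<in>?S. G m' j) = (\<Sum>m'\<in>?S. if m' = wt j then G (wt j) j else 0)"
        using G(3) by (intro sum.cong) auto
      also have "\<dots> = G (wt j) j"
      proof (cases "wt j \<in> ?S")
        case False
        then have "G (wt j) = (\<lambda>j. 0)" using S[of "wt j"] by blast
        then have "G (wt j) j = 0" by (rule fun_cong)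
        then show ?thesis by (simp cong: if_cong)
      qed (use F in simp)
      finally have "c j = G (wt j) j" unfolding ceq .
      then show "G m j = proj m c j" using G(3)[of m j] by (auto simp: proj_def)
    qed
    then show "F = (\<lambda>m. \<beta> (proj m c))" using G(1) by auto
  qed
qed (rule assms)

end

lemma module_rank_line:
  fixes W :: "(complex fps, 'm, 'c) module_scheme"
  assumes tr: "lin_transfer (coord_on {j0} :: (complex fps, nat \<Rightarrow> complex fps, 'u) rep) W \<beta>"
  shows "module_rank W = 1"
  unfolding module_rank_def
proof (rule the_equality)
  have "is_basis W (\<beta> ` m_vec ` {j0})"
    by (rule is_basis_lin_transfer[OF module_coord_on tr is_basis_coord_on]) simp
  then show "\<exists>B. is_basis W B \<and> card B = 1" by (intro exI[of _ "\<beta> ` m_vec ` {j0}"]) simp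
next
  fix r assume "\<exists>B. is_basis W B \<and> card B = r"
  then obtain B where B: "is_basis W B" "card B = r" by blast
  note D = lin_transferD[OF tr, unfolded coord_on_simps]
  have mW: "module (ring_of_type_algebra :: complex fps ring) W" by (rule module_lin_transfer[OF module_coord_on tr])
  interpret W: abelian_monoid W by (rule module_abelian_monoid[OF mW])
  have fin: "finite B" and sub: "B \<subseteq> carrier W" using B(1) by (auto simp: is_basis_def)
  have "\<forall>b\<in>B. \<exists>y. (\<forall>j. j \<notin> {j0} \<longrightarrow> y j = 0) \<and> b = \<beta> y" using sub D(1) by auto
  then obtain y where y: "\<And>b. b \<in> B \<Longrightarrow> (\<forall>j. j \<notin> {j0} \<longrightarrow> y b j = 0) \<and> b = \<beta> (y b)" by metis
  have sum: "(\<Oplus>\<^bsub>W\<^esub>b\<in>B. c b \<odot>\<^bsub>W\<^esub> b) = \<beta> (\<lambda>j. \<Sum>b\<in>B. c b * y b j)" for c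
  proof -
    have "(\<Oplus>\<^bsub>W\<^esub>b\<in>B. c b \<odot>\<^bsub>W\<^esub> b) = (\<Oplus>\<^bsub>W\<^esub>b\<in>B. \<beta> (\<lambda>j. c b * y b j))"
    proof (rule W.finsum_cong')
      fix b assume b: "b \<in> B"
      have "c b \<odot>\<^bsub>W\<^esub> b = c b \<odot>\<^bsub>W\<^esub> \<beta> (y b)" using y[OF b] by simp
      also have "\<dots> = \<beta> (\<lambda>j. c b * y b j)" by (rule D(5)) (use y[OF b] in auto)
      finally show "c b \<odot>\<^bsub>W\<^esub> b = \<beta> (\<lambda>j. c b * y b j)" .
    qed (use y D(1) in auto)
    also have "\<dots> = \<beta> (\<Oplus>\<^bsub>coord_on {j0} :: (complex fps, nat \<Rightarrow> complex fps, 'u) rep\<^esub>b\<in>B. (\<lambda>j. c b * y b j))"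
      by (rule finsum_lin_transfer[OF module_abelian_monoid[OF module_coord_on] W.abelian_monoid_axioms tr]) (use y in auto)
    finally show ?thesis by (subst (asm) finsum_coord_on) (use y fin in auto)
  qed
  have "B \<noteq> {}"
  proof
    assume "B = {}"
    moreover have "\<beta> (m_vec j0) \<in> carrier W" using D(1) by (auto simp: m_vec_def)
    ultimately have "\<beta> (m_vec j0) = \<beta> (\<lambda>j. 0)"
      using B(1) unfolding is_basis_def by (auto simp: D(3))
    then have "m_vec j0 = (\<lambda>j. 0 :: complex fps)"
      by (subst (asm) D(6)) (auto simp: m_vec_def)
    then have "m_vec j0 j0 = (0 :: complex fps)" by (rule fun_cong)
    then show False by (simp add: m_vec_def)
  qed
  moreover have "b1 = b2" if b: "b1 \<in> B" "b2 \<in> B" for b1 b2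
  proof (rule ccontr)
    assume ne: "b1 \<noteq> b2"
    define c where "c = (\<lambda>b\<in>B. if b = b1 then y b2 j0 else if b = b2 then - y b1 j0 else 0)"
    have "(\<Sum>b\<in>B. c b * y b j) = (\<Sum>b\<in>{b1, b2}. c b * y b j)" for j
      by (rule sum.mono_neutral_right) (use fin b in \<open>auto simp: c_def\<close>)
    moreover have "(\<Sum>b\<in>{b1, b2}. c b * y b j) = 0" for j
      using ne b y[OF b(1), THEN conjunct1] y[OF b(2), THEN conjunct1]
      by (cases "j = j0") (simp_all add: c_def)
    ultimately have "(\<lambda>j. \<Sum>b\<in>B. c b * y b j) = (\<lambda>j. 0)" by simp
    then have 1: "c \<in> extensional B \<and> \<zero>\<^bsub>W\<^esub> = (\<Oplus>\<^bsub>W\<^esub>b\<in>B. c b \<odot>\<^bsub>W\<^esub> b)"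
      by (simp add: sum D(3)) (simp add: c_def)
    have 2: "(\<lambda>b\<in>B. 0) \<in> extensional B \<and> \<zero>\<^bsub>W\<^esub> = (\<Oplus>\<^bsub>W\<^esub>b\<in>B. (\<lambda>b\<in>B. 0) b \<odot>\<^bsub>W\<^esub> b)"
      unfolding sum by (simp add: D(3))
    have "\<exists>!c. c \<in> extensional B \<and> \<zero>\<^bsub>W\<^esub> = (\<Oplus>\<^bsub>W\<^esub>b\<in>B. c b \<odot>\<^bsub>W\<^esub> b)"
      using B(1) unfolding is_basis_def by simp
    then obtain d where "\<And>c. c \<in> extensional B \<and> \<zero>\<^bsub>W\<^esub> = (\<Oplus>\<^bsub>W\<^esub>b\<in>B. c b \<odot>\<^bsub>W\<^esub> b) \<Longrightarrow> c = d"
      by (elim ex1E) blast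
    from this[OF 1] this[OF 2] have "c = (\<lambda>b\<in>B. 0)" by simp
    then have "c b1 = 0" "c b2 = 0" using b by simp_all
    then have y0: "y b1 j0 = 0" "y b2 j0 = 0" using b ne by (simp_all add: c_def)
    have "y b1 = y b2"
    proof (rule ext)
      fix j show "y b1 j = y b2 j"
        using y0 y[OF b(1), THEN conjunct1] y[OF b(2), THEN conjunct1] by (cases "j = j0") simp_all
    qed
    moreover have "b1 = \<beta> (y b1)" "b2 = \<beta> (y b2)" using y b by blast+
    ultimately show False using ne by metis
  qed
  ultimately have "\<exists>b. B = {b}" by blast
  then show "r = 1" using B(2) by auto
qed

text \<open>Distinct basis vectors have distinct weights, so every nonzero weight space has rank one.\<close>

lemma chi_coords:
  fixes V :: "(complex fps, 'm, qgen free_alg fps set) rep"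
  assumes "weight_coords J V \<beta> (q_gen r Ht_gen) wt" and inj: "inj_on wt J"
  shows "chi r V = (\<Sum>j\<in>J. Poly_Mapping.single (wt j) 1)"
proof -
  interpret weight_coords J V \<beta> "q_gen r Ht_gen" wt by fact
  let ?W = "weight_space V (q_gen r Ht_gen)"
  have line: "?W (wt j) = \<beta> ` {f. \<forall>i. i \<notin> {j} \<longrightarrow> f i = 0}" if j: "j \<in> J" for j
    unfolding weight_space_eq
    by (rule arg_cong[of _ _ "\<lambda>A. \<beta> ` A"]) (use inj j in \<open>auto simp: inj_on_def\<close>)
  have rank: "module_rank (V\<lparr>carrier := ?W (wt j)\<rparr>) = 1" if j: "j \<in> J" for j
  proof (rule module_rank_line)
    have sub: "{f. \<forall>i. i \<notin> {j} \<longrightarrow> f i = 0} \<subseteq> coords" using j by auto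
    show "lin_transfer (coord_on {j} :: (complex fps, nat \<Rightarrow> complex fps, unit) rep) (V\<lparr>carrier := ?W (wt j)\<rparr>) \<beta>"
      unfolding lin_transfer_def coord_on_simps
    proof (intro conjI ballI allI)
      show "bij_betw \<beta> {f. \<forall>i. i \<notin> {j} \<longrightarrow> f i = 0} (carrier (V\<lparr>carrier := ?W (wt j)\<rparr>))"
        using inj_on_subset[OF D(2) sub] line[OF j] by (simp add: bij_betw_def)
    qed (use D(3) D(4)[OF subsetD[OF sub] subsetD[OF sub]] D(5)[OF subsetD[OF sub]] in simp_all)
  qed
  have "{m. ?W m \<noteq> {\<zero>\<^bsub>V\<^esub>}} = wt ` J"
  proof (intro equalityI subsetI)
    fix m assume "m \<in> wt ` J"
    then obtain j where j: "j \<in> J" "m = wt j" by auto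
    have "\<beta> (m_vec j) \<in> ?W (wt j)" unfolding line[OF j(1)] by (auto simp: m_vec_def)
    moreover have "\<beta> (m_vec j) \<noteq> \<zero>\<^bsub>V\<^esub>"
      unfolding D(3) using j by (subst D(6)) (auto simp: m_vec_def fun_eq_iff)
    ultimately show "m \<in> {m. ?W m \<noteq> {\<zero>\<^bsub>V\<^esub>}}" using j by auto
  next
    fix m assume m: "m \<in> {m. ?W m \<noteq> {\<zero>\<^bsub>V\<^esub>}}"
    show "m \<in> wt ` J"
    proof (rule ccontr)
      assume "m \<notin> wt ` J"
      then have "{f \<in> coords. \<forall>j. f j \<noteq> 0 \<longrightarrow> wt j = m} = {\<lambda>j. 0}" by auto
      then show False using m unfolding weight_space_eq by (simp add: D(3))
    qed
  qed
  then have "chi r V = (\<Sum>m\<in>wt ` J. Poly_Mapping.single m (int (module_rank (V\<lparr>carrier := ?W m\<rparr>))))"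
    by (simp add: chi_def)
  also have "\<dots> = (\<Sum>j\<in>J. Poly_Mapping.single (wt j) 1)"
    by (subst sum.reindex[OF inj]) (simp add: rank)
  finally show ?thesis .
qed

lemma Pi_g_sum:
  assumes J: "finite J" and inj: "inj_on wt J"
  shows "Pi_g g (\<Sum>j\<in>J. Poly_Mapping.single (wt j) 1) =
    (\<Sum>j\<in>{j \<in> J. int g dvd wt j}. Poly_Mapping.single (wt j div int g) 1)"
proof -
  let ?f = "\<Sum>j\<in>J. Poly_Mapping.single (wt j) (1::int)"
  let ?t = "\<lambda>m. if int g dvd m then Poly_Mapping.single (m div int g) (Poly_Mapping.lookup ?f m) else 0"
  have look: "Poly_Mapping.lookup ?f m = (\<Sum>j\<in>J. if wt j = m then 1 else 0)" for m
    by (auto simp: lookup_sum lookup_single when_def intro!: sum.cong)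
  have one: "Poly_Mapping.lookup ?f (wt j) = 1" if "j \<in> J" for j
  proof -
    have "(\<Sum>i\<in>J. if wt i = wt j then 1 else 0) = (\<Sum>i\<in>J. if i = j then 1 else (0::int))"
      using that inj by (intro sum.cong) (auto simp: inj_on_def)
    then show ?thesis using look that J by simp
  qed
  have "Poly_Mapping.keys ?f \<subseteq> wt ` J"
  proof
    fix m assume "m \<in> Poly_Mapping.keys ?f"
    then have "(\<Sum>j\<in>J. if wt j = m then 1 else (0::int)) \<noteq> 0" by (simp add: in_keys_iff look)
    then obtain j where "j \<in> J" "(if wt j = m then 1 else (0::int)) \<noteq> 0"
      using sum.not_neutral_contains_not_neutral by blast
    then show "m \<in> wt ` J" by (auto split: if_splits)
  qed
  then have "Pi_g g ?f = (\<Sum>m\<in>wt ` J. ?t m)"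
    unfolding Pi_g_def by (intro sum.mono_neutral_left) (use J in \<open>auto simp: in_keys_iff\<close>)
  also have "\<dots> = (\<Sum>j\<in>J. if int g dvd wt j then Poly_Mapping.single (wt j div int g) 1 else 0)"
    by (subst sum.reindex[OF inj]) (simp add: one cong: if_cong)
  also have "\<dots> = (\<Sum>j\<in>{j \<in> J. int g dvd wt j}. Poly_Mapping.single (wt j div int g) 1)"
    using J by (intro sum.inter_filter[symmetric])
  finally show ?thesis .
qed

lemma chi_L_q:
  assumes r: "r \<noteq> 0"
  shows "chi r (L_q r n) = (\<Sum>j\<le>n. Poly_Mapping.single (int n - 2 * int j) 1)"
proof (rule chi_coords)
  obtain \<rho> where "L_q r n = (coord_module n)\<lparr>act := \<rho>\<rparr>" using L_q_rep(2)[OF r] by blast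
  then have tr: "lin_transfer (coord_on {..n}) (L_q r n) id" by (metis lin_transfer_coord_module)
  show "weight_coords {..n} (L_q r n) id (q_gen r Ht_gen) (\<lambda>j. int n - 2 * int j)"
  proof
    fix f assume "f \<in> carrier (coord_on {..n} :: (complex fps, _, qgen free_alg fps set) rep)"
    then have f: "\<forall>j>n. f j = 0" by auto
    show "act (L_q r n) (q_gen r Ht_gen) (id f) = id (\<lambda>j. of_int (int n - 2 * int j) * f j)"
    proof (rule ext)
      fix i
      have "(\<Sum>j\<le>n. L_q_mat r n Ht_gen i j * f j) = of_int (int n - 2 * int i) * f i" if "i \<le> n"
        using that by (subst sum_only[of i]) (auto simp: L_q_mat_def)
      then show "act (L_q r n) (q_gen r Ht_gen) (id f) i = id (\<lambda>j. of_int (int n - 2 * int j) * f j) i"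
        using f by (simp add: L_q_rep(3)[OF r] carrier_L_q[OF r] mat_act_def del: of_int_diff)
    qed
  qed (use tr in simp_all)
  show "inj_on (\<lambda>j. int n - 2 * int j) {..n}" by (auto simp: inj_on_def)
qed

section \<open>Laurent polynomials in \<open>Q\<close>\<close>

definition poly_exp :: "complex poly \<Rightarrow> complex fps" where
  "poly_exp p = poly (map_poly fps_const p) (fps_exp 1)"

lemma poly_exp_0 [simp]: "poly_exp 0 = 0"
  by (simp add: poly_exp_def)

lemma poly_exp_pCons: "poly_exp (pCons a p) = fps_const a + fps_exp 1 * poly_exp p"
  by (simp add: poly_exp_def map_poly_pCons)

lemma poly_exp_add: "poly_exp (p + q) = poly_exp p + poly_exp q"
  by (induction p q rule: poly_induct2) (simp_all add: poly_exp_pCons algebra_simps flip: fps_const_add)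

lemma poly_exp_smult: "poly_exp (smult a p) = fps_const a * poly_exp p"
  by (induction p) (simp_all add: poly_exp_pCons algebra_simps flip: fps_const_mult)

lemma poly_exp_mult: "poly_exp (p * q) = poly_exp p * poly_exp q"
  by (induction p) (simp_all add: poly_exp_pCons poly_exp_add poly_exp_smult algebra_simps)

lemma poly_exp_monom: "poly_exp (Polynomial.monom c k) = fps_const c * fps_exp (of_nat k)"
  by (induction k) (simp_all add: monom_0 monom_Suc poly_exp_pCons fps_exp_add_mult mult_ac)

lemma poly_exp_sum: "poly_exp p = (\<Sum>i\<le>Polynomial.degree p. fps_const (Polynomial.coeff p i) * fps_exp (of_nat i))"
proof -
  have "poly_exp p = poly_exp (\<Sum>i\<le>Polynomial.degree p. Polynomial.monom (Polynomial.coeff p i) i)"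
    by (simp add: poly_as_sum_of_monoms)
  also have "\<dots> = (\<Sum>i\<le>Polynomial.degree p. poly_exp (Polynomial.monom (Polynomial.coeff p i) i))"
    by (rule additive_sum) (rule poly_exp_add)
  finally show ?thesis by (simp add: poly_exp_monom)
qed

text \<open>Clearing denominators reduces questions about \<open>\<A>\<close> to polynomials in \<open>Q\<close>.\<close>

lemma A_ring_iff: "f \<in> A_ring \<longleftrightarrow> (\<exists>m p. f = fps_exp (- of_nat m) * poly_exp p)"
proof
  assume "f \<in> A_ring"
  then obtain S c where "finite S" and f: "f = (\<Sum>k\<in>S. fps_const (c k) * fps_exp (of_int k))"
    by (auto simp: A_ring_def)
  show "\<exists>m p. f = fps_exp (- of_nat m) * poly_exp p"
    unfolding f using \<open>finite S\<close>
  proof (induction S rule: finite_induct)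
    case empty
    show ?case by (intro exI[of _ 0]) simp
  next
    case (insert k S)
    then obtain m p where *: "(\<Sum>k\<in>S. fps_const (c k) * fps_exp (of_int k)) = fps_exp (- of_nat m) * poly_exp p"
      by blast
    let ?i = "nat k" and ?j = "nat (- k)"
    have k: "of_int k = of_nat ?i - (of_nat ?j :: complex)" by (cases "k \<ge> 0") simp_all
    have "fps_const (c k) * fps_exp (of_int k) = fps_exp (- of_nat ?j) * poly_exp (Polynomial.monom (c k) ?i)"
      unfolding k by (simp add: poly_exp_monom mult_ac flip: fps_exp_add_mult)
    also have "\<dots> = fps_exp (- of_nat (?j + m)) * poly_exp (Polynomial.monom (c k) ?i * Polynomial.monom 1 m)"
      unfolding poly_exp_mult poly_exp_monom[of 1] by (simp add: mult_ac flip: fps_exp_add_mult)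
    finally have 1: "fps_const (c k) * fps_exp (of_int k) =
        fps_exp (- of_nat (?j + m)) * poly_exp (Polynomial.monom (c k) ?i * Polynomial.monom 1 m)" .
    have 2: "fps_exp (- of_nat m) * poly_exp p = fps_exp (- of_nat (?j + m)) * poly_exp (p * Polynomial.monom 1 ?j)"
      unfolding poly_exp_mult poly_exp_monom[of 1] by (simp add: mult_ac flip: fps_exp_add_mult)
    show ?case
      unfolding sum.insert[OF insert(1,2)] * 1 2
      by (intro exI[of _ "?j + m"]
            exI[of _ "Polynomial.monom (c k) ?i * Polynomial.monom 1 m + p * Polynomial.monom 1 ?j"])
        (simp only: poly_exp_add distrib_left)
  qed
next
  assume "\<exists>m p. f = fps_exp (- of_nat m) * poly_exp p"
  then obtain m p where f: "f = fps_exp (- of_nat m) * poly_exp p" by blast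
  let ?h = "\<lambda>i. int i - int m"
  have inj: "inj_on ?h {..Polynomial.degree p}" by (auto simp: inj_on_def)
  have "f = (\<Sum>i\<le>Polynomial.degree p. fps_const (Polynomial.coeff p i) * fps_exp (of_int (?h i)))"
    unfolding f poly_exp_sum sum_distrib_left
    by (intro sum.cong refl) (simp add: mult_ac flip: fps_exp_add_mult)
  also have "\<dots> = (\<Sum>k\<in>?h ` {..Polynomial.degree p}. fps_const (Polynomial.coeff p (nat (k + int m))) * fps_exp (of_int k))"
    by (subst sum.reindex[OF inj]) simp
  finally show "f \<in> A_ring"
    unfolding A_ring_def
    by (intro CollectI exI[of _ "?h ` {..Polynomial.degree p}"]
        exI[of _ "\<lambda>k. Polynomial.coeff p (nat (k + int m))"] conjI) simp_all
qed

lemma poly_exp_A_ring: "poly_exp p \<in> A_ring"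
  unfolding A_ring_iff by (intro exI[of _ 0] exI[of _ p]) simp

lemma fps_const_A_ring: "fps_const c \<in> A_ring"
  using poly_exp_A_ring[of "[:c:]"] by (simp add: poly_exp_pCons)

lemma A_ring_0: "0 \<in> A_ring" and A_ring_1: "1 \<in> A_ring"
  using fps_const_A_ring[of 0] fps_const_A_ring[of 1] by simp_all

lemma fps_exp_A_ring: "fps_exp (of_int k) \<in> A_ring"
  unfolding A_ring_def by (intro CollectI exI[of _ "{k}"] exI[of _ "\<lambda>_. 1"]) simp

lemma A_ring_add:
  assumes "f \<in> A_ring" "f' \<in> A_ring"
  shows "f + f' \<in> A_ring"
proof -
  obtain m p m' p' where f: "f = fps_exp (- of_nat m) * poly_exp p" "f' = fps_exp (- of_nat m') * poly_exp p'"
    using assms unfolding A_ring_iff by blast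
  have "f + f' = fps_exp (- of_nat (m + m')) *
      poly_exp (p * Polynomial.monom 1 m' + p' * Polynomial.monom 1 m)"
    unfolding f poly_exp_add poly_exp_mult poly_exp_monom distrib_left
    by (simp add: mult_ac flip: fps_exp_add_mult)
  then show ?thesis unfolding A_ring_iff by blast
qed

lemma A_ring_mult:
  assumes "f \<in> A_ring" "f' \<in> A_ring"
  shows "f * f' \<in> A_ring"
proof -
  obtain m p m' p' where f: "f = fps_exp (- of_nat m) * poly_exp p" "f' = fps_exp (- of_nat m') * poly_exp p'"
    using assms unfolding A_ring_iff by blast
  have "f * f' = (fps_exp (- of_nat m) * fps_exp (- of_nat m')) * (poly_exp p * poly_exp p')"
    unfolding f by (simp only: mult_ac)
  also have "fps_exp (- of_nat m) * fps_exp (- of_nat m') = fps_exp (- of_nat (m + m') :: complex)"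
    by (simp flip: fps_exp_add_mult)
  finally show ?thesis unfolding A_ring_iff poly_exp_mult[symmetric] by blast
qed

lemma A_ring_sum: "(\<And>s. s \<in> S \<Longrightarrow> f s \<in> A_ring) \<Longrightarrow> sum f S \<in> A_ring"
  by (induction S rule: infinite_finite_induct) (simp_all add: A_ring_0 A_ring_add)

lemma A_ring_prod: "(\<And>s. s \<in> S \<Longrightarrow> f s \<in> A_ring) \<Longrightarrow> prod f S \<in> A_ring"
  by (induction S rule: infinite_finite_induct) (simp_all add: A_ring_1 A_ring_mult)

lemma A_ring_power: "f \<in> A_ring \<Longrightarrow> f ^ k \<in> A_ring"
  by (induction k) (simp_all add: A_ring_1 A_ring_mult)

lemma A_ring_diff: "f \<in> A_ring \<Longrightarrow> f' \<in> A_ring \<Longrightarrow> f - f' \<in> A_ring"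
  using A_ring_add[of f "fps_const (- 1) * f'"] A_ring_mult[OF fps_const_A_ring, of f' "- 1"]
  by (simp flip: fps_const_neg)

text \<open>An element of \<open>\<A>\<close> is the expansion of an entire function of \<open>h\<close>, so specialization at \<open>Q = \<epsilon>\<close> can be
  defined as evaluation at \<open>h = i\<pi>/g\<close>.\<close>

definition ev :: "nat \<Rightarrow> complex fps \<Rightarrow> complex" where
  "ev g f = eval_fps f (\<i> * of_real pi / of_nat g)"

lemma A_ring_entire: "f \<in> A_ring \<Longrightarrow> fps_conv_radius f = \<infinity>"
proof -
  have add: "fps_conv_radius (a + b) = \<infinity>" if "fps_conv_radius a = \<infinity>" "fps_conv_radius b = \<infinity>" for a b :: "complex fps"
    using fps_conv_radius_add[of a b] that by simp
  have mult: "fps_conv_radius (a * b) = \<infinity>" if "fps_conv_radius a = \<infinity>" "fps_conv_radius b = \<infinity>" for a b :: "complex fps"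
    using fps_conv_radius_mult[of a b] that by simp
  have "fps_conv_radius (poly_exp p) = \<infinity>" for p
    by (induction p) (simp_all add: poly_exp_pCons add mult)
  then show "f \<in> A_ring \<Longrightarrow> fps_conv_radius f = \<infinity>"
    unfolding A_ring_iff by (auto intro!: mult)
qed

lemma ev_add: "f \<in> A_ring \<Longrightarrow> f' \<in> A_ring \<Longrightarrow> ev g (f + f') = ev g f + ev g f'"
  unfolding ev_def by (rule eval_fps_add) (simp_all add: A_ring_entire)

lemma ev_mult: "f \<in> A_ring \<Longrightarrow> f' \<in> A_ring \<Longrightarrow> ev g (f * f') = ev g f * ev g f'"
  unfolding ev_def by (rule eval_fps_mult) (simp_all add: A_ring_entire)

lemma ev_simps [simp]: "ev g (fps_const c) = c" "ev g 0 = 0" "ev g 1 = 1"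
  by (simp_all add: ev_def)

lemma ev_exp: "ev g (fps_exp c) = exp (c * (\<i> * of_real pi / of_nat g))"
  by (simp add: ev_def)

lemma ev_exp_1: "ev g (fps_exp 1) = eps g"
  by (simp add: ev_exp eps_def)

lemma ev_sum: "(\<And>s. s \<in> S \<Longrightarrow> f s \<in> A_ring) \<Longrightarrow> ev g (sum f S) = (\<Sum>s\<in>S. ev g (f s))"
  by (induction S rule: infinite_finite_induct) (simp_all add: ev_add A_ring_sum)

lemma ev_prod: "(\<And>s. s \<in> S \<Longrightarrow> f s \<in> A_ring) \<Longrightarrow> ev g (prod f S) = (\<Prod>s\<in>S. ev g (f s))"
  by (induction S rule: infinite_finite_induct) (simp_all add: ev_mult A_ring_prod)

lemma ev_power: "f \<in> A_ring \<Longrightarrow> ev g (f ^ k) = ev g f ^ k"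
  by (induction k) (simp_all add: ev_mult A_ring_power)

lemma ev_diff: "f \<in> A_ring \<Longrightarrow> f' \<in> A_ring \<Longrightarrow> ev g (f - f') = ev g f - ev g f'"
  using ev_add[of "f - f'" f' g] A_ring_diff[of f f'] by simp

lemma ev_poly_exp: "ev g (poly_exp p) = poly p (eps g)"
  using fps_exp_A_ring[of 1]
  by (induction p) (simp_all add: poly_exp_pCons ev_add ev_mult poly_exp_A_ring fps_const_A_ring A_ring_mult ev_exp_1)

text \<open>A polynomial that vanishes at \<open>\<epsilon>\<close> is divisible by \<open>Q - \<epsilon>\<close>.\<close>

lemma ev_kernel:
  assumes "f \<in> A_ring" "ev g f = 0"
  shows "\<exists>f'\<in>A_ring. f = (fps_exp 1 - fps_const (eps g)) * f'"
proof -
  obtain m p where f: "f = fps_exp (- of_nat m) * poly_exp p" using assms(1) A_ring_iff by auto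
  have m: "fps_exp (- of_nat m) \<in> A_ring" using fps_exp_A_ring[of "- int m"] by simp
  have "ev g f = ev g (fps_exp (- of_nat m)) * poly p (eps g)"
    unfolding f by (simp add: ev_mult m poly_exp_A_ring ev_poly_exp)
  then have "poly p (eps g) = 0" using assms(2) by (simp add: ev_exp)
  then obtain q where "p = [:- eps g, 1:] * q" unfolding poly_eq_0_iff_dvd by (auto elim: dvdE)
  then have "poly_exp p = poly_exp [:- eps g, 1:] * poly_exp q" by (simp only: poly_exp_mult)
  also have "poly_exp [:- eps g, 1:] = fps_exp 1 - fps_const (eps g)"
    by (simp add: poly_exp_pCons)
  finally have "f = (fps_exp 1 - fps_const (eps g)) * (fps_exp (- of_nat m) * poly_exp q)"
    unfolding f by (simp only: mult_ac)
  then show ?thesis using A_ring_mult[OF m poly_exp_A_ring] by blast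
qed

section \<open>Power series over the Laurent polynomials\<close>

lemma A_h'_const: "a \<in> A_ring \<Longrightarrow> fps_const a \<in> A_h'"
  by (simp add: A_h'_def A_ring_0)

lemma A_h'_0: "0 \<in> A_h'" and A_h'_1: "1 \<in> A_h'"
  by (simp_all add: A_h'_def A_ring_0 A_ring_1)

lemma A_h'_add: "x \<in> A_h' \<Longrightarrow> y \<in> A_h' \<Longrightarrow> x + y \<in> A_h'"
  by (simp add: A_h'_def A_ring_add)

lemma A_h'_mult: "x \<in> A_h' \<Longrightarrow> y \<in> A_h' \<Longrightarrow> x * y \<in> A_h'"
  by (auto simp: A_h'_def fps_mult_nth intro!: A_ring_sum A_ring_mult)

lemma A_h'_diff: "x \<in> A_h' \<Longrightarrow> y \<in> A_h' \<Longrightarrow> x - y \<in> A_h'"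
  by (simp add: A_h'_def A_ring_diff)

lemma A_h'_sum: "(\<And>s. s \<in> S \<Longrightarrow> f s \<in> A_h') \<Longrightarrow> sum f S \<in> A_h'"
  by (induction S rule: infinite_finite_induct) (simp_all add: A_h'_0 A_h'_add)

lemma A_h'_X_power: "fps_X ^ N \<in> A_h'"
  by (simp add: A_h'_def fps_X_power_nth A_ring_0 A_ring_1)

lemma A_h'_of_int: "of_int k \<in> A_h'"
  using A_h'_const[OF fps_const_A_ring, of "of_int k"] by (simp add: fps_of_int)

lemma A_h'_incl: "incl_h' c \<in> A_h'"
  by (simp add: A_h'_def incl_h'_def fps_const_A_ring)

lemma Q_minus_eps_A_h': "Q_minus_eps g \<in> A_h'"
  unfolding Q_minus_eps_def using A_h'_const[OF A_ring_diff[OF fps_exp_A_ring[of 1] fps_const_A_ring]] by simp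

abbreviation spec :: "nat \<Rightarrow> complex fps fps \<Rightarrow> complex fps" where
  "spec g \<equiv> map_fps (ev g)"

lemma spec_simps [simp]: "spec g (fps_const a) = fps_const (ev g a)" "spec g 0 = 0" "spec g 1 = 1"
  "spec g (incl_h' c) = c" "spec g (fps_X ^ N) = fps_X ^ N"
  by (simp_all add: fps_eq_iff incl_h'_def fps_X_power_nth)

lemma spec_add: "x \<in> A_h' \<Longrightarrow> y \<in> A_h' \<Longrightarrow> spec g (x + y) = spec g x + spec g y"
  by (simp add: fps_eq_iff A_h'_def ev_add)

lemma spec_diff: "x \<in> A_h' \<Longrightarrow> y \<in> A_h' \<Longrightarrow> spec g (x - y) = spec g x - spec g y"
  by (simp add: fps_eq_iff A_h'_def ev_diff)

lemma spec_mult: "x \<in> A_h' \<Longrightarrow> y \<in> A_h' \<Longrightarrow> spec g (x * y) = spec g x * spec g y"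
  by (simp add: fps_eq_iff A_h'_def fps_mult_nth ev_sum ev_mult A_ring_mult)

lemma spec_sum: "(\<And>s. s \<in> S \<Longrightarrow> f s \<in> A_h') \<Longrightarrow> spec g (sum f S) = (\<Sum>s\<in>S. spec g (f s))"
  by (induction S rule: infinite_finite_induct) (simp_all add: spec_add A_h'_sum)

lemma spec_of_int: "spec g (of_int k) = of_int k"
  by (simp flip: fps_of_int)

lemma spec_Q_minus_eps: "spec g (Q_minus_eps g) = 0"
  using fps_exp_A_ring[of 1] by (simp add: Q_minus_eps_def ev_diff fps_const_A_ring ev_exp_1)

lemma spec_kernel:
  assumes "x \<in> A_h'" "spec g x = 0"
  shows "\<exists>y\<in>A_h'. x = Q_minus_eps g * y"
proof -
  have "\<forall>k. \<exists>f. f \<in> A_ring \<and> x $ k = (fps_exp 1 - fps_const (eps g)) * f"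
  proof
    fix k
    have "spec g x $ k = 0" using assms(2) by simp
    then show "\<exists>f. f \<in> A_ring \<and> x $ k = (fps_exp 1 - fps_const (eps g)) * f"
      using ev_kernel[of "x $ k" g] assms(1) by (auto simp: A_h'_def)
  qed
  from choice[OF this] obtain F where "\<forall>k. F k \<in> A_ring \<and> x $ k = (fps_exp 1 - fps_const (eps g)) * F k" ..
  then show ?thesis
    by (intro bexI[of _ "Abs_fps F"]) (simp_all add: fps_eq_iff[of x] Q_minus_eps_def A_h'_def)
qed

text \<open>Membership in \<open>\<A>[[h']]\<close> is a condition on each coefficient separately, hence a closed condition.\<close>

lemma A_h'_closed:
  assumes "\<And>N. \<exists>y\<in>A_h'. \<exists>z. x = y + fps_X ^ N * z"
  shows "x \<in> A_h'"
  unfolding A_h'_def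
proof (safe)
  fix k
  obtain y z where "y \<in> A_h'" "x = y + fps_X ^ Suc k * z" using assms by blast
  then show "x $ k \<in> A_ring" by (simp add: A_h'_def fps_X_power_mult_nth del: power_Suc)
qed

lemma P_of_A_ring: "P_of g id (of_int a) \<in> A_ring"
proof -
  have u: "exp_series id (of_int a) \<in> A_ring" "exp_series id (- of_int a) \<in> A_ring"
    using fps_exp_A_ring[of a] fps_exp_A_ring[of "- a"] by (simp_all add: exp_series_id)
  show ?thesis
    unfolding P_of_def Let_def
    by (intro A_ring_mult A_ring_prod A_ring_add A_ring_diff A_ring_power u) (simp_all add: fps_const_A_ring)
qed

lemma QT_power_A_h': "QT_power g id (of_int a) (of_int b) \<in> A_h'"
  unfolding QT_power_def
proof (rule A_h'_mult)
  show "fps_const (exp_series id (of_int b)) \<in> A_h'"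
    by (simp add: A_h'_const exp_series_id fps_exp_A_ring)
  show "exp_series (\<lambda>z. fps_const (id z)) (P_of g id (of_int a) * fps_const (of_int b)) \<in> A_h'"
    by (simp add: A_h'_def exp_series_def A_ring_mult A_ring_power P_of_A_ring fps_const_A_ring)
qed

lemma QT_number_A_h': "QT_number g id (of_nat a) \<in> A_h'"
  unfolding QT_number_of_nat using QT_power_A_h'[of g "int a"]
  by (intro A_h'_sum) (simp only: of_int_of_nat_eq)

lemma L_hh_mat_A_h': "L_hh_mat g n x i j \<in> A_h'"
proof (cases x)
  case C_gen
  then show ?thesis using A_h'_of_int[of "int ((n + 1)\<^sup>2)"] A_h'_0 by (simp add: L_hh_mat_def del: of_nat_power)
qed (auto simp: L_hh_mat_def A_h'_mult QT_number_A_h' A_h'_0 A_h'_1 A_h'_of_int simp del: of_int_diff of_nat_Suc)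

section \<open>Adic closures in algebras\<close>

locale adic_algebra = ring U for U :: "('k::comm_ring_1, 'u) module" (structure) +
  fixes t :: 'k
  assumes t_closed [simp]: "x \<in> carrier U \<Longrightarrow> (t ^ N) \<odot> x \<in> carrier U"
    and t_add: "x \<in> carrier U \<Longrightarrow> y \<in> carrier U \<Longrightarrow> (t ^ N) \<odot> (x \<oplus> y) = (t ^ N) \<odot> x \<oplus> (t ^ N) \<odot> y"
    and t_left: "x \<in> carrier U \<Longrightarrow> y \<in> carrier U \<Longrightarrow> ((t ^ N) \<odot> x) \<otimes> y = (t ^ N) \<odot> (x \<otimes> y)"
    and t_right: "x \<in> carrier U \<Longrightarrow> y \<in> carrier U \<Longrightarrow> x \<otimes> ((t ^ N) \<odot> y) = (t ^ N) \<odot> (x \<otimes> y)"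
begin

lemma closureI:
  assumes "x \<in> carrier U" "\<And>N. \<exists>y\<in>S. \<exists>z\<in>carrier U. x = y \<oplus> (t ^ N) \<odot> z"
  shows "x \<in> adic_closure t U S"
  using assms by (simp add: adic_closure_def)

lemma closureE:
  assumes "x \<in> adic_closure t U S"
  obtains y z where "y \<in> S" "z \<in> carrier U" "x = y \<oplus> (t ^ N) \<odot> z"
  using assms unfolding adic_closure_def by blast

lemma closure_carrier: "x \<in> adic_closure t U S \<Longrightarrow> x \<in> carrier U"
  by (simp add: adic_closure_def)

lemma t_zero: "(t ^ N) \<odot> \<zero> = \<zero>"
  using t_right[of \<zero> \<zero> N] by simp

lemma subset_closure: "S \<subseteq> carrier U \<Longrightarrow> S \<subseteq> adic_closure t U S"
proof
  fix x assume S: "S \<subseteq> carrier U" and x: "x \<in> S"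
  show "x \<in> adic_closure t U S"
  proof (rule closureI)
    show "\<exists>y\<in>S. \<exists>z\<in>carrier U. x = y \<oplus> (t ^ N) \<odot> z" for N
      using x S by (intro bexI[of _ x] bexI[of _ \<zero>]) (auto simp: t_zero)
  qed (use x S in auto)
qed

lemma closure_add:
  assumes S: "S \<subseteq> carrier U" "\<And>x y. x \<in> S \<Longrightarrow> y \<in> S \<Longrightarrow> x \<oplus> y \<in> S"
    and x: "x \<in> adic_closure t U S" and x': "x' \<in> adic_closure t U S"
  shows "x \<oplus> x' \<in> adic_closure t U S"
proof (rule closureI)
  fix N
  obtain y z where y: "y \<in> S" "z \<in> carrier U" "x = y \<oplus> (t ^ N) \<odot> z" by (rule closureE[OF x])
  obtain y' z' where y': "y' \<in> S" "z' \<in> carrier U" "x' = y' \<oplus> (t ^ N) \<odot> z'" by (rule closureE[OF x'])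
  have c: "y \<in> carrier U" "y' \<in> carrier U" using S(1) y(1) y'(1) by auto
  have "x \<oplus> x' = (y \<oplus> y') \<oplus> (t ^ N) \<odot> (z \<oplus> z')"
    unfolding y(3) y'(3) t_add[OF y(2) y'(2)] using c y(2) y'(2) by (simp add: a_ac)
  then show "\<exists>y\<in>S. \<exists>z\<in>carrier U. x \<oplus> x' = y \<oplus> (t ^ N) \<odot> z"
    using S(2)[OF y(1) y'(1)] y(2) y'(2) by (intro bexI[of _ "y \<oplus> y'"] bexI[of _ "z \<oplus> z'"]) auto
qed (use x x' in \<open>simp add: closure_carrier\<close>)

lemma closure_mult:
  assumes S: "S \<subseteq> carrier U" "S' \<subseteq> carrier U" "T \<subseteq> carrier U" "\<And>x y. x \<in> S \<Longrightarrow> y \<in> S' \<Longrightarrow> x \<otimes> y \<in> T"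
    and x: "x \<in> adic_closure t U S" and x': "x' \<in> adic_closure t U S'"
  shows "x \<otimes> x' \<in> adic_closure t U T"
proof (rule closureI)
  fix N
  obtain y z where y: "y \<in> S" "z \<in> carrier U" "x = y \<oplus> (t ^ N) \<odot> z" by (rule closureE[OF x])
  obtain y' z' where y': "y' \<in> S'" "z' \<in> carrier U" "x' = y' \<oplus> (t ^ N) \<odot> z'" by (rule closureE[OF x'])
  have c: "y \<in> carrier U" "y' \<in> carrier U" "x' \<in> carrier U" using S y(1) y'(1) closure_carrier[OF x'] by auto
  have "x \<otimes> x' = y \<otimes> x' \<oplus> (t ^ N) \<odot> (z \<otimes> x')"
    unfolding y(3) using c y(2) by (simp add: l_distr t_left)
  also have "y \<otimes> x' = y \<otimes> y' \<oplus> (t ^ N) \<odot> (y \<otimes> z')"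
    unfolding y'(3) using c y'(2) by (simp add: r_distr t_right)
  finally have "x \<otimes> x' = (y \<otimes> y') \<oplus> (t ^ N) \<odot> (y \<otimes> z' \<oplus> z \<otimes> x')"
    using c y(2) y'(2) by (simp add: t_add a_assoc)
  then show "\<exists>y\<in>T. \<exists>z\<in>carrier U. x \<otimes> x' = y \<oplus> (t ^ N) \<odot> z"
    using S(4)[OF y(1) y'(1)] c y(2) y'(2)
    by (intro bexI[of _ "y \<otimes> y'"] bexI[of _ "y \<otimes> z' \<oplus> z \<otimes> x'"]) auto
qed (use x x' in \<open>simp add: closure_carrier\<close>)

lemma closure_ideal:
  assumes I: "ideal I U"
  shows "ideal (adic_closure t U I) U"
proof -
  interpret I: ideal I U by (rule I)
  have sub: "I \<subseteq> carrier U" by (rule I.a_subset)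
  have carr: "carrier U \<subseteq> adic_closure t U (carrier U)" by (rule subset_closure) simp
  have l: "a \<otimes> x \<in> adic_closure t U I" if "a \<in> carrier U" "x \<in> adic_closure t U I" for a x
    by (rule closure_mult[of "carrier U" I I]) (use that sub carr I.I_l_closed in auto)
  have r: "x \<otimes> a \<in> adic_closure t U I" if "a \<in> carrier U" "x \<in> adic_closure t U I" for a x
    by (rule closure_mult[of I "carrier U" I]) (use that sub carr I.I_r_closed in auto)
  show ?thesis
  proof (rule idealI[OF ring_axioms])
    show "subgroup (adic_closure t U I) (add_monoid U)"
    proof (rule subgroup.intro)
      show "adic_closure t U I \<subseteq> carrier (add_monoid U)" using closure_carrier by auto
      show "x \<otimes>\<^bsub>add_monoid U\<^esub> y \<in> adic_closure t U I"
        if "x \<in> adic_closure t U I" "y \<in> adic_closure t U I" for x y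
        using closure_add[OF sub _ that] I.a_closed by simp
      show "\<one>\<^bsub>add_monoid U\<^esub> \<in> adic_closure t U I"
        using subset_closure[OF sub] additive_subgroup.zero_closed[OF I.is_additive_subgroup] by auto
      fix x assume x: "x \<in> adic_closure t U I"
      have "inv\<^bsub>add_monoid U\<^esub> x = \<ominus> \<one> \<otimes> x"
        using closure_carrier[OF x] by (simp add: l_minus a_inv_def[symmetric])
      then show "inv\<^bsub>add_monoid U\<^esub> x \<in> adic_closure t U I" using l[OF _ x] by simp
    qed
  qed (use l r in auto)
qed

end

section \<open>The integral form and its specialization\<close>

lemma X_image: "map_fps (map_fps fa_const) (fps_X ^ N) = fps_X ^ N"
  using rhomD(8)[OF rhom_map_fps[OF rhom_map_fps[OF rhom_fa_const]]] map_fps_X[OF rhom_map_fps[OF rhom_fa_const]]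
  by metis

lemma adic_algebra_U_hh: "adic_algebra (U_hh g) fps_X"
proof -
  interpret ring "U_hh g" by (rule ring_U_hh)
  have "x * (fps_X ^ N * y) = fps_X ^ N * (x * y)" for x y :: "gen free_alg fps fps" and N
    by (metis fps_mult_fps_X_power_commute mult.assoc)
  then show ?thesis
    by unfold_locales (auto simp: carrier_U_hh hh_class_ops X_image distrib_left mult.assoc)
qed

interpretation hh: adic_algebra "U_hh g" fps_X
  by (rule adic_algebra_U_hh)

abbreviation A_subalgebra :: "nat \<Rightarrow> gen free_alg fps fps set set" where
  "A_subalgebra g \<equiv> generated_subalgebra A_h' (U_hh g) (A_generators g)"

lemma A_generators_carrier: "A_generators g \<subseteq> carrier (U_hh g)"
  unfolding A_generators_def by (auto simp: carrier_U_hh hh_gen_eq)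

lemma is_subalgebra_generated:
  assumes "ring U" "\<And>c x. x \<in> carrier U \<Longrightarrow> c \<odot>\<^bsub>U\<^esub> x \<in> carrier U" "G \<subseteq> carrier U"
  shows "is_subalgebra R U (generated_subalgebra R U G)" "G \<subseteq> generated_subalgebra R U G"
proof -
  interpret ring U by fact
  have "is_subalgebra R U (carrier U)" using assms(2) by (auto simp: is_subalgebra_def)
  then have "carrier U \<in> {S. is_subalgebra R U S \<and> G \<subseteq> S}" using assms(3) by simp
  then show "is_subalgebra R U (generated_subalgebra R U G)"
    unfolding generated_subalgebra_def is_subalgebra_def by blast
  show "G \<subseteq> generated_subalgebra R U G" unfolding generated_subalgebra_def by blast
qed

lemma generated_subalgebra_least: "is_subalgebra R U S \<Longrightarrow> G \<subseteq> S \<Longrightarrow> generated_subalgebra R U G \<subseteq> S"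
  unfolding generated_subalgebra_def by blast

lemma is_subalgebra_A: "is_subalgebra A_h' (U_hh g) (A_subalgebra g)"
  and A_generators_subset: "A_generators g \<subseteq> A_subalgebra g"
  using is_subalgebra_generated[OF ring_U_hh smult_closed_U_hh A_generators_carrier] by auto

lemma U_A_simps [simp]:
  "monoid.mult (U_A g) = monoid.mult (U_hh g)" "add (U_A g) = add (U_hh g)" "one (U_A g) = one (U_hh g)"
  "zero (U_A g) = zero (U_hh g)" "module.smult (U_A g) = module.smult (U_hh g)"
  by (simp_all add: U_A_def)

lemma carrier_U_A: "carrier (U_A g) = adic_closure fps_X (U_hh g) (A_subalgebra g)"
  by (simp add: U_A_def)

lemma is_subalgebra_U_A: "is_subalgebra A_h' (U_hh g) (carrier (U_A g))"
proof -
  note S = is_subalgebra_A[of g, unfolded is_subalgebra_def]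
  have sub: "A_subalgebra g \<subseteq> carrier (U_hh g)" using S by blast
  have "c \<odot>\<^bsub>U_hh g\<^esub> x \<in> carrier (U_A g)" if c: "c \<in> A_h'" and x: "x \<in> carrier (U_A g)" for c x
    unfolding carrier_U_A
  proof (rule hh.closureI)
    show "c \<odot>\<^bsub>U_hh g\<^esub> x \<in> carrier (U_hh g)"
      using x unfolding carrier_U_A by (intro smult_closed_U_hh hh.closure_carrier)
    fix N
    obtain y z where y: "y \<in> A_subalgebra g" "z \<in> carrier (U_hh g)" "x = y \<oplus>\<^bsub>U_hh g\<^esub> fps_X ^ N \<odot>\<^bsub>U_hh g\<^esub> z"
      using x unfolding carrier_U_A by (rule hh.closureE)
    obtain y' z' where yz: "y = hh_class g y'" "z = hh_class g z'"
      using y(1,2) sub unfolding carrier_U_hh by blast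
    let ?c = "map_fps (map_fps fa_const) c :: gen free_alg fps fps"
    have "?c * (fps_X ^ N * z') = fps_X ^ N * (?c * z')"
      by (metis fps_mult_fps_X_power_commute mult.assoc)
    then have "c \<odot>\<^bsub>U_hh g\<^esub> x = c \<odot>\<^bsub>U_hh g\<^esub> y \<oplus>\<^bsub>U_hh g\<^esub> fps_X ^ N \<odot>\<^bsub>U_hh g\<^esub> (c \<odot>\<^bsub>U_hh g\<^esub> z)"
      unfolding y(3) yz by (simp add: hh_class_ops X_image distrib_left)
    then show "\<exists>y\<in>A_subalgebra g. \<exists>z\<in>carrier (U_hh g). c \<odot>\<^bsub>U_hh g\<^esub> x = y \<oplus>\<^bsub>U_hh g\<^esub> fps_X ^ N \<odot>\<^bsub>U_hh g\<^esub> z"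
      using S c y(1) smult_closed_U_hh[OF y(2)] by blast
  qed
  moreover have "x \<oplus>\<^bsub>U_hh g\<^esub> y \<in> carrier (U_A g)" "x \<otimes>\<^bsub>U_hh g\<^esub> y \<in> carrier (U_A g)"
    if "x \<in> carrier (U_A g)" "y \<in> carrier (U_A g)" for x y
    using that unfolding carrier_U_A
    using hh.closure_add[OF sub] hh.closure_mult[OF sub sub sub] S by blast+
  moreover have "\<one>\<^bsub>U_hh g\<^esub> \<in> carrier (U_A g)"
    unfolding carrier_U_A using S hh.subset_closure[OF sub] by blast
  moreover have "carrier (U_A g) \<subseteq> carrier (U_hh g)" unfolding carrier_U_A using hh.closure_carrier by blast
  ultimately show ?thesis unfolding is_subalgebra_def by blast
qed

lemmas U_A_closed = is_subalgebra_U_A[unfolded is_subalgebra_def, THEN conjunct1, THEN subsetD]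
  is_subalgebra_U_A[unfolded is_subalgebra_def, THEN conjunct2, THEN conjunct1]
  is_subalgebra_U_A[unfolded is_subalgebra_def, THEN conjunct2, THEN conjunct2, THEN conjunct1, rule_format, THEN conjunct1]
  is_subalgebra_U_A[unfolded is_subalgebra_def, THEN conjunct2, THEN conjunct2, THEN conjunct1, rule_format, THEN conjunct2]
  is_subalgebra_U_A[unfolded is_subalgebra_def, THEN conjunct2, THEN conjunct2, THEN conjunct2, rule_format]

lemma ring_U_A: "ring (U_A g)"
proof -
  have "subring (carrier (U_A g)) (U_hh g)"
  proof (rule hh.subringI)
    fix x assume x: "x \<in> carrier (U_A g)"
    obtain x' where x': "x = hh_class g x'" using U_A_closed(1)[OF x] by (auto simp: carrier_U_hh)
    have m: "map_fps (map_fps fa_const) (- 1) = (- 1 :: gen free_alg fps fps)"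
      by (simp add: rhomD(3,5)[OF rhom_map_fps[OF rhom_map_fps[OF rhom_fa_const]]])
    have "(- 1) \<odot>\<^bsub>U_hh g\<^esub> x = \<ominus>\<^bsub>U_hh g\<^esub> x"
      using U_A_closed(1)[OF x] smult_closed_U_hh
      by (intro hh.minus_equality[symmetric]) (simp_all add: x' hh_class_ops m carrier_U_hh)
    moreover have "(- 1) \<in> A_h'" using A_h'_of_int[of "- 1"] by simp
    ultimately show "\<ominus>\<^bsub>U_hh g\<^esub> x \<in> carrier (U_A g)" using U_A_closed(5)[of "- 1" x] x by metis
  qed (use U_A_closed in auto)
  then show ?thesis using hh.subring_is_ring unfolding U_A_def by simp
qed

lemma adic_algebra_U_A: "adic_algebra (U_A g) fps_X"
proof (intro adic_algebra.intro ring_U_A adic_algebra_axioms.intro)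
qed (use U_A_closed(1) hh.t_add hh.t_left hh.t_right U_A_closed(5)[OF A_h'_X_power] in simp_all)

interpretation A: adic_algebra "U_A g" fps_X
  by (rule adic_algebra_U_A)

lemma hh_gen_U_A: "hh_gen g x \<in> carrier (U_A g)"
proof -
  have "A_subalgebra g \<subseteq> carrier (U_hh g)" using is_subalgebra_A by (simp add: is_subalgebra_def)
  moreover have "hh_gen g x \<in> A_generators g" by (simp add: A_generators_def)
  ultimately show ?thesis
    unfolding carrier_U_A using hh.subset_closure A_generators_subset[of g] by blast
qed

lemma Q_minus_eps_U_A: "Q_minus_eps g \<odot>\<^bsub>U_A g\<^esub> \<one>\<^bsub>U_A g\<^esub> \<in> carrier (U_A g)"
  using U_A_closed(5)[OF Q_minus_eps_A_h' U_A_closed(2)] by simp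

lemma ideal_eps_ideal: "ideal (eps_ideal g) (U_A g)"
  unfolding eps_ideal_def
  by (rule A.closure_ideal, rule A.genideal_ideal) (use Q_minus_eps_U_A in simp)

lemma smult_as_mult:
  assumes "x \<in> carrier (U_hh g)"
  shows "c \<odot>\<^bsub>U_hh g\<^esub> x = (c \<odot>\<^bsub>U_hh g\<^esub> \<one>\<^bsub>U_hh g\<^esub>) \<otimes>\<^bsub>U_hh g\<^esub> x"
  using assms by (auto simp: carrier_U_hh hh_class_ops)

lemma alg_quotient_U_eps: "alg_quotient incl_h' (U_A g) (eps_ideal g)"
proof -
  interpret J: ideal "eps_ideal g" "U_A g" by (rule ideal_eps_ideal)
  have cl: "incl_h' c \<odot>\<^bsub>U_hh g\<^esub> x \<in> carrier (U_A g)" if "x \<in> carrier (U_A g)" for c x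
    using U_A_closed(5)[OF A_h'_incl that] .
  have "incl_h' c \<odot>\<^bsub>U_hh g\<^esub> x \<in> eps_ideal g" if x: "x \<in> eps_ideal g" for c x
  proof -
    have "x \<in> carrier (U_hh g)" using J.a_Hcarr[OF x] U_A_closed(1) by blast
    from smult_as_mult[OF this] show ?thesis
      using J.I_l_closed[OF x cl[OF U_A_closed(2)], of c] by simp
  qed
  moreover have "incl_h' c \<odot>\<^bsub>U_hh g\<^esub> (x \<oplus>\<^bsub>U_hh g\<^esub> y) = incl_h' c \<odot>\<^bsub>U_hh g\<^esub> x \<oplus>\<^bsub>U_hh g\<^esub> incl_h' c \<odot>\<^bsub>U_hh g\<^esub> y"
    if "x \<in> carrier (U_A g)" "y \<in> carrier (U_A g)" for c x y
    using that[THEN U_A_closed(1)] by (auto simp: carrier_U_hh hh_class_ops distrib_left)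
  ultimately show ?thesis
    using cl by (intro alg_quotient.intro ideal_eps_ideal) simp_all
qed

interpretation eps: alg_quotient incl_h' "U_A g" "eps_ideal g"
  by (rule alg_quotient_U_eps)

lemma ring_U_eps: "ring (U_eps g)"
  unfolding U_eps_def by (rule eps.ring_quot)

lemma carrier_U_eps: "carrier (U_eps g) = (\<lambda>x. eps_ideal g +>\<^bsub>U_A g\<^esub> x) ` carrier (U_A g)"
  unfolding U_eps_def by (rule eps.carrier_quot)

lemma eps_gen_carrier: "eps_gen g x \<in> carrier (U_eps g)"
  unfolding eps_gen_def carrier_U_eps using hh_gen_U_A by blast

lemma smult_closed_U_eps: "u \<in> carrier (U_eps g) \<Longrightarrow> c \<odot>\<^bsub>U_eps g\<^esub> u \<in> carrier (U_eps g)"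
  using eps.smult_closed by (auto simp: U_eps_def eps.carrier_quot eps.smult_quot)

section \<open>The matrices of the integral form\<close>

context
  fixes g n :: nat
  assumes g: "g \<ge> 1"
begin

definition hh_cmat :: "gen free_alg fps fps set \<Rightarrow> nat \<Rightarrow> nat \<Rightarrow> complex fps fps" where
  "hh_cmat = coset_mat (hh_mat n (L_hh_mat g n))"

lemma matrep_hh_cmat: "matrep (U_hh g) n hh_cmat"
  unfolding U_hh_eq hh_cmat_def
  by (rule matrep_quot[OF matrep_hh_mat[unfolded free_series2_eq] two_sided_hh_ideal hh_mat_hh_ideal[OF L_hh_relations[OF g]]])

lemma hh_cmat_class: "i \<le> n \<Longrightarrow> j \<le> n \<Longrightarrow> hh_cmat (hh_class g x) i j = hh_mat n (L_hh_mat g n) x i j"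
  unfolding hh_cmat_def by (rule coset_mat_hh[OF g])

lemma hh_cmat_gen: "i \<le> n \<Longrightarrow> j \<le> n \<Longrightarrow> hh_cmat (hh_gen g x) i j = L_hh_mat g n x i j"
  by (simp add: hh_gen_eq hh_cmat_class hh_mat_var)

lemma Q_power_mat:
  assumes ij: "i \<le> n" "j \<le> n" and f: "map_fps (map_fps reflect) f = f"
  shows "hh_cmat (hh_class g (map_fps (map_fps even_subst) f)) i j =
    of_bool (i = j) * map_fps (map_fps (pp_eval (of_int (int n - 2 * int j)) (of_nat (n + 1)))) f"
  unfolding hh_cmat_class[OF ij] by (rule hh_mat_even_subst[OF ij]) (rule reflect_even[OF f])

lemma pp_eval_Q_power: "map_fps (map_fps (pp_eval x y)) (Q_power a) = fps_const (fps_exp (pp_eval x y a))"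
proof -
  have "pp_eval x y (pp_const z) = z" for z by (simp add: pp_eval_def pp_const_def)
  then show ?thesis
    by (simp add: Q_power_def rhomD[OF rhom_map_fps[OF rhom_pp_eval]] exp_series_map[OF rhom_pp_eval] exp_series_id)
qed

lemma reflect_Q_power: "map_fps (map_fps reflect) (Q_power a) = Q_power (reflect a)"
  by (simp add: Q_power_def rhomD[OF rhom_map_fps[OF rhom_reflect]] exp_series_map[OF rhom_reflect] reflect_simps)

lemma A_generators_mat:
  assumes u: "u \<in> A_generators g" and ij: "i \<le> n" "j \<le> n"
  shows "hh_cmat u i j \<in> A_h'"
proof -
  have e: "fps_const (fps_exp (of_int k)) \<in> A_h'" for k by (rule A_h'_const[OF fps_exp_A_ring])
  have ob: "of_bool b * x \<in> A_h'" if "x \<in> A_h'" for x b using that A_h'_0 by simp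
  have r: "rhom (map_fps (map_fps reflect))" by (intro rhom_map_fps rhom_reflect)
  have p: "rhom (map_fps (map_fps (pp_eval x y)))" for x y by (intro rhom_map_fps rhom_pp_eval)
  have "pp_eval x y pp_H = x" "pp_eval x y (- pp_H) = - x" "pp_eval x y pp_sqrtC = y" "pp_eval x y (- pp_sqrtC) = - y" for x y
    by (simp_all add: pp_eval_def pp_H_def pp_sqrtC_def)
  note ev = this
  consider x where "u = hh_gen g x" | "u = hh_class g (map_fps (map_fps even_subst) (Q_power pp_H))"
    | "u = hh_class g (map_fps (map_fps even_subst) (Q_power (- pp_H)))"
    | "u = hh_class g (map_fps (map_fps even_subst) (Q_power pp_sqrtC + Q_power (- pp_sqrtC)))"
    using u unfolding A_generators_def by auto
  then show ?thesis
  proof cases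
    case 1
    then show ?thesis using hh_cmat_gen[OF ij] L_hh_mat_A_h' by simp
  next
    case 2
    have "map_fps (map_fps reflect) (Q_power pp_H) = Q_power pp_H" by (simp add: reflect_Q_power reflect_simps)
    from Q_power_mat[OF ij this] show ?thesis
      unfolding 2 pp_eval_Q_power ev using ob[OF e] by metis
  next
    case 3
    have "map_fps (map_fps reflect) (Q_power (- pp_H)) = Q_power (- pp_H)"
      by (simp add: reflect_Q_power reflect_simps rhomD[OF rhom_reflect])
    from Q_power_mat[OF ij this] show ?thesis
      unfolding 3 pp_eval_Q_power ev using ob[OF e, of _ "- (int n - 2 * int j)"] by (metis of_int_minus)
  next
    case 4
    have "map_fps (map_fps reflect) (Q_power pp_sqrtC + Q_power (- pp_sqrtC)) = Q_power pp_sqrtC + Q_power (- pp_sqrtC)"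
      by (simp add: rhomD(1)[OF r] reflect_Q_power reflect_simps rhomD(5)[OF rhom_reflect] add.commute)
    from Q_power_mat[OF ij this] show ?thesis
      unfolding 4 rhomD(1)[OF p] pp_eval_Q_power ev
      using ob[OF A_h'_add[OF e[of "int (n + 1)"] e[of "- int (n + 1)"]]]
      by (metis of_int_minus of_int_of_nat_eq)
  qed
qed

lemma hh_cmat_ops:
  assumes "i \<le> n" "j \<le> n"
  shows "u \<in> carrier (U_hh g) \<Longrightarrow> v \<in> carrier (U_hh g) \<Longrightarrow>
      hh_cmat (u \<oplus>\<^bsub>U_hh g\<^esub> v) i j = hh_cmat u i j + hh_cmat v i j"
    "u \<in> carrier (U_hh g) \<Longrightarrow> v \<in> carrier (U_hh g) \<Longrightarrow>
      hh_cmat (u \<otimes>\<^bsub>U_hh g\<^esub> v) i j = (\<Sum>l\<le>n. hh_cmat u i l * hh_cmat v l j)"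
    "u \<in> carrier (U_hh g) \<Longrightarrow> hh_cmat (c \<odot>\<^bsub>U_hh g\<^esub> u) i j = c * hh_cmat u i j"
    "hh_cmat \<one>\<^bsub>U_hh g\<^esub> i j = of_bool (i = j)"
  using matrep_hh_cmat assms unfolding matrep_def by blast+

text \<open>The elements with entries in \<open>\<A>[[h']]\<close> form a closed subalgebra, and it contains the generators of the integral form.\<close>

lemma hh_cmat_A_h':
  assumes u: "u \<in> carrier (U_A g)" and ij: "i \<le> n" "j \<le> n"
  shows "hh_cmat u i j \<in> A_h'"
proof -
  let ?S = "{u \<in> carrier (U_hh g). \<forall>i\<le>n. \<forall>j\<le>n. hh_cmat u i j \<in> A_h'}"
  have "is_subalgebra A_h' (U_hh g) ?S"
    unfolding is_subalgebra_def
    using A_h'_0 A_h'_1 by (auto simp: hh_cmat_ops smult_closed_U_hh intro!: A_h'_add A_h'_mult A_h'_sum)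
  then have sub: "A_subalgebra g \<subseteq> ?S"
    using A_generators_carrier A_generators_mat by (intro generated_subalgebra_least) auto
  show ?thesis
  proof (rule A_h'_closed)
    fix N
    obtain y z where y: "y \<in> A_subalgebra g" "z \<in> carrier (U_hh g)" "u = y \<oplus>\<^bsub>U_hh g\<^esub> fps_X ^ N \<odot>\<^bsub>U_hh g\<^esub> z"
      using u unfolding carrier_U_A by (rule hh.closureE)
    then have "hh_cmat u i j = hh_cmat y i j + fps_X ^ N * hh_cmat z i j"
      using sub ij by (auto simp: hh_cmat_ops smult_closed_U_hh)
    then show "\<exists>y\<in>A_h'. \<exists>z. hh_cmat u i j = y + fps_X ^ N * z" using sub y(1) ij by blast
  qed
qed

definition A_mat :: "gen free_alg fps fps set \<Rightarrow> nat \<Rightarrow> nat \<Rightarrow> complex fps" where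
  "A_mat u i j = spec g (hh_cmat u i j)"

lemma A_mat_ops:
  assumes "i \<le> n" "j \<le> n"
  shows "u \<in> carrier (U_A g) \<Longrightarrow> v \<in> carrier (U_A g) \<Longrightarrow>
      A_mat (u \<oplus>\<^bsub>U_hh g\<^esub> v) i j = A_mat u i j + A_mat v i j"
    "u \<in> carrier (U_A g) \<Longrightarrow> v \<in> carrier (U_A g) \<Longrightarrow>
      A_mat (u \<otimes>\<^bsub>U_hh g\<^esub> v) i j = (\<Sum>l\<le>n. A_mat u i l * A_mat v l j)"
    "c \<in> A_h' \<Longrightarrow> u \<in> carrier (U_A g) \<Longrightarrow> A_mat (c \<odot>\<^bsub>U_hh g\<^esub> u) i j = spec g c * A_mat u i j"
    "A_mat \<one>\<^bsub>U_hh g\<^esub> i j = of_bool (i = j)"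
proof -
  assume u: "u \<in> carrier (U_A g)" and v: "v \<in> carrier (U_A g)"
  show "A_mat (u \<oplus>\<^bsub>U_hh g\<^esub> v) i j = A_mat u i j + A_mat v i j"
    using assms u v U_A_closed(1) by (simp add: A_mat_def hh_cmat_ops spec_add hh_cmat_A_h')
  have "spec g (\<Sum>l\<le>n. hh_cmat u i l * hh_cmat v l j) = (\<Sum>l\<le>n. spec g (hh_cmat u i l * hh_cmat v l j))"
    by (rule spec_sum) (use assms u v in \<open>simp add: hh_cmat_A_h' A_h'_mult\<close>)
  also have "\<dots> = (\<Sum>l\<le>n. A_mat u i l * A_mat v l j)"
    by (rule sum.cong) (use assms u v in \<open>simp_all add: hh_cmat_A_h' spec_mult A_mat_def\<close>)
  finally show "A_mat (u \<otimes>\<^bsub>U_hh g\<^esub> v) i j = (\<Sum>l\<le>n. A_mat u i l * A_mat v l j)"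
    using assms u v U_A_closed(1) by (simp add: A_mat_def hh_cmat_ops)
next
  assume "c \<in> A_h'" "u \<in> carrier (U_A g)"
  then show "A_mat (c \<odot>\<^bsub>U_hh g\<^esub> u) i j = spec g c * A_mat u i j"
    using assms U_A_closed(1) by (simp add: A_mat_def hh_cmat_ops spec_mult hh_cmat_A_h')
next
  show "A_mat \<one>\<^bsub>U_hh g\<^esub> i j = of_bool (i = j)"
    using assms by (simp add: A_mat_def hh_cmat_ops of_bool_def)
qed

text \<open>\<open>Q - \<epsilon>\<close> is mapped to \<open>0\<close>, and so is the closure of the ideal it generates, by continuity in \<open>h'\<close>.\<close>

lemma A_mat_eps_ideal:
  assumes u: "u \<in> eps_ideal g" and ij: "i \<le> n" "j \<le> n"
  shows "A_mat u i j = 0"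
proof -
  let ?K = "{u \<in> carrier (U_A g). \<forall>i\<le>n. \<forall>j\<le>n. A_mat u i j = 0}"
  note add = A_mat_ops(1)
  have z: "A_mat \<zero>\<^bsub>U_hh g\<^esub> i j = 0" if "i \<le> n" "j \<le> n" for i j
    using add[OF that A.zero_closed A.zero_closed] A.l_zero[OF A.zero_closed] by simp
  have neg: "A_mat (\<ominus>\<^bsub>U_A g\<^esub> u) i j = - A_mat u i j" if "u \<in> carrier (U_A g)" "i \<le> n" "j \<le> n" for u i j
    using add[OF that(2,3) A.a_inv_closed[OF that(1)] that(1)] A.l_neg[OF that(1)] z[OF that(2,3)]
    by (simp add: eq_neg_iff_add_eq_0)
  have cl: "u \<oplus>\<^bsub>U_hh g\<^esub> v \<in> carrier (U_A g)" "u \<otimes>\<^bsub>U_hh g\<^esub> v \<in> carrier (U_A g)"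
    if "u \<in> carrier (U_A g)" "v \<in> carrier (U_A g)" for u v
    using U_A_closed(3,4)[OF that] by auto
  have "ideal ?K (U_A g)"
  proof (rule idealI[OF ring_U_A])
    show "subgroup ?K (add_monoid (U_A g))"
    proof (rule subgroup.intro)
      fix x assume "x \<in> ?K"
      then show "inv\<^bsub>add_monoid (U_A g)\<^esub> x \<in> ?K"
        unfolding a_inv_def[symmetric] using A.a_inv_closed[of x g] neg[of x] by auto
    qed (use z add cl A.zero_closed in auto)
  qed (use A_mat_ops(2) cl in auto)
  moreover have "Q_minus_eps g \<odot>\<^bsub>U_A g\<^esub> \<one>\<^bsub>U_A g\<^esub> \<in> ?K"
    using Q_minus_eps_U_A A_mat_ops(3)[OF _ _ Q_minus_eps_A_h' U_A_closed(2)] spec_Q_minus_eps by simp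
  ultimately have sub: "Idl\<^bsub>U_A g\<^esub> {Q_minus_eps g \<odot>\<^bsub>U_A g\<^esub> \<one>\<^bsub>U_A g\<^esub>} \<subseteq> ?K"
    by (intro A.genideal_minimal) auto
  show ?thesis
  proof (rule fps_X_adic_zero)
    fix N
    obtain y z where y: "y \<in> Idl\<^bsub>U_A g\<^esub> {Q_minus_eps g \<odot>\<^bsub>U_A g\<^esub> \<one>\<^bsub>U_A g\<^esub>}" "z \<in> carrier (U_A g)"
      "u = y \<oplus>\<^bsub>U_A g\<^esub> fps_X ^ N \<odot>\<^bsub>U_A g\<^esub> z"
      using u unfolding eps_ideal_def by (rule A.closureE)
    have yc: "y \<in> carrier (U_A g)" "A_mat y i j = 0" using sub y(1) ij by auto
    have Xz: "fps_X ^ N \<odot>\<^bsub>U_hh g\<^esub> z \<in> carrier (U_A g)" using U_A_closed(5)[OF A_h'_X_power y(2)] .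
    have "A_mat u i j = fps_X ^ N * A_mat z i j"
      using add[OF ij yc(1) Xz] A_mat_ops(3)[OF ij A_h'_X_power y(2)] yc(2) by (simp add: y(3))
    then show "\<exists>h. A_mat u i j = fps_X ^ N * h" by blast
  qed
qed

definition eps_mat :: "gen free_alg fps fps set set \<Rightarrow> nat \<Rightarrow> nat \<Rightarrow> complex fps" where
  "eps_mat = coset_mat A_mat"

lemma A_mat_coset:
  assumes "x \<in> carrier (U_A g)" "y \<in> eps_ideal g +>\<^bsub>U_A g\<^esub> x" "i \<le> n" "j \<le> n"
  shows "A_mat y i j = A_mat x i j"
proof -
  interpret J: ideal "eps_ideal g" "U_A g" by (rule ideal_eps_ideal)
  obtain k where k: "k \<in> eps_ideal g" "y = k \<oplus>\<^bsub>U_A g\<^esub> x" using assms(2) eps.mem_coset by blast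
  then show ?thesis
    using A_mat_ops(1)[OF assms(3,4) J.a_Hcarr[OF k(1)] assms(1)] A_mat_eps_ideal[OF k(1) assms(3,4)] by simp
qed

lemma eps_mat_coset:
  assumes "x \<in> carrier (U_A g)" "i \<le> n" "j \<le> n"
  shows "eps_mat (eps_ideal g +>\<^bsub>U_A g\<^esub> x) i j = A_mat x i j"
  unfolding eps_mat_def coset_mat_def
  by (rule A_mat_coset[OF assms(1) _ assms(2,3)]) (rule someI[of _ x], rule eps.self_mem_coset, rule assms(1))

lemma matrep_eps_mat: "matrep (U_eps g) n eps_mat"
proof -
  note [simp] = eps.mult_quot eps.add_quot eps.smult_quot eps.one_quot eps_mat_coset U_A_closed(3,4)
  have cl: "u \<oplus>\<^bsub>U_hh g\<^esub> v \<in> carrier (U_A g)" "u \<otimes>\<^bsub>U_hh g\<^esub> v \<in> carrier (U_A g)"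
    if "u \<in> carrier (U_A g)" "v \<in> carrier (U_A g)" for u v
    using U_A_closed(3,4)[OF that] by auto
  show ?thesis
    unfolding matrep_def U_eps_def eps.carrier_quot
    using U_A_closed(5)[OF A_h'_incl] U_A_closed(2)
    by (auto simp: cl A_mat_ops A_h'_incl)
qed

lemma eps_mat_gen: "i \<le> n \<Longrightarrow> j \<le> n \<Longrightarrow> eps_mat (eps_gen g x) i j = spec g (L_hh_mat g n x i j)"
  by (simp add: eps_gen_def eps_mat_coset hh_gen_U_A A_mat_def hh_cmat_gen)

end

section \<open>The numbers at \<open>Q = \<epsilon>\<close>\<close>

lemma eps_cis: "eps g ^ k = cis (real k * pi / real g)"
proof -
  have "eps g = cis (pi / real g)" by (simp add: eps_def cis_conv_exp)
  then show ?thesis by (simp only: Complex.DeMoivre times_divide_eq_right)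
qed

lemma eps_diff_nonzero:
  assumes "0 < k" "k < g"
  shows "eps g ^ k - inverse (eps g) ^ k \<noteq> 0"
proof
  assume *: "eps g ^ k - inverse (eps g) ^ k = 0"
  have "inverse (eps g) ^ k = cis (- (real k * pi / real g))"
    by (simp add: power_inverse eps_cis cis_inverse)
  with * have "Im (cis (real k * pi / real g)) = Im (cis (- (real k * pi / real g)))" by (simp add: eps_cis)
  then have "sin (real k * pi / real g) = 0" by simp
  moreover have "0 < real k * pi / real g" "real k * pi / real g < pi"
    using assms by (simp_all add: field_simps)
  ultimately show False using sin_gt_zero by fastforce
qed

lemma eps_power_mult: "g \<ge> 1 \<Longrightarrow> eps g ^ (g * b) = (- 1) ^ b" "g \<ge> 1 \<Longrightarrow> inverse (eps g) ^ (g * b) = (- 1) ^ b"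
  by (simp_all add: power_mult eps_power_g power_inverse)

lemma ev_exp_of_nat: "ev g (fps_exp (of_nat a)) = eps g ^ a" "ev g (fps_exp (- of_nat a)) = inverse (eps g) ^ a"
proof -
  show "ev g (fps_exp (of_nat a)) = eps g ^ a" by (simp only: ev_exp eps_def exp_of_nat_mult)
  then show "ev g (fps_exp (- of_nat a)) = inverse (eps g) ^ a"
    by (simp add: ev_exp exp_minus power_inverse)
qed

text \<open>If \<open>g\<close> does not divide \<open>a\<close>, the factor of \<open>P(\<epsilon>\<^sup>a)\<close> with \<open>k \<equiv> -a\<close> modulo \<open>g\<close> vanishes; otherwise all factors are equal
  signs. So the deformation parameter \<open>T\<close> is visible in \<open>[a]\<close> only for multiples \<open>a\<close> of \<open>g\<close>.\<close>

lemma ev_P_of: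
  assumes g: "g \<ge> 1"
  shows "ev g (P_of g id (of_nat a)) = of_bool (g dvd a)"
proof -
  let ?u = "eps g ^ a" and ?v = "inverse (eps g) ^ a"
  have u: "exp_series id (of_nat a) \<in> A_ring" "exp_series id (- of_nat a) \<in> A_ring"
    using fps_exp_A_ring[of "int a"] fps_exp_A_ring[of "- int a"] by (simp_all add: exp_series_id)
  let ?f = "\<lambda>k. 1 / (eps g ^ k - inverse (eps g) ^ k) * (eps g ^ k * ?u - inverse (eps g) ^ k * ?v)"
  have "ev g (P_of g id (of_nat a)) = 1 / 2 * (?u ^ (g - 1) + ?v ^ (g - 1)) * (\<Prod>k=1..g - 1. ?f k)"
    unfolding P_of_def Let_def
    by (simp add: ev_mult ev_add ev_diff ev_prod ev_power u exp_series_id[symmetric] A_ring_mult A_ring_add A_ring_diff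
        A_ring_prod A_ring_power fps_const_A_ring del: power_inverse)
      (simp add: exp_series_id ev_exp_of_nat)
  also have "\<dots> = of_bool (g dvd a)"
  proof (cases "g dvd a")
    case True
    then obtain b where b: "a = g * b" by blast
    have "?f k = (- 1) ^ b" if "k \<in> {1..g - 1}" for k
    proof -
      have "eps g ^ k - inverse (eps g) ^ k \<noteq> 0" using that by (intro eps_diff_nonzero) auto
      then show ?thesis unfolding b eps_power_mult[OF g] by (simp add: left_diff_distrib[symmetric] del: power_inverse)
    qed
    then have "(\<Prod>k=1..g - 1. ?f k) = ((- 1) ^ b) ^ (g - 1)" by simp
    moreover have "((- 1 :: complex) ^ b) ^ (g - 1) * ((- 1) ^ b) ^ (g - 1) = 1"
      by (simp flip: power_mult power_add mult_2_right)
    ultimately show ?thesis using True unfolding b eps_power_mult[OF g] by simp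
  next
    case False
    \<comment> \<open>the factor with \<open>\<epsilon>\<^sup>k\<epsilon>\<^sup>a = \<plusminus>1\<close> vanishes\<close>
    let ?k = "g - a mod g"
    have r: "0 < a mod g" "a mod g < g" using False g by (auto simp: dvd_eq_mod_eq_0)
    then have k: "?k \<in> {1..g - 1}" by auto
    have "g * (a div g) + a mod g = a" by simp
    then have ka: "?k + a = g * (a div g + 1)" using r(2) unfolding distrib_left mult_1_right by linarith
    have "eps g ^ ?k * ?u = eps g ^ (?k + a)" "inverse (eps g) ^ ?k * ?v = inverse (eps g) ^ (?k + a)"
      by (simp_all only: power_add)
    then have "?f ?k = 0" unfolding ka eps_power_mult[OF g] by simp
    then have "(\<Prod>k=1..g - 1. ?f k) = 0" using k by (intro prod_zero) auto
    then show ?thesis using False by simp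
  qed
  finally show ?thesis .
qed

lemma spec_QT_power:
  "spec g (QT_power g id (of_int a) (of_int b)) =
    fps_const (ev g (fps_exp (of_int b))) * fps_exp (ev g (P_of g id (of_int a)) * of_int b)"
proof (rule fps_ext)
  fix k
  have "QT_power g id (of_int a) (of_int b) $ k =
      fps_exp (of_int b) * (fps_const (1 / fact k) * (P_of g id (of_int a) * fps_const (of_int b)) ^ k)"
    unfolding QT_power_def exp_series_id by (simp add: exp_series_def)
  then show "spec g (QT_power g id (of_int a) (of_int b)) $ k =
      (fps_const (ev g (fps_exp (of_int b))) * fps_exp (ev g (P_of g id (of_int a)) * of_int b)) $ k"
    by (simp add: ev_mult fps_exp_A_ring ev_power A_ring_mult A_ring_power P_of_A_ring fps_const_A_ring)
qed

definition eps_number :: "nat \<Rightarrow> nat \<Rightarrow> complex fps" where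
  "eps_number g a = spec g (QT_number g id (of_nat a))"

text \<open>\<open>\<epsilon>T - \<epsilon>\<^sup>-\<^sup>1T\<^sup>-\<^sup>1\<close> and \<open>T\<^bsup>gb\<^esup> - T\<^bsup>-gb\<^esup>\<close>.\<close>

definition eps_T :: "nat \<Rightarrow> complex fps" where
  "eps_T g = fps_const (eps g) * fps_exp 1 - fps_const (inverse (eps g)) * fps_exp (- 1)"

definition T_diff :: "nat \<Rightarrow> nat \<Rightarrow> complex fps" where
  "T_diff g b = fps_exp (of_nat (g * b)) - fps_exp (- of_nat (g * b))"

lemma eps_number_quot:
  fixes g a :: nat
  assumes g: "g \<ge> 1"
  defines "p \<equiv> of_bool (g dvd a) :: complex"
  shows "(fps_const (eps g) * fps_exp p - fps_const (inverse (eps g)) * fps_exp (- p)) * eps_number g a =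
    fps_const (eps g ^ a) * fps_exp (p * of_nat a) - fps_const (inverse (eps g) ^ a) * fps_exp (- (p * of_nat a))"
proof -
  let ?Q = "QT_power g id (of_int (int a))"
  have P: "ev g (P_of g id (of_int (int a))) = p" using ev_P_of[OF g, of a] by (simp add: p_def)
  have Q: "?Q (of_int b) \<in> A_h'" for b by (rule QT_power_A_h')
  have "spec g ((?Q (of_int 1) - ?Q (of_int (- 1))) * QT_number g id (of_nat a)) = spec g (?Q (of_int (int a)) - ?Q (of_int (- int a)))"
    using QT_number_quot[of g "of_nat a"] by simp
  then have "(spec g (?Q (of_int 1)) - spec g (?Q (of_int (- 1)))) * eps_number g a =
      spec g (?Q (of_int (int a))) - spec g (?Q (of_int (- int a)))"
    by (simp only: spec_mult[OF A_h'_diff[OF Q Q] QT_number_A_h'] spec_diff[OF Q Q] eps_number_def)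
  then show ?thesis
    unfolding spec_QT_power P using ev_exp_of_nat[of g 1] ev_exp_of_nat[of g a] by simp
qed

text \<open>The numbers that depend on \<open>T\<close>: for \<open>a = gb\<close> the base is \<open>\<epsilon>T\<close>, and \<open>\<epsilon>\<^bsup>gb\<^esup> = (-1)\<^sup>b\<close>.\<close>

lemma eps_number_dvd:
  assumes g: "g \<ge> 1"
  shows "eps_T g * eps_number g (g * b) = fps_const ((- 1) ^ b) * T_diff g b"
  using eps_number_quot[OF g, of "g * b"]
  by (simp add: eps_T_def T_diff_def eps_power_mult[OF g] right_diff_distrib del: power_inverse)

text \<open>The other numbers are the constants \<open>[a]\<^sub>\<epsilon>\<close>, because the exponent of \<open>T\<close> in the base vanishes.\<close>

lemma eps_number_not_dvd:
  assumes g: "g \<ge> 1" and a: "\<not> g dvd a"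
  shows "eps_number g a = fps_const ((eps g ^ a - inverse (eps g) ^ a) / (eps g - inverse (eps g)))"
proof -
  have "g \<noteq> 1" using a by auto
  define x y where "x = eps g - inverse (eps g)" and "y = eps g ^ a - inverse (eps g) ^ a"
  have nz: "x \<noteq> 0" unfolding x_def using g \<open>g \<noteq> 1\<close> eps_diff_nonzero[of 1 g] by simp
  have "fps_const x * eps_number g a = fps_const y"
    unfolding x_def y_def using eps_number_quot[OF g, of a] a by (simp del: power_inverse)
  also have "\<dots> = fps_const x * fps_const (y / x)" using nz by simp
  finally have "fps_const x * eps_number g a = fps_const x * fps_const (y / x)" .
  moreover have "fps_const x \<noteq> 0" using nz by simp
  ultimately have "eps_number g a = fps_const (y / x)" by (metis mult_left_cancel)
  then show ?thesis unfolding x_def y_def .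
qed

lemma T_diff_nonzero:
  assumes "g \<ge> 1" "b > 0"
  shows "T_diff g b \<noteq> 0"
  unfolding T_diff_def by (rule exp_diff_nonzero) (use assms in simp)

lemma eps_factorial_nonzero: "eps_factorial g \<noteq> 0"
proof -
  have "(eps g ^ k - inverse (eps g) ^ k) / (eps g - inverse (eps g)) \<noteq> 0" if "k \<in> {1..g - 1}" for k
  proof -
    have "0 < k" "k < g" "1 < g" using that by auto
    then show ?thesis using eps_diff_nonzero[of k g] eps_diff_nonzero[of 1 g] by auto
  qed
  then show ?thesis unfolding eps_factorial_def by (simp add: prod_zero_iff del: power_inverse)
qed

text \<open>Passing from \<open>m\<close> to \<open>m + 1\<close> replaces the factor \<open>[m+1]\<close> by \<open>[m+1+g]\<close>. Both have the same form, up to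
  the sign coming from \<open>\<epsilon>\<^sup>g = -1\<close>.\<close>

lemma eps_number_prod:
  assumes g: "g \<ge> 1"
  shows "eps_T g * (\<Prod>l=1..g. eps_number g (m + l)) =
    fps_const ((- 1) ^ (m + 1) * eps_factorial g) * T_diff g (m div g + 1)"
proof (induction m)
  case 0
  have "(\<Prod>l=1..g - 1. eps_number g l) =
      (\<Prod>l=1..g - 1. fps_const ((eps g ^ l - inverse (eps g) ^ l) / (eps g - inverse (eps g))))"
    by (intro prod.cong refl eps_number_not_dvd[OF g]) (auto dest: dvd_imp_le)
  also have "\<dots> = fps_const (eps_factorial g)"
    unfolding eps_factorial_def by (simp only: rhom_prod[OF rhom_fps_const])
  finally have *: "(\<Prod>l=1..g - 1. eps_number g l) = fps_const (eps_factorial g)" .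
  have "(\<Prod>l=1..g. eps_number g l) = fps_const (eps_factorial g) * eps_number g (g * 1)"
    using g * by (cases g) simp_all
  then have "eps_T g * (\<Prod>l=1..g. eps_number g l) = fps_const (eps_factorial g) * (eps_T g * eps_number g (g * 1))"
    by (simp only: mult_ac)
  also have "\<dots> = fps_const ((- 1) ^ (0 + 1) * eps_factorial g) * T_diff g (0 div g + 1)"
    unfolding eps_number_dvd[OF g] by (simp flip: fps_const_neg)
  finally show ?case unfolding add_0 .
next
  case (Suc m)
  let ?Y = "eps_number g"
  let ?Z = "\<lambda>m. \<Prod>l=1..g. ?Y (m + l)"
  have shift: "?Y (Suc m) * ?Z (Suc m) = ?Z m * ?Y (Suc m + g)"
  proof -
    have "?Z (Suc m) = (\<Prod>l=2..g + 1. ?Y (m + l))"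
      by (rule prod.reindex_bij_witness[of _ "\<lambda>l. l - 1" Suc]) auto
    moreover have "(\<Prod>l=1..g + 1. ?Y (m + l)) = ?Y (Suc m) * (\<Prod>l=2..g + 1. ?Y (m + l))"
      by (subst prod.atLeast_Suc_atMost) (simp_all add: numeral_2_eq_2)
    moreover have "(\<Prod>l=1..g + 1. ?Y (m + l)) = ?Z m * ?Y (Suc m + g)" by simp
    ultimately show ?thesis by simp
  qed
  show ?case
  proof (cases "g dvd Suc m")
    case False
    then have F': "\<not> g dvd Suc m + g" using dvd_add_left_iff[OF dvd_refl, of g "Suc m"] by blast
    have neg: "?Y (Suc m + g) = - ?Y (Suc m)"
      unfolding eps_number_not_dvd[OF g False] eps_number_not_dvd[OF g F'] power_add
      using g by (simp add: eps_power_g power_inverse diff_divide_distrib flip: fps_const_neg)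
    have nz: "?Y (Suc m) \<noteq> 0"
    proof
      assume "?Y (Suc m) = 0"
      then have "eps g ^ Suc m - inverse (eps g) ^ Suc m = 0 \<or> eps g - inverse (eps g) = 0"
        unfolding eps_number_not_dvd[OF g False] by (simp del: power_Suc power_inverse)
      moreover have "g > 1" using False g by (cases "g = 1") auto
      ultimately have *: "eps g ^ Suc m - inverse (eps g) ^ Suc m = 0" using eps_diff_nonzero[of 1 g] by simp
      let ?k = "Suc m mod g" and ?b = "Suc m div g"
      have m: "Suc m = g * ?b + ?k" by simp
      have "(- 1) ^ ?b * (eps g ^ ?k - inverse (eps g) ^ ?k) = 0"
        using * unfolding arg_cong[OF m, of "\<lambda>x. eps g ^ x"] arg_cong[OF m, of "\<lambda>x. inverse (eps g) ^ x"]
          power_add eps_power_mult[OF g] by (simp add: right_diff_distrib del: power_inverse)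
      then have "eps g ^ ?k - inverse (eps g) ^ ?k = 0" by simp
      moreover have "0 < ?k" "?k < g" using False g by (auto simp: dvd_eq_mod_eq_0)
      ultimately show False using eps_diff_nonzero by blast
    qed
    have "?Y (Suc m) * ?Z (Suc m) = ?Y (Suc m) * (- ?Z m)"
      unfolding shift neg by (simp add: mult.commute)
    then have "?Z (Suc m) = - ?Z m" using nz mult_left_cancel by blast
    moreover have "Suc m div g = m div g" using False g by (simp add: div_Suc dvd_eq_mod_eq_0)
    ultimately show ?thesis using Suc.IH by (simp flip: fps_const_neg)
  next
    case True
    then obtain b where b: "Suc m = g * b" by blast
    then have b0: "b > 0" using g by (cases b) auto
    have m: "m div g + 1 = b"
    proof -
      have "Suc m mod g = 0" using True by auto
      then have "Suc m div g = Suc (m div g)" using g by (simp add: div_Suc)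
      then show ?thesis using b g by simp
    qed
    have Y: "eps_T g * ?Y (Suc m) = fps_const ((- 1) ^ b) * T_diff g b"
      "eps_T g * ?Y (Suc m + g) = fps_const ((- 1) ^ (b + 1)) * T_diff g (b + 1)"
      using eps_number_dvd[OF g, of b] eps_number_dvd[OF g, of "b + 1"] b by (simp_all add: add.commute)
    let ?s = "fps_const ((- 1) ^ b) :: complex fps"
    have "(?s * T_diff g b) * (eps_T g * ?Z (Suc m)) = (eps_T g * ?Y (Suc m)) * (eps_T g * ?Z (Suc m))"
      unfolding Y ..
    also have "\<dots> = (eps_T g * ?Z m) * (eps_T g * ?Y (Suc m + g))"
      using shift by (simp add: mult_ac)
    also have "\<dots> = (?s * T_diff g b) * (fps_const ((- 1) ^ (Suc m + 1) * eps_factorial g) * T_diff g (b + 1))"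
      unfolding Suc.IH m Y by (simp add: mult_ac flip: fps_const_mult fps_const_neg)
    finally have "eps_T g * ?Z (Suc m) = fps_const ((- 1) ^ (Suc m + 1) * eps_factorial g) * T_diff g (b + 1)"
      using T_diff_nonzero[OF g b0] by simp
    moreover have "Suc m div g = b" using b g by simp
    ultimately show ?thesis by simp
  qed
qed

lemma q_number_T_diff:
  assumes "g \<ge> 1"
  shows "T_diff g 1 * q_number (of_nat g) b = T_diff g b"
  using sinh_quot_complex[of "of_nat g" "of_nat g * of_nat b"] assms
  by (simp add: T_diff_def q_number_eq)

text \<open>The coefficient of \<open>(X\<^sup>+)\<^sup>g\<close> from \<open>m\<^bsub>i+g\<^esub>\<close> to \<open>m\<^sub>i\<close> is a product over two runs of \<open>g\<close> consecutive numbers, starting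
  after \<open>i\<close> and after \<open>n - i - g\<close>. Each run contributes one factor \<open>[g-1]\<^sup>!\<^sub>\<epsilon>\<close> and one quotient by
  \<open>\<epsilon>T - \<epsilon>\<^sup>-\<^sup>1T\<^sup>-\<^sup>1\<close>, which the normalization of \<open>\<^sup>LX\<^sup>+\<close> removes, and a sign; the signs combine to \<open>(-1)\<^bsup>n+g\<^esup>\<close>.\<close>

lemma dual_coeff_prod:
  assumes g: "g \<ge> 1" and i: "i + g \<le> n"
  shows "dual_coeff g * fps_to_fls (\<Prod>l=1..g. eps_number g (i + l) * eps_number g (n - (i + l) + 1)) =
    fps_to_fls (fps_const ((- 1) ^ (n + g)) *
      (q_number (of_nat g) (i div g + 1) * q_number (of_nat g) ((n - i - g) div g + 1)))"
proof -
  let ?F = "eps_factorial g" and ?D = "eps_T g" and ?U = "T_diff g 1"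
  let ?q = "q_number (of_nat g) (i div g + 1) * q_number (of_nat g) ((n - i - g) div g + 1)"
  let ?C = "\<Prod>l=1..g. eps_number g (i + l) * eps_number g (n - (i + l) + 1)"
  have "(\<Prod>l=1..g. eps_number g (n - (i + l) + 1)) = (\<Prod>l=1..g. eps_number g (n - i - g + l))"
    by (rule prod.reindex_bij_witness[of _ "\<lambda>l. g + 1 - l" "\<lambda>l. g + 1 - l"])
      (use i in \<open>auto simp: Suc_diff_le\<close>)
  then have "?D ^ 2 * ?C = (?D * (\<Prod>l=1..g. eps_number g (i + l))) * (?D * (\<Prod>l=1..g. eps_number g (n - i - g + l)))"
    by (simp add: prod.distrib power2_eq_square mult_ac)
  also have "\<dots> = fps_const (((- 1) ^ (i + 1) * (- 1) ^ (n - i - g + 1)) * ?F ^ 2) *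
      (T_diff g (i div g + 1) * T_diff g ((n - i - g) div g + 1))"
    unfolding eps_number_prod[OF g] by (simp add: power2_eq_square mult_ac flip: fps_const_mult)
  also have "(- 1) ^ (i + 1) * (- 1) ^ (n - i - g + 1) = ((- 1) ^ (n + g) :: complex)"
  proof -
    have "even (i + 1 + (n - i - g + 1)) \<longleftrightarrow> even (n + g)" using i by presburger
    then have "(- 1 :: complex) ^ (i + 1 + (n - i - g + 1)) = (- 1) ^ (n + g)"
      by (simp only: minus_one_power_iff)
    then show ?thesis by (subst power_add[symmetric])
  qed
  also have "T_diff g (i div g + 1) * T_diff g ((n - i - g) div g + 1) = ?U ^ 2 * ?q"
  proof -
    have 1: "T_diff g (i div g + 1) = ?U * q_number (of_nat g) (i div g + 1)"
      by (rule q_number_T_diff[OF g, symmetric])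
    have 2: "T_diff g ((n - i - g) div g + 1) = ?U * q_number (of_nat g) ((n - i - g) div g + 1)"
      by (rule q_number_T_diff[OF g, symmetric])
    show ?thesis unfolding 1 2 by (simp only: power2_eq_square mult_ac)
  qed
  finally have "?D ^ 2 * ?C = fps_const ((- 1) ^ (n + g) * ?F ^ 2) * (?U ^ 2 * ?q)" .
  then have "fps_to_fls (?D ^ 2 * ?C) = fps_to_fls (fps_const ?F ^ 2 * (?U ^ 2 * (fps_const ((- 1) ^ (n + g)) * ?q)))"
    by (simp add: fps_const_power mult_ac flip: fps_const_mult)
  then have *: "fps_to_fls ?D ^ 2 * fps_to_fls ?C =
      fls_const ?F ^ 2 * (fps_to_fls ?U ^ 2 * fps_to_fls (fps_const ((- 1) ^ (n + g)) * ?q))"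
    by (simp only: fls_times_fps_to_fls fps_to_fls_power fps_const_to_fls)
  have nz: "fls_const ?F \<noteq> 0" "fps_to_fls ?U \<noteq> 0"
    using eps_factorial_nonzero T_diff_nonzero[OF g, of 1] by (simp_all add: fls_const_nonzero)
  have "dual_coeff g = inverse (fls_const ?F ^ 2) * fps_to_fls ?D ^ 2 * inverse (fps_to_fls ?U ^ 2)"
    by (simp add: dual_coeff_def eps_T_def T_diff_def)
  then have "dual_coeff g * fps_to_fls ?C =
      inverse (fls_const ?F ^ 2) * inverse (fps_to_fls ?U ^ 2) * (fps_to_fls ?D ^ 2 * fps_to_fls ?C)"
    by (simp only: mult_ac)
  also have "\<dots> = fps_to_fls (fps_const ((- 1) ^ (n + g)) * ?q)"
    unfolding * using nz by (simp add: field_simps)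
  finally show ?thesis .
qed

section \<open>The specialized module in coordinates\<close>

context
  fixes g n :: nat
  assumes g: "g \<ge> 1"
begin

lemma L_A_simps:
  "carrier (L_A n g) = {f. (\<forall>j>n. f j = 0) \<and> (\<forall>j. f j \<in> A_h')}"
  "zero (L_A n g) = (\<lambda>j. 0)" "add (L_A n g) = (\<lambda>f f' j. f j + f' j)"
  "module.smult (L_A n g) = (\<lambda>c f j. c * f j)" "act (L_A n g) = act (L_hh n g)"
proof -
  obtain \<rho> where L: "L_hh n g = (coord_module n)\<lparr>act := \<rho>\<rparr>" using L_hh_rep(2)[OF g] by blast
  show "carrier (L_A n g) = {f. (\<forall>j>n. f j = 0) \<and> (\<forall>j. f j \<in> A_h')}"
    "zero (L_A n g) = (\<lambda>j. 0)" "add (L_A n g) = (\<lambda>f f' j. f j + f' j)"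
    "module.smult (L_A n g) = (\<lambda>c f j. c * f j)" "act (L_A n g) = act (L_hh n g)"
    by (simp_all add: L_A_def L coord_module_def)
qed

text \<open>The preimages of a coordinate function over \<open>\<complex>[[h']]\<close> under \<open>Q = \<epsilon>\<close>. These are the elements of the quotient
  module \<open>L\<^bsup>\<epsilon>,h'\<^esup>(n,g)\<close>.\<close>

definition fibre :: "(nat \<Rightarrow> complex fps) \<Rightarrow> (nat \<Rightarrow> complex fps fps) set" where
  "fibre c = {f \<in> carrier (L_A n g). \<forall>j. spec g (f j) = c j}"

definition lift :: "(nat \<Rightarrow> complex fps) \<Rightarrow> nat \<Rightarrow> complex fps fps" where
  "lift c = (\<lambda>j. incl_h' (c j))"

abbreviation coords :: "(nat \<Rightarrow> complex fps) set" where
  "coords \<equiv> {c. \<forall>j>n. c j = 0}"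

lemma fibre_iff: "f \<in> fibre c \<longleftrightarrow> (\<forall>j>n. f j = 0) \<and> (\<forall>j. f j \<in> A_h') \<and> (\<forall>j. spec g (f j) = c j)"
  by (auto simp: fibre_def L_A_simps)

lemma incl_h'_0: "incl_h' 0 = 0"
  by (simp add: incl_h'_def fps_eq_iff)

lemma lift_fibre: "c \<in> coords \<Longrightarrow> lift c \<in> fibre c"
  by (simp add: fibre_iff lift_def A_h'_incl incl_h'_0)

abbreviation null :: "(nat \<Rightarrow> complex fps fps) set" where
  "null \<equiv> adic_closure fps_X (L_A n g) ((\<lambda>x. Q_minus_eps g \<odot>\<^bsub>L_A n g\<^esub> x) ` carrier (L_A n g))"

text \<open>By \<open>spec_kernel\<close> the multiples of \<open>Q - \<epsilon>\<close> are exactly the vectors specializing to \<open>0\<close>, and these form a closed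
  set.\<close>

lemma null_eq: "null = fibre (\<lambda>j. 0)"
proof (intro equalityI subsetI)
  fix f assume f: "f \<in> null"
  then have fc: "\<forall>j>n. f j = 0" "\<forall>j. f j \<in> A_h'" by (auto simp: adic_closure_def L_A_simps)
  have "spec g (f j) = 0" for j
  proof (rule fps_X_adic_zero)
    fix N
    obtain y z where yz: "y \<in> carrier (L_A n g)" "z \<in> carrier (L_A n g)"
      "f = (\<lambda>j. Q_minus_eps g * y j + fps_X ^ N * z j)"
      using f unfolding adic_closure_def L_A_simps by blast
    have "y j \<in> A_h'" "z j \<in> A_h'" using yz by (simp_all add: L_A_simps)
    then have "spec g (f j) = fps_X ^ N * spec g (z j)"
      by (simp add: yz(3) spec_add spec_mult A_h'_mult Q_minus_eps_A_h' A_h'_X_power spec_Q_minus_eps)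
    then show "\<exists>h. spec g (f j) = fps_X ^ N * h" by blast
  qed
  then show "f \<in> fibre (\<lambda>j. 0)" using fc by (simp add: fibre_iff)
next
  fix f assume "f \<in> fibre (\<lambda>j. 0)"
  then have f: "\<forall>j>n. f j = 0" "\<forall>j. f j \<in> A_h'" "\<forall>j. spec g (f j) = 0" by (auto simp: fibre_iff)
  have "\<forall>j. \<exists>y. y \<in> A_h' \<and> f j = Q_minus_eps g * y" using spec_kernel f(2,3) by blast
  from choice[OF this] obtain y where y: "\<forall>j. y j \<in> A_h' \<and> f j = Q_minus_eps g * y j" ..
  define y' where "y' = (\<lambda>j. if j \<le> n then y j else 0)"
  have y': "y' \<in> carrier (L_A n g)" using y by (simp add: L_A_simps y'_def A_h'_0)
  have fy: "f = Q_minus_eps g \<odot>\<^bsub>L_A n g\<^esub> y'" using y f(1) by (auto simp: L_A_simps y'_def fun_eq_iff)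
  have "f = f \<oplus>\<^bsub>L_A n g\<^esub> fps_X ^ N \<odot>\<^bsub>L_A n g\<^esub> (\<lambda>j. 0)" "(\<lambda>j. 0) \<in> carrier (L_A n g)" for N
    by (simp_all add: L_A_simps A_h'_0)
  moreover have "f \<in> carrier (L_A n g)" using f by (simp add: L_A_simps)
  ultimately show "f \<in> null" unfolding adic_closure_def using fy y' by blast
qed

lemma coset_null:
  assumes f: "f \<in> carrier (L_A n g)"
  shows "null +>\<^bsub>L_A n g\<^esub> f = fibre (\<lambda>j. spec g (f j))"
proof -
  have f': "\<forall>j>n. f j = 0" "\<And>j. f j \<in> A_h'" using f by (simp_all add: L_A_simps)
  have "null +>\<^bsub>L_A n g\<^esub> f = (\<lambda>h j. h j + f j) ` fibre (\<lambda>j. 0)"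
    unfolding a_r_coset_def' null_eq by (auto simp: L_A_simps(3))
  also have "\<dots> = fibre (\<lambda>j. spec g (f j))"
  proof (intro equalityI subsetI)
    fix x assume "x \<in> (\<lambda>h j. h j + f j) ` fibre (\<lambda>j. 0)"
    then show "x \<in> fibre (\<lambda>j. spec g (f j))" using f' by (auto simp: fibre_iff spec_add A_h'_add)
  next
    fix x assume x: "x \<in> fibre (\<lambda>j. spec g (f j))"
    then have "(\<lambda>j. x j - f j) \<in> fibre (\<lambda>j. 0)" using f' by (simp add: fibre_iff spec_diff A_h'_diff)
    then show "x \<in> (\<lambda>h j. h j + f j) ` fibre (\<lambda>j. 0)" by (rule rev_image_eqI) simp
  qed
  finally show ?thesis .
qed

lemma coset_null_fibre: "f \<in> fibre c \<Longrightarrow> null +>\<^bsub>L_A n g\<^esub> f = fibre c"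
  using coset_null[of f] by (simp add: fibre_iff L_A_simps)

lemma fibre_add:
  assumes "c \<in> coords" "d \<in> coords"
  shows "fibre c <+>\<^bsub>L_A n g\<^esub> fibre d = fibre (\<lambda>j. c j + d j)"
  unfolding set_add_def' L_A_simps
proof (intro equalityI subsetI)
  fix x assume "x \<in> (\<Union>h\<in>fibre c. \<Union>k\<in>fibre d. {\<lambda>j. h j + k j})"
  then obtain h k where "h \<in> fibre c" "k \<in> fibre d" "x = (\<lambda>j. h j + k j)" by blast
  then show "x \<in> fibre (\<lambda>j. c j + d j)" by (simp add: fibre_iff spec_add A_h'_add)
next
  fix x assume x: "x \<in> fibre (\<lambda>j. c j + d j)"
  have d: "lift d \<in> fibre d" by (rule lift_fibre) fact
  then have "(\<lambda>j. x j - lift d j) \<in> fibre c" using x by (simp add: fibre_iff spec_diff A_h'_diff)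
  moreover have "x = (\<lambda>j. (x j - lift d j) + lift d j)" by simp
  ultimately show "x \<in> (\<Union>h\<in>fibre c. \<Union>k\<in>fibre d. {\<lambda>j. h j + k j})" using d by blast
qed

lemma L_eps_simps:
  "carrier (L_eps n g) = fibre ` coords" "zero (L_eps n g) = fibre (\<lambda>j. 0)"
  "c \<in> coords \<Longrightarrow> d \<in> coords \<Longrightarrow> fibre c \<oplus>\<^bsub>L_eps n g\<^esub> fibre d = fibre (\<lambda>j. c j + d j)"
  "c \<in> coords \<Longrightarrow> a \<odot>\<^bsub>L_eps n g\<^esub> fibre c = fibre (\<lambda>j. a * c j)"
proof -
  have "carrier (L_eps n g) = (\<lambda>f. null +>\<^bsub>L_A n g\<^esub> f) ` carrier (L_A n g)"
    unfolding L_eps_def quot_rep_def A_RCOSETS_def' by auto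
  also have "\<dots> = fibre ` coords"
  proof (intro equalityI subsetI)
    fix Z assume "Z \<in> (\<lambda>f. null +>\<^bsub>L_A n g\<^esub> f) ` carrier (L_A n g)"
    then obtain f where f: "f \<in> carrier (L_A n g)" "Z = fibre (\<lambda>j. spec g (f j))" using coset_null by auto
    have "(\<lambda>j. spec g (f j)) \<in> coords" using f(1) by (simp add: L_A_simps)
    then show "Z \<in> fibre ` coords" using f(2) by blast
  next
    fix Z assume "Z \<in> fibre ` coords"
    then obtain c where c: "c \<in> coords" "Z = fibre c" by auto
    have l: "lift c \<in> fibre c" by (rule lift_fibre[OF c(1)])
    then have "Z = null +>\<^bsub>L_A n g\<^esub> lift c" using coset_null_fibre c(2) by blast
    moreover have "lift c \<in> carrier (L_A n g)" using l by (simp add: fibre_def)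
    ultimately show "Z \<in> (\<lambda>f. null +>\<^bsub>L_A n g\<^esub> f) ` carrier (L_A n g)" by blast
  qed
  finally show "carrier (L_eps n g) = fibre ` coords" .
  show "zero (L_eps n g) = fibre (\<lambda>j. 0)" by (simp add: L_eps_def quot_rep_def null_eq)
  show "fibre c \<oplus>\<^bsub>L_eps n g\<^esub> fibre d = fibre (\<lambda>j. c j + d j)" if "c \<in> coords" "d \<in> coords"
    using fibre_add[OF that] by (simp add: L_eps_def quot_rep_def)
  show "a \<odot>\<^bsub>L_eps n g\<^esub> fibre c = fibre (\<lambda>j. a * c j)" if c: "c \<in> coords"
  proof -
    have "null +>\<^bsub>L_A n g\<^esub> (incl_h' a \<odot>\<^bsub>L_A n g\<^esub> x) = fibre (\<lambda>j. a * c j)" if "x \<in> fibre c" for x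
      by (rule coset_null_fibre) (use that in \<open>simp add: fibre_iff L_A_simps A_h'_mult A_h'_incl spec_mult\<close>)
    then have "(\<Union>x\<in>fibre c. null +>\<^bsub>L_A n g\<^esub> (incl_h' a \<odot>\<^bsub>L_A n g\<^esub> x)) = fibre (\<lambda>j. a * c j)"
      using lift_fibre[OF c] by (intro SUP_eq_const) auto
    then show ?thesis by (simp add: L_eps_def quot_rep_def)
  qed
qed

lemma lin_transfer_L_eps: "lin_transfer (coord_on {..n}) (L_eps n g) fibre"
proof -
  have "inj_on fibre coords"
  proof (rule inj_onI)
    fix c d assume "c \<in> coords" "d \<in> coords" "fibre c = fibre d"
    then have "lift c \<in> fibre c" "lift c \<in> fibre d" using lift_fibre by auto
    then show "c = d" by (auto simp: fibre_iff fun_eq_iff)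
  qed
  then show ?thesis
    unfolding lin_transfer_def coord_on_simps
    using L_eps_simps by (auto simp: bij_betw_def not_le)
qed

lemma act_L_eps:
  assumes F: "F \<in> carrier (U_eps g)" and c: "c \<in> coords"
  shows "act (L_eps n g) F (fibre c) = fibre (mat_act n (eps_mat g n F) c)"
proof -
  obtain u where u: "u \<in> carrier (U_A g)" "F = eps_ideal g +>\<^bsub>U_A g\<^esub> u" using F carrier_U_eps by auto
  interpret J: ideal "eps_ideal g" "U_A g" by (rule ideal_eps_ideal)
  have *: "null +>\<^bsub>L_A n g\<^esub> act (L_A n g) y x = fibre (mat_act n (eps_mat g n F) c)"
    if y: "y \<in> F" and x: "x \<in> fibre c" for x y
  proof (rule coset_null_fibre)
    have "y \<in> carrier (U_A g)"
      using y u J.a_Hcarr A.a_closed unfolding u(2) eps.mem_coset by auto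
    then have ye: "hh_cmat g n y i j \<in> A_h'" "A_mat g n y i j = spec g (hh_cmat g n y i j)" if "i \<le> n" "j \<le> n" for i j
      using hh_cmat_A_h'[OF g] A_mat_def[OF g] that by auto
    obtain y' where y': "y = hh_class g y'"
      using \<open>y \<in> carrier (U_A g)\<close> U_A_closed(1) carrier_U_hh by blast
    have xc: "x \<in> carrier (L_hh n g)" "\<And>j. x j \<in> A_h'" "\<And>j. spec g (x j) = c j"
      using x by (auto simp: fibre_iff carrier_L_hh[OF g])
    have ax: "act (L_A n g) y x = mat_act n (hh_cmat g n y) x"
      unfolding L_A_simps y' L_hh_rep(3)[OF g xc(1)]
      by (rule mat_act_cong) (simp add: hh_cmat_class[OF g])
    have "spec g (\<Sum>j\<le>n. hh_cmat g n y i j * x j) = (\<Sum>j\<le>n. eps_mat g n F i j * c j)" if "i \<le> n" for i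
    proof -
      have "spec g (\<Sum>j\<le>n. hh_cmat g n y i j * x j) = (\<Sum>j\<le>n. spec g (hh_cmat g n y i j * x j))"
        by (rule spec_sum) (use that ye xc in \<open>simp add: A_h'_mult\<close>)
      also have "\<dots> = (\<Sum>j\<le>n. A_mat g n y i j * c j)"
        by (rule sum.cong) (use that ye xc in \<open>simp_all add: spec_mult\<close>)
      also have "\<dots> = (\<Sum>j\<le>n. eps_mat g n F i j * c j)"
        using that A_mat_coset[OF g u(1)] eps_mat_coset[OF g u(1)] y unfolding u(2) by (intro sum.cong) auto
      finally show ?thesis .
    qed
    moreover have "(\<Sum>j\<le>n. hh_cmat g n y i j * x j) \<in> A_h'" if "i \<le> n" for i
      by (rule A_h'_sum) (use that ye xc in \<open>simp add: A_h'_mult\<close>)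
    ultimately show "act (L_A n g) y x \<in> fibre (mat_act n (eps_mat g n F) c)"
      unfolding ax fibre_iff by (simp add: mat_act_def A_h'_0)
  qed
  have "u \<in> F" unfolding u(2) by (rule eps.self_mem_coset[OF u(1)])
  have inner: "(\<Union>x\<in>fibre c. null +>\<^bsub>L_A n g\<^esub> act (L_A n g) y x) = fibre (mat_act n (eps_mat g n F) c)" if "y \<in> F" for y
    using lift_fibre[OF c] *[OF that] by (intro SUP_eq_const) auto
  have "(\<Union>y\<in>F. \<Union>x\<in>fibre c. null +>\<^bsub>L_A n g\<^esub> act (L_A n g) y x) = fibre (mat_act n (eps_mat g n F) c)"
  proof (rule SUP_eq_const)
    show "F \<noteq> {}" using \<open>u \<in> F\<close> by blast
  qed (rule inner)
  then show ?thesis by (simp add: L_eps_def quot_rep_def)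
qed

lemma alg_module_L_eps: "alg_module (U_eps g) (L_eps n g)"
proof -
  interpret ring "U_eps g" by (rule ring_U_eps)
  let ?W = "(coord_module n)\<lparr>act := \<lambda>F. mat_act n (eps_mat g n F)\<rparr> :: (complex fps, nat \<Rightarrow> complex fps, gen free_alg fps fps set set) rep"
  have W: "alg_module (U_eps g) ?W"
    by (rule alg_module_matrep[OF matrep_eps_mat[OF g]]) (simp_all add: smult_closed_U_eps)
  have tr: "lin_transfer ?W (L_eps n g) fibre"
    using lin_transfer_L_eps by (simp add: lin_transfer_def coord_module_eq)
  show ?thesis
    by (rule alg_module_lin_transfer[OF W tr])
      (use act_L_eps in \<open>simp_all add: smult_closed_U_eps coord_module_def\<close>)
qed

lemma weight_coords_L_eps:
  "weight_coords {..n} (L_eps n g) fibre (eps_gen g H_gen) (\<lambda>j. int n - 2 * int j)"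
proof
  fix f :: "nat \<Rightarrow> complex fps"
  assume "f \<in> carrier (coord_on {..n} :: (complex fps, nat \<Rightarrow> complex fps, gen free_alg fps fps set set) rep)"
  then have f: "f \<in> coords" by (auto simp: not_le)
  have "mat_act n (eps_mat g n (eps_gen g H_gen)) f = (\<lambda>j. of_int (int n - 2 * int j) * f j)"
  proof (rule ext)
    fix i
    have "(\<Sum>j\<le>n. eps_mat g n (eps_gen g H_gen) i j * f j) = of_int (int n - 2 * int i) * f i" if "i \<le> n"
      using that by (subst sum_only[of i])
        (auto simp: eps_mat_gen[OF g] L_hh_mat_def spec_of_int simp del: of_int_diff)
    then show "mat_act n (eps_mat g n (eps_gen g H_gen)) f i = of_int (int n - 2 * int i) * f i"
      using f by (auto simp: mat_act_def simp del: of_int_diff)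
  qed
  then show "act (L_eps n g) (eps_gen g H_gen) (fibre f) = fibre (\<lambda>j. of_int (int n - 2 * int j) * f j)"
    using act_L_eps[OF eps_gen_carrier f] by simp
qed (use lin_transfer_L_eps in simp_all)

lemma weight_module_L_eps: "weight_module (U_eps g) (eps_gen g H_gen) (L_eps n g)"
  by (rule weight_coords.weight_moduleI[OF weight_coords_L_eps alg_module_L_eps])

lemma dual_space_eq:
  "dual_space n g = fibre ` {c \<in> coords. \<forall>j. c j \<noteq> 0 \<longrightarrow> int g dvd int n - 2 * int j}"
  unfolding dual_space_def weight_coords.sum_of_weight_spaces_eq[OF weight_coords_L_eps] by (simp add: not_le)

lemma mat_act_closed: "mat_act n B c \<in> coords"
  by (simp add: mat_act_def)

lemma act_L_eps_pow:
  assumes F: "F \<in> carrier (U_eps g)" and c: "c \<in> coords"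
  shows "act (L_eps n g) (F [^]\<^bsub>U_eps g\<^esub> k) (fibre c) = fibre ((mat_act n (eps_mat g n F) ^^ k) c)"
proof -
  interpret R: ring "U_eps g" by (rule ring_U_eps)
  let ?M = "mat_act n (eps_mat g n F)"
  note A = alg_moduleD[OF alg_module_L_eps]
  show ?thesis using c
  proof (induction k arbitrary: c)
    case 0
    then show ?case using A(8)[of "fibre c"] L_eps_simps(1) by auto
  next
    case (Suc k)
    have car: "fibre c \<in> carrier (L_eps n g)" using Suc.prems L_eps_simps(1) by auto
    have "act (L_eps n g) (F [^]\<^bsub>U_eps g\<^esub> Suc k) (fibre c) =
        act (L_eps n g) (F [^]\<^bsub>U_eps g\<^esub> k) (act (L_eps n g) F (fibre c))"
      using A(7)[OF R.nat_pow_closed[OF F] F car] by simp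
    also have "\<dots> = fibre ((?M ^^ k) (?M c))"
      unfolding act_L_eps[OF F Suc.prems] by (rule Suc.IH[OF mat_act_closed])
    finally show ?case by (simp add: funpow_swap1)
  qed
qed

lemma lowering_pow:
  assumes c: "c \<in> coords"
  shows "(mat_act n (eps_mat g n (eps_gen g X_minus)) ^^ k) c = (\<lambda>i. if k \<le> i \<and> i \<le> n then c (i - k) else 0)"
proof (induction k)
  case 0
  then show ?case using c by (auto simp: fun_eq_iff)
next
  case (Suc k)
  let ?M = "mat_act n (eps_mat g n (eps_gen g X_minus))"
  have M: "?M d = (\<lambda>i. if 0 < i \<and> i \<le> n then d (i - 1) else 0)" for d
  proof (rule ext)
    fix i
    have "(\<Sum>j\<le>n. eps_mat g n (eps_gen g X_minus) i j * d j) = (if 0 < i then d (i - 1) else 0)" if i: "i \<le> n"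
    proof (cases i)
      case 0
      then show ?thesis by (auto simp: eps_mat_gen[OF g] L_hh_mat_def intro!: sum.neutral)
    next
      case (Suc m)
      then show ?thesis using i by (subst sum_only[of m]) (auto simp: eps_mat_gen[OF g] L_hh_mat_def)
    qed
    then show "?M d i = (if 0 < i \<and> i \<le> n then d (i - 1) else 0)"
      by (cases "i \<le> n") (simp_all add: mat_act_def)
  qed
  show ?case unfolding funpow.simps comp_apply unfolding Suc.IH unfolding M by (auto simp: fun_eq_iff)
qed

lemma raising_pow:
  assumes c: "c \<in> coords"
  shows "(mat_act n (eps_mat g n (eps_gen g X_plus)) ^^ k) c = (\<lambda>i. if i + k \<le> n
    then (\<Prod>l=1..k. eps_number g (i + l) * eps_number g (n - (i + l) + 1)) * c (i + k) else 0)"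
proof (induction k)
  case 0
  then show ?case using c by (auto simp: fun_eq_iff)
next
  case (Suc k)
  let ?M = "mat_act n (eps_mat g n (eps_gen g X_plus))"
  let ?b = "\<lambda>j. eps_number g j * eps_number g (n - j + 1)"
  have M: "?M d = (\<lambda>i. if i < n then ?b (Suc i) * d (Suc i) else 0)" for d
  proof (rule ext)
    fix i
    have e: "eps_mat g n (eps_gen g X_plus) i j = of_bool (j = Suc i) * ?b j" if "i \<le> n" "j \<le> n" for j
      using that by (simp add: eps_mat_gen[OF g] L_hh_mat_def eps_number_def spec_mult QT_number_A_h' del: of_nat_Suc)
    have "(\<Sum>j\<le>n. eps_mat g n (eps_gen g X_plus) i j * d j) = (if i < n then ?b (Suc i) * d (Suc i) else 0)" if i: "i \<le> n"
    proof (cases "i < n")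
      case True
      then show ?thesis by (subst sum_only[of "Suc i"]) (auto simp: e)
    next
      case False
      have "eps_mat g n (eps_gen g X_plus) i j * d j = 0" if "j \<le> n" for j
      proof -
        have "j \<noteq> Suc i" using False that by simp
        then show ?thesis by (simp add: e[OF i that])
      qed
      then show ?thesis using False by (simp add: sum.neutral)
    qed
    then show "?M d i = (if i < n then ?b (Suc i) * d (Suc i) else 0)"
      by (cases "i \<le> n") (simp_all add: mat_act_def)
  qed
  have "(\<Prod>l=1..Suc k. ?b (i + l)) = ?b (Suc i) * (\<Prod>l=1..k. ?b (Suc i + l))" for i
  proof -
    have "(\<Prod>l=1..Suc k. ?b (i + l)) = ?b (i + 1) * (\<Prod>l=Suc 1..Suc k. ?b (i + l))"
      by (rule prod.atLeast_Suc_atMost) simp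
    also have "(\<Prod>l=Suc 1..Suc k. ?b (i + l)) = (\<Prod>l=1..k. ?b (i + Suc l))"
      by (rule prod.shift_bounds_cl_Suc_ivl)
    finally show ?thesis by simp
  qed
  then show ?case unfolding funpow.simps comp_apply unfolding Suc.IH unfolding M by (auto simp: fun_eq_iff mult.assoc)
qed

end

section \<open>Localization at \<open>h'\<close>\<close>

context
  fixes V :: "(complex fps, 'm, 'u) rep"
  assumes V: "module (ring_of_type_algebra :: complex fps ring) V"
begin

lemma smult_smult: "v \<in> carrier V \<Longrightarrow> c \<odot>\<^bsub>V\<^esub> (d \<odot>\<^bsub>V\<^esub> v) = (c * d) \<odot>\<^bsub>V\<^esub> v"
  using module.smult_assoc1[OF V, of c d v] by (simp add: ring_of_type_algebra_def)

lemma smult_one: "v \<in> carrier V \<Longrightarrow> 1 \<odot>\<^bsub>V\<^esub> v = v"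
  using module.smult_one[OF V, of v] by (simp add: ring_of_type_algebra_def)

lemma loc_rel_iff: "((v, k), (w, l)) \<in> loc_rel V \<longleftrightarrow> v \<in> carrier V \<and> w \<in> carrier V \<and>
    (\<exists>r. fps_X ^ (r + l) \<odot>\<^bsub>V\<^esub> v = fps_X ^ (r + k) \<odot>\<^bsub>V\<^esub> w)"
  by (simp add: loc_rel_def)

lemma equiv_loc_rel: "equiv (carrier V \<times> UNIV) (loc_rel V)"
proof -
  have "((v, k), (u, m)) \<in> loc_rel V"
    if A: "((v, k), (w, l)) \<in> loc_rel V" and B: "((w, l), (u, m)) \<in> loc_rel V" for v k w l u m
  proof -
    obtain r where r: "fps_X ^ (r + l) \<odot>\<^bsub>V\<^esub> v = fps_X ^ (r + k) \<odot>\<^bsub>V\<^esub> w" using A loc_rel_iff by blast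
    obtain q where q: "fps_X ^ (q + m) \<odot>\<^bsub>V\<^esub> w = fps_X ^ (q + l) \<odot>\<^bsub>V\<^esub> u" using B loc_rel_iff by blast
    have c: "v \<in> carrier V" "w \<in> carrier V" "u \<in> carrier V" using A B loc_rel_iff by blast+
    have "fps_X ^ (r + q + l + m) \<odot>\<^bsub>V\<^esub> v = fps_X ^ (q + m) \<odot>\<^bsub>V\<^esub> (fps_X ^ (r + l) \<odot>\<^bsub>V\<^esub> v)"
      unfolding smult_smult[OF c(1)] by (simp add: power_add mult_ac)
    also have "\<dots> = fps_X ^ (r + k) \<odot>\<^bsub>V\<^esub> (fps_X ^ (q + m) \<odot>\<^bsub>V\<^esub> w)"
      unfolding r smult_smult[OF c(2)] by (simp add: mult_ac)
    also have "\<dots> = fps_X ^ (r + q + l + k) \<odot>\<^bsub>V\<^esub> u"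
      unfolding q smult_smult[OF c(3)] by (simp add: power_add mult_ac)
    finally show ?thesis using c loc_rel_iff by blast
  qed
  then have "trans (loc_rel V)" unfolding trans_def by (metis surj_pair)
  moreover have "sym (loc_rel V)" unfolding sym_def by (auto simp: loc_rel_def) metis
  moreover have "loc_rel V \<subseteq> (carrier V \<times> UNIV) \<times> (carrier V \<times> UNIV)" by (auto simp: loc_rel_def)
  moreover have "refl_on (carrier V \<times> UNIV) (loc_rel V)" by (auto simp: loc_rel_def refl_on_def)
  ultimately show ?thesis by (simp add: equiv_def)
qed

lemma loc_frac_eq_iff:
  assumes "v \<in> carrier V" "w \<in> carrier V"
  shows "loc_frac V v k = loc_frac V w l \<longleftrightarrow>
    (\<exists>r. fps_X ^ (r + l) \<odot>\<^bsub>V\<^esub> v = fps_X ^ (r + k) \<odot>\<^bsub>V\<^esub> w)"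
  unfolding loc_frac_def using eq_equiv_class_iff[OF equiv_loc_rel, of "(v, k)" "(w, l)"] assms
  by (simp add: loc_rel_iff)

lemma UN_loc_frac:
  assumes v: "v \<in> carrier V"
    and F: "\<And>v k w l r. v \<in> carrier V \<Longrightarrow> w \<in> carrier V \<Longrightarrow>
      fps_X ^ (r + l) \<odot>\<^bsub>V\<^esub> v = fps_X ^ (r + k) \<odot>\<^bsub>V\<^esub> w \<Longrightarrow> F v k = F w l"
  shows "(\<Union>(w, l)\<in>loc_frac V v k. F w l) = F v k"
proof -
  have "(\<lambda>(w, l). F w l) respects loc_rel V"
  proof (rule congruentI)
    fix p q assume pq: "(p, q) \<in> loc_rel V"
    obtain v k w l where e: "p = (v, k)" "q = (w, l)" by (metis surj_pair)
    then obtain r where "v \<in> carrier V" "w \<in> carrier V" "fps_X ^ (r + l) \<odot>\<^bsub>V\<^esub> v = fps_X ^ (r + k) \<odot>\<^bsub>V\<^esub> w"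
      using pq loc_rel_iff by blast
    then show "(case p of (w, l) \<Rightarrow> F w l) = (case q of (w, l) \<Rightarrow> F w l)"
      unfolding e prod.case by (rule F)
  qed
  from UN_equiv_class[OF equiv_loc_rel this, of "(v, k)"] show ?thesis
    using v by (simp add: loc_frac_def)
qed

lemma localize_act:
  assumes v: "v \<in> carrier V"
    and u: "\<And>x. x \<in> carrier V \<Longrightarrow> act V u x \<in> carrier V"
      "\<And>c x. x \<in> carrier V \<Longrightarrow> act V u (c \<odot>\<^bsub>V\<^esub> x) = c \<odot>\<^bsub>V\<^esub> act V u x"
  shows "act (localize V) u (loc_frac V v k) = loc_frac V (act V u v) k"
proof -
  have "(\<Union>(w, l)\<in>loc_frac V v k. loc_frac V (act V u w) l) = loc_frac V (act V u v) k"
  proof (rule UN_loc_frac[OF v])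
    fix v k w l r
    assume *: "v \<in> carrier V" "w \<in> carrier V" "fps_X ^ (r + l) \<odot>\<^bsub>V\<^esub> v = fps_X ^ (r + k) \<odot>\<^bsub>V\<^esub> w"
    then have "fps_X ^ (r + l) \<odot>\<^bsub>V\<^esub> act V u v = fps_X ^ (r + k) \<odot>\<^bsub>V\<^esub> act V u w"
      using u(2) by metis
    then show "loc_frac V (act V u v) k = loc_frac V (act V u w) l"
      using * u(1) by (subst loc_frac_eq_iff) blast+
  qed
  then show ?thesis by (simp add: localize_def)
qed

lemma localize_smult:
  assumes v: "v \<in> carrier V"
  shows "c \<odot>\<^bsub>localize V\<^esub> loc_frac V v k = loc_frac V
    ((fps_X ^ nat (fls_subdegree c) * fls_base_factor_to_fps c) \<odot>\<^bsub>V\<^esub> v) (k + nat (- fls_subdegree c))"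
proof -
  let ?a = "fps_X ^ nat (fls_subdegree c) * fls_base_factor_to_fps c" and ?d = "nat (- fls_subdegree c)"
  have "(\<Union>(w, l)\<in>loc_frac V v k. loc_frac V (?a \<odot>\<^bsub>V\<^esub> w) (l + ?d)) = loc_frac V (?a \<odot>\<^bsub>V\<^esub> v) (k + ?d)"
  proof (rule UN_loc_frac[OF v])
    fix v k w l r
    assume *: "v \<in> carrier V" "w \<in> carrier V" "fps_X ^ (r + l) \<odot>\<^bsub>V\<^esub> v = fps_X ^ (r + k) \<odot>\<^bsub>V\<^esub> w"
    have "fps_X ^ (r + (l + ?d)) \<odot>\<^bsub>V\<^esub> (?a \<odot>\<^bsub>V\<^esub> v) = (fps_X ^ ?d * ?a) \<odot>\<^bsub>V\<^esub> (fps_X ^ (r + l) \<odot>\<^bsub>V\<^esub> v)"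
      unfolding smult_smult[OF *(1)] by (simp add: power_add mult_ac)
    also have "\<dots> = fps_X ^ (r + (k + ?d)) \<odot>\<^bsub>V\<^esub> (?a \<odot>\<^bsub>V\<^esub> w)"
      unfolding *(3) smult_smult[OF *(2)] by (simp add: power_add mult_ac)
    finally show "loc_frac V (?a \<odot>\<^bsub>V\<^esub> v) (k + ?d) = loc_frac V (?a \<odot>\<^bsub>V\<^esub> w) (l + ?d)"
      using * module_type_smult_closed[OF V] by (subst loc_frac_eq_iff) blast+
  qed
  then show ?thesis by (simp add: localize_def)
qed

end

lemma fls_times_X_power:
  fixes c :: "complex fls"
  shows "c * fps_to_fls (fps_X ^ nat (- fls_subdegree c)) =
    fps_to_fls (fps_X ^ nat (fls_subdegree c) * fls_base_factor_to_fps c)"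
proof -
  have X: "fps_to_fls (fps_X ^ m) = fls_shift (- int m) (1 :: complex fls)" for m
    by (simp add: fps_to_fls_power fls_X_power_conv_shift_1)
  show ?thesis
    by (simp only: fls_times_fps_to_fls X fps_to_fls_base_factor_to_fps fls_shifted_times_simps mult_1_right mult_1_left)
      (simp add: fls_shift_fls_shift[symmetric] fls_base_factor_def)
qed

text \<open>A free module has no \<open>h'\<close>-torsion, so an identity between Laurent series in every coordinate may be multiplied by a
  power of \<open>h'\<close> to become an identity of fractions.\<close>

lemma localize_smult_coords:
  fixes V :: "(complex fps, 'm, 'u) rep"
  assumes tr: "lin_transfer (coord_on J :: (complex fps, nat \<Rightarrow> complex fps, 'u) rep) V \<beta>"
    and x: "\<forall>j. j \<notin> J \<longrightarrow> x j = 0" and y: "\<forall>j. j \<notin> J \<longrightarrow> y j = 0"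
    and eq: "\<And>j. c * fps_to_fls (x j) = fps_to_fls (y j)"
  shows "c \<odot>\<^bsub>localize V\<^esub> loc_frac V (\<beta> x) 0 = loc_frac V (\<beta> y) 0"
proof -
  note D = lin_transferD[OF tr, unfolded coord_on_simps]
  have V: "module (ring_of_type_algebra :: complex fps ring) V"
    by (rule module_lin_transfer[OF module_coord_on tr])
  let ?a = "fps_X ^ nat (fls_subdegree c) * fls_base_factor_to_fps c" and ?d = "nat (- fls_subdegree c)"
  have "?a * x j = fps_X ^ ?d * y j" for j
  proof -
    have "fps_to_fls (?a * x j) = c * fps_to_fls (fps_X ^ ?d) * fps_to_fls (x j)"
      by (simp add: fls_times_X_power fls_times_fps_to_fls)
    also have "\<dots> = fps_to_fls (fps_X ^ ?d * y j)"
      by (simp add: fls_times_fps_to_fls mult_ac flip: eq)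
    finally show ?thesis by (simp only: fps_to_fls_eq_iff)
  qed
  moreover have xy: "\<beta> x \<in> carrier V" "\<beta> y \<in> carrier V" using x y D(1) by auto
  ultimately have "?a \<odot>\<^bsub>V\<^esub> \<beta> x = fps_X ^ ?d \<odot>\<^bsub>V\<^esub> \<beta> y"
    using D(5)[of x ?a] D(5)[of y "fps_X ^ ?d"] x y by simp
  then have "loc_frac V (?a \<odot>\<^bsub>V\<^esub> \<beta> x) (0 + ?d) = loc_frac V (\<beta> y) 0"
    using xy module_type_smult_closed[OF V]
    by (subst loc_frac_eq_iff[OF V]) (auto intro!: exI[of _ 0] simp: smult_one[OF V])
  then show ?thesis unfolding localize_smult[OF V xy(1)] .
qed

lemma loc_frac_inj:
  fixes V :: "(complex fps, 'm, 'u) rep"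
  assumes tr: "lin_transfer (coord_on J :: (complex fps, nat \<Rightarrow> complex fps, 'u) rep) V \<beta>"
    and x: "\<forall>j. j \<notin> J \<longrightarrow> x j = 0" and y: "\<forall>j. j \<notin> J \<longrightarrow> y j = 0"
    and eq: "loc_frac V (\<beta> x) 0 = loc_frac V (\<beta> y) 0"
  shows "x = y"
proof -
  note D = lin_transferD[OF tr, unfolded coord_on_simps]
  have V: "module (ring_of_type_algebra :: complex fps ring) V"
    by (rule module_lin_transfer[OF module_coord_on tr])
  have xy: "\<beta> x \<in> carrier V" "\<beta> y \<in> carrier V" using x y D(1) by auto
  obtain r where r: "fps_X ^ (r + 0) \<odot>\<^bsub>V\<^esub> \<beta> x = fps_X ^ (r + 0) \<odot>\<^bsub>V\<^esub> \<beta> y"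
    using eq unfolding loc_frac_eq_iff[OF V xy] by blast
  then have "\<beta> (\<lambda>j. fps_X ^ r * x j) = \<beta> (\<lambda>j. fps_X ^ r * y j)" using D(5) x y by simp
  then have "(\<lambda>j. fps_X ^ r * x j) = (\<lambda>j. fps_X ^ r * y j)" using D(6) x y by simp
  then show ?thesis by (simp add: fun_eq_iff)
qed

section \<open>The dual operators in coordinates\<close>

text \<open>The operators \<open>\<^sup>LX\<^sup>\<plusminus>\<close>, \<open>\<^sup>LH\<close> in coordinates, with the sign of \<open>\<^sup>LX\<^sup>+\<close> removed.\<close>

definition dual_act :: "nat \<Rightarrow> nat \<Rightarrow> qgen \<Rightarrow> (nat \<Rightarrow> complex fps) \<Rightarrow> nat \<Rightarrow> complex fps" where
  "dual_act g n x c = (case x of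
     Xt_plus \<Rightarrow> (\<lambda>i. if i + g \<le> n
       then q_number (of_nat g) (i div g + 1) * q_number (of_nat g) ((n - i - g) div g + 1) * c (i + g) else 0)
   | Xt_minus \<Rightarrow> (\<lambda>i. if g \<le> i \<and> i \<le> n then c (i - g) else 0)
   | Ht_gen \<Rightarrow> (\<lambda>i. fps_const (1 / of_nat g) * of_int (int n - 2 * int i) * c i))"

context
  fixes g n :: nat
  assumes g: "g \<ge> 1"
begin

lemma localize_act_L_eps:
  assumes F: "F \<in> carrier (U_eps g)" and c: "\<forall>j>n. c j = 0"
  shows "act (localize (L_eps n g)) F (loc_frac (L_eps n g) (fibre g n c) 0) =
    loc_frac (L_eps n g) (act (L_eps n g) F (fibre g n c)) 0"
proof -
  note A = alg_moduleD[OF alg_module_L_eps[OF g, of n]]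
  have "fibre g n c \<in> carrier (L_eps n g)" using L_eps_simps(1)[OF g, of n] c by auto
  then show ?thesis by (rule localize_act[OF A(1)]) (rule A(2)[OF F] A(4)[OF F], assumption)+
qed

text \<open>The sign for \<open>Xt_plus\<close> is the one by which \<open>\<^sup>LX\<^sup>+\<close> fails to satisfy the relations of \<open>U\<^bsub>gh'\<^esub>(sl\<^sub>2)\<close>.\<close>

lemma dual_op_fibre:
  assumes c: "\<forall>j>n. c j = 0"
  shows "dual_op n g x (loc_frac (L_eps n g) (fibre g n c) 0) = loc_frac (L_eps n g)
    (fibre g n (\<lambda>i. (if x = Xt_plus then fps_const ((- 1) ^ (n + g)) else 1) * dual_act g n x c i)) 0"
proof -
  interpret R: ring "U_eps g" by (rule ring_U_eps)
  have c': "c \<in> {c. \<forall>j>n. c j = 0}" using c by simp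
  note pow = localize_act_L_eps[OF R.nat_pow_closed[OF eps_gen_carrier] c, of _ g]
    act_L_eps_pow[OF g eps_gen_carrier c', of _ g]
  note sm = localize_smult_coords[OF lin_transfer_L_eps[OF g]]
  show ?thesis
  proof (cases x)
    case Xt_plus
    let ?x = "\<lambda>i. if i + g \<le> n then (\<Prod>l=1..g. eps_number g (i + l) * eps_number g (n - (i + l) + 1)) * c (i + g) else 0"
    let ?y = "\<lambda>i. fps_const ((- 1) ^ (n + g)) * dual_act g n Xt_plus c i"
    have "dual_coeff g \<odot>\<^bsub>localize (L_eps n g)\<^esub> loc_frac (L_eps n g) (fibre g n ?x) 0 = loc_frac (L_eps n g) (fibre g n ?y) 0"
    proof (rule sm)
      fix i
      show "dual_coeff g * fps_to_fls (?x i) = fps_to_fls (?y i)"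
      proof (cases "i + g \<le> n")
        case True
        let ?P = "\<Prod>l=1..g. eps_number g (i + l) * eps_number g (n - (i + l) + 1)"
        have "dual_coeff g * fps_to_fls (?P * c (i + g)) = dual_coeff g * fps_to_fls ?P * fps_to_fls (c (i + g))"
          by (simp only: fls_times_fps_to_fls mult.assoc)
        also have "\<dots> = fps_to_fls (?y i)"
          unfolding dual_coeff_prod[OF g True] using True
          by (simp only: dual_act_def qgen.case if_True flip: fls_times_fps_to_fls) (simp only: mult.assoc)
        finally show ?thesis using True by simp
      qed (simp add: dual_act_def)
    qed (auto simp: dual_act_def)
    then show ?thesis
      by (simp add: Xt_plus dual_op_def Let_def pow raising_pow[OF g c'])
  next
    case Xt_minus
    then show ?thesis
      by (simp add: dual_op_def Let_def pow lowering_pow[OF g c'] dual_act_def)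
  next
    case Ht_gen
    have H: "act (L_eps n g) (eps_gen g H_gen) (fibre g n c) = fibre g n (\<lambda>j. of_int (int n - 2 * int j) * c j)"
      using weight_coords.H[OF weight_coords_L_eps[OF g]] c by (simp add: not_le)
    have "fls_const (1 / of_nat g) \<odot>\<^bsub>localize (L_eps n g)\<^esub>
        loc_frac (L_eps n g) (fibre g n (\<lambda>j. of_int (int n - 2 * int j) * c j)) 0 =
      loc_frac (L_eps n g) (fibre g n (\<lambda>j. fps_const (1 / of_nat g) * (of_int (int n - 2 * int j) * c j))) 0"
      by (rule sm) (use c in \<open>simp_all add: fls_times_fps_to_fls\<close>)
    then show ?thesis
      by (simp add: Ht_gen dual_op_def Let_def localize_act_L_eps[OF eps_gen_carrier c] H dual_act_def mult.assoc)
  qed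
qed

text \<open>Multiplication by \<open>s\<close> restores the sign; for \<open>n = 0\<close> both sides vanish on \<open>Xt_plus\<close>, because \<open>(X\<^sup>+)\<^sup>g\<close> does.\<close>

lemma twisted_dual_op_fibre:
  assumes c: "\<forall>j>n. c j = 0" and s: "n = 0 \<or> s = (- 1) ^ (n + g)"
  shows "twisted_dual_op s n g x (loc_frac (L_eps n g) (fibre g n c) 0) =
    loc_frac (L_eps n g) (fibre g n (dual_act g n x c)) 0"
proof (cases "x = Xt_plus")
  case True
  have "of_int s \<odot>\<^bsub>localize (L_eps n g)\<^esub> loc_frac (L_eps n g)
      (fibre g n (\<lambda>i. fps_const ((- 1) ^ (n + g)) * dual_act g n Xt_plus c i)) 0 =
    loc_frac (L_eps n g) (fibre g n (dual_act g n Xt_plus c)) 0"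
  proof (rule localize_smult_coords[OF lin_transfer_L_eps[OF g]])
    fix j
    have "of_int s * (fps_const ((- 1) ^ (n + g)) * dual_act g n Xt_plus c j) = dual_act g n Xt_plus c j"
      using s
    proof
      assume "n = 0"
      then show ?thesis using g by (simp add: dual_act_def)
    next
      assume s: "s = (- 1) ^ (n + g)"
      have "of_int s * fps_const ((- 1) ^ (n + g)) = (1 :: complex fps)"
        unfolding s by (simp add: fps_const_power flip: fps_of_int power_mult_distrib)
      then show ?thesis by (simp flip: mult.assoc)
    qed
    moreover have "of_int s = fps_to_fls (of_int s :: complex fps)"
      by (simp add: fls_of_int flip: fps_of_int)
    ultimately show "of_int s * fps_to_fls (fps_const ((- 1) ^ (n + g)) * dual_act g n Xt_plus c j) =
        fps_to_fls (dual_act g n Xt_plus c j)"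
      by (simp only: flip: fls_times_fps_to_fls)
  qed (auto simp: dual_act_def)
  then show ?thesis
    using True dual_op_fibre[OF c, of Xt_plus] by (simp add: twisted_dual_op_def)
next
  case False
  then show ?thesis using dual_op_fibre[OF c, of x] by (simp add: twisted_dual_op_def)
qed

end

section \<open>Transport of representations\<close>

lemma lin_transfer_comp:
  assumes 1: "lin_transfer W Y \<beta>" and 2: "lin_transfer Y V \<gamma>"
    and cl: "\<And>c x. x \<in> carrier W \<Longrightarrow> c \<odot>\<^bsub>W\<^esub> x \<in> carrier W"
      "\<And>x y. x \<in> carrier W \<Longrightarrow> y \<in> carrier W \<Longrightarrow> x \<oplus>\<^bsub>W\<^esub> y \<in> carrier W"
  shows "lin_transfer W V (\<lambda>x. \<gamma> (\<beta> x))"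
proof -
  note D1 = lin_transferD[OF 1] and D2 = lin_transferD[OF 2]
  have b: "\<beta> x \<in> carrier Y" if "x \<in> carrier W" for x using that D1(1) by auto
  have "bij_betw (\<gamma> \<circ> \<beta>) (carrier W) (carrier V)"
    using 1 2 bij_betw_trans unfolding lin_transfer_def by blast
  then show ?thesis
    unfolding lin_transfer_def using D1(3,4,5) D2(3,4,5) b by (auto simp: comp_def)
qed

text \<open>Given a representation \<open>W\<close> whose generators correspond to the prescribed operators, the action sought is the one
  transported from \<open>W\<close>. This avoids any verification of relations on \<open>V\<close>.\<close>

lemma rep_by_generators_transfer:
  fixes U :: "('k::comm_ring_1, 'u) module" and V :: "('k, 'm, 'u) rep"
  assumes W: "alg_module U W" and tr: "lin_transfer W V \<beta>"
    and U: "ring U" "\<And>c u. u \<in> carrier U \<Longrightarrow> c \<odot>\<^bsub>U\<^esub> u \<in> carrier U" "\<And>x. \<gamma> x \<in> carrier U"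
    and T: "\<And>x w. w \<in> carrier W \<Longrightarrow> T x (\<beta> w) = \<beta> (act W (\<gamma> x) w)"
    and uniq: "unique_action U \<gamma> V"
  obtains \<rho> where "rep_by_generators U \<gamma> V T = V\<lparr>act := \<rho>\<rparr>" "alg_module U (V\<lparr>act := \<rho>\<rparr>)"
    "\<And>u w. u \<in> carrier U \<Longrightarrow> w \<in> carrier W \<Longrightarrow> \<rho> u (\<beta> w) = \<beta> (act W u w)"
proof -
  interpret U: ring U by fact
  note D = lin_transferD[OF tr] and A = alg_moduleD[OF W]
  define \<rho> where "\<rho> = (\<lambda>u\<in>carrier U. \<lambda>v\<in>carrier V. \<beta> (act W u (the_inv_into (carrier W) \<beta> v)))"
  have \<rho>: "\<rho> u (\<beta> w) = \<beta> (act W u w)" if "u \<in> carrier U" "w \<in> carrier W" for u w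
    using that by (simp add: \<rho>_def D(1) the_inv_into_f_f[OF D(2)])
  have tr': "lin_transfer W (V\<lparr>act := \<rho>\<rparr>) \<beta>" using tr by (simp add: lin_transfer_def)
  have alg: "alg_module U (V\<lparr>act := \<rho>\<rparr>)"
    by (rule alg_module_lin_transfer[OF W tr']) (simp_all add: \<rho> U)
  have "rep_by_generators U \<gamma> V T = V\<lparr>act := \<rho>\<rparr>"
  proof (rule rep_by_generators_eqI[OF _ alg _ uniq])
    have "\<rho> u v \<in> carrier V" if "u \<in> carrier U" "v \<in> carrier V" for u v
      using that alg_moduleD(2)[OF alg] by simp
    then show "\<rho> \<in> carrier U \<rightarrow>\<^sub>E (carrier V \<rightarrow>\<^sub>E carrier V)"
      by (auto simp: \<rho>_def)
    fix x v assume "v \<in> carrier V"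
    then obtain w where "w \<in> carrier W" "v = \<beta> w" using D(1) by auto
    then show "\<rho> (\<gamma> x) v = T x v" using \<rho>[OF U(3)] T by simp
  qed
  then show ?thesis using alg \<rho> that by blast
qed

lemma rep_iso_transfer:
  assumes W: "alg_module U W" and tr: "lin_transfer W V \<beta>"
    and act: "\<And>u w. u \<in> carrier U \<Longrightarrow> w \<in> carrier W \<Longrightarrow> act V u (\<beta> w) = \<beta> (act W u w)"
  shows "rep_iso U V W"
proof -
  note D = lin_transferD[OF tr] and A = alg_moduleD[OF W]
  let ?i = "the_inv_into (carrier W) \<beta>"
  have i: "?i (\<beta> w) = w" if "w \<in> carrier W" for w by (rule the_inv_into_f_f[OF D(2) that])
  have "bij_betw ?i (carrier V) (carrier W)"
    using tr bij_betw_the_inv_into unfolding lin_transfer_def by blast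
  moreover note module_type_smult_closed[OF A(1)] module_add_closed[OF A(1)]
  ultimately show ?thesis
    unfolding rep_iso_def by (intro exI[of _ ?i]) (auto simp: D(1,4,5) i act A(2))
qed

lemma alg_module_rep_sum:
  fixes U :: "('k::comm_ring_1, 'u) module"
  assumes V: "alg_module U V" and W: "alg_module U W"
  shows "alg_module U (rep_sum V W)"
proof -
  note A = alg_moduleD[OF V] and B = alg_moduleD[OF W]
  interpret V: module "ring_of_type_algebra :: 'k ring" V by (rule A(1))
  interpret W: module "ring_of_type_algebra :: 'k ring" W by (rule B(1))
  let ?S = "rep_sum V W"
  have S: "carrier ?S = carrier V \<times> carrier W" "zero ?S = (\<zero>\<^bsub>V\<^esub>, \<zero>\<^bsub>W\<^esub>)"
    "add ?S = (\<lambda>x y. (fst x \<oplus>\<^bsub>V\<^esub> fst y, snd x \<oplus>\<^bsub>W\<^esub> snd y))"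
    "module.smult ?S = (\<lambda>c x. (c \<odot>\<^bsub>V\<^esub> fst x, c \<odot>\<^bsub>W\<^esub> snd x))"
    "act ?S = (\<lambda>u x. (act V u (fst x), act W u (snd x)))"
    by (simp_all add: rep_sum_def)
  note cl = module_type_smult_closed[OF A(1)] module_type_smult_closed[OF B(1)]
  have "\<exists>y\<in>carrier ?S. y \<oplus>\<^bsub>?S\<^esub> x = \<zero>\<^bsub>?S\<^esub>" if "x \<in> carrier ?S" for x
    by (rule bexI[of _ "(\<ominus>\<^bsub>V\<^esub> fst x, \<ominus>\<^bsub>W\<^esub> snd x)"])
      (use that in \<open>auto simp: S V.M.l_neg W.M.l_neg\<close>)
  then have "abelian_group ?S"
    by (intro abelian_groupI)
      (auto simp: S V.M.a_assoc V.M.a_comm V.M.a_lcomm W.M.a_assoc W.M.a_comm W.M.a_lcomm)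
  then have "module (ring_of_type_algebra :: 'k ring) ?S"
    by (rule moduleI[OF V.R.is_cring])
      (use V.smult_l_distr V.smult_r_distr V.smult_assoc1 V.smult_one
        W.smult_l_distr W.smult_r_distr W.smult_assoc1 W.smult_one cl in
        \<open>auto simp: S ring_of_type_algebra_def\<close>)
  then show ?thesis
    unfolding alg_module_def using A(2-) B(2-) by (auto simp: S)
qed

section \<open>The dual representation\<close>

text \<open>For \<open>a = 0\<close> and \<open>a = g/2\<close> the vectors \<open>m\<^sub>j\<close> with \<open>j \<equiv> a\<close> modulo \<open>g\<close> span a summand of the dual representation; \<open>emb g a\<close> is its
  inclusion in coordinates.\<close>

definition emb :: "nat \<Rightarrow> nat \<Rightarrow> (nat \<Rightarrow> complex fps) \<Rightarrow> nat \<Rightarrow> complex fps" where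
  "emb g a w = (\<lambda>j. if j mod g = a then w (j div g) else 0)"

lemma mat_act_L_q_mat:
  assumes w: "\<forall>k>M. w k = 0"
  shows "mat_act M (L_q_mat r M Xt_minus) w = (\<lambda>k. if 1 \<le> k \<and> k \<le> M then w (k - 1) else 0)"
    "mat_act M (L_q_mat r M Xt_plus) w =
      (\<lambda>k. if k < M then q_number r (k + 1) * q_number r (M - k) * w (k + 1) else 0)"
    "mat_act M (L_q_mat r M Ht_gen) w = (\<lambda>k. of_int (int M - 2 * int k) * w k)"
proof -
  have *: "mat_act M A w k = A k l * w l" if "k \<le> M" "l \<le> M" "\<And>j. j \<le> M \<Longrightarrow> j \<noteq> l \<Longrightarrow> A k j = 0" for A k l
    using that by (simp add: mat_act_def sum_only[of l])
  have **: "mat_act M A w k = 0" if "\<And>j. j \<le> M \<Longrightarrow> A k j = 0" for A k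
    using that by (simp add: mat_act_def)
  have out: "mat_act M A w k = 0" if "k > M" for A k
    using that by (simp add: mat_act_def)
  show "mat_act M (L_q_mat r M Xt_minus) w = (\<lambda>k. if 1 \<le> k \<and> k \<le> M then w (k - 1) else 0)"
  proof
    fix k
    consider "k > M" | "k = 0" | "1 \<le> k" "k \<le> M" by linarith
    then show "mat_act M (L_q_mat r M Xt_minus) w k = (if 1 \<le> k \<and> k \<le> M then w (k - 1) else 0)"
      by cases (auto simp: out L_q_mat_def ** *[of _ "k - 1"])
  qed
  show "mat_act M (L_q_mat r M Xt_plus) w =
      (\<lambda>k. if k < M then q_number r (k + 1) * q_number r (M - k) * w (k + 1) else 0)"
  proof
    fix k
    consider "k > M" | "k = M" | "k < M" by linarith
    then show "mat_act M (L_q_mat r M Xt_plus) w k =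
        (if k < M then q_number r (k + 1) * q_number r (M - k) * w (k + 1) else 0)"
      by cases (auto simp: out L_q_mat_def ** *[of _ "k + 1"] simp flip: Suc_diff_Suc)
  qed
  show "mat_act M (L_q_mat r M Ht_gen) w = (\<lambda>k. of_int (int M - 2 * int k) * w k)"
  proof
    fix k
    show "mat_act M (L_q_mat r M Ht_gen) w k = of_int (int M - 2 * int k) * w k"
      using w by (cases "k \<le> M") (auto simp: out L_q_mat_def *[of _ k] simp del: of_int_diff)
  qed
qed

text \<open>The index \<open>gk + a\<close> has weight \<open>n - 2(gk + a) = g(M - 2k)\<close>, which is \<open>g\<close> times the weight of the \<open>k\<close>-th basis vector of
  \<open>L\<^bsup>gh'\<^esup>(M)\<close>.\<close>

lemma dual_act_emb:
  assumes a: "a < g" and n: "n = g * M + 2 * a" and w: "\<forall>k>M. w k = 0"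
  shows "dual_act g n x (emb g a w) = emb g a (mat_act M (L_q_mat (of_nat g) M x) w)"
proof
  fix i
  define k b where "k = i div g" and "b = i mod g"
  have i: "i = g * k + b" "b < g" using a by (auto simp: k_def b_def)
  have mp: "(i + g) mod g = b" "(i + g) div g = k + 1" using a by (auto simp: k_def b_def)
  have mm: "(i - g) mod g = b" "(i - g) div g = k - 1" if "g \<le> i"
  proof -
    have "i - g + g = i" using that by simp
    then show "(i - g) mod g = b" "(i - g) div g = k - 1"
      using a mod_add_self2[of "i - g" g] div_add_self2[of g "i - g"] by (auto simp: k_def b_def)
  qed
  show "dual_act g n x (emb g a w) i = emb g a (mat_act M (L_q_mat (of_nat g) M x) w) i"
  proof (cases "b = a")
    case False
    then show ?thesis
      using mp mm by (cases x) (auto simp: dual_act_def emb_def b_def)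
  next
    case True
    have le: "g \<le> i \<longleftrightarrow> 1 \<le> k"
      using div_greater_zero_iff[of i g] a unfolding k_def by auto
    have pl: "i + g \<le> n \<longleftrightarrow> k < M"
    proof
      assume "i + g \<le> n"
      then have "g * (k + 1) \<le> g * M + a" unfolding n i True by simp
      then have "g * (k + 1) < g * (M + 1)" using a unfolding distrib_left by linarith
      then have "k + 1 < M + 1" by (simp only: mult_less_cancel1)
      then show "k < M" by simp
    next
      assume "k < M"
      then have "g * (k + 1) \<le> g * M" by (intro mult_left_mono) auto
      then show "i + g \<le> n" unfolding n i True by simp
    qed
    show ?thesis
    proof (cases x)
      case Xt_plus
      have "(n - i - g) div g + 1 = M - k" if "k < M"
      proof -
        obtain m where m: "M = k + 1 + m" using \<open>k < M\<close> less_imp_Suc_add by auto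
        have "n - i - g = a + g * m" unfolding n i True m by (simp add: algebra_simps)
        then show ?thesis using a by (simp add: m)
      qed
      then show ?thesis using True mp pl
        by (simp add: Xt_plus dual_act_def emb_def mat_act_L_q_mat[OF w] flip: k_def b_def)
    next
      case Xt_minus
      have "i \<le> n \<longleftrightarrow> k \<le> M" if "1 \<le> k"
      proof
        assume "i \<le> n"
        then have "g * k \<le> g * M + a" unfolding n i True by simp
        then have "g * k < g * (M + 1)" using a unfolding distrib_left by linarith
        then have "k < M + 1" by (simp only: mult_less_cancel1)
        then show "k \<le> M" by simp
      next
        assume "k \<le> M"
        then have "g * k \<le> g * M" by (intro mult_left_mono) auto
        then show "i \<le> n" unfolding n i True by linarith
      qed
      then show ?thesis using True mm le
        by (auto simp: Xt_minus dual_act_def emb_def mat_act_L_q_mat[OF w] simp flip: k_def b_def)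
    next
      case Ht_gen
      have "int n - 2 * int i = int g * (int M - 2 * int k)"
        unfolding n i True by (simp add: algebra_simps)
      then have "fps_const (1 / of_nat g) * of_int (int n - 2 * int i) = (of_int (int M - 2 * int k) :: complex fps)"
        using a by (simp add: fps_of_int[symmetric] del: of_int_diff fps_of_int)
      then show ?thesis using True
        by (simp add: Ht_gen dual_act_def emb_def mat_act_L_q_mat[OF w] del: of_int_diff of_int_mult flip: k_def b_def)
    qed
  qed
qed

definition dual_index :: "nat \<Rightarrow> nat \<Rightarrow> nat set" where
  "dual_index g n = {j. j \<le> n \<and> int g dvd int n - 2 * int j}"

lemma dual_space_fibre:
  assumes g: "g \<ge> 1"
  shows "dual_space n g = fibre g n ` {c. \<forall>j. j \<notin> dual_index g n \<longrightarrow> c j = 0}"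
proof -
  have "{c \<in> {c. \<forall>j>n. c j = 0}. \<forall>j. c j \<noteq> 0 \<longrightarrow> int g dvd int n - 2 * int j} =
      {c :: nat \<Rightarrow> complex fps. \<forall>j. j \<notin> dual_index g n \<longrightarrow> c j = 0}"
    by (auto simp: dual_index_def not_le)
  then show ?thesis unfolding dual_space_eq[OF g] by simp
qed

text \<open>A representation \<open>W\<close> that realizes the dual operators in coordinates. All properties of the dual representation
  follow from the existence of \<open>W\<close>, whichever the parity of \<open>g\<close>.\<close>

locale dual_coords =
  fixes g n :: nat and s :: int and W :: "(complex fps, 'w, qgen free_alg fps set) rep"
    and \<beta> :: "'w \<Rightarrow> nat \<Rightarrow> complex fps"
  assumes g: "g \<ge> 1" and s: "n = 0 \<or> s = (- 1) ^ (n + g)"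
    and W: "alg_module (U_q (of_nat g)) W"
    and \<beta>: "lin_transfer W (coord_on (dual_index g n) :: (complex fps, nat \<Rightarrow> complex fps, qgen free_alg fps set) rep) \<beta>"
    and \<beta>_act: "\<And>x w. w \<in> carrier W \<Longrightarrow> \<beta> (act W (q_gen (of_nat g) x) w) = dual_act g n x (\<beta> w)"
begin

abbreviation "L \<equiv> L_eps n g"
abbreviation "fib \<equiv> fibre g n"
abbreviation "K \<equiv> {c :: nat \<Rightarrow> complex fps. \<forall>j. j \<notin> dual_index g n \<longrightarrow> c j = 0}"

definition dual_rec :: "(complex fps, (nat \<Rightarrow> complex fps fps) set, qgen free_alg fps set) rep" where
  "dual_rec = \<lparr>carrier = dual_space n g, monoid.mult = undefined, one = undefined, zero = \<zero>\<^bsub>L\<^esub>,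
      add = add L, module.smult = module.smult L, act = undefined\<rparr>"

lemma K_coords: "c \<in> K \<Longrightarrow> \<forall>j>n. c j = 0"
  by (auto simp: dual_index_def)

lemma fib_inj: "c \<in> K \<Longrightarrow> d \<in> K \<Longrightarrow> loc_frac L (fib c) 0 = loc_frac L (fib d) 0 \<Longrightarrow> c = d"
  by (rule loc_frac_inj[OF lin_transfer_L_eps[OF g, of n]]) (auto simp: dual_index_def)

lemma tr_dual: "lin_transfer (coord_on (dual_index g n) :: (complex fps, nat \<Rightarrow> complex fps, qgen free_alg fps set) rep)
    (dual_rec\<lparr>act := \<rho>\<rparr>) fib"
proof -
  have sub: "K \<subseteq> {c. \<forall>j>n. c j = 0}" by (auto simp: dual_index_def)
  have "inj_on fib {c. \<forall>j>n. c j = 0}"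
    using lin_transferD(2)[OF lin_transfer_L_eps[OF g, of n]] by (simp add: not_le)
  then have "inj_on fib K" using sub by (rule inj_on_subset)
  then have "bij_betw fib K (carrier dual_rec)"
    by (simp only: bij_betw_def dual_rec_def dual_space_fibre[OF g]) simp
  moreover have "fib x \<oplus>\<^bsub>L\<^esub> fib y = fib (\<lambda>j. x j + y j)" if "x \<in> K" "y \<in> K" for x y
    using that sub by (intro L_eps_simps(3)[OF g]) blast+
  moreover have "c \<odot>\<^bsub>L\<^esub> fib x = fib (\<lambda>j. c * x j)" if "x \<in> K" for x c
    using that sub by (intro L_eps_simps(4)[OF g]) blast
  ultimately show ?thesis
    by (simp add: lin_transfer_def dual_rec_def L_eps_simps(2)[OF g])
qed

lemma \<beta>_image: "K = \<beta> ` carrier W"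
  using lin_transferD(1)[OF \<beta>] by simp

lemma dual_act_K:
  assumes "c \<in> K"
  shows "dual_act g n x c \<in> K"
proof -
  obtain w where w: "w \<in> carrier W" "c = \<beta> w" using assms unfolding \<beta>_image by blast
  have "\<beta> (act W (q_gen (of_nat g) x) w) \<in> K"
    unfolding \<beta>_image by (rule imageI, rule alg_moduleD(2)[OF W q_gen_carrier w(1)])
  then show ?thesis unfolding \<beta>_act[OF w(1)] w(2) .
qed

lemma tr_W: "lin_transfer W (dual_rec\<lparr>act := \<rho>\<rparr>) (\<lambda>w. fib (\<beta> w))"
  by (rule lin_transfer_comp[OF \<beta> tr_dual])
    (rule module_type_smult_closed[OF alg_moduleD(1)[OF W]] module_add_closed[OF alg_moduleD(1)[OF W]], assumption+)+

lemma dual_L_action: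
  obtains \<rho> where "dual_L s n g = dual_rec\<lparr>act := \<rho>\<rparr>" "alg_module (U_q (of_nat g)) (dual_L s n g)"
    "\<And>u w. u \<in> carrier (U_q (of_nat g)) \<Longrightarrow> w \<in> carrier W \<Longrightarrow> \<rho> u (fib (\<beta> w)) = fib (\<beta> (act W u w))"
proof -
  let ?T = "\<lambda>x v. THE w. w \<in> dual_space n g \<and> loc_frac L w 0 = twisted_dual_op s n g x (loc_frac L v 0)"
  have \<beta>_K: "\<beta> w \<in> K" if "w \<in> carrier W" for w unfolding \<beta>_image using that by (rule imageI)
  have T: "?T x (fib (\<beta> w)) = fib (\<beta> (act W (q_gen (of_nat g) x) w))" if w: "w \<in> carrier W" for x w
  proof (rule the_equality)
    have d: "dual_act g n x (\<beta> w) \<in> K" by (rule dual_act_K[OF \<beta>_K[OF w]])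
    have t: "twisted_dual_op s n g x (loc_frac L (fib (\<beta> w)) 0) = loc_frac L (fib (dual_act g n x (\<beta> w))) 0"
      by (rule twisted_dual_op_fibre[OF g K_coords[OF \<beta>_K[OF w]] s])
    show "fib (\<beta> (act W (q_gen (of_nat g) x) w)) \<in> dual_space n g \<and>
        loc_frac L (fib (\<beta> (act W (q_gen (of_nat g) x) w))) 0 = twisted_dual_op s n g x (loc_frac L (fib (\<beta> w)) 0)"
      unfolding t \<beta>_act[OF w] dual_space_fibre[OF g] using d by blast
    fix v assume v: "v \<in> dual_space n g \<and> loc_frac L v 0 = twisted_dual_op s n g x (loc_frac L (fib (\<beta> w)) 0)"
    then obtain c where c: "c \<in> K" "v = fib c" unfolding dual_space_fibre[OF g] by blast
    have "c = dual_act g n x (\<beta> w)" by (rule fib_inj[OF c(1) d]) (use v c t in simp)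
    then show "v = fib (\<beta> (act W (q_gen (of_nat g) x) w))" using c \<beta>_act[OF w] by simp
  qed
  have tr: "lin_transfer W dual_rec (\<lambda>w. fib (\<beta> w))" using tr_W[of "act dual_rec"] by simp
  have "separated fps_X dual_rec"
    using separated_lin_transfer[OF module_coord_on tr_dual separated_coord_on_X, of "act dual_rec"] by simp
  then have uniq: "unique_action (U_q (of_nat g)) (q_gen (of_nat g)) dual_rec" by (rule unique_action_U_q)
  have L: "dual_L s n g = rep_by_generators (U_q (of_nat g)) (q_gen (of_nat g)) dual_rec ?T"
    by (simp add: dual_L_def dual_rec_def)
  show ?thesis
    by (rule rep_by_generators_transfer[OF W tr ring_U_q smult_closed_U_q q_gen_carrier T uniq])
      (use that L in simp_all)
qed

lemma act_dual_L:
  assumes c: "c \<in> K"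
  shows "act (dual_L s n g) (q_gen (of_nat g) x) (fib c) = fib (dual_act g n x c)"
proof -
  obtain \<rho> where \<rho>: "dual_L s n g = dual_rec\<lparr>act := \<rho>\<rparr>"
    "\<And>u w. u \<in> carrier (U_q (of_nat g)) \<Longrightarrow> w \<in> carrier W \<Longrightarrow> \<rho> u (fib (\<beta> w)) = fib (\<beta> (act W u w))"
    using dual_L_action by metis
  obtain w where "w \<in> carrier W" "c = \<beta> w" using c unfolding \<beta>_image by blast
  then show ?thesis using \<rho>(2)[OF q_gen_carrier] \<beta>_act by (simp add: \<rho>(1))
qed

lemma alg_module_dual_L: "alg_module (U_q (of_nat g)) (dual_L s n g)"
  using dual_L_action by metis

lemma tr_dual_L: "lin_transfer (coord_on (dual_index g n) :: (complex fps, nat \<Rightarrow> complex fps, qgen free_alg fps set) rep)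
    (dual_L s n g) fib"
  using dual_L_action tr_dual by metis

lemma rep_iso_dual_L: "rep_iso (U_q (of_nat g)) (dual_L s n g) W"
proof -
  obtain \<rho> where \<rho>: "dual_L s n g = dual_rec\<lparr>act := \<rho>\<rparr>"
    "\<And>u w. u \<in> carrier (U_q (of_nat g)) \<Longrightarrow> w \<in> carrier W \<Longrightarrow> \<rho> u (fib (\<beta> w)) = fib (\<beta> (act W u w))"
    using dual_L_action by metis
  show ?thesis unfolding \<rho>(1) by (rule rep_iso_transfer[OF W tr_W]) (simp add: \<rho>(2))
qed

lemma carrier_dual_L: "carrier (dual_L s n g) = dual_space n g"
  by (simp add: dual_L_def rep_by_generators_def)

lemma finite_dual_index: "finite (dual_index g n)"
  by (rule finite_subset[of _ "{..n}"]) (auto simp: dual_index_def)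

lemma finite_rank_dual_L: "finite_rank_rep (U_q (of_nat g)) (dual_L s n g)"
  unfolding finite_rank_rep_def
  using alg_module_dual_L is_basis_lin_transfer[OF module_coord_on tr_dual_L is_basis_coord_on[OF finite_dual_index]]
  by blast

lemma dual_op_dual_L:
  assumes v: "v \<in> carrier (dual_L s n g)"
  shows "dual_op n g x (loc_frac L v 0) \<in> (\<lambda>w. loc_frac L w 0) ` carrier (dual_L s n g)"
    "loc_frac L (act (dual_L s n g) (q_gen (of_nat g) x) v) 0 = twisted_dual_op s n g x (loc_frac L v 0)"
proof -
  obtain c where c: "c \<in> K" "v = fib c" using v unfolding carrier_dual_L dual_space_fibre[OF g] by blast
  note c' = K_coords[OF c(1)]
  have "(\<lambda>i. (if x = Xt_plus then fps_const ((- 1) ^ (n + g)) else 1) * dual_act g n x c i) \<in> K"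
    using dual_act_K[OF c(1), of x] by auto
  then show "dual_op n g x (loc_frac L v 0) \<in> (\<lambda>w. loc_frac L w 0) ` carrier (dual_L s n g)"
    unfolding c(2) dual_op_fibre[OF g c'] carrier_dual_L dual_space_fibre[OF g] by (intro imageI)
  show "loc_frac L (act (dual_L s n g) (q_gen (of_nat g) x) v) 0 = twisted_dual_op s n g x (loc_frac L v 0)"
    unfolding c(2) twisted_dual_op_fibre[OF g c' s] act_dual_L[OF c(1)] ..
qed

lemma chi_dual_L: "chi (of_nat g) (dual_L s n g) = (Pi_g g \<circ> chi 1) (L_q 1 n)"
proof -
  let ?wt = "\<lambda>j. (int n - 2 * int j) div int g"
  have wt: "int n - 2 * int j = int g * ?wt j" if "j \<in> dual_index g n" for j
    using that by (simp add: dual_index_def)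
  have inj: "inj_on ?wt (dual_index g n)"
  proof (rule inj_onI)
    fix i j assume "i \<in> dual_index g n" "j \<in> dual_index g n" "?wt i = ?wt j"
    then have "int n - 2 * int i = int n - 2 * int j" using wt by metis
    then show "i = j" by simp
  qed
  have "weight_coords (dual_index g n) (dual_L s n g) fib (q_gen (of_nat g) Ht_gen) ?wt"
  proof (unfold_locales)
    fix f assume "f \<in> carrier (coord_on (dual_index g n) :: (complex fps, nat \<Rightarrow> complex fps, qgen free_alg fps set) rep)"
    then have f: "f \<in> K" by simp
    have "dual_act g n Ht_gen f j = of_int (?wt j) * f j" for j
    proof (cases "j \<in> dual_index g n")
      case True
      have "fps_const (1 / of_nat g) * of_int (int n - 2 * int j) = (of_int (?wt j) :: complex fps)"
        by (subst wt[OF True]) (use g in \<open>simp add: fps_of_int[symmetric] del: of_int_diff fps_of_int\<close>)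
      then show ?thesis by (simp add: dual_act_def del: of_int_diff)
    qed (use f in \<open>simp add: dual_act_def\<close>)
    then have "dual_act g n Ht_gen f = (\<lambda>j. of_int (?wt j) * f j)" by blast
    then show "act (dual_L s n g) (q_gen (of_nat g) Ht_gen) (fib f) = fib (\<lambda>j. of_int (?wt j) * f j)"
      using act_dual_L[OF f] by simp
  qed (use finite_dual_index tr_dual_L in simp_all)
  from chi_coords[OF this inj] have "chi (of_nat g) (dual_L s n g) = (\<Sum>j\<in>dual_index g n. Poly_Mapping.single (?wt j) 1)" .
  also have "\<dots> = Pi_g g (\<Sum>j\<le>n. Poly_Mapping.single (int n - 2 * int j) 1)"
  proof -
    have "inj_on (\<lambda>j. int n - 2 * int j) {..n}" by (simp add: inj_on_def)
    from Pi_g_sum[OF finite_atMost this] show ?thesis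
      by (simp add: dual_index_def)
  qed
  finally show ?thesis by (simp add: chi_L_q)
qed

end

lemma emb_linear:
  "emb g a (\<lambda>j. u j + v j) = (\<lambda>j. emb g a u j + emb g a v j)"
  "emb g a (\<lambda>j. c * u j) = (\<lambda>j. c * emb g a u j)" "emb g a (\<lambda>j. 0) = (\<lambda>j. 0)"
  by (auto simp: emb_def fun_eq_iff)

lemma emb_at: "a < g \<Longrightarrow> emb g a w (g * k + a) = w k"
  by (simp add: emb_def)

lemma L_q_fields:
  assumes "r \<noteq> 0"
  shows "zero (L_q r n) = (\<lambda>j. 0)" "add (L_q r n) = (\<lambda>f f' j. f j + f' j)"
    "module.smult (L_q r n) = (\<lambda>c f j. c * f j)"
  using L_q_rep(2)[OF assms, of n] by (auto simp: coord_module_def)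

text \<open>Since \<open>g\<close> is odd or \<open>n = 0\<close>, the weight \<open>n - 2j\<close> is divisible by \<open>g\<close> only if \<open>j\<close> is.\<close>

lemma dual_coords_odd:
  assumes g: "g \<ge> 1" and n: "g dvd n" and s: "n = 0 \<or> s = (- 1) ^ (n + g)" and o: "odd g \<or> n = 0"
  shows "dual_coords g n s (L_q (of_nat g) (n div g)) (emb g 0)"
proof
  let ?N = "n div g"
  have r: "(of_nat g :: complex) \<noteq> 0" using g by simp
  have N: "n = g * ?N + 2 * 0" using n by simp
  have idx: "j \<in> dual_index g n \<longleftrightarrow> j \<le> n \<and> g dvd j" for j
  proof (cases "n = 0")
    case False
    then have "coprime (int g) 2" using o by simp
    moreover have "int g dvd int n" using n by simp
    ultimately show ?thesis
      by (simp add: dual_index_def dvd_diff_right_iff coprime_dvd_mult_right_iff)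
  qed (auto simp: dual_index_def)
  show "alg_module (U_q (of_nat g)) (L_q (of_nat g) ?N)" by (rule L_q_rep(1)[OF r])
  show "emb g 0 (act (L_q (of_nat g) ?N) (q_gen (of_nat g) x) w) = dual_act g n x (emb g 0 w)"
    if "w \<in> carrier (L_q (of_nat g) ?N)" for x w
    using that dual_act_emb[OF _ N, of w x] g unfolding L_q_rep(3)[OF r that] by (simp add: carrier_L_q[OF r])
  let ?C = "{f :: nat \<Rightarrow> complex fps. \<forall>j>?N. f j = 0}" and ?K = "{c :: nat \<Rightarrow> complex fps. \<forall>j. j \<notin> dual_index g n \<longrightarrow> c j = 0}"
  have "bij_betw (emb g 0) ?C ?K"
  proof (rule bij_betwI[where g = "\<lambda>c k. c (g * k)"])
    show "emb g 0 \<in> ?C \<rightarrow> ?K"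
    proof (clarsimp)
      fix w :: "nat \<Rightarrow> complex fps" and j assume w: "\<forall>j>?N. w j = 0" and j: "j \<notin> dual_index g n"
      show "emb g 0 w j = 0"
      proof (cases "g dvd j")
        case True
        then have "n < j" using j idx by auto
        then have "?N < j div g" using True n g by (auto elim!: dvdE)
        then show ?thesis using w by (simp add: emb_def)
      qed (simp add: emb_def dvd_eq_mod_eq_0)
    qed
    show "(\<lambda>c k. c (g * k)) \<in> ?K \<rightarrow> ?C"
    proof (clarsimp)
      fix c :: "nat \<Rightarrow> complex fps" and k assume c: "\<forall>j. j \<notin> dual_index g n \<longrightarrow> c j = 0" and k: "?N < k"
      have "n < g * k" using k n g by (auto elim!: dvdE)
      then show "c (g * k) = 0" using c idx by auto
    qed
    show "(\<lambda>k. emb g 0 w (g * k)) = w" for w using emb_at[of 0 g w] g by auto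
    show "emb g 0 (\<lambda>k. c (g * k)) = c" if "c \<in> ?K" for c
    proof
      fix j show "emb g 0 (\<lambda>k. c (g * k)) j = c j"
        using that idx[of j] by (auto simp: emb_def dvd_eq_mod_eq_0)
    qed
  qed
  then show "lin_transfer (L_q (of_nat g) ?N) (coord_on (dual_index g n)) (emb g 0)"
    by (simp add: lin_transfer_def L_q_fields[OF r] carrier_L_q[OF r] emb_linear)
qed (use g s in auto)

text \<open>For \<open>g = 2h\<close> the weight \<open>n - 2j\<close> is divisible by \<open>g\<close> if and only if \<open>h\<close> divides \<open>j\<close>, that is, \<open>j\<close> is congruent to \<open>0\<close> or to
  \<open>h\<close> modulo \<open>g\<close>.\<close>

lemma dual_coords_even:
  assumes g: "g = 2 * h" "h \<ge> 1" and n: "g dvd n" "n > 0" and s: "s = (- 1) ^ (n + g)"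
  shows "dual_coords g n s (rep_sum (L_q (of_nat g) (n div g)) (L_q (of_nat g) (n div g - 1)))
    (\<lambda>(u, v) j. emb g 0 u j + emb g h v j)"
proof
  let ?N = "n div g"
  let ?W = "rep_sum (L_q (of_nat g) ?N) (L_q (of_nat g) (?N - 1))"
  let ?e = "\<lambda>(u, v) j. emb g 0 u j + emb g h v j"
  have r: "(of_nat g :: complex) \<noteq> 0" using g by simp
  have Npos: "?N \<ge> 1" using n g by (auto elim!: dvdE)
  have N: "n = g * ?N + 2 * 0" using n by simp
  have N1: "n = g * (?N - 1) + 2 * h"
  proof -
    obtain m where m: "?N = Suc m" using Npos by (cases ?N) auto
    show ?thesis using N unfolding m by (simp add: g(1))
  qed
  have W: "carrier ?W = {u. \<forall>j>?N. u j = 0} \<times> {v. \<forall>j>?N - 1. v j = 0}" "zero ?W = (\<lambda>j. 0, \<lambda>j. 0)"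
    "add ?W = (\<lambda>x y. (\<lambda>j. fst x j + fst y j, \<lambda>j. snd x j + snd y j))"
    "module.smult ?W = (\<lambda>c x. (\<lambda>j. c * fst x j, \<lambda>j. c * snd x j))"
    "act ?W = (\<lambda>u x. (act (L_q (of_nat g) ?N) u (fst x), act (L_q (of_nat g) (?N - 1)) u (snd x)))"
    by (simp_all add: rep_sum_def L_q_fields[OF r] carrier_L_q[OF r])
  have idx: "j \<in> dual_index g n \<longleftrightarrow> j \<le> n \<and> (j mod g = 0 \<or> j mod g = h)" for j
  proof -
    have "int g dvd int n - 2 * int j \<longleftrightarrow> int g dvd 2 * int j"
      using n by (simp add: dvd_diff_right_iff)
    also have "\<dots> \<longleftrightarrow> h dvd j" by (simp add: g(1))
    also have "\<dots> \<longleftrightarrow> j mod g = 0 \<or> j mod g = h"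
    proof
      assume "h dvd j"
      then obtain k where k: "j = h * k" by (elim dvdE)
      show "j mod g = 0 \<or> j mod g = h"
        unfolding k g(1) mult.commute[of 2 h] mult_mod_right[symmetric] using g(2) by (cases "even k") (auto simp: odd_iff_mod_2_eq_one even_iff_mod_2_eq_zero)
    next
      have "h dvd g" by (simp add: g(1))
      moreover assume "j mod g = 0 \<or> j mod g = h"
      ultimately show "h dvd j" by (metis dvd_mod_iff dvd_0_right dvd_refl)
    qed
    finally show ?thesis by (auto simp: dual_index_def)
  qed
  show "alg_module (U_q (of_nat g)) ?W" by (intro alg_module_rep_sum L_q_rep(1)[OF r])
  show "?e (act ?W (q_gen (of_nat g) x) w) = dual_act g n x (?e w)" if w: "w \<in> carrier ?W" for x w
  proof -
    obtain u v where uv: "w = (u, v)" "\<forall>j>?N. u j = 0" "\<forall>j>?N - 1. v j = 0" using w W(1) by auto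
    have add: "dual_act g n x (\<lambda>j. p j + q j) = (\<lambda>j. dual_act g n x p j + dual_act g n x q j)" for p q
      by (cases x) (auto simp: dual_act_def fun_eq_iff distrib_left)
    have hg: "0 < g" "h < g" using g by auto
    have "dual_act g n x (emb g 0 u) = emb g 0 (act (L_q (of_nat g) ?N) (q_gen (of_nat g) x) u)"
      using dual_act_emb[OF hg(1) N uv(2)] L_q_rep(3)[OF r, of u ?N x] uv(2) by (simp add: carrier_L_q[OF r])
    moreover have "dual_act g n x (emb g h v) = emb g h (act (L_q (of_nat g) (?N - 1)) (q_gen (of_nat g) x) v)"
      using dual_act_emb[OF hg(2) N1 uv(3)] L_q_rep(3)[OF r, of v "?N - 1" x] uv(3) by (simp add: carrier_L_q[OF r])
    ultimately show ?thesis unfolding uv(1) W(5) prod.case fst_conv snd_conv add by simp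
  qed
  let ?K = "{c :: nat \<Rightarrow> complex fps. \<forall>j. j \<notin> dual_index g n \<longrightarrow> c j = 0}"
  have dm: "j = g * (j div g) + j mod g" for j by simp
  have "bij_betw ?e (carrier ?W) ?K"
  proof (rule bij_betwI[where g = "\<lambda>c. (\<lambda>k. c (g * k), \<lambda>k. c (g * k + h))"])
    show "?e \<in> carrier ?W \<rightarrow> ?K"
    proof (rule Pi_I)
      fix w assume "w \<in> carrier ?W"
      then obtain u v where w: "w = (u, v)" and u: "\<forall>j>?N. u j = 0" and v: "\<forall>j>?N - 1. v j = 0" unfolding W(1) by auto
      have "emb g 0 u j + emb g h v j = 0" if j: "j \<notin> dual_index g n" for j
      proof -
        have "emb g 0 u j = 0"
        proof (cases "j mod g = 0")
          case True
          then have "g * ?N < g * (j div g)" using j idx N dm[of j] by auto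
          then show ?thesis using u by (simp add: emb_def)
        qed (simp add: emb_def)
        moreover have "emb g h v j = 0"
        proof (cases "j mod g = h")
          case True
          then have "g * (?N - 1) + 2 * h < g * (j div g) + h" using j idx N1 dm[of j] by auto
          then have "g * (?N - 1) < g * (j div g)" by linarith
          then show ?thesis using v by (simp add: emb_def)
        qed (simp add: emb_def)
        ultimately show ?thesis by simp
      qed
      then show "?e w \<in> ?K" by (simp add: w)
    qed
    show "(\<lambda>c. (\<lambda>k. c (g * k), \<lambda>k. c (g * k + h))) \<in> ?K \<rightarrow> carrier ?W"
    proof (rule Pi_I)
      fix c assume c: "c \<in> ?K"
      have "c (g * k) = 0" if "k > ?N" for k
      proof -
        have "g * ?N < g * k" using that g by simp
        then have "n < g * k" using N by linarith
        then have "g * k \<notin> dual_index g n" using idx by simp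
        then show ?thesis using c by blast
      qed
      moreover have "c (g * k + h) = 0" if "k > ?N - 1" for k
      proof -
        have "g * (?N - 1 + 1) \<le> g * k" using that by (intro mult_left_mono) auto
        then have "g * (?N - 1) + g \<le> g * k" by (simp only: distrib_left mult_1_right)
        then have "n < g * k + h" using N1 g by linarith
        then have "g * k + h \<notin> dual_index g n" using idx by simp
        then show ?thesis using c by blast
      qed
      ultimately show "(\<lambda>k. c (g * k), \<lambda>k. c (g * k + h)) \<in> carrier ?W" unfolding W(1) by simp
    qed
    have hg: "h < g" "h \<noteq> 0" using g by simp_all
    show "(\<lambda>k. ?e w (g * k), \<lambda>k. ?e w (g * k + h)) = w" for w
      using hg by (cases w) (simp add: emb_def)
    show "?e (\<lambda>k. c (g * k), \<lambda>k. c (g * k + h)) = c" if c: "c \<in> ?K" for c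
    proof
      fix j
      consider "j mod g = 0" | "j mod g = h" | "j mod g \<noteq> 0" "j mod g \<noteq> h" by blast
      then show "?e (\<lambda>k. c (g * k), \<lambda>k. c (g * k + h)) j = c j"
      proof cases
        case 1
        then show ?thesis using dm[of j] g by (simp add: emb_def)
      next
        case 2
        then show ?thesis using dm[of j] g by (simp add: emb_def)
      next
        case 3
        then show ?thesis using c idx[of j] by (simp add: emb_def)
      qed
    qed
  qed
  then show "lin_transfer ?W (coord_on (dual_index g n)) ?e"
    unfolding lin_transfer_def W(2-4) by (auto simp: emb_linear fun_eq_iff algebra_simps)
qed (use g s in auto)

theorem mainTheorem2:
  fixes g n :: nat and s :: int
  assumes "g \<ge> 1" and "g dvd n"
    and "n = 0 \<or> s = (- 1) ^ (n + g)"
  shows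
    "(is_deformation g (L_hh n g) (L_q 1 n) \<and> indecomposable (U_q 1) (L_q 1 n)) \<and>
     weight_module (U_eps g) (eps_gen g H_gen) (L_eps n g) \<and>
     (carrier (dual_L s n g) = sum_of_weight_spaces (L_eps n g) (eps_gen g H_gen) {m. int g dvd m} \<and>
      carrier (dual_L s n g) \<subseteq> carrier (L_eps n g) \<and>
      finite_rank_rep (U_q (of_nat g)) (dual_L s n g) \<and>
      (\<forall>x. \<forall>v\<in>carrier (dual_L s n g).
         dual_op n g x (loc_frac (L_eps n g) v 0) \<in>
           (\<lambda>w. loc_frac (L_eps n g) w 0) ` carrier (dual_L s n g) \<and>
         loc_frac (L_eps n g) (act (dual_L s n g) (q_gen (of_nat g) x) v) 0 =
           twisted_dual_op s n g x (loc_frac (L_eps n g) v 0))) \<and>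
     (Pi_g g \<circ> chi 1) (L_q 1 n) = chi (of_nat g) (dual_L s n g) \<and>
     (even g \<longrightarrow>
        (n > 0 \<longrightarrow> rep_iso (U_q (of_nat g)) (dual_L s n g)
           (rep_sum (L_q (of_nat g) (n div g)) (L_q (of_nat g) (n div g - 1)))) \<and>
        (n = 0 \<longrightarrow> rep_iso (U_q (of_nat g)) (dual_L s n g) (L_q (of_nat g) 0))) \<and>
     (odd g \<longrightarrow> rep_iso (U_q (of_nat g)) (dual_L s n g) (L_q (of_nat g) (n div g)))"
proof -
  note g = assms(1) and n = assms(2) and s = assms(3)
  let ?even = "\<lambda>h. dual_coords g n s (rep_sum (L_q (of_nat g) (n div g)) (L_q (of_nat g) (n div g - 1)))
    (\<lambda>(u, v) j. emb g 0 u j + emb g h v j)"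
  have odd: "dual_coords g n s (L_q (of_nat g) (n div g)) (emb g 0)" if "odd g \<or> n = 0"
    by (rule dual_coords_odd[OF g n s that])
  have even: "\<exists>h. ?even h" if e: "even g" "n > 0"
  proof -
    obtain h where h: "g = 2 * h" using e(1) by (elim evenE)
    then have "?even h" by (intro dual_coords_even) (use g n s e in auto)
    then show ?thesis ..
  qed
  have sub: "carrier (dual_L s n g) \<subseteq> carrier (L_eps n g)"
    unfolding dual_L_def rep_by_generators_def
    by (auto simp: dual_space_fibre[OF g] L_eps_simps(1)[OF g] dual_index_def)
  have dual: "finite_rank_rep (U_q (of_nat g)) (dual_L s n g) \<and>
      (\<forall>x. \<forall>v\<in>carrier (dual_L s n g).
         dual_op n g x (loc_frac (L_eps n g) v 0) \<in> (\<lambda>w. loc_frac (L_eps n g) w 0) ` carrier (dual_L s n g) \<and>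
         loc_frac (L_eps n g) (act (dual_L s n g) (q_gen (of_nat g) x) v) 0 =
           twisted_dual_op s n g x (loc_frac (L_eps n g) v 0)) \<and>
      (Pi_g g \<circ> chi 1) (L_q 1 n) = chi (of_nat g) (dual_L s n g)"
  proof (cases "odd g \<or> n = 0")
    case True
    interpret dual_coords g n s "L_q (of_nat g) (n div g)" "emb g 0" by (rule odd[OF True])
    show ?thesis using finite_rank_dual_L dual_op_dual_L chi_dual_L by simp
  next
    case False
    then obtain h where "?even h" using even by auto
    then interpret dual_coords g n s "rep_sum (L_q (of_nat g) (n div g)) (L_q (of_nat g) (n div g - 1))"
      "\<lambda>(u, v) j. emb g 0 u j + emb g h v j" .
    show ?thesis using finite_rank_dual_L dual_op_dual_L chi_dual_L by simp
  qed
  have "rep_iso (U_q (of_nat g)) (dual_L s n g)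
      (rep_sum (L_q (of_nat g) (n div g)) (L_q (of_nat g) (n div g - 1)))" if "even g" "n > 0"
    using even[OF that] dual_coords.rep_iso_dual_L by blast
  moreover have "rep_iso (U_q (of_nat g)) (dual_L s n g) (L_q (of_nat g) (n div g))" if "odd g \<or> n = 0"
    using odd[OF that] by (rule dual_coords.rep_iso_dual_L)
  moreover have "carrier (dual_L s n g) = sum_of_weight_spaces (L_eps n g) (eps_gen g H_gen) {m. int g dvd m}"
    by (simp add: dual_L_def rep_by_generators_def dual_space_def)
  moreover note L_hh_deformation[OF g] L_q_indecomposable[of 1] weight_module_L_eps[OF g] sub dual
  ultimately show ?thesis by auto
qed

end
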